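(* The periodic solution $u_{\rm per}$ is orbitally asymptotically stable (respectively orbitally stable, respectively orbitally unstable) if and only if the fixed point $(\varphi_\alpha,x_\alpha)$ of the Poincaré map $\mathbf P$ is asymptotically stable (respectively stable, respectively unstable).
   Context: Setting. Fix $N\ge1$, $T>0$, reals $\alpha<\beta$, $k\in\mathbb R^N$, $\mathbf A,\mathbf B\in\mathbb R^{N\times N}$, and a linear functional $\mathbf Mx=\sum_{j=1}^N m_{j-1}x_j$ on $\mathbb R^N$ with $m_0\neq0$. Let $0<s<1$, $1<p<\min\{1/s,1/(1-s)\}$, and $0<\sigma\le T/3$. Put $\mathbb L_p(a,b)=(L_p(a,b))^N$, $\mathbb W^1_p(a,b)=(W^1_p(a,b))^N$, $\mathbb L_p=\mathbb L_p(-2T,0)$. Let $W_p^s(a,b)$ be the Sobolev–Slobodeckij space with norm $\|\varphi\|_{L_p(a,b)}+\big(\int_a^b\int_a^b\frac{|\varphi(t)-\varphi(\xi)|^p}{|t-\xi|^{1+sp}}d\xi dt\big)^{1/p}$, and $\mathbb W_p^s(a,b)=(W_p^s(a,b))^N$. Let $\mathbb B_p^s$ be the space of $\varphi\in\mathbb L_p$ whose restriction to $(-T-\sigma,0)$ lies in $\mathbb W_p^s(-T-\sigma,0)$, with norm $\|\varphi\|_{\mathbb L_p}+\|\varphi\|_{\mathbb W_p^s(-T-\sigma,0)}$. $\|\nu,y\|$ denotes a product norm. Hysteresis: for $g\in C[0,T_1]$ and $X_t=\{t'\in(0,t]:g(t')\in\{\alpha,\beta\}\}$, $z=\mathcal H(g)$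 is given by $z(0)=1$ if $g(0)<\beta$, $z(0)=-1$ if $g(0)\ge\beta$, and for $t>0$: $z(t)=z(0)$ if $X_t=\emptyset$; $z(t)=1$ (resp. $-1$) if $X_t\ne\emptyset$ and $g(\max X_t)=\alpha$ (resp. $\beta$). A switching time of $u$ is a discontinuity point of $\mathcal H(\mathbf Mu)$. Problem (P): $u'(t)=k\mathcal H(\mathbf Mu)(t)-\mathbf Bu(t)+\mathbf Au(t-2T)$ for a.e. $t>0$, $u=\varphi$ on $(-2T,0)$, $u(0+)=x$, with $u\in\mathbb L_p(-2T,T_1)$, $u|_{(0,T_1)}\in\mathbb W_p^1(0,T_1)$ for all $T_1>0$. For each $(\varphi,x)\in\mathbb L_p\times\mathbb R^N$ it has a unique solution, denoted $u(\varphi,x;t)$. Also, $u_\pm(\varphi,x;t)$ denotes the unique solution of $u_\pm'=\pm k-\mathbf Bu_\pm+\mathbf Au_\pm(t-2T)$, $t>0$, with $u_\pm=\varphi$ on $(-2T,0)$, $u_\pm(0+)=x$. Standing assumption on the periodic solution. $(\varphi_\alpha,x_\alpha)\in\mathbb B_p^s\times\mathbb R^N$ generates a $2T$-periodic solution $u_{\rm per}(t)=u(\varphi_\alpha,x_\alpha;t)$ of (P), i.e. $u_{\rm per}(2T)=x_\alpha$, $u_{\rm per}(2T+\xi)=\varphi_\alpha(\xi)$ for $\xi\in(-2T,0)$, and $\mathcal H(\mathbf Mu_{\rm per})(2T)=\mathcal H(\mathbf Mu_{\rm per})(0)$, such that: (1) $\mathbf Mx_\alpha=\alpha$; (2) $u_{\rm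 per}$ has exactly two switching times along its period, $t=T$ (where $\mathbf Mu_{\rm per}(T)=\beta$) and $t=2T$ (where $\mathbf Mu_{\rm per}(2T)=\alpha$); (3) $\varphi_\alpha'(\theta)=-\varphi_\alpha'(\theta+T)$ for $\theta\in(-2T,-T)$ (here $\varphi_\alpha\in C^\infty[-2T,-T]\cap C^\infty[-T,0]$ automatically); (4) the left derivatives $\frac{d}{dt}\mathbf Mu_{\rm per}(T-)$ and $\frac{d}{dt}\mathbf Mu_{\rm per}(2T-)$ are nonzero. Stability of $u_{\rm per}$. The orbit of a solution $u=u(\varphi,x;\cdot)$ of (P) is $\gamma(u)=\{(u(t+\xi)|_{\xi\in(-2T,0)},u(t)):t\ge0\}\subset\mathbb B_p^s\times\mathbb R^N$. Let $\Gamma_1$, $\Gamma_2$ be the sets of $(u_{\rm per}(t+\xi)|_{\xi\in(-2T,0)},u_{\rm per}(t))$ with $t\in[0,T]$, resp. $t\in[T,2T]$, and $\Gamma=\Gamma_1\cup\Gamma_2$. $u_{\rm per}$ is orbitally stable if for every neighbourhood $\Omega$ of $\Gamma$ there are neighbourhoods $\Omega_1$ of $\Gamma_1$ and $\Omega_2$ of $\Gamma_2$ (in $\mathbb B_p^s\times\mathbb R^N$) such that $\gamma(u(\varphi,x;\cdot))\subset\Omega$ whenever $(\varphi,x)\in\Omega_1$, $\mathbf Mx<\beta$, or $(\varphi,x)\in\Omega_2$, $\mathbf Mx\ge\beta$. It is orbitally asymptotically stable if in addition there are neighbourhoods $\Theta_1$ of $\Gamma_1$, $\Theta_2$ of $\Gamma_2$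 such that whenever $(\varphi,x)\in\Theta_1$, $\mathbf Mx<\beta$, or $(\varphi,x)\in\Theta_2$, $\mathbf Mx\ge\beta$, the distance in $\mathbb B_p^s\times\mathbb R^N$ from $(u(\varphi,x;t+\xi)|_{\xi\in(-2T,0)},u(\varphi,x;t))$ to $\Gamma$ tends to $0$ as $t\to\infty$. It is orbitally unstable if not orbitally stable. Poincaré map. $\mathbb T_\alpha=\{(\varphi,x)\in\mathbb B_p^s\times\mathbb R^N:\mathbf Mx=\alpha\}$, $\mathbb T_\beta$ likewise with $\beta$. For $\mathbf Mx<\beta$, $\mathbf t_\beta(\varphi,x)\in(0,\infty]$ is the first $t>0$ with $\mathbf Mu_+(\varphi,x;t)=\beta$ ($\infty$ if none); for $\mathbf Mx>\alpha$, $\mathbf t_\alpha(\varphi,x)$ is the first $t>0$ with $\mathbf Mu_-(\varphi,x;t)=\alpha$ ($\infty$ if none). Hit map $\mathbf P_\beta$: on $\{(\varphi,x)\in\mathbb T_\alpha:\mathbf t_\beta(\varphi,x)<\infty\}$, $\mathbf P_\beta(\varphi,x)=(u_+(\varphi,x;\mathbf t_\beta+\xi)|_{\xi\in(-2T,0)},u_+(\varphi,x;\mathbf t_\beta))\in\mathbb T_\beta$ with $\mathbf t_\beta=\mathbf t_\beta(\varphi,x)$; $\mathbf P_\alpha$ from $\{(\varphi,x)\in\mathbb T_\beta:\mathbf t_\alpha(\varphi,x)<\infty\}$ to $\mathbb T_\alpha$ is defined in the same way with $u_-,\mathbf t_\alpha$. $\mathbf P=\mathbf P_\alpha\circ\mathbf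 P_\beta$ on its natural domain $\mathcal Dom(\mathbf P)\subset\mathbb T_\alpha$. A fixed point $(\varphi,x)$ of $\mathbf P$ is stable if for every $\varepsilon>0$ there is $\delta>0$ such that $\|\nu,y\|_{\mathbb B_p^s\times\mathbb R^N}\le\delta$ and $(\varphi+\nu,x+y)\in\mathbb T_\alpha$ imply, for all $n\in\mathbb N$, $\mathbf P^n(\varphi+\nu,x+y)\in\mathcal Dom(\mathbf P)$ and $\|\mathbf P^n(\varphi+\nu,x+y)-(\varphi,x)\|_{\mathbb B_p^s\times\mathbb R^N}\le\varepsilon$; asymptotically stable if in addition $\|\mathbf P^n(\varphi+\nu,x+y)-(\varphi,x)\|_{\mathbb B_p^s\times\mathbb R^N}\to0$ as $n\to\infty$; unstable if not stable. *)

theory Defs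
  imports "HOL-Analysis.Analysis"
begin

text \<open>
  Elements of the function spaces are represented by functions, and two functions that agree almost
  everywhere on the interval in question represent the same element; the norms below are therefore
  seminorms on representatives. Every class of measurable functions has a Borel representative, so
  measurability is taken with respect to \<open>lborel\<close>. Values outside the interval are irrelevant.
\<close>

section \<open>Function spaces\<close>

definition Lp :: "real \<Rightarrow> real \<Rightarrow> real \<Rightarrow> (real \<Rightarrow> real) set" where
  "Lp p a b = {f. set_borel_measurable lborel {a<..<b} f \<and>
     (\<integral>\<^sup>+t\<in>{a<..<b}. ennreal (\<bar>f t\<bar> powr p) \<partial>lborel) < \<infinity>}"

definition Lp_norm :: "real \<Rightarrow> real \<Rightarrow> real \<Rightarrow> (real \<Rightarrow> real) \<Rightarrow> real" where
  "Lp_norm p a b f =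
     enn2real (\<integral>\<^sup>+t\<in>{a<..<b}. ennreal (\<bar>f t\<bar> powr p) \<partial>lborel) powr (1 / p)"

definition slobodeckij_integral :: "real \<Rightarrow> real \<Rightarrow> real \<Rightarrow> real \<Rightarrow> (real \<Rightarrow> real) \<Rightarrow> ennreal" where
  "slobodeckij_integral s p a b f =
     (\<integral>\<^sup>+t\<in>{a<..<b}. (\<integral>\<^sup>+\<xi>\<in>{a<..<b}.
        ennreal (\<bar>f t - f \<xi>\<bar> powr p / \<bar>t - \<xi>\<bar> powr (1 + s * p)) \<partial>lborel) \<partial>lborel)"

definition Wsp :: "real \<Rightarrow> real \<Rightarrow> real \<Rightarrow> real \<Rightarrow> (real \<Rightarrow> real) set" where
  "Wsp s p a b = {f \<in> Lp p a b. slobodeckij_integral s p a b f < \<infinity>}"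

definition Wsp_norm :: "real \<Rightarrow> real \<Rightarrow> real \<Rightarrow> real \<Rightarrow> (real \<Rightarrow> real) \<Rightarrow> real" where
  "Wsp_norm s p a b f =
     Lp_norm p a b f + enn2real (slobodeckij_integral s p a b f) powr (1 / p)"

text \<open>Weak derivative on \<open>(a, b)\<close>, tested against continuously differentiable functions with compact
  support in \<open>(a, b)\<close>.\<close>

definition weak_deriv :: "real \<Rightarrow> real \<Rightarrow> (real \<Rightarrow> real) \<Rightarrow> (real \<Rightarrow> real) \<Rightarrow> bool" where
  "weak_deriv a b f g \<longleftrightarrow>
     (\<forall>\<psi> \<psi>'. (\<forall>t. (\<psi> has_real_derivative \<psi>' t) (at t)) \<and> continuous_on UNIV \<psi>' \<and>
        (\<exists>c d. a < c \<and> d < b \<and> (\<forall>t. t \<notin> {c..d} \<longrightarrow> \<psi> t = 0)) \<longrightarrow>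
        (LBINT t:{a<..<b}. f t * \<psi>' t) = - (LBINT t:{a<..<b}. g t * \<psi> t))"

definition W1p :: "real \<Rightarrow> real \<Rightarrow> real \<Rightarrow> (real \<Rightarrow> real) set" where
  "W1p p a b = {f \<in> Lp p a b. \<exists>g \<in> Lp p a b. weak_deriv a b f g}"

text \<open>The \<open>N\<close>-th Cartesian power of a scalar function space, and its (sum) product norm.\<close>

definition vec_space :: "(real \<Rightarrow> real) set \<Rightarrow> (real \<Rightarrow> real ^ 'n) set" where
  "vec_space X = {f. \<forall>i. (\<lambda>t. f t $ i) \<in> X}"

definition vec_norm :: "((real \<Rightarrow> real) \<Rightarrow> real) \<Rightarrow> (real \<Rightarrow> real ^ 'n) \<Rightarrow> real" where
  "vec_norm nrm f = (\<Sum>i\<in>UNIV. nrm (\<lambda>t. f t $ i))"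


section \<open>Hysteresis\<close>

text \<open>For continuous \<open>g\<close> and \<open>t > 0\<close>, the set \<open>X\<^sub>t\<close> has a greatest element whenever it is nonempty.\<close>

definition hysteresis :: "real \<Rightarrow> real \<Rightarrow> (real \<Rightarrow> real) \<Rightarrow> real \<Rightarrow> real" where
  "hysteresis \<alpha> \<beta> g t =
     (let X = {t'. 0 < t' \<and> t' \<le> t \<and> g t' \<in> {\<alpha>, \<beta>}} in
      if X = {} then (if g 0 < \<beta> then 1 else -1)
      else (if g (GREATEST t'. t' \<in> X) = \<alpha> then 1 else -1))"

definition switching_time ::
  "real \<Rightarrow> real \<Rightarrow> real ^ 'n \<Rightarrow> (real \<Rightarrow> real ^ 'n) \<Rightarrow> real \<Rightarrow> bool" where
  "switching_time \<alpha> \<beta> m u t \<longleftrightarrow>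
     0 \<le> t \<and> \<not> continuous (at t within {0..}) (hysteresis \<alpha> \<beta> (\<lambda>\<tau>. m \<bullet> u \<tau>))"


section \<open>Solutions, stability and the Poincare map\<close>

text \<open>
  The functional \<open>\<^bold>M x\<close> is \<open>m \<bullet> x\<close>, with \<open>m\<close> its coefficient vector. A point \<open>(\<phi>, x)\<close> of the phase
  space has its first component considered on \<open>(-2T, 0)\<close>.
\<close>

context
  fixes T \<alpha> \<beta> s p \<sigma> :: real
    and k m :: "real ^ 'n"
    and A B :: "real ^ 'n ^ 'n"
begin

definition Bsp :: "(real \<Rightarrow> real ^ 'n) set" where
  "Bsp = vec_space (Lp p (-2 * T) 0) \<inter> vec_space (Wsp s p (- T - \<sigma>) 0)"

definition Bsp_norm :: "(real \<Rightarrow> real ^ 'n) \<Rightarrow> real" where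
  "Bsp_norm \<phi> = vec_norm (Lp_norm p (-2 * T) 0) \<phi> + vec_norm (Wsp_norm s p (- T - \<sigma>) 0) \<phi>"

definition phase_space :: "((real \<Rightarrow> real ^ 'n) \<times> (real ^ 'n)) set" where
  "phase_space = Bsp \<times> UNIV"

definition phase_norm :: "(real \<Rightarrow> real ^ 'n) \<times> (real ^ 'n) \<Rightarrow> real" where
  "phase_norm z = Bsp_norm (fst z) + norm (snd z)"

definition phase_dist ::
  "(real \<Rightarrow> real ^ 'n) \<times> (real ^ 'n) \<Rightarrow> (real \<Rightarrow> real ^ 'n) \<times> (real ^ 'n) \<Rightarrow> real" where
  "phase_dist z w = phase_norm (\<lambda>\<xi>. fst z \<xi> - fst w \<xi>, snd z - snd w)"

definition phase_open :: "((real \<Rightarrow> real ^ 'n) \<times> (real ^ 'n)) set \<Rightarrow> bool" where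
  "phase_open U \<longleftrightarrow> U \<subseteq> phase_space \<and>
     (\<forall>z\<in>U. \<exists>\<epsilon>>0. \<forall>w\<in>phase_space. phase_dist w z < \<epsilon> \<longrightarrow> w \<in> U)"

definition phase_nbhd ::
  "((real \<Rightarrow> real ^ 'n) \<times> (real ^ 'n)) set \<Rightarrow> ((real \<Rightarrow> real ^ 'n) \<times> (real ^ 'n)) set \<Rightarrow> bool" where
  "phase_nbhd G \<Omega> \<longleftrightarrow> \<Omega> \<subseteq> phase_space \<and> (\<exists>U. phase_open U \<and> G \<subseteq> U \<and> U \<subseteq> \<Omega>)"

text \<open>
  \<open>u' = h k - B u + A u(\<cdot> - 2T)\<close> a.e. on \<open>(0, \<infinity>)\<close>, \<open>u = \<phi>\<close> on \<open>(-2T, 0)\<close>, \<open>u(0+) = x\<close>. On \<open>[0, \<infinity>)\<close>,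
  \<open>u\<close> is the continuous representative, with \<open>u 0\<close> the limit \<open>u(0+)\<close>.
\<close>

definition is_solution ::
  "(real \<Rightarrow> real) \<Rightarrow> (real \<Rightarrow> real ^ 'n) \<Rightarrow> real ^ 'n \<Rightarrow> (real \<Rightarrow> real ^ 'n) \<Rightarrow> bool" where
  "is_solution h \<phi> x u \<longleftrightarrow>
     (\<forall>t. -2 * T < t \<and> t < 0 \<longrightarrow> u t = \<phi> t) \<and>
     continuous_on {0..} u \<and> u 0 = x \<and>
     (\<forall>T1>0. u \<in> vec_space (Lp p (-2 * T) T1) \<and> u \<in> vec_space (W1p p 0 T1) \<and>
        (\<exists>u'. u' \<in> vec_space (Lp p 0 T1) \<and>
           (\<forall>i. weak_deriv 0 T1 (\<lambda>t. u t $ i) (\<lambda>t. u' t $ i)) \<and>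
           (AE t in lborel. 0 < t \<and> t < T1 \<longrightarrow>
              u' t = h t *\<^sub>R k - B *v u t + A *v u (t - 2 * T))))"

text \<open>The solutions are unique on \<open>(-2T, \<infinity>)\<close>; the values on \<open>(-\<infinity>, -2T]\<close> are unspecified and never
  used.\<close>

definition hsol :: "(real \<Rightarrow> real ^ 'n) \<Rightarrow> real ^ 'n \<Rightarrow> real \<Rightarrow> real ^ 'n" where
  "hsol \<phi> x = (SOME u. is_solution (hysteresis \<alpha> \<beta> (\<lambda>t. m \<bullet> u t)) \<phi> x u)"

definition u_plus :: "(real \<Rightarrow> real ^ 'n) \<Rightarrow> real ^ 'n \<Rightarrow> real \<Rightarrow> real ^ 'n" where
  "u_plus \<phi> x = (SOME u. is_solution (\<lambda>_. 1) \<phi> x u)"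

definition u_minus :: "(real \<Rightarrow> real ^ 'n) \<Rightarrow> real ^ 'n \<Rightarrow> real \<Rightarrow> real ^ 'n" where
  "u_minus \<phi> x = (SOME u. is_solution (\<lambda>_. -1) \<phi> x u)"

definition state :: "(real \<Rightarrow> real ^ 'n) \<Rightarrow> real \<Rightarrow> (real \<Rightarrow> real ^ 'n) \<times> (real ^ 'n)" where
  "state u t = (\<lambda>\<xi>. u (t + \<xi>), u t)"

definition orbit :: "(real \<Rightarrow> real ^ 'n) \<Rightarrow> ((real \<Rightarrow> real ^ 'n) \<times> (real ^ 'n)) set" where
  "orbit u = state u ` {0..}"

definition Gamma1 :: "(real \<Rightarrow> real ^ 'n) \<Rightarrow> ((real \<Rightarrow> real ^ 'n) \<times> (real ^ 'n)) set" where
  "Gamma1 uper = state uper ` {0..T}"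

definition Gamma2 :: "(real \<Rightarrow> real ^ 'n) \<Rightarrow> ((real \<Rightarrow> real ^ 'n) \<times> (real ^ 'n)) set" where
  "Gamma2 uper = state uper ` {T..2 * T}"

definition orbitally_stable :: "(real \<Rightarrow> real ^ 'n) \<Rightarrow> bool" where
  "orbitally_stable uper \<longleftrightarrow>
     (\<forall>\<Omega>. phase_nbhd (Gamma1 uper \<union> Gamma2 uper) \<Omega> \<longrightarrow>
        (\<exists>\<Omega>1 \<Omega>2. phase_nbhd (Gamma1 uper) \<Omega>1 \<and> phase_nbhd (Gamma2 uper) \<Omega>2 \<and>
           (\<forall>\<phi> x. ((\<phi>, x) \<in> \<Omega>1 \<and> m \<bullet> x < \<beta>) \<or> ((\<phi>, x) \<in> \<Omega>2 \<and> m \<bullet> x \<ge> \<beta>) \<longrightarrow>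
              orbit (hsol \<phi> x) \<subseteq> \<Omega>)))"

definition orbitally_asymp_stable :: "(real \<Rightarrow> real ^ 'n) \<Rightarrow> bool" where
  "orbitally_asymp_stable uper \<longleftrightarrow> orbitally_stable uper \<and>
     (\<exists>\<Theta>1 \<Theta>2. phase_nbhd (Gamma1 uper) \<Theta>1 \<and> phase_nbhd (Gamma2 uper) \<Theta>2 \<and>
        (\<forall>\<phi> x. ((\<phi>, x) \<in> \<Theta>1 \<and> m \<bullet> x < \<beta>) \<or> ((\<phi>, x) \<in> \<Theta>2 \<and> m \<bullet> x \<ge> \<beta>) \<longrightarrow>
           ((\<lambda>t. INF w\<in>Gamma1 uper \<union> Gamma2 uper. phase_dist (state (hsol \<phi> x) t) w)
              \<longlongrightarrow> 0) at_top))"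

definition orbitally_unstable :: "(real \<Rightarrow> real ^ 'n) \<Rightarrow> bool" where
  "orbitally_unstable uper \<longleftrightarrow> \<not> orbitally_stable uper"

definition section_at :: "real \<Rightarrow> ((real \<Rightarrow> real ^ 'n) \<times> (real ^ 'n)) set" where
  "section_at c = {z \<in> phase_space. m \<bullet> snd z = c}"

text \<open>The first hitting times \<open>t\<^sub>\<beta>\<close>, \<open>t\<^sub>\<alpha>\<close>. They are finite iff the level is hit at all, which is how
  finiteness is expressed in the domains of the hit maps.\<close>

definition t_beta :: "(real \<Rightarrow> real ^ 'n) \<times> (real ^ 'n) \<Rightarrow> real" where
  "t_beta z = (LEAST t. 0 < t \<and> m \<bullet> u_plus (fst z) (snd z) t = \<beta>)"

definition t_alpha :: "(real \<Rightarrow> real ^ 'n) \<times> (real ^ 'n) \<Rightarrow> real" where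
  "t_alpha z = (LEAST t. 0 < t \<and> m \<bullet> u_minus (fst z) (snd z) t = \<alpha>)"

definition dom_P_beta :: "((real \<Rightarrow> real ^ 'n) \<times> (real ^ 'n)) set" where
  "dom_P_beta = {z \<in> section_at \<alpha>. \<exists>t>0. m \<bullet> u_plus (fst z) (snd z) t = \<beta>}"

definition dom_P_alpha :: "((real \<Rightarrow> real ^ 'n) \<times> (real ^ 'n)) set" where
  "dom_P_alpha = {z \<in> section_at \<beta>. \<exists>t>0. m \<bullet> u_minus (fst z) (snd z) t = \<alpha>}"

definition P_beta ::
  "(real \<Rightarrow> real ^ 'n) \<times> (real ^ 'n) \<Rightarrow> (real \<Rightarrow> real ^ 'n) \<times> (real ^ 'n)" where
  "P_beta z = state (u_plus (fst z) (snd z)) (t_beta z)"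

definition P_alpha ::
  "(real \<Rightarrow> real ^ 'n) \<times> (real ^ 'n) \<Rightarrow> (real \<Rightarrow> real ^ 'n) \<times> (real ^ 'n)" where
  "P_alpha z = state (u_minus (fst z) (snd z)) (t_alpha z)"

definition poincare ::
  "(real \<Rightarrow> real ^ 'n) \<times> (real ^ 'n) \<Rightarrow> (real \<Rightarrow> real ^ 'n) \<times> (real ^ 'n)" where
  "poincare = P_alpha \<circ> P_beta"

definition dom_poincare :: "((real \<Rightarrow> real ^ 'n) \<times> (real ^ 'n)) set" where
  "dom_poincare = {z \<in> dom_P_beta. P_beta z \<in> dom_P_alpha}"

definition fp_stable :: "(real \<Rightarrow> real ^ 'n) \<Rightarrow> real ^ 'n \<Rightarrow> bool" where
  "fp_stable \<phi> x \<longleftrightarrow>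
     (\<forall>\<epsilon>>0. \<exists>\<delta>>0. \<forall>\<nu>\<in>Bsp. \<forall>y.
        phase_norm (\<nu>, y) \<le> \<delta> \<and> (\<lambda>\<xi>. \<phi> \<xi> + \<nu> \<xi>, x + y) \<in> section_at \<alpha> \<longrightarrow>
        (\<forall>n. (poincare ^^ n) (\<lambda>\<xi>. \<phi> \<xi> + \<nu> \<xi>, x + y) \<in> dom_poincare \<and>
             phase_dist ((poincare ^^ n) (\<lambda>\<xi>. \<phi> \<xi> + \<nu> \<xi>, x + y)) (\<phi>, x) \<le> \<epsilon>))"

definition fp_asymp_stable :: "(real \<Rightarrow> real ^ 'n) \<Rightarrow> real ^ 'n \<Rightarrow> bool" where
  "fp_asymp_stable \<phi> x \<longleftrightarrow> fp_stable \<phi> x \<and>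
     (\<exists>\<delta>>0. \<forall>\<nu>\<in>Bsp. \<forall>y.
        phase_norm (\<nu>, y) \<le> \<delta> \<and> (\<lambda>\<xi>. \<phi> \<xi> + \<nu> \<xi>, x + y) \<in> section_at \<alpha> \<longrightarrow>
        (\<lambda>n. phase_dist ((poincare ^^ n) (\<lambda>\<xi>. \<phi> \<xi> + \<nu> \<xi>, x + y)) (\<phi>, x)) \<longlonglongrightarrow> 0)"

definition fp_unstable :: "(real \<Rightarrow> real ^ 'n) \<Rightarrow> real ^ 'n \<Rightarrow> bool" where
  "fp_unstable \<phi> x \<longleftrightarrow> \<not> fp_stable \<phi> x"

end

end

theory Submission
  imports Defs
begin

text \<open>
  Near the periodic orbit, a solution of (P) is a concatenation of flights with a constant value of the
  relay. Since \<open>\<^bold>M u\<^sub>p\<^sub>e\<^sub>r\<close> reaches the levels transversally, a flight starting near the orbit ends at a time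
  and in a state close to the corresponding switch, uniformly in the starting point. This rests on
  continuous dependence in \<open>B\<^sub>p\<^sup>s\<close>, where the history has to be joined to the trajectory across the jump at
  \<open>t = 0\<close>; for \<open>sp < 1\<close> a fractional Hardy inequality controls this. Consequently the visits of the
  section \<open>\<^bold>M x = \<alpha>\<close> are the iterates of \<open>\<^bold>P\<close>, and stability of the fixed point passes to the orbit.

  Conversely, orbital stability only says that the states of a solution stay near some point of \<open>\<Gamma>\<close>.
  A solution starting on the section near the fixed point is, at time \<open>T / 2\<close>, roughly near the state of
  \<open>u\<^sub>p\<^sub>e\<^sub>r\<close> at \<open>T / 2\<close>, which has a positive distance to the states on \<open>\<Gamma>\<^sub>2\<close>. So the nearby point of \<open>\<Gamma>\<close> lies
  on \<open>\<Gamma>\<^sub>1\<close>, and the rest of the cycle leads close to the fixed point.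
\<close>

section \<open>Minkowski's inequality\<close>

text \<open>The relay is discontinuous, so nearby solutions of (P) are not compared directly. An arc
  of the periodic orbit is continued past its switch with the relay frozen; this arc and a nearby
  flight solve the same linear equation, \<open>k\<close> cancels in the difference, and one
  constant bounds the distance of their states on \<open>[0, 2T]\<close>. The weak formulation of
  (P) is traded for an integral equation, which additivity of the integral allows to shift, restrict
  and restart. Since \<open>hsol\<close>, \<open>u_plus\<close> and \<open>u_minus\<close> are
  chosen by \<open>SOME\<close>, existence has to be proved, for the hysteretic problem too. A
  restart is legitimate only where the relay has the value that the initial rule would assign. This
  holds at every switch and on a plus flight below \<beta>, so solutions are cut only there.
  Iterates of the Poincare map and states of a solution are different representatives that agree on
  \<open>(-2T, 0)\<close>, hence the relation \<open>phase_eq\<close>.\<close>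

lemma powr_add_le:
  fixes a b x y p :: real
  assumes "a > 0" "b > 0" "x \<ge> 0" "y \<ge> 0" "p \<ge> 1"
  shows "(x + y) powr p \<le> (a + b) powr (p - 1) * (a powr (1 - p) * x powr p + b powr (1 - p) * y powr p)"
proof -
  have pa: "a powr (1 - p) = a / a powr p" "b powr (1 - p) = b / b powr p"
    and pab: "(a + b) powr (p - 1) = (a + b) powr p / (a + b)"
    using assms by (simp_all add: powr_diff)
  consider "x = 0" | "y = 0" | "x > 0" "y > 0" using assms by force
  then show ?thesis
  proof cases
    case 1
    have "1 \<le> (a + b) powr (p - 1) * b powr (1 - p)"
    proof -
      have "b powr (p - 1) \<le> (a + b) powr (p - 1)" by (rule powr_mono2) (use assms in auto)
      moreover have "b powr (1 - p) = 1 / b powr (p - 1)" using assms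
        by (metis minus_diff_eq powr_minus_divide)
      ultimately show ?thesis using assms by simp
    qed
    then have "1 * y powr p \<le> (a + b) powr (p - 1) * b powr (1 - p) * y powr p"
      by (intro mult_right_mono) auto
    with 1 show ?thesis using assms by simp
  next
    case 2
    have "1 \<le> (a + b) powr (p - 1) * a powr (1 - p)"
    proof -
      have "a powr (p - 1) \<le> (a + b) powr (p - 1)" by (rule powr_mono2) (use assms in auto)
      moreover have "a powr (1 - p) = 1 / a powr (p - 1)" using assms
        by (metis minus_diff_eq powr_minus_divide)
      ultimately show ?thesis using assms by simp
    qed
    then have "1 * x powr p \<le> (a + b) powr (p - 1) * a powr (1 - p) * x powr p"
      by (intro mult_right_mono) auto
    with 2 show ?thesis using assms by simp
  next
    case 3
    \<comment> \<open>Convexity of the p-th power at the points \<open>x / a\<close> and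
      \<open>y / b\<close> with weights \<open>a / (a + b)\<close> and \<open>b / (a + b)\<close>.
      If \<open>a\<close> and \<open>b\<close> bound the norms of two functions, integration of the
      result is Minkowski's inequality.\<close>
    define t where "t = b / (a + b)"
    have t: "0 \<le> t" "t \<le> 1" "1 - t = a / (a + b)" using assms by (auto simp: t_def field_simps)
    have "((1 - t) *\<^sub>R (x / a) + t *\<^sub>R (y / b)) powr p \<le> (1 - t) * (x / a) powr p + t * (y / b) powr p"
      by (rule convex_onD[OF powr_convex[OF assms(5)]]) (use 3 t assms in auto)
    moreover have "(1 - t) *\<^sub>R (x / a) + t *\<^sub>R (y / b) = (x + y) / (a + b)"
    proof -
      have "(1 - t) * (x / a) = x / (a + b)" "t * (y / b) = y / (a + b)"
        unfolding t(3) using assms by (simp_all add: t_def)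
      then show ?thesis by (simp add: add_divide_distrib)
    qed
    moreover have "((x + y) / (a + b)) powr p = (x + y) powr p / (a + b) powr p"
      "(x / a) powr p = x powr p / a powr p" "(y / b) powr p = y powr p / b powr p"
      using assms by (simp_all add: powr_divide)
    ultimately have "(x + y) powr p / (a + b) powr p \<le>
        (a * (x powr p / a powr p) + b * (y powr p / b powr p)) / (a + b)"
      unfolding t by (simp add: t_def add_divide_distrib mult.commute)
    then have "(x + y) powr p \<le> (a + b) powr p * ((a * (x powr p / a powr p) + b * (y powr p / b powr p)) / (a + b))"
      using assms by (simp add: field_simps)
    then show ?thesis unfolding pa pab by (simp add: field_simps)
  qed
qed

lemma powr_add_le2:
  fixes x y p :: real
  assumes "x \<ge> 0" "y \<ge> 0" "p \<ge> 1"
  shows "(x + y) powr p \<le> 2 powr (p - 1) * (x powr p + y powr p)"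
  using powr_add_le[of 1 1 x y p] assms by simp

text \<open>Comparison of each term with the largest one; the constant is crude but depends on the
  number of terms only.\<close>

lemma powr_sum_le:
  fixes f :: "'i \<Rightarrow> real"
  assumes "finite I" "\<And>i. i \<in> I \<Longrightarrow> f i \<ge> 0" "p \<ge> 1"
  shows "(\<Sum>i\<in>I. f i) powr p \<le> card I powr p * (\<Sum>i\<in>I. f i powr p)"
proof (cases "I = {}")
  case False
  define M where "M = Max (f ` I)"
  have fM: "f i \<le> M" if "i \<in> I" for i using that assms by (simp add: M_def)
  obtain j where j: "j \<in> I" "M = f j" using assms False unfolding M_def
    by (metis (mono_tags, lifting) Max_in finite_imageI image_iff image_is_empty)
  have M0: "M \<ge> 0" using j assms by auto
  have "(\<Sum>i\<in>I. f i) \<le> card I * M" using sum_bounded_above[of I f M] fM by simp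
  then have "(\<Sum>i\<in>I. f i) powr p \<le> (card I * M) powr p"
    using assms by (intro powr_mono2) (auto intro: sum_nonneg)
  also have "\<dots> = card I powr p * M powr p" using M0 by (simp add: powr_mult)
  also have "\<dots> \<le> card I powr p * (\<Sum>i\<in>I. f i powr p)"
    using j assms by (intro mult_left_mono) (auto intro: member_le_sum)
  finally show ?thesis .
qed auto

text \<open>Replaces Hoelder's inequality: up to a constant, the optimal \<open>c\<close> recovers it.\<close>

lemma abs_le_young:
  fixes x c p :: real
  assumes "c > 0" "p \<ge> 1"
  shows "\<bar>x\<bar> \<le> c + c powr (1 - p) * \<bar>x\<bar> powr p"
proof (cases "\<bar>x\<bar> \<le> c")
  case True
  then show ?thesis by (simp add: add_increasing2)
next
  case False
  then have "\<bar>x\<bar> powr p = \<bar>x\<bar> powr (p - 1) * \<bar>x\<bar>" using assms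
    by (simp add: powr_diff)
  moreover have "c powr (p - 1) \<le> \<bar>x\<bar> powr (p - 1)" using False assms by (intro powr_mono2) auto
  moreover have "c powr (1 - p) = 1 / c powr (p - 1)" using assms
    by (metis minus_diff_eq powr_minus_divide)
  moreover have "c powr (p - 1) > 0" using assms by simp
  ultimately have "1 \<le> \<bar>x\<bar> powr (p - 1) * c powr (1 - p)"
    by (simp add: divide_le_eq)
  then have "\<bar>x\<bar> * 1 \<le> \<bar>x\<bar> * (\<bar>x\<bar> powr (p - 1) * c powr (1 - p))"
    by (intro mult_left_mono) auto
  then have "\<bar>x\<bar> \<le> c powr (1 - p) * \<bar>x\<bar> powr p"
    using \<open>\<bar>x\<bar> powr p = _\<close> by (simp add: ac_simps)
  then show ?thesis using assms by simp
qed

text \<open>An arbitrary measure is allowed so that one Minkowski inequality serves both parts of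
  the norm: the Slobodeckij seminorm is the L_p norm of a difference quotient over the
  plane.\<close>

definition pow_int :: "real \<Rightarrow> 'a measure \<Rightarrow> ('a \<Rightarrow> real) \<Rightarrow> ennreal" where
  "pow_int p M f = (\<integral>\<^sup>+x. ennreal (\<bar>f x\<bar> powr p) \<partial>M)"

definition pow_norm :: "real \<Rightarrow> 'a measure \<Rightarrow> ('a \<Rightarrow> real) \<Rightarrow> real" where
  "pow_norm p M f = enn2real (pow_int p M f) powr (1 / p)"

lemma pow_norm_nonneg [simp]: "pow_norm p M f \<ge> 0"
  by (simp add: pow_norm_def)

lemma pow_norm_le_iff:
  assumes "pow_int p M f < \<infinity>" "p > 0" "D \<ge> 0"
  shows "pow_norm p M f \<le> D \<longleftrightarrow> pow_int p M f \<le> ennreal (D powr p)"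
proof -
  obtain r where r: "pow_int p M f = ennreal r" "r \<ge> 0" using assms(1)
    by (cases "pow_int p M f") auto
  have "r powr (1 / p) \<le> D \<longleftrightarrow> r \<le> D powr p"
  proof
    assume "r powr (1 / p) \<le> D"
    then have "(r powr (1 / p)) powr p \<le> D powr p" using assms by (intro powr_mono2) auto
    then show "r \<le> D powr p" using r assms by (simp add: powr_powr)
  next
    assume "r \<le> D powr p"
    then have "r powr (1 / p) \<le> (D powr p) powr (1 / p)" using assms r by (intro powr_mono2) auto
    then show "r powr (1 / p) \<le> D" using assms by (simp add: powr_powr)
  qed
  then show ?thesis using r by (simp add: pow_norm_def)
qed

lemma pow_norm_leI:
  assumes "pow_int p M f \<le> ennreal (D powr p)" "p > 0" "D \<ge> 0"
  shows "pow_norm p M f \<le> D"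
  using assms pow_norm_le_iff[of p M f D] by (simp add: order_le_less_trans)

text \<open>The bounds \<open>a\<close> and \<open>b\<close> of the two norms are also the weights
  in \<open>powr_add_le\<close>, whose right-hand side then integrates to
  \<open>(a + b) powr (p - 1) * (a + b)\<close>.\<close>

lemma pow_int_add:
  assumes [measurable]: "f \<in> borel_measurable M" "g \<in> borel_measurable M" and p: "p \<ge> 1"
    and a: "a > 0" "pow_int p M f \<le> ennreal (a powr p)" and b: "b > 0" "pow_int p M g \<le> ennreal (b powr p)"
  shows "pow_int p M (\<lambda>x. f x + g x) \<le> ennreal ((a + b) powr p)"
proof -
  define A B C where "A = a powr (1 - p)" "B = b powr (1 - p)" "C = (a + b) powr (p - 1)"
  have [simp]: "A \<ge> 0" "B \<ge> 0" "C \<ge> 0" by (auto simp: A_B_C_def)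
  have "pow_int p M (\<lambda>x. f x + g x) \<le> (\<integral>\<^sup>+x. ennreal C * (ennreal A * ennreal (\<bar>f x\<bar> powr p) + ennreal B * ennreal (\<bar>g x\<bar> powr p)) \<partial>M)"
    unfolding pow_int_def
  proof (rule nn_integral_mono)
    fix x
    have "\<bar>f x + g x\<bar> powr p \<le> (\<bar>f x\<bar> + \<bar>g x\<bar>) powr p" using p by (intro powr_mono2) auto
    also have "\<dots> \<le> C * (A * \<bar>f x\<bar> powr p + B * \<bar>g x\<bar> powr p)"
      unfolding A_B_C_def by (rule powr_add_le) (use a b p in auto)
    finally show "ennreal (\<bar>f x + g x\<bar> powr p) \<le> ennreal C * (ennreal A * ennreal (\<bar>f x\<bar> powr p) + ennreal B * ennreal (\<bar>g x\<bar> powr p))"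
      by (simp flip: ennreal_mult ennreal_plus add: ennreal_leI)
  qed
  also have "\<dots> = ennreal C * (ennreal A * pow_int p M f + ennreal B * pow_int p M g)"
    by (simp add: nn_integral_cmult nn_integral_add pow_int_def)
  also have "\<dots> \<le> ennreal C * (ennreal A * ennreal (a powr p) + ennreal B * ennreal (b powr p))"
    by (intro mult_left_mono add_mono a b) auto
  also have "\<dots> = ennreal (C * (A * a powr p + B * b powr p))"
    by (simp flip: ennreal_mult ennreal_plus)
  also have "C * (A * a powr p + B * b powr p) = (a + b) powr p"
    using a b by (simp add: A_B_C_def powr_diff)
  finally show ?thesis .
qed

lemma pow_int_add_finite:
  assumes "f \<in> borel_measurable M" "g \<in> borel_measurable M" "p \<ge> 1"
    and "pow_int p M f < \<infinity>" "pow_int p M g < \<infinity>"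
  shows "pow_int p M (\<lambda>x. f x + g x) < \<infinity>"
    and "pow_norm p M (\<lambda>x. f x + g x) \<le> pow_norm p M f + pow_norm p M g"
proof -
  \<comment> \<open>\<open>pow_int_add\<close> needs positive bounds, while a norm may vanish; hence
    the slack \<open>e\<close>, which tends to 0 at the end.\<close>
  have *: "pow_int p M (\<lambda>x. f x + g x) \<le> ennreal ((pow_norm p M f + e + (pow_norm p M g + e)) powr p)" if "e > 0" for e
  proof (rule pow_int_add)
    show "pow_int p M f \<le> ennreal ((pow_norm p M f + e) powr p)"
      using assms that by (subst pow_norm_le_iff[symmetric]) auto
    show "pow_int p M g \<le> ennreal ((pow_norm p M g + e) powr p)"
      using assms that by (subst pow_norm_le_iff[symmetric]) auto
  qed (use that assms in \<open>auto intro: add_nonneg_pos\<close>)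
  show fin: "pow_int p M (\<lambda>x. f x + g x) < \<infinity>"
    using *[of 1] by (simp add: order_le_less_trans)
  show "pow_norm p M (\<lambda>x. f x + g x) \<le> pow_norm p M f + pow_norm p M g"
  proof (rule field_le_epsilon)
    fix e :: real assume "e > 0"
    then show "pow_norm p M (\<lambda>x. f x + g x) \<le> pow_norm p M f + pow_norm p M g + e"
      using *[of "e/2"] assms by (subst pow_norm_le_iff[OF fin]) (auto simp: algebra_simps)
  qed
qed

lemma pow_int_uminus [simp]: "pow_int p M (\<lambda>x. - f x) = pow_int p M f"
  by (simp add: pow_int_def)

lemma pow_norm_uminus [simp]: "pow_norm p M (\<lambda>x. - f x) = pow_norm p M f"
  by (simp add: pow_norm_def)

section \<open>The spaces \<open>L\<^sub>p\<close> and \<open>W\<^sub>p\<^sup>s\<close> on an interval\<close>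

text \<open>Extension by zero turns integrals over an interval into integrals over the line, and
  measurability on the interval into Borel measurability.\<close>

definition cut :: "real \<Rightarrow> real \<Rightarrow> (real \<Rightarrow> real) \<Rightarrow> real \<Rightarrow> real" where
  "cut a b f t = indicator {a<..<b} t * f t"

text \<open>Both terms carry both indicators, so the quotient vanishes off the square and is linear
  in \<open>f\<close>. The exponent \<open>(1 + s * p) / p\<close> becomes \<open>1 + s * p\<close>
  in the p-th power. On the diagonal the value is 0.\<close>

definition slob_quot :: "real \<Rightarrow> real \<Rightarrow> real \<Rightarrow> real \<Rightarrow> (real \<Rightarrow> real) \<Rightarrow> real \<times> real \<Rightarrow> real" where
  "slob_quot s p a b f = (\<lambda>(t, \<xi>). (cut a b f t * indicator {a<..<b} \<xi> - indicator {a<..<b} t * cut a b f \<xi>)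
     / \<bar>t - \<xi>\<bar> powr ((1 + s * p) / p))"

lemma cut_cong: "(\<And>t. a < t \<Longrightarrow> t < b \<Longrightarrow> f t = g t) \<Longrightarrow> cut a b f = cut a b g"
  by (auto simp: cut_def fun_eq_iff indicator_def)

lemma set_borel_measurable_cut: "set_borel_measurable lborel {a<..<b} f \<longleftrightarrow> cut a b f \<in> borel_measurable borel"
  by (simp add: set_borel_measurable_def cut_def[abs_def])

lemma measurable_slob_quot [measurable]:
  assumes [measurable]: "cut a b f \<in> borel_measurable borel"
  shows "slob_quot s p a b f \<in> borel_measurable (lborel \<Otimes>\<^sub>M lborel)"
  unfolding slob_quot_def by measurable

lemma Lp_integral_eq: "(\<integral>\<^sup>+t\<in>{a<..<b}. ennreal (\<bar>f t\<bar> powr p) \<partial>lborel) = pow_int p lborel (cut a b f)"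
  unfolding pow_int_def cut_def by (intro nn_integral_cong) (auto simp: indicator_def)

lemma Lp_iff: "f \<in> Lp p a b \<longleftrightarrow> cut a b f \<in> borel_measurable borel \<and> pow_int p lborel (cut a b f) < \<infinity>"
  by (simp add: Lp_def set_borel_measurable_cut Lp_integral_eq)

lemma Lp_norm_eq: "Lp_norm p a b f = pow_norm p lborel (cut a b f)"
  by (simp add: Lp_norm_def Lp_integral_eq pow_norm_def)

lemma slobodeckij_integral_eq:
  assumes [measurable]: "cut a b f \<in> borel_measurable borel" and "p > 0"
  shows "slobodeckij_integral s p a b f = pow_int p (lborel \<Otimes>\<^sub>M lborel) (slob_quot s p a b f)"
proof -
  have "pow_int p (lborel \<Otimes>\<^sub>M lborel) (slob_quot s p a b f)
      = (\<integral>\<^sup>+t. \<integral>\<^sup>+\<xi>. ennreal (\<bar>slob_quot s p a b f (t, \<xi>)\<bar> powr p) \<partial>lborel \<partial>lborel)"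
    unfolding pow_int_def by (rule lborel.nn_integral_fst[symmetric]) measurable
  also have "\<dots> = slobodeckij_integral s p a b f"
    unfolding slobodeckij_integral_def slob_quot_def cut_def
    using assms(2) by (auto intro!: nn_integral_cong simp: indicator_def powr_divide powr_powr)
  finally show ?thesis by simp
qed

lemma Wsp_iff:
  assumes "p > 0"
  shows "f \<in> Wsp s p a b \<longleftrightarrow> f \<in> Lp p a b \<and> pow_int p (lborel \<Otimes>\<^sub>M lborel) (slob_quot s p a b f) < \<infinity>"
  using assms by (auto simp: Wsp_def Lp_iff slobodeckij_integral_eq)

lemma Wsp_norm_eq:
  assumes "p > 0" "f \<in> Lp p a b"
  shows "Wsp_norm s p a b f = pow_norm p lborel (cut a b f) + pow_norm p (lborel \<Otimes>\<^sub>M lborel) (slob_quot s p a b f)"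
  using assms by (auto simp: Wsp_norm_def Lp_iff slobodeckij_integral_eq Lp_norm_eq pow_norm_def)

lemma cut_add: "cut a b (\<lambda>x. f x + g x) = (\<lambda>x. cut a b f x + cut a b g x)"
  by (auto simp: cut_def fun_eq_iff algebra_simps)

lemma cut_uminus: "cut a b (\<lambda>x. - f x) = (\<lambda>x. - cut a b f x)"
  by (auto simp: cut_def fun_eq_iff)

lemma slob_quot_add: "slob_quot s p a b (\<lambda>x. f x + g x) = (\<lambda>x. slob_quot s p a b f x + slob_quot s p a b g x)"
  by (auto simp: slob_quot_def cut_add fun_eq_iff add_divide_distrib[symmetric] algebra_simps)

lemma slob_quot_uminus: "slob_quot s p a b (\<lambda>x. - f x) = (\<lambda>x. - slob_quot s p a b f x)"
  by (auto simp: slob_quot_def cut_uminus fun_eq_iff minus_divide_left)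

lemma Lp_add:
  assumes "p \<ge> 1" "f \<in> Lp p a b" "g \<in> Lp p a b"
  shows "(\<lambda>x. f x + g x) \<in> Lp p a b" "Lp_norm p a b (\<lambda>x. f x + g x) \<le> Lp_norm p a b f + Lp_norm p a b g"
  using assms pow_int_add_finite[of "cut a b f" lborel "cut a b g" p]
  by (auto simp: Lp_iff Lp_norm_eq cut_add)

lemma Wsp_add:
  assumes "p \<ge> 1" "f \<in> Wsp s p a b" "g \<in> Wsp s p a b"
  shows "(\<lambda>x. f x + g x) \<in> Wsp s p a b"
    and "Wsp_norm s p a b (\<lambda>x. f x + g x) \<le> Wsp_norm s p a b f + Wsp_norm s p a b g"
proof -
  have p: "p > 0" using assms by simp
  have f: "f \<in> Lp p a b" "cut a b f \<in> borel_measurable borel" "pow_int p (lborel \<Otimes>\<^sub>M lborel) (slob_quot s p a b f) < \<infinity>"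
    and g: "g \<in> Lp p a b" "cut a b g \<in> borel_measurable borel" "pow_int p (lborel \<Otimes>\<^sub>M lborel) (slob_quot s p a b g) < \<infinity>"
    using assms by (auto simp: Wsp_iff[OF p] Lp_iff)
  note 1 = Lp_add[OF assms(1) f(1) g(1)]
  note 2 = pow_int_add_finite[OF measurable_slob_quot[OF f(2)] measurable_slob_quot[OF g(2)] assms(1) f(3) g(3)]
  show "(\<lambda>x. f x + g x) \<in> Wsp s p a b"
    using 1 2 by (simp add: Wsp_iff[OF p] slob_quot_add)
  show "Wsp_norm s p a b (\<lambda>x. f x + g x) \<le> Wsp_norm s p a b f + Wsp_norm s p a b g"
    using 1 2 by (simp add: Wsp_norm_eq[OF p] f g slob_quot_add flip: Lp_norm_eq)
qed

lemma Lp_uminus: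
  "(\<lambda>x. - f x) \<in> Lp p a b \<longleftrightarrow> f \<in> Lp p a b" "Lp_norm p a b (\<lambda>x. - f x) = Lp_norm p a b f"
proof -
  have "(\<lambda>x. - cut a b f x) \<in> borel_measurable borel \<longleftrightarrow> cut a b f \<in> borel_measurable borel"
    using borel_measurable_uminus_eq by blast
  then show "(\<lambda>x. - f x) \<in> Lp p a b \<longleftrightarrow> f \<in> Lp p a b" "Lp_norm p a b (\<lambda>x. - f x) = Lp_norm p a b f"
    by (simp_all add: Lp_iff Lp_norm_eq cut_uminus)
qed

lemma Wsp_uminus:
  assumes "p > 0" "f \<in> Wsp s p a b"
  shows "(\<lambda>x. - f x) \<in> Wsp s p a b" "Wsp_norm s p a b (\<lambda>x. - f x) = Wsp_norm s p a b f"
  using assms by (auto simp: Wsp_iff Wsp_norm_eq slob_quot_uminus Lp_uminus cut_uminus)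

lemma Wsp_norm_nonneg: "Wsp_norm s p a b f \<ge> 0" "Lp_norm p a b f \<ge> 0"
  by (auto simp: Wsp_norm_def Lp_norm_def)

text \<open>L_p embeds into L_1 on a bounded interval. Integrating \<open>abs_le_young\<close> costs
  \<open>(b - a) * c\<close> for its constant term and \<open>c powr (1 - p) * c powr p\<close>,
  that is \<open>c\<close>, for the other one; hence the factor \<open>b - a + 1\<close>.\<close>

lemma Lp_abs_integral:
  assumes f: "f \<in> Lp p a b" and p: "p \<ge> 1" and ab: "a \<le> b" and c: "c > 0"
  shows "f absolutely_integrable_on {a..b}"
    and "pow_int p lborel (cut a b f) \<le> ennreal (c powr p) \<Longrightarrow> integral {a..b} (\<lambda>x. \<bar>f x\<bar>) \<le> (b - a + 1) * c"
proof -
  have [measurable]: "cut a b f \<in> borel_measurable borel" and fin: "pow_int p lborel (cut a b f) < \<infinity>"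
    using f by (auto simp: Lp_iff)
  have *: "(\<integral>\<^sup>+x. ennreal \<bar>cut a b f x\<bar> \<partial>lborel) \<le> ennreal ((b - a) * c) + ennreal (c powr (1 - p)) * pow_int p lborel (cut a b f)"
    if "c > 0" for c
  proof -
    have "(\<integral>\<^sup>+x. ennreal \<bar>cut a b f x\<bar> \<partial>lborel) \<le> (\<integral>\<^sup>+x. ennreal c * indicator {a<..<b} x + ennreal (c powr (1 - p)) * ennreal (\<bar>cut a b f x\<bar> powr p) \<partial>lborel)"
    proof (rule nn_integral_mono)
      fix x
      show "ennreal \<bar>cut a b f x\<bar> \<le> ennreal c * indicator {a<..<b} x + ennreal (c powr (1 - p)) * ennreal (\<bar>cut a b f x\<bar> powr p)"
        using abs_le_young[of c p "f x"] that p
        by (auto simp: cut_def indicator_def simp flip: ennreal_mult ennreal_plus intro!: ennreal_leI)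
    qed
    also have "\<dots> = ennreal c * emeasure lborel {a<..<b} + ennreal (c powr (1 - p)) * pow_int p lborel (cut a b f)"
      by (simp add: nn_integral_add nn_integral_cmult pow_int_def)
    also have "ennreal c * emeasure lborel {a<..<b} = ennreal ((b - a) * c)"
      using ab that by (simp flip: ennreal_mult add: mult.commute)
    finally show ?thesis .
  qed
  have "(\<integral>\<^sup>+x. ennreal \<bar>cut a b f x\<bar> \<partial>lborel) < \<infinity>"
    using *[of 1] fin by (auto simp: order_le_less_trans)
  then have int: "integrable lborel (cut a b f)"
    by (intro integrableI_bounded) auto
  then have si: "set_integrable lborel {a<..<b} f" by (simp add: set_integrable_def cut_def[abs_def])
  then have "f absolutely_integrable_on {a<..<b}"
    unfolding set_integrable_def by (intro integrable_completion[THEN iffD2] borel_measurable_integrable)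
  moreover have n1: "negligible {x \<in> {a<..<b} - {a..b}. f x \<noteq> 0}" for f :: "real \<Rightarrow> real"
    by (rule negligible_subset[of "{}"]) auto
  moreover have n2: "negligible {x \<in> {a..b} - {a<..<b}. f x \<noteq> 0}" for f :: "real \<Rightarrow> real"
    by (rule negligible_subset[of "{a,b}"]) auto
  ultimately show ai: "f absolutely_integrable_on {a..b}"
    by (rule absolutely_integrable_spike_set)
  assume le: "pow_int p lborel (cut a b f) \<le> ennreal (c powr p)"
  have "integral {a..b} (\<lambda>x. \<bar>f x\<bar>) = integral {a<..<b} (\<lambda>x. \<bar>f x\<bar>)"
    by (rule integral_spike_set[OF n2 n1])
  also have "\<dots> = (LBINT x:{a<..<b}. \<bar>f x\<bar>)"
    using set_borel_integral_eq_integral(2)[OF set_integrable_abs[OF si]] by simp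
  also have "\<dots> = (\<integral>x. \<bar>cut a b f x\<bar> \<partial>lborel)"
    by (simp add: set_lebesgue_integral_def cut_def abs_mult)
  finally have eq: "integral {a..b} (\<lambda>x. \<bar>f x\<bar>) = (\<integral>x. \<bar>cut a b f x\<bar> \<partial>lborel)" .
  have "ennreal (\<integral>x. \<bar>cut a b f x\<bar> \<partial>lborel) = (\<integral>\<^sup>+x. ennreal \<bar>cut a b f x\<bar> \<partial>lborel)"
    using int by (intro nn_integral_eq_integral[symmetric]) auto
  also have "\<dots> \<le> ennreal ((b - a) * c) + ennreal (c powr (1 - p)) * ennreal (c powr p)"
    by (rule order_trans[OF *[OF c]]) (intro add_left_mono mult_left_mono le, auto)
  also have "\<dots> = ennreal ((b - a + 1) * c)"
    using c ab by (simp flip: ennreal_mult ennreal_plus add: powr_add[symmetric] algebra_simps)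
  finally have "(\<integral>x. \<bar>cut a b f x\<bar> \<partial>lborel) \<le> (b - a + 1) * c"
    using c ab by (subst (asm) ennreal_le_iff) auto
  with eq show "integral {a..b} (\<lambda>x. \<bar>f x\<bar>) \<le> (b - a + 1) * c" by simp
qed

section \<open>Estimates for the Slobodeckij seminorm\<close>

lemma nn_integral_powr_from_0:
  fixes L \<gamma> :: real
  assumes "\<gamma> > 0" "L \<ge> 0"
  shows "(\<integral>\<^sup>+h. ennreal (indicator {0<..<L} h * h powr (\<gamma> - 1)) \<partial>lborel) = ennreal (L powr \<gamma> / \<gamma>)"
proof (rule nn_integral_has_integral_lborel)
  have "((\<lambda>h. h powr (\<gamma> - 1)) has_integral (L powr \<gamma> / \<gamma>)) {0..L}"
    using has_integral_powr_from_0[of "\<gamma> - 1" L] assms by simp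
  then have "((\<lambda>h. h powr (\<gamma> - 1)) has_integral (L powr \<gamma> / \<gamma>)) {0<..<L}"
    using has_integral_Icc_iff_Ioo by blast
  then have "((\<lambda>h. if h \<in> {0<..<L} then h powr (\<gamma> - 1) else 0) has_integral (L powr \<gamma> / \<gamma>)) UNIV"
    by (simp only: has_integral_restrict_UNIV)
  moreover have "(\<lambda>h. if h \<in> {0<..<L} then h powr (\<gamma> - 1) else 0) = (\<lambda>h. indicator {0<..<L} h * h powr (\<gamma> - 1))"
    by (auto simp: fun_eq_iff)
  ultimately show "((\<lambda>h. indicator {0<..<L} h * h powr (\<gamma> - 1)) has_integral (L powr \<gamma> / \<gamma>)) UNIV"
    by simp
qed (auto simp: indicator_def)

lemma nn_integral_powr_tail:
  fixes x q :: real
  assumes "q > 0" "x > 0"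
  shows "(\<integral>\<^sup>+t. ennreal (indicator {0<..} t * (t + x) powr (- 1 - q)) \<partial>lborel) \<le> ennreal (x powr (- q) / q)"
proof -
  have "((\<lambda>h. h powr (- 1 - q)) has_integral (x powr (- q) / q)) {x..}"
    using has_integral_powr_to_inf[of "- 1 - q" x] assms by (simp add: minus_divide_divide)
  then have "((\<lambda>h. if h \<in> {x..} then h powr (- 1 - q) else 0) has_integral (x powr (- q) / q)) UNIV"
    by (simp only: has_integral_restrict_UNIV)
  then have *: "(\<integral>\<^sup>+t. ennreal (if t \<in> {x..} then t powr (- 1 - q) else 0) \<partial>lborel) = ennreal (x powr (- q) / q)"
    by (intro nn_integral_has_integral_lborel) auto
  have "(\<integral>\<^sup>+t. ennreal (indicator {0<..} t * (t + x) powr (- 1 - q)) \<partial>lborel)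
      \<le> (\<integral>\<^sup>+t. ennreal (if x + 1 * t \<in> {x..} then (x + 1 * t) powr (- 1 - q) else 0) \<partial>lborel)"
    by (intro nn_integral_mono) (auto simp: indicator_def add.commute)
  also have "\<dots> = (\<integral>\<^sup>+t. ennreal (if t \<in> {x..} then t powr (- 1 - q) else 0) \<partial>lborel)"
    by (subst nn_integral_real_affine[of "\<lambda>t. ennreal (if t \<in> {x..} then t powr (- 1 - q) else 0)" 1 x]) auto
  finally show ?thesis using * by simp
qed

text \<open>The point \<open>t\<close> splits the interval into two pieces; reflection and
  translation carry each of them into \<open>(0, b - a)\<close>.\<close>

lemma nn_integral_powr_sym:
  fixes a b t \<gamma> :: real
  assumes "\<gamma> > 0" "a \<le> b" "a \<le> t" "t \<le> b"
  shows "(\<integral>\<^sup>+\<xi>. ennreal (indicator {a<..<b} \<xi> * \<bar>t - \<xi>\<bar> powr (\<gamma> - 1)) \<partial>lborel) \<le> ennreal (2 * (b - a) powr \<gamma> / \<gamma>)"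
proof -
  let ?\<phi> = "\<lambda>h. ennreal (indicator {0<..<b - a} h * h powr (\<gamma> - 1))"
  have "(\<integral>\<^sup>+\<xi>. ennreal (indicator {a<..<b} \<xi> * \<bar>t - \<xi>\<bar> powr (\<gamma> - 1)) \<partial>lborel)
     \<le> (\<integral>\<^sup>+\<xi>. ?\<phi> (t + (- 1) * \<xi>) + ?\<phi> (- t + 1 * \<xi>) \<partial>lborel)"
    using assms by (intro nn_integral_mono) (auto simp: indicator_def abs_if)
  also have "\<dots> = (\<integral>\<^sup>+\<xi>. ?\<phi> (t + (- 1) * \<xi>) \<partial>lborel) + (\<integral>\<^sup>+\<xi>. ?\<phi> (- t + 1 * \<xi>) \<partial>lborel)"
    by (intro nn_integral_add) auto
  also have "(\<integral>\<^sup>+\<xi>. ?\<phi> (t + (- 1) * \<xi>) \<partial>lborel) = (\<integral>\<^sup>+\<xi>. ?\<phi> \<xi> \<partial>lborel)"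
    by (subst nn_integral_real_affine[of ?\<phi> "-1" t]) auto
  also have "(\<integral>\<^sup>+\<xi>. ?\<phi> (- t + 1 * \<xi>) \<partial>lborel) = (\<integral>\<^sup>+\<xi>. ?\<phi> \<xi> \<partial>lborel)"
    by (subst nn_integral_real_affine[of ?\<phi> 1 "-t"]) auto
  also have "(\<integral>\<^sup>+\<xi>. ?\<phi> \<xi> \<partial>lborel) + (\<integral>\<^sup>+\<xi>. ?\<phi> \<xi> \<partial>lborel) = ennreal (2 * (b - a) powr \<gamma> / \<gamma>)"
    using assms by (simp add: nn_integral_powr_from_0 flip: ennreal_plus)
  finally show ?thesis .
qed

definition slob_kernel :: "real \<Rightarrow> real \<Rightarrow> (real \<Rightarrow> real) \<Rightarrow> real \<Rightarrow> real \<Rightarrow> ennreal" where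
  "slob_kernel s p f t \<xi> = ennreal (\<bar>f t - f \<xi>\<bar> powr p / \<bar>t - \<xi>\<bar> powr (1 + s * p))"

lemma slob_kernel_measurable [measurable]:
  assumes [measurable]: "f \<in> borel_measurable borel" "g \<in> borel_measurable M" "h \<in> borel_measurable M"
  shows "(\<lambda>x. slob_kernel s p f (g x) (h x)) \<in> borel_measurable M"
  unfolding slob_kernel_def by measurable

lemma slobodeckij_integral_kernel:
  "slobodeckij_integral s p a b f =
    (\<integral>\<^sup>+t. (\<integral>\<^sup>+\<xi>. slob_kernel s p f t \<xi> * indicator {a<..<b} \<xi> \<partial>lborel) * indicator {a<..<b} t \<partial>lborel)"
  by (simp add: slobodeckij_integral_def slob_kernel_def)

text \<open>Here \<gamma> is the excess over the critical exponent \<open>s * p\<close>: division by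
  the kernel leaves the integrable power \<open>\<gamma> - 1\<close>. The assumption concerns p-th
  powers, so that Lipschitz bounds and interpolated bounds are both covered.\<close>

lemma slobodeckij_integral_hoelder:
  assumes "\<And>t \<xi>. t \<in> {a<..<b} \<Longrightarrow> \<xi> \<in> {a<..<b} \<Longrightarrow> \<bar>f t - f \<xi>\<bar> powr p \<le> K * \<bar>t - \<xi>\<bar> powr (\<gamma> + s * p)"
    and "\<gamma> > 0" "a \<le> b" "K \<ge> 0"
  shows "slobodeckij_integral s p a b f \<le> ennreal ((b - a) * (K * (2 * (b - a) powr \<gamma> / \<gamma>)))"
proof -
  have inner: "(\<integral>\<^sup>+\<xi>. slob_kernel s p f t \<xi> * indicator {a<..<b} \<xi> \<partial>lborel) \<le> ennreal (K * (2 * (b - a) powr \<gamma> / \<gamma>))"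
    if t: "t \<in> {a<..<b}" for t
  proof -
    have "(\<integral>\<^sup>+\<xi>. slob_kernel s p f t \<xi> * indicator {a<..<b} \<xi> \<partial>lborel)
      \<le> (\<integral>\<^sup>+\<xi>. ennreal K * ennreal (indicator {a<..<b} \<xi> * \<bar>t - \<xi>\<bar> powr (\<gamma> - 1)) \<partial>lborel)"
    proof (rule nn_integral_mono)
      fix \<xi> :: real
      show "slob_kernel s p f t \<xi> * indicator {a<..<b} \<xi> \<le> ennreal K * ennreal (indicator {a<..<b} \<xi> * \<bar>t - \<xi>\<bar> powr (\<gamma> - 1))"
      proof (cases "\<xi> \<in> {a<..<b} \<and> t \<noteq> \<xi>")
        case True
        have "\<bar>t - \<xi>\<bar> powr (\<gamma> + s * p) = \<bar>t - \<xi>\<bar> powr (1 + s * p) * \<bar>t - \<xi>\<bar> powr (\<gamma> - 1)"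
          by (simp flip: powr_add add: algebra_simps)
        then have "\<bar>f t - f \<xi>\<bar> powr p / \<bar>t - \<xi>\<bar> powr (1 + s * p) \<le> K * \<bar>t - \<xi>\<bar> powr (\<gamma> - 1)"
          using True assms(1)[OF t, of \<xi>] by (simp add: divide_le_eq ac_simps)
        then show ?thesis using True assms
          by (simp add: slob_kernel_def ennreal_leI flip: ennreal_mult)
      qed (auto simp: slob_kernel_def)
    qed
    also have "\<dots> = ennreal K * (\<integral>\<^sup>+\<xi>. ennreal (indicator {a<..<b} \<xi> * \<bar>t - \<xi>\<bar> powr (\<gamma> - 1)) \<partial>lborel)"
      by (intro nn_integral_cmult) measurable
    also have "\<dots> \<le> ennreal K * ennreal (2 * (b - a) powr \<gamma> / \<gamma>)"
      using t assms by (intro mult_left_mono nn_integral_powr_sym) auto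
    also have "\<dots> = ennreal (K * (2 * (b - a) powr \<gamma> / \<gamma>))"
      using assms by (intro ennreal_mult[symmetric]) auto
    finally show ?thesis .
  qed
  have "slobodeckij_integral s p a b f \<le> (\<integral>\<^sup>+t. ennreal (K * (2 * (b - a) powr \<gamma> / \<gamma>)) * indicator {a<..<b} t \<partial>lborel)"
    unfolding slobodeckij_integral_kernel
  proof (rule nn_integral_mono)
    fix t :: real
    show "(\<integral>\<^sup>+\<xi>. slob_kernel s p f t \<xi> * indicator {a<..<b} \<xi> \<partial>lborel) * indicator {a<..<b} t
      \<le> ennreal (K * (2 * (b - a) powr \<gamma> / \<gamma>)) * indicator {a<..<b} t"
      by (cases "t \<in> {a<..<b}") (use inner[of t] in simp_all)
  qed
  also have "\<dots> = ennreal ((b - a) * (K * (2 * (b - a) powr \<gamma> / \<gamma>)))"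
    using assms by (subst nn_integral_cmult_indicator) (simp_all add: mult.commute flip: ennreal_mult)
  finally show ?thesis .
qed

text \<open>Hoelder's inequality for an increment, up to the factor \<open>2 powr p\<close>,
  obtained by optimising the constant in \<open>abs_le_young\<close>.\<close>

lemma powr_increment_le:
  fixes f g :: "real \<Rightarrow> real"
  assumes le: "ennreal \<bar>f t - f \<xi>\<bar> \<le> (\<integral>\<^sup>+r. ennreal \<bar>g r\<bar> * indicator {\<xi><..<t} r \<partial>lborel)"
    and [measurable]: "g \<in> borel_measurable borel" and lt: "\<xi> < t" and p: "p \<ge> 1"
  shows "ennreal (\<bar>f t - f \<xi>\<bar> powr p) \<le> ennreal (2 powr p * (t - \<xi>) powr (p - 1)) * (\<integral>\<^sup>+r. ennreal (\<bar>g r\<bar> powr p) * indicator {\<xi><..<t} r \<partial>lborel)"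
    (is "_ \<le> _ * ?G")
proof (cases "?G = \<infinity>")
  case True
  then show ?thesis using lt by (simp add: ennreal_mult_top)
next
  case False
  then obtain G where G: "?G = ennreal G" "G \<ge> 0" by (cases ?G) auto
  define l where "l = t - \<xi>"
  have l: "l > 0" using lt by (simp add: l_def)
  have *: "\<bar>f t - f \<xi>\<bar> \<le> c * l + c powr (1 - p) * G" if c: "c > 0" for c
  proof -
    have "ennreal \<bar>f t - f \<xi>\<bar> \<le> (\<integral>\<^sup>+r. ennreal c * indicator {\<xi><..<t} r + ennreal (c powr (1 - p)) * (ennreal (\<bar>g r\<bar> powr p) * indicator {\<xi><..<t} r) \<partial>lborel)"
    proof (rule order_trans[OF le], rule nn_integral_mono)
      fix r
      show "ennreal \<bar>g r\<bar> * indicator {\<xi><..<t} r \<le> ennreal c * indicator {\<xi><..<t} r + ennreal (c powr (1 - p)) * (ennreal (\<bar>g r\<bar> powr p) * indicator {\<xi><..<t} r)"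
        using abs_le_young[OF c p, of "g r"] c
        by (auto simp: indicator_def simp flip: ennreal_mult ennreal_plus intro!: ennreal_leI)
    qed
    also have "\<dots> = ennreal c * emeasure lborel {\<xi><..<t} + ennreal (c powr (1 - p)) * ?G"
      by (simp add: nn_integral_add nn_integral_cmult)
    also have "\<dots> = ennreal (c * l + c powr (1 - p) * G)"
      using c lt G by (simp add: l_def flip: ennreal_mult ennreal_plus)
    finally show ?thesis using c l G by (subst (asm) ennreal_le_iff) auto
  qed
  have "\<bar>f t - f \<xi>\<bar> powr p \<le> 2 powr p * l powr (p - 1) * G"
  proof (cases "G = 0")
    case True
    \<comment> \<open>No optimal \<open>c\<close> exists here; instead \<open>c\<close> is taken
      arbitrarily small.\<close>
    have "\<bar>f t - f \<xi>\<bar> \<le> 0"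
    proof (rule field_le_epsilon)
      fix e :: real assume "e > 0"
      then show "\<bar>f t - f \<xi>\<bar> \<le> 0 + e" using *[of "e / l"] l True by simp
    qed
    then show ?thesis using True by simp
  next
    case False
    \<comment> \<open>This value solves \<open>c * l = c powr (1 - p) * G\<close>, which makes the
      two terms of the bound equal.\<close>
    define c where "c = (G / l) powr (1 / p)"
    have c: "c > 0" using False G l by (simp add: c_def)
    have cp: "c powr p = G / l" using p G l by (simp add: c_def powr_powr)
    have "c powr (1 - p) = c / (G / l)" using c cp by (simp add: powr_diff)
    then have "c powr (1 - p) * G = c * l" using False l by simp
    with *[OF c] have "\<bar>f t - f \<xi>\<bar> \<le> 2 * c * l" by simp
    then have "\<bar>f t - f \<xi>\<bar> powr p \<le> (2 * c * l) powr p" using p by (intro powr_mono2) auto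
    also have "\<dots> = 2 powr p * (G / l) * l powr p" using c l cp by (simp add: powr_mult)
    also have "\<dots> = 2 powr p * l powr (p - 1) * G" using l by (simp add: powr_diff)
    finally show ?thesis .
  qed
  then show ?thesis using G by (simp add: l_def ennreal_leI flip: ennreal_mult)
qed

text \<open>The embedding of W^1_p into W^s_p, with \<open>g\<close> majorising the derivative. Put
  \<open>h = \<xi> - t\<close> and \<open>\<gamma> = p - s * p\<close>: the increment bound leaves
  the power \<open>\<gamma> - 2\<close> of \<open>\<bar>h\<bar>\<close>. After exchanging the
  integrals, a point \<open>r\<close> lies between \<open>t\<close> and \<open>t + h\<close> for a
  set of \<open>t\<close> of measure \<open>\<bar>h\<bar>\<close>, and the power becomes the
  integrable \<open>\<gamma> - 1\<close>.\<close>

lemma slobodeckij_integral_W1p: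
  fixes f g :: "real \<Rightarrow> real"
  assumes le: "\<And>t \<xi>. a < \<xi> \<Longrightarrow> \<xi> < t \<Longrightarrow> t < b \<Longrightarrow> ennreal \<bar>f t - f \<xi>\<bar> \<le> (\<integral>\<^sup>+r. ennreal \<bar>g r\<bar> * indicator {\<xi><..<t} r \<partial>lborel)"
    and [measurable]: "g \<in> borel_measurable borel" and ab: "a \<le> b" and p: "p \<ge> 1" and sp: "s * p < p"
  shows "slobodeckij_integral s p a b f \<le> ennreal (2 powr p * (2 * (b - a) powr (p - s * p) / (p - s * p)))
      * (\<integral>\<^sup>+r. ennreal (\<bar>g r\<bar> powr p) * indicator {a<..<b} r \<partial>lborel)"
proof -
  define \<gamma> where "\<gamma> = p - s * p"
  have \<gamma>: "\<gamma> > 0" using sp by (simp add: \<gamma>_def)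
  define L where "L = b - a"
  define gp where "gp r = ennreal (\<bar>g r\<bar> powr p) * indicator {a<..<b} r" for r
  have [measurable]: "gp \<in> borel_measurable borel" unfolding gp_def by measurable
  define btw where "btw x y r = (if x < r \<and> r < y \<or> y < r \<and> r < x then 1 else (0::ennreal))" for x y r :: real
  \<comment> \<open>Majorant of the kernel in the coordinates \<open>t\<close> and \<open>h\<close>;
    both variables range over the whole line, so Fubini applies without moving boundaries.\<close>
  define F where "F t h = ennreal (2 powr p * indicator {-L<..<L} h * \<bar>h\<bar> powr (\<gamma> - 2)) * (\<integral>\<^sup>+r. btw t (t + h) r * gp r \<partial>lborel)" for t h
  have btw_meas [measurable]: "(\<lambda>x. btw (u x) (v x) (w x)) \<in> borel_measurable M"
    if [measurable]: "u \<in> borel_measurable M" "v \<in> borel_measurable M" "w \<in> borel_measurable M" for M :: "'z measure" and u v w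
    unfolding btw_def by measurable
  have F_meas [measurable]: "case_prod F \<in> borel_measurable (lborel \<Otimes>\<^sub>M lborel)"
    unfolding F_def by measurable
  have k: "slob_kernel s p f t \<xi> * indicator {a<..<b} \<xi> \<le> F t (\<xi> - t)" if t: "t \<in> {a<..<b}" for t \<xi>
  proof (cases "\<xi> \<in> {a<..<b} \<and> \<xi> \<noteq> t")
    case True
    have main: "ennreal (\<bar>f y - f x\<bar> powr p / \<bar>y - x\<bar> powr (1 + s * p)) \<le> ennreal (2 powr p * \<bar>y - x\<bar> powr (\<gamma> - 2)) * (\<integral>\<^sup>+r. ennreal (\<bar>g r\<bar> powr p) * indicator {x<..<y} r \<partial>lborel)"
      if "a < x" "x < y" "y < b" for x y
    proof -
      have "ennreal (\<bar>f y - f x\<bar> powr p / \<bar>y - x\<bar> powr (1 + s * p)) = ennreal (\<bar>y - x\<bar> powr (- (1 + s * p))) * ennreal (\<bar>f y - f x\<bar> powr p)"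
        unfolding powr_minus by (simp add: divide_inverse mult.commute flip: ennreal_mult)
      also have "\<dots> \<le> ennreal (\<bar>y - x\<bar> powr (- (1 + s * p))) * (ennreal (2 powr p * (y - x) powr (p - 1)) * (\<integral>\<^sup>+r. ennreal (\<bar>g r\<bar> powr p) * indicator {x<..<y} r \<partial>lborel))"
        by (intro mult_left_mono powr_increment_le[OF le]) (use that p in auto)
      also have "\<dots> = ennreal (2 powr p * (\<bar>y - x\<bar> powr (- (1 + s * p)) * (y - x) powr (p - 1))) * (\<integral>\<^sup>+r. ennreal (\<bar>g r\<bar> powr p) * indicator {x<..<y} r \<partial>lborel)"
          by (subst mult.assoc[symmetric], subst ennreal_mult[symmetric]) (auto simp: ac_simps)
      also have "\<bar>y - x\<bar> powr (- (1 + s * p)) * (y - x) powr (p - 1) = \<bar>y - x\<bar> powr (\<gamma> - 2)"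
        using that by (simp add: \<gamma>_def algebra_simps flip: powr_add)
      finally show ?thesis .
    qed
    consider "t < \<xi>" | "\<xi> < t" using True by force
    then show ?thesis
    proof cases
      case 1
      have "(\<integral>\<^sup>+r. ennreal (\<bar>g r\<bar> powr p) * indicator {t<..<\<xi>} r \<partial>lborel) = (\<integral>\<^sup>+r. btw t (t + (\<xi> - t)) r * gp r \<partial>lborel)"
        using 1 t True by (intro nn_integral_cong) (auto simp: btw_def gp_def indicator_def)
      moreover have "slob_kernel s p f t \<xi> = slob_kernel s p f \<xi> t" by (simp add: slob_kernel_def abs_minus_commute)
      ultimately show ?thesis
        using main[of t \<xi>] 1 t True by (simp add: F_def slob_kernel_def L_def)
    next
      case 2
      have "(\<integral>\<^sup>+r. ennreal (\<bar>g r\<bar> powr p) * indicator {\<xi><..<t} r \<partial>lborel) = (\<integral>\<^sup>+r. btw t (t + (\<xi> - t)) r * gp r \<partial>lborel)"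
        using 2 t True by (intro nn_integral_cong) (auto simp: btw_def gp_def indicator_def)
      then show ?thesis
        using main[of \<xi> t] 2 t True by (simp add: F_def slob_kernel_def L_def abs_minus_commute)
    qed
  qed (auto simp: slob_kernel_def)
  have "slobodeckij_integral s p a b f \<le> (\<integral>\<^sup>+t. \<integral>\<^sup>+h. F t h \<partial>lborel \<partial>lborel)"
    unfolding slobodeckij_integral_kernel
  proof (rule nn_integral_mono)
    fix t :: real
    show "(\<integral>\<^sup>+\<xi>. slob_kernel s p f t \<xi> * indicator {a<..<b} \<xi> \<partial>lborel) * indicator {a<..<b} t \<le> (\<integral>\<^sup>+h. F t h \<partial>lborel)"
    proof (cases "t \<in> {a<..<b}")
      case True
      have [measurable]: "F t \<in> borel_measurable borel" using F_meas by measurable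
      have "(\<integral>\<^sup>+\<xi>. slob_kernel s p f t \<xi> * indicator {a<..<b} \<xi> \<partial>lborel) \<le> (\<integral>\<^sup>+\<xi>. F t (- t + 1 * \<xi>) \<partial>lborel)"
        using k[OF True] by (intro nn_integral_mono) simp
      also have "\<dots> = (\<integral>\<^sup>+h. F t h \<partial>lborel)"
        by (subst nn_integral_real_affine[of "F t" 1 "-t"]) auto
      finally show ?thesis using True by simp
    qed auto
  qed
  also have "\<dots> = (\<integral>\<^sup>+h. \<integral>\<^sup>+t. F t h \<partial>lborel \<partial>lborel)"
    by (rule lborel_pair.Fubini'[symmetric]) measurable
  also have "\<dots> \<le> (\<integral>\<^sup>+h. ennreal (2 powr p) * ennreal (indicator {-L<..<L} h * \<bar>0 - h\<bar> powr (\<gamma> - 1)) * (\<integral>\<^sup>+r. gp r \<partial>lborel) \<partial>lborel)"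
  proof (rule nn_integral_mono)
    fix h :: real
    \<comment> \<open>The gain of one power of \<open>\<bar>h\<bar>\<close>.\<close>
    have b: "(\<integral>\<^sup>+t. btw t (t + h) r \<partial>lborel) = ennreal \<bar>h\<bar>" for r
    proof -
      have "(\<integral>\<^sup>+t. btw t (t + h) r \<partial>lborel) = (\<integral>\<^sup>+t. indicator {min r (r - h)<..<max r (r - h)} t \<partial>lborel)"
        by (intro nn_integral_cong) (auto simp: btw_def indicator_def min_def max_def)
      also have "\<dots> = ennreal \<bar>h\<bar>" by (simp add: min_def max_def)
      finally show ?thesis .
    qed
    have "(\<integral>\<^sup>+t. F t h \<partial>lborel) = ennreal (2 powr p * indicator {-L<..<L} h * \<bar>h\<bar> powr (\<gamma> - 2)) * (\<integral>\<^sup>+t. \<integral>\<^sup>+r. btw t (t + h) r * gp r \<partial>lborel \<partial>lborel)"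
      unfolding F_def by (rule nn_integral_cmult) measurable
    also have "(\<integral>\<^sup>+t. \<integral>\<^sup>+r. btw t (t + h) r * gp r \<partial>lborel \<partial>lborel) = (\<integral>\<^sup>+r. \<integral>\<^sup>+t. btw t (t + h) r * gp r \<partial>lborel \<partial>lborel)"
      by (rule lborel_pair.Fubini'[symmetric]) measurable
    also have "\<dots> = (\<integral>\<^sup>+r. ennreal \<bar>h\<bar> * gp r \<partial>lborel)"
      by (intro nn_integral_cong) (simp add: nn_integral_multc b)
    also have "\<dots> = ennreal \<bar>h\<bar> * (\<integral>\<^sup>+r. gp r \<partial>lborel)" by (intro nn_integral_cmult) measurable
    also have "ennreal (2 powr p * indicator {-L<..<L} h * \<bar>h\<bar> powr (\<gamma> - 2)) * (ennreal \<bar>h\<bar> * (\<integral>\<^sup>+r. gp r \<partial>lborel))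
        = ennreal (2 powr p * indicator {-L<..<L} h * (\<bar>h\<bar> powr (\<gamma> - 2) * \<bar>h\<bar>)) * (\<integral>\<^sup>+r. gp r \<partial>lborel)"
      by (simp add: mult.assoc[symmetric] flip: ennreal_mult)
    also have "\<bar>h\<bar> powr (\<gamma> - 2) * \<bar>h\<bar> = \<bar>0 - h\<bar> powr (\<gamma> - 1)"
    proof (cases "h = 0")
      case False
      then show ?thesis using powr_add[of "\<bar>h\<bar>" "\<gamma> - 2" 1] by simp
    qed simp
    finally show "(\<integral>\<^sup>+t. F t h \<partial>lborel) \<le> ennreal (2 powr p) * ennreal (indicator {-L<..<L} h * \<bar>0 - h\<bar> powr (\<gamma> - 1)) * (\<integral>\<^sup>+r. gp r \<partial>lborel)"
      by (simp add: mult.assoc flip: ennreal_mult)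
  qed
  also have "\<dots> = ennreal (2 powr p) * (\<integral>\<^sup>+h. ennreal (indicator {-L<..<L} h * \<bar>0 - h\<bar> powr (\<gamma> - 1)) \<partial>lborel) * (\<integral>\<^sup>+r. gp r \<partial>lborel)"
    by (simp add: nn_integral_multc nn_integral_cmult)
  finally have upper: "slobodeckij_integral s p a b f \<le> \<dots>" .
  have half: "(\<integral>\<^sup>+h. ennreal (indicator {-L<..<L} h * \<bar>0 - h\<bar> powr (\<gamma> - 1)) \<partial>lborel) \<le> ennreal (2 * L powr \<gamma> / \<gamma>)"
  proof -
    let ?\<phi> = "\<lambda>h. ennreal (indicator {0<..<L} h * h powr (\<gamma> - 1))"
    have "(\<integral>\<^sup>+h. ennreal (indicator {-L<..<L} h * \<bar>0 - h\<bar> powr (\<gamma> - 1)) \<partial>lborel) \<le> (\<integral>\<^sup>+h. ?\<phi> (0 + (- 1) * h) + ?\<phi> h \<partial>lborel)"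
      by (intro nn_integral_mono) (auto simp: indicator_def abs_if)
    also have "\<dots> = (\<integral>\<^sup>+h. ?\<phi> (0 + (- 1) * h) \<partial>lborel) + (\<integral>\<^sup>+h. ?\<phi> h \<partial>lborel)"
      by (intro nn_integral_add) auto
    also have "(\<integral>\<^sup>+h. ?\<phi> (0 + (- 1) * h) \<partial>lborel) = (\<integral>\<^sup>+h. ?\<phi> h \<partial>lborel)"
      by (subst nn_integral_real_affine[of ?\<phi> "-1" 0]) auto
    also have "(\<integral>\<^sup>+\<xi>. ?\<phi> \<xi> \<partial>lborel) + (\<integral>\<^sup>+\<xi>. ?\<phi> \<xi> \<partial>lborel) = ennreal (2 * L powr \<gamma> / \<gamma>)"
      using \<gamma> ab by (simp add: nn_integral_powr_from_0 L_def flip: ennreal_plus)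
    finally show ?thesis .
  qed
  note upper
  also have "ennreal (2 powr p) * (\<integral>\<^sup>+h. ennreal (indicator {-L<..<L} h * \<bar>0 - h\<bar> powr (\<gamma> - 1)) \<partial>lborel) * (\<integral>\<^sup>+r. gp r \<partial>lborel)
     \<le> ennreal (2 powr p) * ennreal (2 * L powr \<gamma> / \<gamma>) * (\<integral>\<^sup>+r. gp r \<partial>lborel)"
    by (intro mult_right_mono mult_left_mono half) auto
  also have "ennreal (2 powr p) * ennreal (2 * L powr \<gamma> / \<gamma>) = ennreal (2 powr p * (2 * L powr \<gamma> / \<gamma>))"
    using \<gamma> by (simp flip: ennreal_mult)
  finally show ?thesis unfolding gp_def L_def \<gamma>_def .
qed

text \<open>The cutoff at \<open>-\<epsilon>\<close> makes the left-hand side finite, which is what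
  allows half of it to be subtracted from both sides. The resulting bound is uniform in \<epsilon>,
  as monotone convergence requires.\<close>

lemma hardy_truncated:
  fixes f :: "real \<Rightarrow> real"
  assumes [measurable]: "f \<in> borel_measurable borel" and q: "0 < s * p" and p: "p \<ge> 1"
    and L: "L > 0" and lam: "\<mu> \<ge> 1" "2 powr (p - 1) * 2 powr (s * p) * \<mu> powr (s * p - 1) \<le> 1/2"
    and fin: "(\<integral>\<^sup>+\<xi>. ennreal (\<bar>f \<xi>\<bar> powr p) * indicator {-L<..<0} \<xi> \<partial>lborel) < \<infinity>" and \<epsilon>: "\<epsilon> > 0"
  shows "(\<integral>\<^sup>+\<xi>. ennreal (\<bar>f \<xi>\<bar> powr p * \<bar>\<xi>\<bar> powr (- (s * p))) * indicator {-L<..<-\<epsilon>} \<xi> \<partial>lborel)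
    \<le> 2 * (ennreal (2 powr (p - 1) * ((2 * \<mu>) powr (1 + s * p) / \<mu>)) * slobodeckij_integral s p (-L) 0 f
         + ennreal ((L / (2 * \<mu>)) powr (- (s * p))) * (\<integral>\<^sup>+\<xi>. ennreal (\<bar>f \<xi>\<bar> powr p) * indicator {-L<..<0} \<xi> \<partial>lborel))"
    (is "?F \<le> 2 * (ennreal ?C1 * ?S + ennreal ?C2 * ?I)")
proof -
  define q where "q = s * p"
  have q0: "q > 0" using q by (simp add: q_def)
  \<comment> \<open>For \<open>\<bar>\<xi>\<bar> < l\<close> the comparison interval from
    \<open>2 * \<mu> * \<xi>\<close> to \<open>\<mu> * \<xi>\<close> lies inside
    \<open>(-L, 0)\<close>.\<close>
  define l where "l = L / (2 * \<mu>)"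
  have l: "l > 0" using L lam by (simp add: l_def)
  \<comment> \<open>On the comparison interval \<open>\<bar>\<xi>\<bar>\<close> exceeds
    \<open>\<bar>y\<bar> / (2 * \<mu>)\<close>; this moves the weight from \<xi> to
    \<open>y\<close>.\<close>
  define K2 where "K2 y = 2 powr (p - 1) / \<mu> * \<bar>f y\<bar> powr p * (\<bar>y\<bar> / (2 * \<mu>)) powr (- 1 - q)" for y
  have [measurable]: "K2 \<in> borel_measurable borel" unfolding K2_def by measurable
  have K2: "K2 y \<ge> 0" for y using lam by (simp add: K2_def)
  \<comment> \<open>The share of the values \<open>f y\<close>. Each such \<open>y\<close> is
    farther from 0 than \<xi> and hence also below \<open>-\<epsilon>\<close>, so that exchanging
    the integrals reproduces the same truncated integral.\<close>
  define W where "W \<xi> y = ennreal (K2 y) * (if -L < y \<and> y < -\<epsilon> \<and> y / \<mu> < \<xi> \<and> \<xi> < y / (2 * \<mu>) then 1 else 0)" for \<xi> y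
  have [measurable]: "case_prod W \<in> borel_measurable (lborel \<Otimes>\<^sub>M lborel)" unfolding W_def by measurable
  define w where "w \<xi> = ennreal (\<bar>f \<xi>\<bar> powr p * \<bar>\<xi>\<bar> powr (- q))" for \<xi>
  have [measurable]: "w \<in> borel_measurable borel" unfolding w_def by measurable
  have F: "?F = (\<integral>\<^sup>+\<xi>. w \<xi> * indicator {-L<..<-\<epsilon>} \<xi> \<partial>lborel)" by (simp add: w_def q_def)
  \<comment> \<open>The weight is averaged over the comparison interval, of length
    \<open>\<mu> * x\<close>. The difference \<open>f \<xi> - f y\<close> is charged to the seminorm
    and the value \<open>f y\<close> to \<open>W\<close>.\<close>
  have near: "w \<xi> \<le> ennreal ?C1 * (\<integral>\<^sup>+y. slob_kernel s p f \<xi> y * indicator {-L<..<0} y \<partial>lborel) + (\<integral>\<^sup>+y. W \<xi> y \<partial>lborel)"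
    if xi: "-l < \<xi>" "\<xi> < -\<epsilon>" for \<xi>
  proof -
    define x where "x = - \<xi>"
    have x: "x > \<epsilon>" "x > 0" "x < l" "\<xi> = - x" using xi \<epsilon> by (auto simp: x_def)
    have Llx: "2 * \<mu> * x < L" using x lam by (simp add: l_def field_simps)
    have len: "emeasure lborel {- (2 * \<mu> * x) <..< - (\<mu> * x)} = ennreal (\<mu> * x)"
      using x lam by simp
    have "w \<xi> = ennreal (\<bar>f \<xi>\<bar> powr p * x powr (- q) / (\<mu> * x)) * ennreal (\<mu> * x)"
      using x lam by (simp add: w_def flip: ennreal_mult)
    also have "\<dots> = (\<integral>\<^sup>+y. ennreal (\<bar>f \<xi>\<bar> powr p * x powr (- q) / (\<mu> * x)) * indicator {- (2 * \<mu> * x) <..< - (\<mu> * x)} y \<partial>lborel)"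
      by (simp add: nn_integral_cmult_indicator len)
    also have "\<dots> \<le> (\<integral>\<^sup>+y. ennreal ?C1 * (slob_kernel s p f \<xi> y * indicator {-L<..<0} y) + W \<xi> y \<partial>lborel)"
    proof (rule nn_integral_mono)
      fix y
      show "ennreal (\<bar>f \<xi>\<bar> powr p * x powr (- q) / (\<mu> * x)) * indicator {- (2 * \<mu> * x) <..< - (\<mu> * x)} y
         \<le> ennreal ?C1 * (slob_kernel s p f \<xi> y * indicator {-L<..<0} y) + W \<xi> y"
      proof (cases "y \<in> {- (2 * \<mu> * x) <..< - (\<mu> * x)}")
        case True
        define z where "z = - y"
        have z: "\<mu> * x < z" "z < 2 * \<mu> * x" "y = - z" using True by (auto simp: z_def)
        have xlx: "x \<le> \<mu> * x" using x lam by simp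
        have z2: "z > x" "z < L" "z > \<epsilon>" "z > 0" using z xlx Llx x by linarith+
        have e1: "x powr (- q) / (\<mu> * x) = x powr (- 1 - q) / \<mu>"
        proof -
          have "x powr (- q - 1) = x powr (- q) / x" using x by (subst powr_diff) simp
          moreover have "- 1 - q = - q - 1" by simp
          ultimately show ?thesis by (simp only: divide_divide_eq_left mult.commute)
        qed
        have e2: "x powr (- 1 - q) \<le> (2 * \<mu>) powr (1 + q) * (z - x) powr (- 1 - q)"
        proof -
          have "(z - x) / (2 * \<mu>) \<le> x" using z x lam by (simp add: field_simps)
          then have "x powr (- 1 - q) \<le> ((z - x) / (2 * \<mu>)) powr (- 1 - q)"
            using z2 lam q0 by (intro powr_mono2') auto
          also have "\<dots> = (2 * \<mu>) powr (1 + q) * (z - x) powr (- 1 - q)"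
          proof -
            have "(2 * \<mu>) powr (- 1 - q) = inverse ((2 * \<mu>) powr (1 + q))"
              using powr_minus[of "2 * \<mu>" "1 + q"] by simp
            moreover have "((z - x) / (2 * \<mu>)) powr (- 1 - q) = (z - x) powr (- 1 - q) / (2 * \<mu>) powr (- 1 - q)"
              using z2 lam by (subst powr_divide) auto
            ultimately show ?thesis by (simp only: divide_inverse inverse_inverse_eq mult.commute)
          qed
          finally show ?thesis .
        qed
        have e3: "x powr (- 1 - q) \<le> (z / (2 * \<mu>)) powr (- 1 - q)"
          using z z2 lam q0 by (intro powr_mono2') (auto simp: field_simps)
        have "\<bar>f \<xi>\<bar> \<le> \<bar>f \<xi> - f y\<bar> + \<bar>f y\<bar>" by simp
        then have "\<bar>f \<xi>\<bar> powr p \<le> (\<bar>f \<xi> - f y\<bar> + \<bar>f y\<bar>) powr p" using p by (intro powr_mono2) auto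
        also have "\<dots> \<le> 2 powr (p - 1) * (\<bar>f \<xi> - f y\<bar> powr p + \<bar>f y\<bar> powr p)"
          using p by (intro powr_add_le2) auto
        finally have "\<bar>f \<xi>\<bar> powr p * x powr (- q) / (\<mu> * x) \<le> 2 powr (p - 1) * (\<bar>f \<xi> - f y\<bar> powr p + \<bar>f y\<bar> powr p) * (x powr (- 1 - q) / \<mu>)"
          unfolding times_divide_eq_right[symmetric] e1 using lam by (intro mult_right_mono) auto
        also have "\<dots> = 2 powr (p - 1) / \<mu> * \<bar>f \<xi> - f y\<bar> powr p * x powr (- 1 - q) + 2 powr (p - 1) / \<mu> * \<bar>f y\<bar> powr p * x powr (- 1 - q)"
          by (simp add: distrib_left distrib_right add_divide_distrib mult.commute mult.left_commute)
        also have "\<dots> \<le> 2 powr (p - 1) / \<mu> * \<bar>f \<xi> - f y\<bar> powr p * ((2 * \<mu>) powr (1 + q) * (z - x) powr (- 1 - q)) + K2 y"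
          unfolding K2_def using lam e2 e3 z z2
          by (intro add_mono mult_left_mono) auto
        also have "\<dots> = ?C1 * (\<bar>f \<xi> - f y\<bar> powr p / \<bar>\<xi> - y\<bar> powr (1 + s * p)) + K2 y"
        proof -
          have "(z - x) powr (- 1 - q) = inverse (\<bar>\<xi> - y\<bar> powr (1 + s * p))"
            using powr_minus[of "z - x" "1 + q"] z z2 x by (simp add: algebra_simps q_def)
          then show ?thesis by (simp add: q_def divide_inverse)
        qed
        finally have "\<bar>f \<xi>\<bar> powr p * x powr (- q) / (\<mu> * x) \<le> \<dots>" .
        moreover have "W \<xi> y = ennreal (K2 y)" unfolding W_def using z z2 x lam by (auto simp: field_simps)
        ultimately show ?thesis using True z z2 K2 lam
          by (simp add: slob_kernel_def ennreal_leI flip: ennreal_mult ennreal_plus)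
      qed simp
    qed
    also have "\<dots> = ennreal ?C1 * (\<integral>\<^sup>+y. slob_kernel s p f \<xi> y * indicator {-L<..<0} y \<partial>lborel) + (\<integral>\<^sup>+y. W \<xi> y \<partial>lborel)"
      by (subst nn_integral_add) (auto simp: nn_integral_cmult W_def)
    finally show ?thesis .
  qed
  \<comment> \<open>Away from 0 the weight is bounded and the L_p norm suffices.\<close>
  have far: "w \<xi> \<le> ennreal (l powr (- q)) * ennreal (\<bar>f \<xi>\<bar> powr p)" if "\<xi> \<le> -l" for \<xi>
  proof -
    have "\<bar>\<xi>\<bar> powr (- q) \<le> l powr (- q)" using that l q0 by (intro powr_mono2') auto
    then show ?thesis by (simp add: w_def mult_right_mono mult.commute ennreal_leI flip: ennreal_mult)
  qed
  have "?F \<le> (\<integral>\<^sup>+\<xi>. (ennreal ?C1 * ((\<integral>\<^sup>+y. slob_kernel s p f \<xi> y * indicator {-L<..<0} y \<partial>lborel) * indicator {-L<..<0} \<xi>) + (\<integral>\<^sup>+y. W \<xi> y \<partial>lborel))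
      + ennreal (l powr (- q)) * (ennreal (\<bar>f \<xi>\<bar> powr p) * indicator {-L<..<0} \<xi>) \<partial>lborel)"
    unfolding F
  proof (rule nn_integral_mono)
    fix \<xi>
    show "w \<xi> * indicator {-L<..<-\<epsilon>} \<xi> \<le> (ennreal ?C1 * ((\<integral>\<^sup>+y. slob_kernel s p f \<xi> y * indicator {-L<..<0} y \<partial>lborel) * indicator {-L<..<0} \<xi>) + (\<integral>\<^sup>+y. W \<xi> y \<partial>lborel))
      + ennreal (l powr (- q)) * (ennreal (\<bar>f \<xi>\<bar> powr p) * indicator {-L<..<0} \<xi>)"
    proof (cases "\<xi> \<in> {-L<..<-\<epsilon>}")
      case True
      then show ?thesis using near[of \<xi>] far[of \<xi>] \<epsilon>
        by (cases "-l < \<xi>") (auto intro: order_trans add_increasing add_increasing2)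
    qed simp
  qed
  also have "\<dots> = ennreal ?C1 * ?S + (\<integral>\<^sup>+\<xi>. \<integral>\<^sup>+y. W \<xi> y \<partial>lborel \<partial>lborel) + ennreal (l powr (- q)) * ?I"
    unfolding slobodeckij_integral_kernel by (simp add: nn_integral_add nn_integral_cmult)
  also have "(\<integral>\<^sup>+\<xi>. \<integral>\<^sup>+y. W \<xi> y \<partial>lborel \<partial>lborel) = (\<integral>\<^sup>+y. \<integral>\<^sup>+\<xi>. W \<xi> y \<partial>lborel \<partial>lborel)"
    by (rule lborel_pair.Fubini'[symmetric]) measurable
  also have "\<dots> \<le> (\<integral>\<^sup>+y. ennreal (1/2) * (w y * indicator {-L<..<-\<epsilon>} y) \<partial>lborel)"
  proof (rule nn_integral_mono)
    fix y :: real
    show "(\<integral>\<^sup>+\<xi>. W \<xi> y \<partial>lborel) \<le> ennreal (1/2) * (w y * indicator {-L<..<-\<epsilon>} y)"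
    proof (cases "y \<in> {-L<..<-\<epsilon>}")
      case True
      define z where "z = - y"
      have z: "z > 0" "y = - z" using True \<epsilon> by (auto simp: z_def)
      have "(\<integral>\<^sup>+\<xi>. W \<xi> y \<partial>lborel) = (\<integral>\<^sup>+\<xi>. ennreal (K2 y) * indicator {y / \<mu> <..< y / (2 * \<mu>)} \<xi> \<partial>lborel)"
        using True by (intro nn_integral_cong) (auto simp: W_def indicator_def)
      also have "\<dots> = ennreal (K2 y * (z / (2 * \<mu>)))"
      proof -
        have "y / (2 * \<mu>) - y / \<mu> = z / (2 * \<mu>)" "y / \<mu> \<le> y / (2 * \<mu>)"
          using z lam by (simp_all add: field_simps)
        then have "emeasure lborel {y / \<mu> <..< y / (2 * \<mu>)} = ennreal (z / (2 * \<mu>))" by simp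
        then have "(\<integral>\<^sup>+\<xi>. ennreal (K2 y) * indicator {y / \<mu> <..< y / (2 * \<mu>)} \<xi> \<partial>lborel) = ennreal (K2 y) * ennreal (z / (2 * \<mu>))"
          by (subst nn_integral_cmult_indicator) auto
        also have "\<dots> = ennreal (K2 y * (z / (2 * \<mu>)))"
          using K2 z lam by (intro ennreal_mult[symmetric]) auto
        finally show ?thesis .
      qed
      \<comment> \<open>Integration over \<xi>, in an interval of length
        \<open>z / (2 * \<mu>)\<close>, produces exactly the factor that the hypothesis on \<mu>
        bounds by 1/2.\<close>
      also have "K2 y * (z / (2 * \<mu>)) = (2 powr (p - 1) * 2 powr q * \<mu> powr (q - 1)) * (\<bar>f y\<bar> powr p * z powr (- q))"
      proof -
        have "(z / (2 * \<mu>)) powr (- 1 - q) * (z / (2 * \<mu>)) = (z / (2 * \<mu>)) powr (- q)"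
          using z lam powr_add[of "z / (2 * \<mu>)" "- 1 - q" 1] by simp
        also have "\<dots> = z powr (- q) * (2 powr q * \<mu> powr q)"
        proof -
          have "(z / (2 * \<mu>)) powr (- q) = z powr (- q) / (2 * \<mu>) powr (- q)"
            using z lam by (subst powr_divide) auto
          moreover have "(2 * \<mu>) powr (- q) = inverse ((2 * \<mu>) powr q)" by (rule powr_minus)
          moreover have "(2 * \<mu>) powr q = 2 powr q * \<mu> powr q" using lam by (subst powr_mult) auto
          ultimately show ?thesis by (simp only: divide_inverse inverse_inverse_eq)
        qed
        finally have e: "(z / (2 * \<mu>)) powr (- 1 - q) * (z / (2 * \<mu>)) = z powr (- q) * (2 powr q * \<mu> powr q)" .
        have "K2 y * (z / (2 * \<mu>)) = 2 powr (p - 1) / \<mu> * \<bar>f y\<bar> powr p * ((z / (2 * \<mu>)) powr (- 1 - q) * (z / (2 * \<mu>)))"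
          using z by (simp add: K2_def)
        also note e
        also have "\<mu> powr q = \<mu> powr (q - 1) * \<mu>" using lam powr_add[of \<mu> "q - 1" 1] by simp
        finally show ?thesis using lam by simp
      qed
      also have "ennreal \<dots> \<le> ennreal (1/2 * (\<bar>f y\<bar> powr p * z powr (- q)))"
        using lam by (intro ennreal_leI mult_right_mono) (auto simp: q_def)
      also have "\<dots> = ennreal (1/2) * w y" using z unfolding w_def by (subst ennreal_mult) auto
      finally show ?thesis using True by simp
    qed (auto simp: W_def)
  qed
  also have "\<dots> = ennreal (1/2) * ?F" unfolding F by (intro nn_integral_cmult) measurable
  finally have *: "?F \<le> ennreal ?C1 * ?S + ennreal (1/2) * ?F + ennreal (l powr (- q)) * ?I"
    by (simp add: add_mono)
  have Ffin: "?F < \<infinity>"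
  proof -
    have "?F \<le> (\<integral>\<^sup>+\<xi>. ennreal (\<epsilon> powr (- q)) * (ennreal (\<bar>f \<xi>\<bar> powr p) * indicator {-L<..<0} \<xi>) \<partial>lborel)"
      unfolding F
    proof (rule nn_integral_mono)
      fix \<xi>
      have "\<bar>\<xi>\<bar> powr (- q) \<le> \<epsilon> powr (- q)" if "\<xi> < - \<epsilon>" using that \<epsilon> q0 by (intro powr_mono2') auto
      then show "w \<xi> * indicator {-L<..<-\<epsilon>} \<xi> \<le> ennreal (\<epsilon> powr (- q)) * (ennreal (\<bar>f \<xi>\<bar> powr p) * indicator {-L<..<0} \<xi>)"
        using \<epsilon> by (auto simp: w_def indicator_def mult_right_mono mult.commute intro!: ennreal_leI simp flip: ennreal_mult)
    qed
    also have "\<dots> = ennreal (\<epsilon> powr (- q)) * ?I" by (intro nn_integral_cmult) measurable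
    also have "\<dots> < \<infinity>" using fin by (simp add: ennreal_mult_less_top)
    finally show ?thesis .
  qed
  have absorb: "X \<le> 2 * (Y + Z)" if le: "X \<le> Y + ennreal (1/2) * X + Z" and Xfin: "X < \<infinity>" for X Y Z :: ennreal
  proof (cases "Y < \<infinity> \<and> Z < \<infinity>")
    case True
    then obtain x y z where xyz: "X = ennreal x" "Y = ennreal y" "Z = ennreal z" "x \<ge> 0" "y \<ge> 0" "z \<ge> 0"
      using Xfin by (cases X; cases Y; cases Z) auto
    have "ennreal (1/2) * ennreal x = ennreal (x / 2)"
      using xyz by (subst ennreal_mult[symmetric]) auto
    then have "ennreal x \<le> ennreal (y + x / 2 + z)" using le xyz
      by (simp only: xyz ennreal_plus add_nonneg_nonneg half_gt_zero_iff) (simp add: xyz)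
    then have "x \<le> y + x / 2 + z" using xyz by (subst (asm) ennreal_le_iff) auto
    then have "ennreal x \<le> ennreal (2 * (y + z))" by (intro ennreal_leI) simp
    then show ?thesis using xyz by (simp add: ennreal_mult)
  next
    case False
    then have "Y = top \<or> Z = top" unfolding infinity_ennreal_def using less_top by blast
    then show ?thesis by (auto simp: ennreal_mult_top)
  qed
  show ?thesis using absorb[OF * Ffin] by (simp add: l_def q_def)
qed

text \<open>Fractional Hardy inequality. The value of \<open>f\<close> at \<open>\<xi>\<close> is compared with its values at \<open>y \<in> (2\<mu>\<xi>, \<mu>\<xi>)\<close>;
  as \<open>sp < 1\<close>, the average over \<open>y\<close> contributes a fraction \<open>O(\<mu>\<^sup>s\<^sup>p\<^sup>-\<^sup>1)\<close> of the left-hand side, which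
  is absorbed for large \<open>\<mu>\<close>.\<close>

lemma hardy:
  assumes q: "0 < s * p" "s * p < 1" and p: "p \<ge> 1" and L: "L > 0"
  obtains C where "C > 0" "\<And>f. f \<in> borel_measurable borel \<Longrightarrow>
    (\<integral>\<^sup>+\<xi>. ennreal (\<bar>f \<xi>\<bar> powr p * \<bar>\<xi>\<bar> powr (- (s * p))) * indicator {-L<..<0} \<xi> \<partial>lborel)
    \<le> ennreal C * (slobodeckij_integral s p (-L) 0 f + (\<integral>\<^sup>+\<xi>. ennreal (\<bar>f \<xi>\<bar> powr p) * indicator {-L<..<0} \<xi> \<partial>lborel))"
proof -
  \<comment> \<open>Solves \<open>2 powr (p - 1) * 2 powr (s * p) * \<mu> powr (s * p - 1) =
    1/2\<close>, which is possible with a large \<mu> because \<open>s * p - 1\<close> is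
    negative.\<close>
  define \<mu> where "\<mu> = (2 powr (p + s * p)) powr (1 / (1 - s * p))"
  have lam: "\<mu> \<ge> 1" unfolding \<mu>_def using q p by (intro ge_one_powr_ge_zero) auto
  have "\<mu> powr (s * p - 1) = 2 powr (- (p + s * p))"
  proof -
    have "(p + s * p) * (1 / (1 - s * p)) * (s * p - 1) = - (p + s * p)" using q by (simp add: divide_simps) (simp add: algebra_simps)
    then show ?thesis unfolding \<mu>_def powr_powr by simp
  qed
  then have "2 powr (p - 1) * 2 powr (s * p) * \<mu> powr (s * p - 1) = 2 powr (- 1)"
    by (simp flip: powr_add)
  then have lam2: "2 powr (p - 1) * 2 powr (s * p) * \<mu> powr (s * p - 1) \<le> 1/2" by (simp add: powr_minus)
  define C1 where "C1 = 2 powr (p - 1) * ((2 * \<mu>) powr (1 + s * p) / \<mu>)"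
  define C2 where "C2 = (L / (2 * \<mu>)) powr (- (s * p))"
  have C: "C1 > 0" "C2 > 0" using lam L by (auto simp: C1_def C2_def)
  show thesis
  proof (rule that[of "2 * (C1 + C2)"])
    show "2 * (C1 + C2) > 0" using C by simp
    fix f :: "real \<Rightarrow> real" assume [measurable]: "f \<in> borel_measurable borel"
    let ?I = "\<integral>\<^sup>+\<xi>. ennreal (\<bar>f \<xi>\<bar> powr p) * indicator {-L<..<0} \<xi> \<partial>lborel"
    let ?S = "slobodeckij_integral s p (-L) 0 f"
    let ?w = "\<lambda>\<xi>. ennreal (\<bar>f \<xi>\<bar> powr p * \<bar>\<xi>\<bar> powr (- (s * p)))"
    have bound: "2 * (ennreal C1 * ?S + ennreal C2 * ?I) \<le> ennreal (2 * (C1 + C2)) * (?S + ?I)"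
    proof -
      have "2 * (ennreal C1 * ?S + ennreal C2 * ?I) \<le> 2 * (ennreal (C1 + C2) * ?S + ennreal (C1 + C2) * ?I)"
        using C by (intro mult_left_mono add_mono mult_right_mono ennreal_leI) auto
      also have "\<dots> = ennreal (2 * (C1 + C2)) * (?S + ?I)"
      proof -
        have "ennreal (2 * (C1 + C2)) = 2 * ennreal (C1 + C2)"
          using C by (subst ennreal_mult) auto
        then show ?thesis by (simp only: mult.assoc distrib_left)
      qed
      finally show ?thesis .
    qed
    show "(\<integral>\<^sup>+\<xi>. ?w \<xi> * indicator {-L<..<0} \<xi> \<partial>lborel) \<le> ennreal (2 * (C1 + C2)) * (?S + ?I)"
    proof (cases "?I < \<infinity>")
      case True
      \<comment> \<open>Monotone convergence along the cutoffs
        \<open>1 / real (Suc n)\<close>.\<close>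
      have "(\<lambda>\<xi>. ?w \<xi> * indicator {-L<..<0} \<xi>) = (\<lambda>\<xi>. SUP n. ?w \<xi> * indicator {-L<..<- (1 / real (Suc n))} \<xi>)"
      proof
        fix \<xi> :: real
        show "?w \<xi> * indicator {-L<..<0} \<xi> = (SUP n. ?w \<xi> * indicator {-L<..<- (1 / real (Suc n))} \<xi>)"
        proof (cases "\<xi> \<in> {-L<..<0}")
          case True
          then obtain n where n: "inverse (real (Suc n)) < - \<xi>" using reals_Archimedean[of "- \<xi>"] by auto
          show ?thesis
          proof (rule antisym)
            have "?w \<xi> * indicator {-L<..<0} \<xi> = ?w \<xi> * indicator {-L<..<- (1 / real (Suc n))} \<xi>"
              using True n by (simp add: divide_inverse)
            also have "\<dots> \<le> (SUP n. ?w \<xi> * indicator {-L<..<- (1 / real (Suc n))} \<xi>)"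
              by (rule SUP_upper) simp
            finally show "?w \<xi> * indicator {-L<..<0} \<xi> \<le> \<dots>" .
            show "(SUP n. ?w \<xi> * indicator {-L<..<- (1 / real (Suc n))} \<xi>) \<le> ?w \<xi> * indicator {-L<..<0} \<xi>"
              using True by (intro SUP_least) (auto simp: indicator_def)
          qed
        next
          case False
          have "\<xi> \<notin> {-L<..<- (1 / real (Suc n))}" for n
          proof
            assume *: "\<xi> \<in> {-L<..<- (1 / real (Suc n))}"
            have "0 < 1 / real (Suc n)" by simp
            with * have "\<xi> < 0" unfolding greaterThanLessThan_iff by linarith
            with * False show False by auto
          qed
          then show ?thesis using False by simp
        qed
      qed
      then have "(\<integral>\<^sup>+\<xi>. ?w \<xi> * indicator {-L<..<0} \<xi> \<partial>lborel) = (\<integral>\<^sup>+\<xi>. (SUP n. ?w \<xi> * indicator {-L<..<- (1 / real (Suc n))} \<xi>) \<partial>lborel)"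
        by simp
      also have "\<dots> = (SUP n. \<integral>\<^sup>+\<xi>. ?w \<xi> * indicator {-L<..<- (1 / real (Suc n))} \<xi> \<partial>lborel)"
      proof (rule nn_integral_monotone_convergence_SUP)
        show "incseq (\<lambda>n \<xi>. ?w \<xi> * indicator {-L<..<- (1 / real (Suc n))} \<xi>)"
        proof (intro incseq_SucI le_funI)
          fix n \<xi>
          have "1 / real (Suc (Suc n)) \<le> 1 / real (Suc n)" by (simp add: frac_le)
          then show "?w \<xi> * indicator {-L<..<- (1 / real (Suc n))} \<xi> \<le> ?w \<xi> * indicator {-L<..<- (1 / real (Suc (Suc n)))} \<xi>"
            by (auto simp: indicator_def simp del: of_nat_Suc)
        qed
      qed measurable
      also have "\<dots> \<le> 2 * (ennreal C1 * ?S + ennreal C2 * ?I)"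
        unfolding C1_def C2_def
        by (intro SUP_least hardy_truncated[OF _ q(1) p L lam lam2 True]) auto
      finally show ?thesis using bound by simp
    next
      case False
      then have "?I = \<infinity>" using less_top by fastforce
      then show ?thesis using C by (simp add: ennreal_mult_top del: distrib_left_numeral)
    qed
  qed
qed

text \<open>Only pairs with \<xi> < 0 < t are new. For them \<open>t - \<xi>\<close> equals
  \<open>\<bar>t\<bar> + \<bar>\<xi>\<bar>\<close>, the values of \<open>f\<close> are separated by
  \<open>powr_add_le2\<close>, and one variable integrates out. What remains are the two integrals
  with weight \<open>\<bar>\<xi>\<bar> powr (- (s * p))\<close>. The one-sided values at 0 need not
  match.\<close>

lemma slobodeckij_integral_concat:
  fixes f :: "real \<Rightarrow> real"
  assumes [measurable]: "f \<in> borel_measurable borel" and q: "0 < s * p" and p: "p \<ge> 1" and ab: "a < 0" "0 < b"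
  shows "slobodeckij_integral s p a b f \<le> slobodeckij_integral s p a 0 f + slobodeckij_integral s p 0 b f
     + 2 * (ennreal (2 powr (p - 1) / (s * p)) * ((\<integral>\<^sup>+\<xi>. ennreal (\<bar>f \<xi>\<bar> powr p * \<bar>\<xi>\<bar> powr (- (s * p))) * indicator {a<..<0} \<xi> \<partial>lborel)
         + (\<integral>\<^sup>+\<xi>. ennreal (\<bar>f \<xi>\<bar> powr p * \<bar>\<xi>\<bar> powr (- (s * p))) * indicator {0<..<b} \<xi> \<partial>lborel)))"
proof -
  define q where "q = s * p"
  have q0: "q > 0" using q by (simp add: q_def)
  let ?k = "slob_kernel s p f"
  let ?iA = "indicator {a<..<0} :: real \<Rightarrow> ennreal" and ?iB = "indicator {0<..<b} :: real \<Rightarrow> ennreal"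
  have split: "(\<integral>\<^sup>+\<xi>. g \<xi> * indicator {a<..<b} \<xi> \<partial>lborel) = (\<integral>\<^sup>+\<xi>. g \<xi> * ?iA \<xi> \<partial>lborel) + (\<integral>\<^sup>+\<xi>. g \<xi> * ?iB \<xi> \<partial>lborel)"
    if [measurable]: "g \<in> borel_measurable borel" for g
  proof -
    have "AE \<xi> in lborel. \<xi> \<noteq> (0::real)" by (rule AE_lborel_singleton)
    then have "(\<integral>\<^sup>+\<xi>. g \<xi> * indicator {a<..<b} \<xi> \<partial>lborel) = (\<integral>\<^sup>+\<xi>. g \<xi> * ?iA \<xi> + g \<xi> * ?iB \<xi> \<partial>lborel)"
      using ab by (intro nn_integral_cong_AE) (auto elim!: eventually_mono simp: indicator_def)
    then show ?thesis by (simp add: nn_integral_add)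
  qed
  \<comment> \<open>The mixed part; it occurs twice, by symmetry of the kernel.\<close>
  define X where "X = (\<integral>\<^sup>+\<xi>. (\<integral>\<^sup>+t. ?k t \<xi> * ?iB t \<partial>lborel) * ?iA \<xi> \<partial>lborel)"
  have sym: "?k t \<xi> = ?k \<xi> t" for t \<xi> by (simp add: slob_kernel_def abs_minus_commute)
  have "slobodeckij_integral s p a b f = (\<integral>\<^sup>+t. ((\<integral>\<^sup>+\<xi>. ?k t \<xi> * ?iA \<xi> \<partial>lborel) + (\<integral>\<^sup>+\<xi>. ?k t \<xi> * ?iB \<xi> \<partial>lborel)) * indicator {a<..<b} t \<partial>lborel)"
    unfolding slobodeckij_integral_kernel by (subst split) auto
  also have "\<dots> = (\<integral>\<^sup>+t. ((\<integral>\<^sup>+\<xi>. ?k t \<xi> * ?iA \<xi> \<partial>lborel) + (\<integral>\<^sup>+\<xi>. ?k t \<xi> * ?iB \<xi> \<partial>lborel)) * ?iA t \<partial>lborel)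
      + (\<integral>\<^sup>+t. ((\<integral>\<^sup>+\<xi>. ?k t \<xi> * ?iA \<xi> \<partial>lborel) + (\<integral>\<^sup>+\<xi>. ?k t \<xi> * ?iB \<xi> \<partial>lborel)) * ?iB t \<partial>lborel)"
    by (rule split) measurable
  also have "\<dots> = slobodeckij_integral s p a 0 f + (\<integral>\<^sup>+t. (\<integral>\<^sup>+\<xi>. ?k t \<xi> * ?iB \<xi> \<partial>lborel) * ?iA t \<partial>lborel)
      + ((\<integral>\<^sup>+t. (\<integral>\<^sup>+\<xi>. ?k t \<xi> * ?iA \<xi> \<partial>lborel) * ?iB t \<partial>lborel) + slobodeckij_integral s p 0 b f)"
    unfolding slobodeckij_integral_kernel by (simp add: distrib_right nn_integral_add)
  also have "(\<integral>\<^sup>+t. (\<integral>\<^sup>+\<xi>. ?k t \<xi> * ?iB \<xi> \<partial>lborel) * ?iA t \<partial>lborel) = X"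
    unfolding X_def by (subst sym) simp
  also have "(\<integral>\<^sup>+t. (\<integral>\<^sup>+\<xi>. ?k t \<xi> * ?iA \<xi> \<partial>lborel) * ?iB t \<partial>lborel) = X"
  proof -
    have "(\<integral>\<^sup>+t. (\<integral>\<^sup>+\<xi>. ?k t \<xi> * ?iA \<xi> \<partial>lborel) * ?iB t \<partial>lborel) = (\<integral>\<^sup>+t. (\<integral>\<^sup>+\<xi>. ?k t \<xi> * ?iA \<xi> * ?iB t \<partial>lborel) \<partial>lborel)"
      by (subst nn_integral_multc) auto
    also have "\<dots> = (\<integral>\<^sup>+\<xi>. (\<integral>\<^sup>+t. ?k t \<xi> * ?iA \<xi> * ?iB t \<partial>lborel) \<partial>lborel)"
      by (rule lborel_pair.Fubini'[symmetric]) measurable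
    also have "\<dots> = (\<integral>\<^sup>+\<xi>. (\<integral>\<^sup>+t. ?k t \<xi> * ?iB t * ?iA \<xi> \<partial>lborel) \<partial>lborel)"
      by (simp add: ac_simps)
    also have "\<dots> = X" unfolding X_def by (subst nn_integral_multc) auto
    finally show ?thesis .
  qed
  finally have S: "slobodeckij_integral s p a b f = slobodeckij_integral s p a 0 f + slobodeckij_integral s p 0 b f + (X + X)"
    by (simp add: ac_simps)
  define c where "c = 2 powr (p - 1)"
  define w where "w \<xi> = ennreal (\<bar>f \<xi>\<bar> powr p)" for \<xi>
  have [measurable]: "w \<in> borel_measurable borel" unfolding w_def by measurable
  define G where "G t \<xi> = ennreal (c * (\<bar>t\<bar> + \<bar>\<xi>\<bar>) powr (- 1 - q))" for t \<xi> :: real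
  have [measurable]: "(\<lambda>x. G (u x) (v x)) \<in> borel_measurable M" if [measurable]: "u \<in> borel_measurable M" "v \<in> borel_measurable M" for u v and M :: "'z measure"
    unfolding G_def by measurable
  have k_le: "?k t \<xi> \<le> w \<xi> * G t \<xi> + w t * G t \<xi>" if "t > 0" "\<xi> < 0" for t \<xi>
  proof -
    have "\<bar>f t - f \<xi>\<bar> powr p \<le> (\<bar>f \<xi>\<bar> + \<bar>f t\<bar>) powr p" using p by (intro powr_mono2) auto
    also have "\<dots> \<le> c * (\<bar>f \<xi>\<bar> powr p + \<bar>f t\<bar> powr p)" unfolding c_def using p by (intro powr_add_le2) auto
    finally have "\<bar>f t - f \<xi>\<bar> powr p / \<bar>t - \<xi>\<bar> powr (1 + s * p) \<le> c * (\<bar>f \<xi>\<bar> powr p + \<bar>f t\<bar> powr p) / \<bar>t - \<xi>\<bar> powr (1 + s * p)"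
      by (intro divide_right_mono) auto
    also have "\<dots> = c * (\<bar>f \<xi>\<bar> powr p + \<bar>f t\<bar> powr p) * (\<bar>t\<bar> + \<bar>\<xi>\<bar>) powr (- 1 - q)"
      using that powr_minus[of "t - \<xi>" "1 + q"] by (simp add: divide_inverse q_def algebra_simps)
    also have "\<dots> = \<bar>f \<xi>\<bar> powr p * (c * (\<bar>t\<bar> + \<bar>\<xi>\<bar>) powr (- 1 - q)) + \<bar>f t\<bar> powr p * (c * (\<bar>t\<bar> + \<bar>\<xi>\<bar>) powr (- 1 - q))"
      by (simp add: algebra_simps)
    finally show ?thesis by (simp add: slob_kernel_def w_def G_def c_def ennreal_leI flip: ennreal_mult ennreal_plus)
  qed
  have c0: "c > 0" by (simp add: c_def)
  have GB: "(\<integral>\<^sup>+t. G t \<xi> * ?iB t \<partial>lborel) \<le> ennreal (c / q * \<bar>\<xi>\<bar> powr (- q))" if "\<xi> \<noteq> 0" for \<xi>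
  proof -
    have "(\<integral>\<^sup>+t. G t \<xi> * ?iB t \<partial>lborel) \<le> (\<integral>\<^sup>+t. ennreal c * ennreal (indicator {0<..} t * (t + \<bar>\<xi>\<bar>) powr (- 1 - q)) \<partial>lborel)"
      using c0 by (intro nn_integral_mono) (auto simp: G_def indicator_def simp flip: ennreal_mult)
    also have "\<dots> = ennreal c * (\<integral>\<^sup>+t. ennreal (indicator {0<..} t * (t + \<bar>\<xi>\<bar>) powr (- 1 - q)) \<partial>lborel)"
      by (rule nn_integral_cmult) measurable
    also have "\<dots> \<le> ennreal c * ennreal (\<bar>\<xi>\<bar> powr (- q) / q)"
      using that q0 by (intro mult_left_mono nn_integral_powr_tail) auto
    finally show ?thesis using c0 q0 by (simp flip: ennreal_mult)
  qed
  have GA: "(\<integral>\<^sup>+\<xi>. G t \<xi> * ?iA \<xi> \<partial>lborel) \<le> ennreal (c / q * \<bar>t\<bar> powr (- q))" if "t \<noteq> 0" for t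
  proof -
    let ?h = "\<lambda>\<xi>. ennreal (indicator {0<..} \<xi> * (\<xi> + \<bar>t\<bar>) powr (- 1 - q))"
    have "(\<integral>\<^sup>+\<xi>. G t \<xi> * ?iA \<xi> \<partial>lborel) \<le> (\<integral>\<^sup>+\<xi>. ennreal c * ?h (0 + (- 1) * \<xi>) \<partial>lborel)"
      using c0 by (intro nn_integral_mono) (auto simp: G_def indicator_def add.commute simp flip: ennreal_mult)
    also have "\<dots> = ennreal c * (\<integral>\<^sup>+\<xi>. ?h (0 + (- 1) * \<xi>) \<partial>lborel)"
      by (rule nn_integral_cmult) measurable
    also have "(\<integral>\<^sup>+\<xi>. ?h (0 + (- 1) * \<xi>) \<partial>lborel) = (\<integral>\<^sup>+\<xi>. ?h \<xi> \<partial>lborel)"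
      by (subst nn_integral_real_affine[of ?h "-1" 0]) auto
    also have "ennreal c * (\<integral>\<^sup>+\<xi>. ?h \<xi> \<partial>lborel) \<le> ennreal c * ennreal (\<bar>t\<bar> powr (- q) / q)"
      using that q0 by (intro mult_left_mono nn_integral_powr_tail) auto
    finally show ?thesis using c0 q0 by (simp flip: ennreal_mult)
  qed
  have "X \<le> (\<integral>\<^sup>+\<xi>. \<integral>\<^sup>+t. w \<xi> * ?iA \<xi> * (G t \<xi> * ?iB t) + w t * ?iB t * (G t \<xi> * ?iA \<xi>) \<partial>lborel \<partial>lborel)"
    unfolding X_def
  proof (rule nn_integral_mono)
    fix \<xi>
    have "(\<integral>\<^sup>+t. ?k t \<xi> * ?iB t \<partial>lborel) * ?iA \<xi> = (\<integral>\<^sup>+t. ?k t \<xi> * ?iB t * ?iA \<xi> \<partial>lborel)"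
      by (subst nn_integral_multc) auto
    also have "\<dots> \<le> (\<integral>\<^sup>+t. w \<xi> * ?iA \<xi> * (G t \<xi> * ?iB t) + w t * ?iB t * (G t \<xi> * ?iA \<xi>) \<partial>lborel)"
      using k_le by (intro nn_integral_mono) (auto simp: indicator_def)
    finally show "(\<integral>\<^sup>+t. ?k t \<xi> * ?iB t \<partial>lborel) * ?iA \<xi> \<le> \<dots>" .
  qed
  also have "\<dots> = (\<integral>\<^sup>+\<xi>. \<integral>\<^sup>+t. w \<xi> * ?iA \<xi> * (G t \<xi> * ?iB t) \<partial>lborel \<partial>lborel) + (\<integral>\<^sup>+\<xi>. \<integral>\<^sup>+t. w t * ?iB t * (G t \<xi> * ?iA \<xi>) \<partial>lborel \<partial>lborel)"
    by (simp add: nn_integral_add)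
  also have "(\<integral>\<^sup>+\<xi>. \<integral>\<^sup>+t. w t * ?iB t * (G t \<xi> * ?iA \<xi>) \<partial>lborel \<partial>lborel) = (\<integral>\<^sup>+t. \<integral>\<^sup>+\<xi>. w t * ?iB t * (G t \<xi> * ?iA \<xi>) \<partial>lborel \<partial>lborel)"
    by (rule lborel_pair.Fubini'[symmetric]) measurable
  also have "(\<integral>\<^sup>+\<xi>. \<integral>\<^sup>+t. w \<xi> * ?iA \<xi> * (G t \<xi> * ?iB t) \<partial>lborel \<partial>lborel) \<le> (\<integral>\<^sup>+\<xi>. ennreal (c / q) * (ennreal (\<bar>f \<xi>\<bar> powr p * \<bar>\<xi>\<bar> powr (- q)) * ?iA \<xi>) \<partial>lborel)"
  proof (rule nn_integral_mono)
    fix \<xi> :: real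
    have "(\<integral>\<^sup>+t. w \<xi> * ?iA \<xi> * (G t \<xi> * ?iB t) \<partial>lborel) = w \<xi> * ?iA \<xi> * (\<integral>\<^sup>+t. G t \<xi> * ?iB t \<partial>lborel)"
      by (rule nn_integral_cmult) measurable
    also have "\<dots> \<le> ennreal (c / q) * (ennreal (\<bar>f \<xi>\<bar> powr p * \<bar>\<xi>\<bar> powr (- q)) * ?iA \<xi>)"
    proof (cases "\<xi> \<in> {a<..<0}")
      case True
      then have "w \<xi> * (\<integral>\<^sup>+t. G t \<xi> * ?iB t \<partial>lborel) \<le> w \<xi> * ennreal (c / q * \<bar>\<xi>\<bar> powr (- q))"
        by (intro mult_left_mono GB) auto
      then show ?thesis using True c0 q0 by (simp add: w_def ac_simps flip: ennreal_mult)
    qed simp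
    finally show "(\<integral>\<^sup>+t. w \<xi> * ?iA \<xi> * (G t \<xi> * ?iB t) \<partial>lborel) \<le> \<dots>" .
  qed
  also have "\<dots> = ennreal (c / q) * (\<integral>\<^sup>+\<xi>. (ennreal (\<bar>f \<xi>\<bar> powr p * \<bar>\<xi>\<bar> powr (- q)) * ?iA \<xi>) \<partial>lborel)"
    by (rule nn_integral_cmult) measurable
  also have "(\<integral>\<^sup>+t. \<integral>\<^sup>+\<xi>. w t * ?iB t * (G t \<xi> * ?iA \<xi>) \<partial>lborel \<partial>lborel) \<le> (\<integral>\<^sup>+t. ennreal (c / q) * (ennreal (\<bar>f t\<bar> powr p * \<bar>t\<bar> powr (- q)) * ?iB t) \<partial>lborel)"
  proof (rule nn_integral_mono)
    fix t :: real
    have "(\<integral>\<^sup>+\<xi>. w t * ?iB t * (G t \<xi> * ?iA \<xi>) \<partial>lborel) = w t * ?iB t * (\<integral>\<^sup>+\<xi>. G t \<xi> * ?iA \<xi> \<partial>lborel)"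
      by (rule nn_integral_cmult) measurable
    also have "\<dots> \<le> ennreal (c / q) * (ennreal (\<bar>f t\<bar> powr p * \<bar>t\<bar> powr (- q)) * ?iB t)"
    proof (cases "t \<in> {0<..<b}")
      case True
      then have "w t * (\<integral>\<^sup>+\<xi>. G t \<xi> * ?iA \<xi> \<partial>lborel) \<le> w t * ennreal (c / q * \<bar>t\<bar> powr (- q))"
        by (intro mult_left_mono GA) auto
      then show ?thesis using True c0 q0 by (simp add: w_def ac_simps flip: ennreal_mult)
    qed simp
    finally show "(\<integral>\<^sup>+\<xi>. w t * ?iB t * (G t \<xi> * ?iA \<xi>) \<partial>lborel) \<le> \<dots>" .
  qed
  also have "\<dots> = ennreal (c / q) * (\<integral>\<^sup>+\<xi>. (ennreal (\<bar>f \<xi>\<bar> powr p * \<bar>\<xi>\<bar> powr (- q)) * ?iB \<xi>) \<partial>lborel)"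
    by (rule nn_integral_cmult) measurable
  finally have "X \<le> ennreal (c / q) * ((\<integral>\<^sup>+\<xi>. (ennreal (\<bar>f \<xi>\<bar> powr p * \<bar>\<xi>\<bar> powr (- q)) * ?iA \<xi>) \<partial>lborel)
      + (\<integral>\<^sup>+\<xi>. (ennreal (\<bar>f \<xi>\<bar> powr p * \<bar>\<xi>\<bar> powr (- q)) * ?iB \<xi>) \<partial>lborel))"
    by (simp add: distrib_left add_mono)
  then show ?thesis unfolding S c_def q_def mult_2
    by (intro add_left_mono add_mono) auto
qed

section \<open>The linear delay equation\<close>

text \<open>The maximum of \<open>exp (- (\<kappa> * t)) * norm (v t)\<close> over the compact
  interval is inserted for \<open>V\<close>, and \<open>step\<close> is applied at the point where
  it is attained. Half of the maximum is absorbed; \<kappa> is meant to be chosen so large that the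
  factor 1/2 holds.\<close>

lemma weighted_gronwall:
  fixes v :: "real \<Rightarrow> 'a::real_normed_vector"
  assumes cont: "continuous_on {0..b} v" and "D \<ge> 0" "\<kappa> \<ge> 0"
    and step: "\<And>V t. V \<ge> 0 \<Longrightarrow> t \<in> {0..b} \<Longrightarrow> (\<And>r. r \<in> {0..t} \<Longrightarrow> norm (v r) \<le> V * exp (\<kappa> * r)) \<Longrightarrow>
      norm (v t) \<le> D + V / 2 * exp (\<kappa> * t)"
    and t: "t \<in> {0..b}"
  shows "norm (v t) \<le> 2 * D * exp (\<kappa> * t)"
proof -
  define f where "f t = exp (- (\<kappa> * t)) * norm (v t)" for t
  have "continuous_on {0..b} f" unfolding f_def by (intro continuous_intros cont)
  then obtain m where m: "m \<in> {0..b}" "\<And>r. r \<in> {0..b} \<Longrightarrow> f r \<le> f m"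
    using continuous_attains_sup[of "{0..b}" f] t by auto
  have nv: "norm (v r) = f r * exp (\<kappa> * r)" for r by (simp add: f_def exp_minus)
  have f0: "f m \<ge> 0" by (simp add: f_def)
  have "norm (v m) \<le> D + f m / 2 * exp (\<kappa> * m)"
    using m f0 by (intro step) (auto simp: nv intro!: mult_right_mono)
  then have "f m / 2 * exp (\<kappa> * m) \<le> D" by (simp add: nv)
  moreover have "f m / 2 * 1 \<le> f m / 2 * exp (\<kappa> * m)" using f0 m assms by (intro mult_left_mono) auto
  ultimately have "f m \<le> 2 * D" by simp
  then have "f t \<le> 2 * D" using m(2)[OF t] by simp
  then show ?thesis by (simp add: nv mult_right_mono)
qed

lemma continuous_on_atLeastI:
  fixes f :: "real \<Rightarrow> 'a::topological_space"
  assumes "\<And>b. b \<ge> a \<Longrightarrow> continuous_on {a..b} f"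
  shows "continuous_on {a..} f"
  unfolding continuous_on_eq_continuous_within
proof
  fix x assume x: "x \<in> {a..}"
  have "continuous (at x within {a..x + 1}) f"
    using assms[of "x + 1"] x by (auto simp: continuous_on_eq_continuous_within)
  moreover have "at x within {a..x + 1} = at x within {a..}"
    by (rule at_within_nhd[of x "{..<x + 1}"]) auto
  ultimately show "continuous (at x within {a..}) f" by simp
qed

lemma exp_has_integral:
  fixes c t :: real
  assumes "c > 0" "t \<ge> 0"
  shows "((\<lambda>r. exp (c * r)) has_integral ((exp (c * t) - 1) / c)) {0..t}"
proof -
  have "((\<lambda>r. exp (c * r)) has_integral (exp (c * t) / c - exp (c * 0) / c)) {0..t}"
    using assms by (intro fundamental_theorem_of_calculus)
      (auto intro!: derivative_eq_intros simp flip: has_real_derivative_iff_has_vector_derivative)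
  then show ?thesis by (simp add: diff_divide_distrib)
qed

section \<open>The delay equation in integral form: uniqueness, shifts, existence\<close>

locale delay_equation =
  fixes T :: real and k :: "real ^ 'n" and A B :: "real ^ 'n ^ 'n"
  assumes T_pos: "T > 0"
begin

definition rhs :: "(real \<Rightarrow> real) \<Rightarrow> (real \<Rightarrow> real ^ 'n) \<Rightarrow> real \<Rightarrow> real ^ 'n" where
  "rhs h u r = h r *\<^sub>R k - B *v u r + A *v u (r - 2 * T)"

text \<open>An integral equation for the gauge integral, without L_p conditions. The value
  \<open>u (- 2 * T)\<close> enters only at the single point \<open>r = 0\<close> and is left
  unspecified.\<close>

definition delay_sol :: "(real \<Rightarrow> real) \<Rightarrow> (real \<Rightarrow> real ^ 'n) \<Rightarrow> real ^ 'n \<Rightarrow> (real \<Rightarrow> real ^ 'n) \<Rightarrow> bool" where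
  "delay_sol h \<phi> x u \<longleftrightarrow> (\<forall>t. -2 * T < t \<and> t < 0 \<longrightarrow> u t = \<phi> t) \<and> continuous_on {0..} u \<and> u 0 = x \<and>
     (\<forall>t\<ge>0. (rhs h u has_integral (u t - x)) {0..t})"

definition "KA = onorm ((*v) A)"
definition "KB = onorm ((*v) B)"
text \<open>Rate of the exponential weight. Integrating the linear terms against
  \<open>exp (growth * r)\<close> costs the factor \<open>(KA + KB) / growth\<close>, which this
  choice keeps below 1/2.\<close>

definition "growth = 2 * (KA + KB) + 1"

lemma K_nonneg [simp]: "KA \<ge> 0" "KB \<ge> 0"
  unfolding KA_def KB_def by (auto intro: onorm_pos_le)

lemma growth_pos: "growth > 0" and growth_ge: "(KA + KB) / growth \<le> 1/2"
proof -
  have gen: "2 * c + 1 > 0 \<and> c / (2 * c + 1) \<le> 1/2" if "c \<ge> 0" for c :: real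
    using that by (auto simp: divide_le_eq)
  have "2 * (KA + KB) + 1 > 0 \<and> (KA + KB) / (2 * (KA + KB) + 1) \<le> 1/2" by (rule gen) simp
  then show "growth > 0" "(KA + KB) / growth \<le> 1/2" unfolding growth_def by blast+
qed

lemma norm_A: "norm (A *v x) \<le> KA * norm x" and norm_B: "norm (B *v x) \<le> KB * norm x"
  unfolding KA_def KB_def by (simp_all add: onorm)

text \<open>\<open>N\<close> collects the inhomogeneity, including the delayed term as long as it
  reads the initial history. From \<open>2 * T\<close> on, the delayed term is controlled by the
  same weighted norm as the undelayed one, because the weight increases.\<close>

lemma delay_gronwall:
  fixes v w :: "real \<Rightarrow> real ^ 'n"
  assumes cont: "continuous_on {0..b} v"
    and w: "\<And>t. t \<in> {0..b} \<Longrightarrow> (w has_integral (v t - y)) {0..t}"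
    and bd: "\<And>r. r \<in> {0<..<b} \<Longrightarrow> norm (w r) \<le> N r + KB * norm (v r) + (if r \<ge> 2 * T then KA * norm (v (r - 2 * T)) else 0)"
    and N: "N integrable_on {0..b}" "\<And>r. N r \<ge> 0" "integral {0..b} N \<le> Q"
    and t: "t \<in> {0..b}"
  shows "norm (v t) \<le> 2 * (norm y + Q) * exp (growth * t)"
proof (rule weighted_gronwall[OF cont _ _ _ t])
  have "integral {0..b} N \<ge> 0" by (rule integral_nonneg[OF N(1)]) (use N in auto)
  then show "norm y + Q \<ge> 0" using N(3) norm_ge_zero[of y] by linarith
  show "growth \<ge> 0" using growth_pos by simp
  fix V t assume V: "V \<ge> 0" and t: "t \<in> {0..b}" and le: "\<And>r. r \<in> {0..t} \<Longrightarrow> norm (v r) \<le> V * exp (growth * r)"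
  \<comment> \<open>The bound on \<open>w\<close> holds in the open interval only; changing two
    values does not affect the integral.\<close>
  define w' where "w' r = (if r \<in> {0, b} then 0 else w r)" for r
  have w': "(w' has_integral (v t - y)) {0..t}"
    by (rule has_integral_spike_finite[OF _ _ w[OF t], of "{0, b}"]) (auto simp: w'_def)
  let ?g = "\<lambda>r. N r + (KA + KB) * V * exp (growth * r)"
  have Nt: "N integrable_on {0..t}" using N(1) t by (rule_tac integrable_on_subinterval) auto
  have E: "((\<lambda>r. (KA + KB) * V * exp (growth * r)) has_integral ((KA + KB) * V * ((exp (growth * t) - 1) / growth))) {0..t}"
    using exp_has_integral[OF growth_pos, of t] t by (intro has_integral_mult_right) auto
  have "norm (integral {0..t} w') \<le> integral {0..t} ?g"
  proof (rule integral_norm_bound_integral)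
    show "w' integrable_on {0..t}" using w' by blast
    show "?g integrable_on {0..t}" using Nt E by (intro integrable_add) auto
    fix r assume r: "r \<in> {0..t}"
    show "norm (w' r) \<le> ?g r"
    proof (cases "r \<in> {0, b}")
      case True
      then show ?thesis using N(2)[of r] V by (auto simp: w'_def)
    next
      case False
      then have r': "r \<in> {0<..<b}" using r t by auto
      have "KB * norm (v r) \<le> KB * (V * exp (growth * r))" using le r by (intro mult_left_mono) auto
      moreover have "(if r \<ge> 2 * T then KA * norm (v (r - 2 * T)) else 0) \<le> KA * (V * exp (growth * r))"
      proof (cases "r \<ge> 2 * T")
        case True
        have "norm (v (r - 2 * T)) \<le> V * exp (growth * (r - 2 * T))" using True r T_pos by (intro le) auto
        also have "\<dots> \<le> V * exp (growth * r)" using V T_pos growth_pos by (intro mult_left_mono) (auto intro!: mult_left_mono)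
        finally show ?thesis using True by (auto intro: mult_left_mono)
      qed (use V in auto)
      ultimately have "norm (w r) \<le> N r + KB * (V * exp (growth * r)) + KA * (V * exp (growth * r))"
        using bd[OF r'] by linarith
      then show ?thesis using False by (simp add: w'_def algebra_simps)
    qed
  qed
  also have "integral {0..t} ?g = integral {0..t} N + (KA + KB) * V * ((exp (growth * t) - 1) / growth)"
    using integral_add[OF Nt has_integral_integrable[OF E]] integral_unique[OF E] by (simp only:)
  also have "integral {0..t} N \<le> integral {0..b} N" using N Nt t by (intro integral_subset_le) auto
  also have "(KA + KB) * V * ((exp (growth * t) - 1) / growth) \<le> V / 2 * exp (growth * t)"
  proof -
    have "(KA + KB) / growth * (V * (exp (growth * t) - 1)) \<le> 1/2 * (V * exp (growth * t))"
      using growth_ge V growth_pos t by (intro mult_mono mult_left_mono) auto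
    then show ?thesis by (simp add: mult_ac)
  qed
  finally have "norm (v t - y) \<le> integral {0..b} N + V / 2 * exp (growth * t)"
    using w' by (simp add: integral_unique)
  moreover have "norm (v t) \<le> norm y + norm (v t - y)" by (rule norm_triangle_sub)
  ultimately show "norm (v t) \<le> norm y + Q + V / 2 * exp (growth * t)"
    using N(3) by linarith
qed

lemma rhs_diff: "rhs h u r - rhs h' u' r = (h r - h' r) *\<^sub>R k - B *v (u r - u' r) + A *v (u (r - 2 * T) - u' (r - 2 * T))"
  by (simp add: rhs_def algebra_simps matrix_vector_mult_diff_distrib)

lemma delay_solD:
  assumes "delay_sol h \<phi> x u"
  shows "\<And>t. -2 * T < t \<Longrightarrow> t < 0 \<Longrightarrow> u t = \<phi> t" "continuous_on {0..} u" "u 0 = x"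
    "\<And>t. t \<ge> 0 \<Longrightarrow> (rhs h u has_integral (u t - x)) {0..t}"
  using assms by (auto simp: delay_sol_def)

text \<open>The difference satisfies \<open>delay_gronwall\<close> with zero data. The relay
  functions have to agree on \<open>(0, b)\<close> only, so that a solution can be identified with a
  constant-relay flight up to its next switch.\<close>

lemma delay_sol_unique:
  assumes u: "delay_sol h \<phi> x u" and u': "delay_sol h' \<phi>' x u'"
    and h: "\<And>r. 0 < r \<Longrightarrow> r < b \<Longrightarrow> h r = h' r" and \<phi>: "\<And>t. -2 * T < t \<Longrightarrow> t < 0 \<Longrightarrow> \<phi> t = \<phi>' t"
    and t: "-2 * T < t" "t \<le> b"
  shows "u t = u' t"
proof (cases "t < 0")
  case True
  then show ?thesis using delay_solD(1)[OF u, of t] delay_solD(1)[OF u', of t] \<phi>[of t] t by simp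
next
  case False
  have "norm (u t - u' t) \<le> 2 * (norm (0 :: real ^ 'n) + 0) * exp (growth * t)"
  proof (rule delay_gronwall)
    show "continuous_on {0..b} (\<lambda>t. u t - u' t)"
      using delay_solD(2)[OF u] delay_solD(2)[OF u'] by (intro continuous_intros) (auto elim: continuous_on_subset)
    show "((\<lambda>r. rhs h u r - rhs h' u' r) has_integral (u t - u' t - 0)) {0..t}" if "t \<in> {0..b}" for t
      using has_integral_diff[OF delay_solD(4)[OF u, of t] delay_solD(4)[OF u', of t]] that by simp
    show "norm (rhs h u r - rhs h' u' r) \<le> 0 + KB * norm (u r - u' r) + (if r \<ge> 2 * T then KA * norm (u (r - 2 * T) - u' (r - 2 * T)) else 0)"
      if r: "r \<in> {0<..<b}" for r
    proof -
      have "norm (rhs h u r - rhs h' u' r) \<le> norm (B *v (u r - u' r)) + norm (A *v (u (r - 2 * T) - u' (r - 2 * T)))"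
        unfolding rhs_diff using h[of r] r norm_triangle_ineq[of "- (B *v (u r - u' r))" "A *v (u (r - 2 * T) - u' (r - 2 * T))"] by simp
      moreover have "r < 2 * T \<Longrightarrow> u (r - 2 * T) - u' (r - 2 * T) = 0"
        using delay_solD(1)[OF u, of "r - 2 * T"] delay_solD(1)[OF u', of "r - 2 * T"] \<phi>[of "r - 2 * T"] r by simp
      ultimately show ?thesis using norm_B[of "u r - u' r"] norm_A[of "u (r - 2 * T) - u' (r - 2 * T)"] by auto
    qed
  qed (use False t in auto)
  then show ?thesis by simp
qed

lemma delay_sol_shift:
  assumes u: "delay_sol h \<phi> x u" and a: "a \<ge> 0"
  shows "delay_sol (\<lambda>t. h (a + t)) (\<lambda>\<xi>. u (a + \<xi>)) (u a) (\<lambda>t. u (a + t))"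
  unfolding delay_sol_def
proof (intro conjI allI impI)
  have "continuous_on ((+) a ` {0..}) u"
    using delay_solD(2)[OF u] a by (auto elim: continuous_on_subset)
  then show "continuous_on {0..} (\<lambda>t. u (a + t))"
    by (rule continuous_on_compose2) (auto intro!: continuous_intros)
  fix t :: real assume t: "t \<ge> 0"
  have 1: "rhs h u integrable_on {a..a + t}"
  proof (rule integrable_on_subinterval)
    show "rhs h u integrable_on {0..a + t}" using delay_solD(4)[OF u, of "a + t"] a t by auto
  qed (use a in auto)
  have "(u a - x) + integral {a..a + t} (rhs h u) = u (a + t) - x"
  proof (rule has_integral_unique)
    show "(rhs h u has_integral ((u a - x) + integral {a..a + t} (rhs h u))) {0..a + t}"
      by (rule has_integral_combine[of _ a]) (use a t delay_solD(4)[OF u, of a] 1 in auto)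
    show "(rhs h u has_integral (u (a + t) - x)) {0..a + t}"
      using delay_solD(4)[OF u, of "a + t"] a t by auto
  qed
  then have "integral {a..a + t} (rhs h u) = (u (a + t) - x) - (u a - x)"
    by (metis add_diff_cancel_left')
  then have "(rhs h u has_integral (u (a + t) - u a)) {a..a + t}"
    using integrable_integral[OF 1] by simp
  from has_integral_shift_real_ivl[OF this, of a]
  have "((\<lambda>r. rhs h u (r + a)) has_integral (u (a + t) - u a)) {0..t}" by simp
  moreover have "rhs h u (r + a) = rhs (\<lambda>t. h (a + t)) (\<lambda>t. u (a + t)) r" for r
    by (simp add: rhs_def add.commute add_diff_eq)
  ultimately show "(rhs (\<lambda>t. h (a + t)) (\<lambda>t. u (a + t)) has_integral u (a + t) - u a) {0..t}" by simp
qed auto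

lemma delay_sol_cong:
  assumes "delay_sol h \<phi> x u" "\<And>t. t > 0 \<Longrightarrow> h t = h' t" "\<And>t. -2 * T < t \<Longrightarrow> t < 0 \<Longrightarrow> \<phi> t = \<phi>' t"
  shows "delay_sol h' \<phi>' x u"
proof -
  have "(rhs h' u has_integral I) {0..t}" if "(rhs h u has_integral I) {0..t}" for I t
    by (rule has_integral_spike_finite[OF _ _ that, of "{0}"]) (auto simp: rhs_def assms(2))
  then show ?thesis using assms(1,3) by (auto simp: delay_sol_def)
qed

text \<open>The delayed term thereby splits into a known forcing, defined on the whole line, and a
  part that reads \<open>u\<close> at nonnegative times.\<close>

definition hist :: "(real \<Rightarrow> real ^ 'n) \<Rightarrow> real \<Rightarrow> real ^ 'n" where
  "hist \<phi> r = (if r \<in> {0<..<2 * T} then A *v \<phi> (r - 2 * T) else 0)"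

text \<open>Banach's fixed point theorem for the rescaled unknown
  \<open>exp (- (\<kappa> * t)) *\<^sub>R u t\<close> among bounded continuous functions. The weight
  makes the integral operator a contraction with factor 1/2 on the entire half-line at once.\<close>

lemma delay_sol_exists:
  fixes \<phi> :: "real \<Rightarrow> real ^ 'n"
  assumes h: "\<And>t. t \<ge> 0 \<Longrightarrow> h integrable_on {0..t}" "\<And>t. \<bar>h t\<bar> \<le> 1"
    and hist: "hist \<phi> absolutely_integrable_on UNIV"
  shows "\<exists>u. delay_sol h \<phi> x u"
proof -
  define \<kappa> where "\<kappa> = growth"
  have kap: "\<kappa> > 0" "(KA + KB) / \<kappa> \<le> 1/2" using growth_pos growth_ge by (auto simp: \<kappa>_def)
  \<comment> \<open>The forcing: initial value, relay and initial history. It grows at most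
    linearly, so the weighted unknown stays bounded.\<close>
  define D where "D t = x + integral {0..t} h *\<^sub>R k + integral {0..t} (hist \<phi>)" for t
  have hk: "((\<lambda>r. h r *\<^sub>R k) has_integral (integral {0..t} h *\<^sub>R k)) {0..t}" if "t \<ge> 0" for t
    using has_integral_scaleR_left[OF integrable_integral[OF h(1)[OF that]]] .
  have hist_int: "hist \<phi> integrable_on {0..t}" "(\<lambda>r. norm (hist \<phi> r)) integrable_on {0..t}" for t
    using absolutely_integrable_on_subinterval[OF hist, of 0 t] by (auto simp: absolutely_integrable_on_def)
  define Q where "Q = integral UNIV (\<lambda>r. norm (hist \<phi> r))"
  have D_cont: "continuous_on {0..} D"
    unfolding D_def using h hist_int
    by (intro continuous_on_atLeastI continuous_intros indefinite_integral_continuous_1) auto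
  have D_bound: "norm (D t) \<le> norm x + Q + t * norm k" if t: "t \<ge> 0" for t
  proof -
    have "norm (integral {0..t} (hist \<phi>)) \<le> integral {0..t} (\<lambda>r. norm (hist \<phi> r))"
      by (rule integral_norm_bound_integral) (use hist_int in auto)
    also have "\<dots> \<le> Q" unfolding Q_def
      by (rule integral_subset_le) (use hist hist_int in \<open>auto simp: absolutely_integrable_on_def\<close>)
    finally have 1: "norm (integral {0..t} (hist \<phi>)) \<le> Q" .
    have "norm (integral {0..t} h) \<le> integral {0..t} (\<lambda>r. 1)"
      by (rule integral_norm_bound_integral) (use h t in auto)
    then have "\<bar>integral {0..t} h\<bar> \<le> t" using t by simp
    then have "norm (integral {0..t} h *\<^sub>R k) \<le> t * norm k" by (simp add: mult_right_mono)
    then show ?thesis unfolding D_def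
      using 1 norm_triangle_ineq[of "x + integral {0..t} h *\<^sub>R k" "integral {0..t} (hist \<phi>)"]
        norm_triangle_ineq[of x "integral {0..t} h *\<^sub>R k"] by linarith
  qed
  have Q0: "Q \<ge> 0" unfolding Q_def by (rule integral_nonneg) (use hist in \<open>auto simp: absolutely_integrable_on_def\<close>)
  define J where "J v t = integral {0..t} (\<lambda>r. exp (\<kappa> * r) *\<^sub>R apply_bcontfun v r)" for v :: "real \<Rightarrow>\<^sub>C (real ^ 'n)" and t
  have Jint: "(\<lambda>r. exp (\<kappa> * r) *\<^sub>R apply_bcontfun v r) integrable_on {0..t}" for v :: "real \<Rightarrow>\<^sub>C (real ^ 'n)" and t
    by (intro integrable_continuous_interval continuous_intros) auto
  have J_cont: "continuous_on {0..} (J v)" for v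
    unfolding J_def by (intro continuous_on_atLeastI indefinite_integral_continuous_1 Jint)
  have J_bound: "norm (J v t) \<le> norm v * (exp (\<kappa> * t) / \<kappa>)" if t: "t \<ge> 0" for v t
  proof -
    have "norm (J v t) \<le> integral {0..t} (\<lambda>r. norm v * exp (\<kappa> * r))"
      unfolding J_def
    proof (intro integral_norm_bound_integral Jint)
      show "(\<lambda>r. norm v * exp (\<kappa> * r)) integrable_on {0..t}"
        by (intro integrable_continuous_interval continuous_intros)
      show "norm (exp (\<kappa> * r) *\<^sub>R apply_bcontfun v r) \<le> norm v * exp (\<kappa> * r)" for r
        using norm_bounded[of v r] by (simp add: mult.commute mult_right_mono)
    qed
    also have "\<dots> = norm v * ((exp (\<kappa> * t) - 1) / \<kappa>)"
      by (rule integral_unique[OF has_integral_mult_right[OF exp_has_integral[OF kap(1) t]]])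
    also have "\<dots> \<le> norm v * (exp (\<kappa> * t) / \<kappa>)" using kap by (intro mult_left_mono divide_right_mono) auto
    finally show ?thesis .
  qed
  have J_diff: "J v t - J w t = J (v - w) t" for v w t
    unfolding J_def integral_diff[OF Jint Jint, symmetric] by (simp add: scaleR_diff_right)
  \<comment> \<open>\<open>J v\<close> is the primitive of the unscaled unknown. The shifted
    argument is cut at 0 because the earlier values are accounted for by \<open>hist \<phi>\<close>
    in \<open>D\<close>.\<close>
  define L where "L v t = A *v J v (max (t - 2 * T) 0) - B *v J v t" for v t
  have L_diff: "L v t - L w t = L (v - w) t" for v w t
    by (simp add: L_def J_diff[symmetric] matrix_vector_mult_diff_distrib)
  have L_bound: "norm (L v t) \<le> norm v / 2 * exp (\<kappa> * t)" if t: "t \<ge> 0" for v t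
  proof -
    have "norm (L v t) \<le> norm (A *v J v (max (t - 2 * T) 0)) + norm (B *v J v t)"
      unfolding L_def by (rule norm_triangle_ineq4)
    also have "\<dots> \<le> KA * norm (J v (max (t - 2 * T) 0)) + KB * norm (J v t)" by (intro add_mono norm_A norm_B)
    also have "\<dots> \<le> KA * (norm v * (exp (\<kappa> * t) / \<kappa>)) + KB * (norm v * (exp (\<kappa> * t) / \<kappa>))"
    proof (intro add_mono mult_left_mono J_bound t K_nonneg)
      have "norm (J v (max (t - 2 * T) 0)) \<le> norm v * (exp (\<kappa> * max (t - 2 * T) 0) / \<kappa>)" by (intro J_bound) auto
      also have "\<dots> \<le> norm v * (exp (\<kappa> * t) / \<kappa>)"
        using t T_pos kap by (intro mult_left_mono divide_right_mono) auto
      finally show "norm (J v (max (t - 2 * T) 0)) \<le> norm v * (exp (\<kappa> * t) / \<kappa>)" .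
    qed
    also have "\<dots> = (KA + KB) / \<kappa> * (norm v * exp (\<kappa> * t))" by (simp add: add_divide_distrib algebra_simps)
    also have "\<dots> \<le> 1/2 * (norm v * exp (\<kappa> * t))" using kap by (intro mult_right_mono) auto
    finally show ?thesis by simp
  qed
  have L_cont: "continuous_on {0..} (L v)" for v
    unfolding L_def
    by (intro continuous_intros continuous_on_compose2[OF J_cont] J_cont
        bounded_linear.continuous_on[OF matrix_vector_mul_bounded_linear]) auto
  \<comment> \<open>Elements of the type of bounded continuous functions live on the whole line;
    \<open>max t 0\<close> extends them as constants to the negative axis.\<close>
  define F where "F v t = exp (- (\<kappa> * max t 0)) *\<^sub>R (D (max t 0) + L v (max t 0))" for v t
  have F_bcont: "F v \<in> bcontfun" for v
  proof (rule bcontfun_normI)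
    show "continuous_on UNIV (F v)" unfolding F_def
      by (intro continuous_intros continuous_on_compose2[OF D_cont] continuous_on_compose2[OF L_cont]) auto
    fix t :: real
    let ?t = "max t 0"
    have "norm (D ?t + L v ?t) \<le> (norm x + Q + ?t * norm k) + norm v / 2 * exp (\<kappa> * ?t)"
      using norm_triangle_ineq[of "D ?t" "L v ?t"] D_bound[of ?t] L_bound[of ?t v] by simp
    then have "norm (F v t) \<le> exp (- (\<kappa> * ?t)) * ((norm x + Q + ?t * norm k) + norm v / 2 * exp (\<kappa> * ?t))"
      unfolding F_def by (simp add: mult_left_mono)
    also have "\<dots> = exp (- (\<kappa> * ?t)) * (norm x + Q) + (?t * exp (- (\<kappa> * ?t))) * norm k + norm v / 2"
      by (simp add: algebra_simps exp_minus divide_simps)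
    also have "\<dots> \<le> 1 * (norm x + Q) + 1 / \<kappa> * norm k + norm v / 2"
    proof (intro add_mono mult_right_mono)
      show "exp (- (\<kappa> * ?t)) \<le> 1" using kap by simp
      have "\<kappa> * ?t \<le> exp (\<kappa> * ?t)" using exp_ge_add_one_self[of "\<kappa> * ?t"] by linarith
      then show "?t * exp (- (\<kappa> * ?t)) \<le> 1 / \<kappa>" using kap by (simp add: exp_minus field_simps)
    qed (use Q0 in auto)
    finally show "norm (F v t) \<le> 1 * (norm x + Q) + 1 / \<kappa> * norm k + norm v / 2" .
  qed
  have "\<exists>!v. Bcontfun (F v) = v"
  proof (rule banach_fix_type[of "1/2"])
    show "\<forall>v w. dist (Bcontfun (F v)) (Bcontfun (F w)) \<le> 1 / 2 * dist v w"
    proof (intro allI dist_bound)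
      fix v w :: "real \<Rightarrow>\<^sub>C (real ^ 'n)" and t :: real
      let ?t = "max t 0"
      have "dist (F v t) (F w t) = exp (- (\<kappa> * ?t)) * norm (L (v - w) ?t)"
      proof -
        have "F v t - F w t = exp (- (\<kappa> * ?t)) *\<^sub>R (L v ?t - L w ?t)"
          unfolding F_def by (simp only: scaleR_diff_right[symmetric] add_diff_cancel_left)
        then show ?thesis by (simp only: dist_norm L_diff norm_scaleR abs_exp_cancel)
      qed
      also have "\<dots> \<le> exp (- (\<kappa> * ?t)) * (norm (v - w) / 2 * exp (\<kappa> * ?t))"
        by (intro mult_left_mono L_bound) auto
      also have "\<dots> = 1/2 * dist v w" by (simp add: exp_minus dist_norm)
      finally show "dist (apply_bcontfun (Bcontfun (F v)) t) (apply_bcontfun (Bcontfun (F w)) t) \<le> 1/2 * dist v w"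
        by (simp add: Bcontfun_inverse F_bcont)
    qed
  qed auto
  then obtain v where "Bcontfun (F v) = v" by blast
  then have v: "apply_bcontfun v t = F v t" for t
    by (metis Bcontfun_inverse F_bcont)
  define u where "u t = (if t < 0 then \<phi> t else exp (\<kappa> * t) *\<^sub>R apply_bcontfun v t)" for t
  have u: "u t = D t + L v t" if "t \<ge> 0" for t
    using that by (simp add: u_def v F_def exp_minus max_absorb1)
  have "delay_sol h \<phi> x u"
    unfolding delay_sol_def
  proof (intro conjI allI impI)
    show "continuous_on {0..} u"
      by (rule continuous_on_eq[of _ "\<lambda>t. D t + L v t"]) (auto intro!: continuous_intros D_cont L_cont simp: u)
    show "u 0 = x" using T_pos by (simp add: u D_def L_def J_def)
    fix t :: real assume t: "t \<ge> 0"
    have uJ: "(u has_integral J v t) {0..t}" if "t \<ge> 0" for t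
    proof -
      have "((\<lambda>r. exp (\<kappa> * r) *\<^sub>R apply_bcontfun v r) has_integral J v t) {0..t}"
        unfolding J_def by (rule integrable_integral[OF Jint])
      then show ?thesis by (rule has_integral_eq[rotated]) (auto simp: u_def)
    qed
    have Bu: "((\<lambda>r. B *v u r) has_integral (B *v J v t)) {0..t}"
      using has_integral_linear[OF uJ[OF t] matrix_vector_mul_bounded_linear[of B]] by (simp add: o_def)
    have late: "((\<lambda>r. if r \<in> {2 * T..t} then A *v u (r - 2 * T) else 0) has_integral (A *v J v (max (t - 2 * T) 0))) {0..t}"
    proof (cases "t \<ge> 2 * T")
      case True
      have "((\<lambda>r. A *v u r) has_integral (A *v J v (t - 2 * T))) {0..t - 2 * T}"
        using has_integral_linear[OF uJ[of "t - 2 * T"] matrix_vector_mul_bounded_linear[of A]] True by (simp add: o_def)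
      from has_integral_shift_real_ivl[OF this, of "- (2 * T)"]
      have "((\<lambda>r. A *v u (r - 2 * T)) has_integral (A *v J v (t - 2 * T))) {2 * T..t}" by simp
      then show ?thesis using True T_pos by (subst has_integral_restrict) auto
    next
      case False
      then show ?thesis by (simp add: J_def)
    qed
    \<comment> \<open>The delayed term is split at \<open>2 * T\<close>; at \<open>r = 0\<close> the
      two sides may differ, which is harmless.\<close>
    have Au: "((\<lambda>r. A *v u (r - 2 * T)) has_integral (integral {0..t} (hist \<phi>) + A *v J v (max (t - 2 * T) 0))) {0..t}"
    proof (rule has_integral_spike_finite[of "{0}"])
      show "((\<lambda>r. hist \<phi> r + (if r \<in> {2 * T..t} then A *v u (r - 2 * T) else 0)) has_integral
          (integral {0..t} (hist \<phi>) + A *v J v (max (t - 2 * T) 0))) {0..t}"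
        using hist_int late by (intro has_integral_add integrable_integral)
    qed (auto simp: hist_def u_def)
    have "((\<lambda>r. h r *\<^sub>R k - B *v u r + A *v u (r - 2 * T)) has_integral
       (integral {0..t} h *\<^sub>R k - B *v J v t + (integral {0..t} (hist \<phi>) + A *v J v (max (t - 2 * T) 0)))) {0..t}"
      by (intro has_integral_add has_integral_diff hk Bu Au t)
    moreover have "integral {0..t} h *\<^sub>R k - B *v J v t + (integral {0..t} (hist \<phi>) + A *v J v (max (t - 2 * T) 0)) = u t - x"
      using t by (simp add: u D_def L_def)
    ultimately show "(rhs h u has_integral (u t - x)) {0..t}" by (simp add: rhs_def[abs_def])
  qed (auto simp: u_def)
  then show ?thesis by blast
qed

end

section \<open>Weak derivatives\<close>

lemma Lp_set_integrable:
  assumes "f \<in> Lp p a b" "p \<ge> 1" "a \<le> b"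
  shows "set_integrable lborel {a<..<b} f"
proof -
  have "f absolutely_integrable_on {a<..<b}"
    by (rule set_integrable_subset[OF Lp_abs_integral(1)[OF assms, of 1]]) auto
  then have "integrable (completion lborel) (cut a b f)"
    by (simp add: set_integrable_def cut_def[abs_def])
  then show ?thesis
    using assms(1) by (simp add: integrable_completion Lp_iff set_integrable_def cut_def[abs_def])
qed

lemma test_function_outside:
  fixes \<psi> :: "real \<Rightarrow> real"
  assumes "\<And>t. (\<psi> has_real_derivative \<psi>' t) (at t)" "\<And>t. t \<notin> {c..d} \<Longrightarrow> \<psi> t = 0" "t \<notin> {c..d}"
  shows "\<psi>' t = 0"
proof (rule DERIV_unique[OF assms(1)])
  have "((\<lambda>_. 0) has_real_derivative 0) (at t)" by simp
  then show "(\<psi> has_real_derivative 0) (at t)"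
    by (rule has_field_derivative_transform_within_open[of _ _ _ "- {c..d}"])
       (use assms in \<open>auto intro!: open_Compl\<close>)
qed

lemma set_integral_compact_support:
  fixes g :: "real \<Rightarrow> real"
  assumes "a < c" "d < b" "\<And>t. t \<notin> {c..d} \<Longrightarrow> g t = 0" "continuous_on {c..d} g"
  shows "set_integrable lborel {a<..<b} g" "(LBINT t:{a<..<b}. g t) = integral {c..d} g"
proof -
  have eq: "(\<lambda>t. indicator {a<..<b} t *\<^sub>R g t) = (\<lambda>t. indicator {c..d} t *\<^sub>R g t)"
    using assms by (auto simp: fun_eq_iff indicator_def)
  have s: "set_integrable lborel {c..d} g" by (rule borel_integrable_atLeastAtMost'[OF assms(4)])
  then show "set_integrable lborel {a<..<b} g" unfolding set_integrable_def eq .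
  have "(LBINT t:{a<..<b}. g t) = (LBINT t:{c..d}. g t)" unfolding set_lebesgue_integral_def eq ..
  also have "\<dots> = integral {c..d} g" by (rule set_borel_integral_eq_integral(2)[OF s])
  finally show "(LBINT t:{a<..<b}. g t) = integral {c..d} g" .
qed

text \<open>Fubini on the triangle \<open>r < t\<close>.\<close>

lemma weak_deriv_integral:
  fixes f g :: "real \<Rightarrow> real"
  assumes g: "set_integrable lborel {0<..<b} g" and f: "\<And>t. t \<in> {0<..<b} \<Longrightarrow> f t = f0 + (LBINT r:{0<..<t}. g r)"
    and b: "b > 0"
  shows "weak_deriv 0 b f g"
  unfolding weak_deriv_def
proof (intro allI impI)
  fix \<psi> \<psi>' :: "real \<Rightarrow> real"
  assume *: "(\<forall>t. (\<psi> has_real_derivative \<psi>' t) (at t)) \<and> continuous_on UNIV \<psi>' \<and>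
      (\<exists>c d. 0 < c \<and> d < b \<and> (\<forall>t. t \<notin> {c..d} \<longrightarrow> \<psi> t = 0))"
  then obtain c d where cd: "0 < c" "d < b" "\<And>t. t \<notin> {c..d} \<Longrightarrow> \<psi> t = 0" by blast
  have der: "\<And>t. (\<psi> has_real_derivative \<psi>' t) (at t)" and cont: "continuous_on UNIV \<psi>'" using * by auto
  have \<psi>'0: "\<And>t. t \<notin> {c..d} \<Longrightarrow> \<psi>' t = 0" using test_function_outside[OF der cd(3)] .
  have contS: "continuous_on S \<psi>'" for S by (rule continuous_on_subset[OF cont]) simp
  have [measurable]: "\<psi>' \<in> borel_measurable borel" using cont by (rule borel_measurable_continuous_onI)
  define G where "G r = indicator {0<..<b} r * g r" for r
  define Y where "Y t = indicator {0<..<b} t * \<psi>' t" for t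
  have G: "integrable lborel G" using g by (simp add: G_def[abs_def] set_integrable_def)
  then have [measurable]: "G \<in> borel_measurable borel" by (auto dest: borel_measurable_integrable)
  have [measurable]: "Y \<in> borel_measurable borel" unfolding Y_def by measurable
  have Yi: "set_integrable lborel {0<..<b} \<psi>'"
    by (rule set_integral_compact_support(1)[OF cd(1,2)]) (use \<psi>'0 contS in auto)
  then have Y: "integrable lborel Y" by (simp add: Y_def[abs_def] set_integrable_def)
  \<comment> \<open>The inner integral over \<open>t > r\<close>. The boundary term at
    \<open>b\<close> vanishes with the test function.\<close>
  have FTC: "(LBINT t. Y t * indicator {r<..} t) = - \<psi> r" if r: "0 < r" "r < b" for r
  proof -
    have "(LBINT t. Y t * indicator {r<..} t) = (LBINT t. indicator {r..b} t * \<psi>' t)"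
    proof (rule integral_cong_AE)
      have "AE t in lborel. t \<noteq> r" "AE t in lborel. t \<noteq> b" by (rule AE_lborel_singleton)+
      then show "AE t in lborel. Y t * indicator {r<..} t = indicator {r..b} t * \<psi>' t"
        by eventually_elim (use r in \<open>auto simp: Y_def indicator_def\<close>)
    qed auto
    also have "\<dots> = integral {r..b} \<psi>'"
      using set_borel_integral_eq_integral(2)[OF borel_integrable_atLeastAtMost'[OF contS]]
      by (simp add: set_lebesgue_integral_def)
    also have "\<dots> = \<psi> b - \<psi> r"
      using der r by (intro integral_unique fundamental_theorem_of_calculus)
        (auto simp flip: has_real_derivative_iff_has_vector_derivative intro: has_field_derivative_at_within)
    also have "\<psi> b = 0" using cd by auto
    finally show ?thesis by simp
  qed
  define F where "F = (\<lambda>(r, t). G r * (Y t * indicator {r<..} t))"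
  have [measurable]: "F \<in> borel_measurable (lborel \<Otimes>\<^sub>M lborel)"
  proof -
    have "F = (\<lambda>(r, t). G r * (Y t * (if r < t then 1 else 0)))" by (auto simp: F_def fun_eq_iff)
    then show ?thesis by simp
  qed
  have F: "integrable (lborel \<Otimes>\<^sub>M lborel) F"
  proof (rule lborel_pair.Fubini_integrable)
    define C where "C = (LBINT t. norm (Y t))"
    have le: "(LBINT t. norm (F (r, t))) \<le> norm (G r) * C" for r
    proof -
      have "(LBINT t. norm (F (r, t))) \<le> (LBINT t. norm (G r) * norm (Y t))"
        using Y by (intro integral_mono_AE' integrable_mult_right integrable_norm) (auto simp: F_def norm_mult abs_mult indicator_def)
      then show ?thesis using Y by (simp add: C_def)
    qed
    show "integrable lborel (\<lambda>r. LBINT t. norm (F (r, t)))"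
    proof (rule Bochner_Integration.integrable_bound)
      show "integrable lborel (\<lambda>r. norm (G r) * C)" using G by auto
      show "AE r in lborel. norm (LBINT t. norm (F (r, t))) \<le> norm (norm (G r) * C)"
        using le by (auto intro!: AE_I2 simp: C_def)
    qed measurable
    show "AE r in lborel. integrable lborel (\<lambda>t. F (r, t))"
    proof (rule AE_I2)
      fix r
      show "integrable lborel (\<lambda>t. F (r, t))"
        by (rule Bochner_Integration.integrable_bound[of _ "\<lambda>t. G r * Y t"]) (use Y in \<open>auto simp: F_def indicator_def\<close>)
    qed
  qed measurable
  have "(LBINT t. LBINT r. F (r, t)) = (LBINT r. LBINT t. F (r, t))"
    using lborel_pair.Fubini_integral[of "\<lambda>r t. F (r, t)"] F by simp
  also have "(LBINT r. LBINT t. F (r, t)) = (LBINT r. - (indicator {0<..<b} r * (g r * \<psi> r)))"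
  proof (intro Bochner_Integration.integral_cong refl)
    fix r
    show "(LBINT t. F (r, t)) = - (indicator {0<..<b} r * (g r * \<psi> r))"
      using FTC[of r] by (cases "r \<in> {0<..<b}") (auto simp: F_def G_def)
  qed
  also have "(LBINT t. LBINT r. F (r, t)) = (LBINT t. indicator {0<..<b} t * (f t * \<psi>' t) - f0 * Y t)"
  proof (intro Bochner_Integration.integral_cong refl)
    fix t
    show "(LBINT r. F (r, t)) = indicator {0<..<b} t * (f t * \<psi>' t) - f0 * Y t"
    proof (cases "t \<in> {0<..<b}")
      case True
      have "(LBINT r. F (r, t)) = (LBINT r. (indicator {0<..<t} r * g r) * \<psi>' t)"
        using True by (intro Bochner_Integration.integral_cong refl) (auto simp: F_def G_def Y_def indicator_def)
      also have "\<dots> = (LBINT r:{0<..<t}. g r) * \<psi>' t"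
        by (simp add: set_lebesgue_integral_def)
      finally show ?thesis using True by (simp add: f Y_def algebra_simps)
    qed (simp add: F_def Y_def)
  qed
  also have "\<dots> = (LBINT t:{0<..<b}. f t * \<psi>' t) - f0 * (LBINT t. Y t)"
  proof -
    have "integrable lborel (\<lambda>t. LBINT r. F (r, t))"
      using lborel_pair.integrable_snd[of "\<lambda>r t. F (r, t)"] F by simp
    then have "integrable lborel (\<lambda>t. (LBINT r. F (r, t)) + f0 * Y t)" using Y by auto
    moreover have "(LBINT r. F (r, t)) + f0 * Y t = indicator {0<..<b} t * (f t * \<psi>' t)" for t
    proof (cases "t \<in> {0<..<b}")
      case True
      have "(LBINT r. F (r, t)) = (LBINT r. (indicator {0<..<t} r * g r) * \<psi>' t)"
        using True by (intro Bochner_Integration.integral_cong refl) (auto simp: F_def G_def Y_def indicator_def)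
      also have "\<dots> = (LBINT r:{0<..<t}. g r) * \<psi>' t"
        by (simp add: set_lebesgue_integral_def)
      finally show ?thesis using True by (simp add: f Y_def algebra_simps)
    qed (simp add: F_def Y_def)
    ultimately have "integrable lborel (\<lambda>t. indicator {0<..<b} t * (f t * \<psi>' t))" by simp
    then show ?thesis using Y by (simp add: set_lebesgue_integral_def)
  qed
  also have "(LBINT t. Y t) = 0"
  proof -
    have "(LBINT t. Y t) = (LBINT t:{0<..<b}. \<psi>' t)" by (simp add: Y_def set_lebesgue_integral_def)
    also have "\<dots> = integral {c..d} \<psi>'"
      by (rule set_integral_compact_support(2)[OF cd(1,2)]) (use \<psi>'0 contS in auto)
    also have "\<dots> = 0"
    proof (cases "c \<le> d")
      case True
      define e where "e = min (c / 2) 1"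
      define e' where "e' = d + 1"
      have e: "e < c" "e' > d" using cd by (auto simp: e_def e'_def min_def)
      have "integral {c..d} \<psi>' = integral {e..e'} \<psi>'"
        using e \<psi>'0 by (intro integral_spike_set) (auto intro!: empty_imp_negligible)
      also have "\<dots> = \<psi> e' - \<psi> e" using der e True
        by (intro integral_unique fundamental_theorem_of_calculus)
          (auto simp flip: has_real_derivative_iff_has_vector_derivative intro: has_field_derivative_at_within)
      also have "\<dots> = 0" using cd(3)[of e] cd(3)[of e'] e by simp
      finally show ?thesis .
    qed simp
    finally show ?thesis .
  qed
  finally show "(LBINT t:{0<..<b}. f t * \<psi>' t) = - (LBINT t:{0<..<b}. g t * \<psi> t)"
    by (simp add: set_lebesgue_integral_def)
qed

text \<open>Testing against \<open>\<psi>' = \<rho> (F - c)\<close> with a bump \<open>\<rho>\<close> and the \<open>\<rho>\<close>-mean \<open>c\<close> of \<open>F\<close>.\<close>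

lemma du_Bois_Reymond:
  fixes F :: "real \<Rightarrow> real"
  assumes F: "continuous_on {0<..<b} F" and wd: "weak_deriv 0 b F (\<lambda>_. 0)"
    and t: "0 < t1" "t1 < t2" "t2 < b"
  shows "F t1 = F t2"
proof -
  define a' where "a' = t1 / 2"
  define b' where "b' = (t2 + b) / 2"
  have ab: "0 < a'" "a' < t1" "t2 < b'" "b' < b" using t by (auto simp: a'_def b'_def)
  \<comment> \<open>Positive inside and zero at both ends, so that \<open>\<psi>'\<close> remains
    continuous when it is extended by zero.\<close>
  define \<rho> where "\<rho> t = (t - a') * (b' - t)" for t
  have Fc: "continuous_on {a'..b'} F" using ab t by (intro continuous_on_subset[OF F]) auto
  have \<rho>c: "continuous_on S \<rho>" for S unfolding \<rho>_def by (intro continuous_intros)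
  have \<rho>0: "\<rho> t \<ge> 0" if "t \<in> {a'..b'}" for t using that by (auto simp: \<rho>_def)
  define R where "R = integral {a'..b'} \<rho>"
  have R: "R \<noteq> 0"
  proof -
    have "\<not> (\<forall>x\<in>{a'..b'}. \<rho> x = 0)" using ab t by (auto simp: \<rho>_def intro!: bexI[of _ t1])
    then show ?thesis unfolding R_def using integral_eq_0_iff[OF \<rho>c _ \<rho>0, of a' b'] ab t by auto
  qed
  define c where "c = integral {a'..b'} (\<lambda>t. \<rho> t * F t) / R"
  define \<psi>' where "\<psi>' t = (if t \<in> {a'..b'} then \<rho> t * (F t - c) else 0)" for t
  have \<psi>'c: "continuous_on UNIV \<psi>'"
  proof -
    have "continuous_on ({a'..b'} \<union> ({..a'} \<union> {b'..})) \<psi>'"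
    proof (intro continuous_on_closed_Un)
      show "continuous_on {a'..b'} \<psi>'"
        by (rule continuous_on_eq[of _ "\<lambda>t. \<rho> t * (F t - c)"]) (auto intro!: continuous_intros Fc \<rho>c simp: \<psi>'_def)
      show "continuous_on {..a'} \<psi>'" "continuous_on {b'..} \<psi>'"
        by (rule continuous_on_eq[of _ "\<lambda>_. 0"]; auto simp: \<psi>'_def \<rho>_def)+
    qed auto
    moreover have "{a'..b'} \<union> ({..a'} \<union> {b'..}) = UNIV" by auto
    ultimately show ?thesis by simp
  qed
  have \<psi>'cS: "continuous_on S \<psi>'" for S by (rule continuous_on_subset[OF \<psi>'c]) simp
  have "integral {a'..b'} \<psi>' = integral {a'..b'} (\<lambda>t. \<rho> t * F t - c * \<rho> t)"
    by (intro integral_cong) (auto simp: \<psi>'_def algebra_simps)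
  also have "\<dots> = integral {a'..b'} (\<lambda>t. \<rho> t * F t) - c * R"
    unfolding R_def by (subst integral_diff) (auto intro!: integrable_continuous_interval continuous_intros Fc \<rho>c)
  also have "\<dots> = 0" using R by (simp add: c_def)
  \<comment> \<open>The vanishing mean is what makes the primitive \<psi> zero beyond
    \<open>b'\<close>, hence an admissible test function.\<close>
  finally have int0: "integral {a'..b'} \<psi>' = 0" .
  define \<psi> where "\<psi> t = integral {0..t} \<psi>'" for t
  have \<psi>low: "\<psi> t = 0" if "t < a'" for t
    unfolding \<psi>_def using that by (intro integral_unique has_integral_is_0) (auto simp: \<psi>'_def)
  have \<psi>high: "\<psi> t = 0" if "t > b'" for t
  proof -
    have "integral {0..t} \<psi>' = integral {a'..b'} \<psi>'"
      using that ab t by (intro integral_spike_set) (auto intro!: empty_imp_negligible simp: \<psi>'_def)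
    then show ?thesis using int0 by (simp add: \<psi>_def)
  qed
  have der: "(\<psi> has_real_derivative \<psi>' t) (at t)" for t
  proof (cases "t < a'")
    case True
    have "((\<lambda>_. 0) has_real_derivative 0) (at t)" by simp
    then have "(\<psi> has_real_derivative 0) (at t)"
      by (rule has_field_derivative_transform_within_open[of _ _ _ "{..<a'}"]) (use True \<psi>low in auto)
    then show ?thesis using True by (simp add: \<psi>'_def)
  next
    case False
    then have t0: "t > 0" using ab by auto
    have "((\<lambda>x. integral {0..x} \<psi>') has_real_derivative \<psi>' t) (at t within {0..t + 1})"
      using \<psi>'cS t0 by (intro integral_has_real_derivative) auto
    moreover have "at t within {0..t + 1} = at t" using t0 by (intro at_within_interior) auto
    ultimately show ?thesis by (simp add: \<psi>_def[abs_def])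
  qed
  have supp: "\<psi> t = 0" if "t \<notin> {a'..b'}" for t
    using that \<psi>low[of t] \<psi>high[of t] by force
  have "(LBINT t:{0<..<b}. F t * \<psi>' t) = - (LBINT t:{0<..<b}. 0 * \<psi> t)"
    using wd der \<psi>'c ab supp unfolding weak_deriv_def by blast
  moreover have "(LBINT t:{0<..<b}. F t * \<psi>' t) = integral {a'..b'} (\<lambda>t. F t * \<psi>' t)"
    using ab by (intro set_integral_compact_support(2) continuous_on_mult Fc \<psi>'cS)
      (auto simp: \<psi>'_def)
  ultimately have "integral {a'..b'} (\<lambda>t. F t * \<psi>' t) = 0" by (simp add: set_lebesgue_integral_def)
  then have "integral {a'..b'} (\<lambda>t. F t * \<psi>' t - c * \<psi>' t) = 0"
    using int0 by (subst integral_diff)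
      (auto intro!: integrable_continuous_interval continuous_on_mult continuous_on_const Fc \<psi>'cS)
  \<comment> \<open>Subtracting \<open>c\<close> times the vanishing mean completes the square; the
    integrand is now nonnegative.\<close>
  also have "integral {a'..b'} (\<lambda>t. F t * \<psi>' t - c * \<psi>' t) = integral {a'..b'} (\<lambda>t. \<rho> t * (F t - c)\<^sup>2)"
    by (intro integral_cong) (auto simp: \<psi>'_def power2_eq_square algebra_simps)
  finally have "\<forall>t\<in>{a'..b'}. \<rho> t * (F t - c)\<^sup>2 = 0"
  proof (subst (asm) integral_eq_0_iff)
    show "continuous_on {a'..b'} (\<lambda>t. \<rho> t * (F t - c)\<^sup>2)" by (intro continuous_intros Fc \<rho>c)
  qed (use ab t \<rho>0 in auto)
  then have "\<rho> t1 * (F t1 - c)\<^sup>2 = 0" "\<rho> t2 * (F t2 - c)\<^sup>2 = 0" using ab t by auto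
  moreover have "\<rho> t1 \<noteq> 0" "\<rho> t2 \<noteq> 0" using ab t by (auto simp: \<rho>_def)
  ultimately show ?thesis by simp
qed

text \<open>\<open>f\<close> and the primitive of \<open>g\<close> differ by a continuous function
  with weak derivative zero. By \<open>du_Bois_Reymond\<close> it is constant on the open interval,
  and continuity at 0 from the right gives the constant.\<close>

lemma weak_deriv_imp_integral:
  fixes f g :: "real \<Rightarrow> real"
  assumes f: "continuous_on {0..} f" and g: "g \<in> Lp p 0 b" and wd: "weak_deriv 0 b f g"
    and p: "p \<ge> 1" and t: "0 \<le> t" "t < b"
  shows "(g has_integral (f t - f 0)) {0..t}"
proof -
  have b: "b > 0" using t by simp
  have si: "set_integrable lborel {0<..<b} g" using Lp_set_integrable[OF g p] b by simp
  have gi: "g integrable_on {0..t}" if "0 \<le> t" "t \<le> b" for t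
    using absolutely_integrable_on_subinterval[OF Lp_abs_integral(1)[OF g p _, of 1], of 0 t] that
    by (auto simp: absolutely_integrable_on_def)
  define G where "G t = integral {0..t} g" for t
  have G_eq: "G t = (LBINT r:{0<..<t}. g r)" if "0 < t" "t < b" for t
  proof -
    have "set_integrable lborel {0<..<t} g" using si by (rule set_integrable_subset) (use that in auto)
    then have "(LBINT r:{0<..<t}. g r) = integral {0<..<t} g" by (rule set_borel_integral_eq_integral(2))
    then show ?thesis by (simp add: G_def integral_open_interval_real)
  qed
  have Gc: "continuous_on {0..b} G" unfolding G_def
    using gi[of b] b by (intro indefinite_integral_continuous_1) auto
  have wdG: "weak_deriv 0 b G g"
    by (rule weak_deriv_integral[OF si _ b, of _ 0]) (auto simp: G_eq)
  define F where "F t = f t - G t" for t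
  have Fc: "continuous_on {0..b} F" unfolding F_def
    by (intro continuous_intros Gc continuous_on_subset[OF f]) auto
  have wdF: "weak_deriv 0 b F (\<lambda>_. 0)"
    unfolding weak_deriv_def
  proof (intro allI impI)
    fix \<psi> \<psi>' :: "real \<Rightarrow> real"
    assume *: "(\<forall>t. (\<psi> has_real_derivative \<psi>' t) (at t)) \<and> continuous_on UNIV \<psi>' \<and>
      (\<exists>c d. 0 < c \<and> d < b \<and> (\<forall>t. t \<notin> {c..d} \<longrightarrow> \<psi> t = 0))"
    then obtain c d where cd: "0 < c" "d < b" "\<And>t. t \<notin> {c..d} \<Longrightarrow> \<psi> t = 0" by blast
    have der: "\<And>t. (\<psi> has_real_derivative \<psi>' t) (at t)" and cont: "continuous_on UNIV \<psi>'" using * by auto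
    have \<psi>'0: "\<And>t. t \<notin> {c..d} \<Longrightarrow> \<psi>' t = 0" using test_function_outside[OF der cd(3)] .
    have "set_integrable lborel {0<..<b} (\<lambda>t. f t * \<psi>' t)" "set_integrable lborel {0<..<b} (\<lambda>t. G t * \<psi>' t)"
      using cd \<psi>'0
      by (auto intro!: set_integral_compact_support(1)[OF cd(1,2)] continuous_on_mult
          continuous_on_subset[OF cont] continuous_on_subset[OF f] continuous_on_subset[OF Gc])
    then have "(LBINT t:{0<..<b}. f t * \<psi>' t - G t * \<psi>' t) = (LBINT t:{0<..<b}. f t * \<psi>' t) - (LBINT t:{0<..<b}. G t * \<psi>' t)"
      by (rule set_integral_diff)
    also have "\<dots> = 0"
    proof -
      have "(LBINT t:{0<..<b}. f t * \<psi>' t) = - (LBINT t:{0<..<b}. g t * \<psi> t)"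
        using wd * unfolding weak_deriv_def by blast
      moreover have "(LBINT t:{0<..<b}. G t * \<psi>' t) = - (LBINT t:{0<..<b}. g t * \<psi> t)"
        using wdG * unfolding weak_deriv_def by blast
      ultimately show ?thesis by simp
    qed
    finally show "(LBINT t:{0<..<b}. F t * \<psi>' t) = - (LBINT t:{0<..<b}. 0 * \<psi> t)"
      by (simp add: F_def algebra_simps set_lebesgue_integral_def)
  qed
  have "F t = F 0"
  proof (cases "t = 0")
    case False
    then have t0: "t > 0" using t by simp
    have "(F \<longlongrightarrow> F 0) (at 0 within {0..b})" using Fc b by (auto simp: continuous_on_def)
    then have "(F \<longlongrightarrow> F 0) (at 0 within {0<..<t})"
      by (rule tendsto_within_subset) (use t in auto)
    moreover have "eventually (\<lambda>x. F x = F t) (at 0 within {0<..<t})"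
      unfolding eventually_at_filter
    proof (intro always_eventually allI impI)
      fix x assume "x \<in> {0<..<t}"
      then show "F x = F t"
        by (intro du_Bois_Reymond[OF continuous_on_subset[OF Fc] wdF _ _ t(2)]) auto
    qed
    ultimately have "((\<lambda>_. F t) \<longlongrightarrow> F 0) (at 0 within {0<..<t})"
      by (rule Lim_transform_eventually)
    moreover have "at 0 within {0<..<t} \<noteq> bot"
      using t0 by (simp add: at_within_eq_bot_iff islimpt_greaterThanLessThan1)
    ultimately show ?thesis by (simp add: tendsto_const_iff)
  qed simp
  then have "f t - f 0 = G t" by (simp add: F_def G_def)
  then show ?thesis using integrable_integral[OF gi[of t]] t by (simp add: G_def)
qed

section \<open>Solutions as solutions of an integral equation\<close>

lemma cut_shift: "cut a b (\<lambda>\<xi>. f (c + \<xi>)) = (\<lambda>t. cut (a + c) (b + c) f (c + 1 * t))"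
  by (auto simp: cut_def fun_eq_iff indicator_def)

lemma cut_shift_measurable:
  assumes [measurable]: "cut (a + c) (b + c) f \<in> borel_measurable borel"
  shows "cut a b (\<lambda>\<xi>. f (c + \<xi>)) \<in> borel_measurable borel"
  unfolding cut_shift by measurable

lemma pow_int_cut_shift:
  assumes [measurable]: "cut (a + c) (b + c) f \<in> borel_measurable borel"
  shows "pow_int p lborel (cut a b (\<lambda>\<xi>. f (c + \<xi>))) = pow_int p lborel (cut (a + c) (b + c) f)"
  unfolding cut_shift pow_int_def
  by (subst nn_integral_real_affine[of "\<lambda>t. ennreal (\<bar>cut (a + c) (b + c) f t\<bar> powr p)" 1 c]) auto

lemma Lp_shift: "f \<in> Lp p (a + c) (b + c) \<Longrightarrow> (\<lambda>\<xi>. f (c + \<xi>)) \<in> Lp p a b"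
  by (simp add: Lp_iff cut_shift_measurable pow_int_cut_shift)

lemma cut_subset: "a \<le> c \<Longrightarrow> d \<le> b \<Longrightarrow> cut c d f = (\<lambda>t. indicator {c<..<d} t * cut a b f t)"
  by (auto simp: cut_def fun_eq_iff indicator_def)

lemma cut_subset_measurable:
  assumes [measurable]: "cut a b f \<in> borel_measurable borel" and "a \<le> c" "d \<le> b"
  shows "cut c d f \<in> borel_measurable borel"
  unfolding cut_subset[OF assms(2,3), of f] by measurable

lemma pow_int_cut_mono: "a \<le> c \<Longrightarrow> d \<le> b \<Longrightarrow> pow_int p lborel (cut c d f) \<le> pow_int p lborel (cut a b f)"
  unfolding pow_int_def by (intro nn_integral_mono) (auto simp: cut_def indicator_def)

lemma Lp_subset: "f \<in> Lp p a b \<Longrightarrow> a \<le> c \<Longrightarrow> d \<le> b \<Longrightarrow> f \<in> Lp p c d"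
  using pow_int_cut_mono[of a c d b p f] by (auto simp: Lp_iff cut_subset_measurable intro: order_le_less_trans)

lemma Lp_cmult:
  assumes f: "f \<in> Lp p a b"
  shows "(\<lambda>x. c * f x) \<in> Lp p a b"
proof -
  have [measurable]: "cut a b f \<in> borel_measurable borel" and fin: "pow_int p lborel (cut a b f) < \<infinity>"
    using f by (auto simp: Lp_iff)
  have eq: "cut a b (\<lambda>x. c * f x) = (\<lambda>x. c * cut a b f x)" by (auto simp: cut_def fun_eq_iff)
  have "pow_int p lborel (\<lambda>x. c * cut a b f x) = (\<integral>\<^sup>+x. ennreal (\<bar>c\<bar> powr p) * ennreal (\<bar>cut a b f x\<bar> powr p) \<partial>lborel)"
    unfolding pow_int_def by (intro nn_integral_cong) (simp add: abs_mult powr_mult flip: ennreal_mult)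
  also have "\<dots> = ennreal (\<bar>c\<bar> powr p) * pow_int p lborel (cut a b f)"
    unfolding pow_int_def by (intro nn_integral_cmult) measurable
  finally show ?thesis using fin by (simp add: Lp_iff eq ennreal_mult_less_top)
qed

lemma Lp_sum:
  assumes "finite I" "\<And>i. i \<in> I \<Longrightarrow> f i \<in> Lp p a b" "p \<ge> 1"
  shows "(\<lambda>x. \<Sum>i\<in>I. f i x) \<in> Lp p a b"
  using assms(1,2)
proof (induction I rule: finite_induct)
  case empty
  then show ?case by (simp add: Lp_iff cut_def[abs_def] pow_int_def)
next
  case (insert i I)
  then show ?case using Lp_add(1)[OF assms(3), of "f i" a b "\<lambda>x. \<Sum>i\<in>I. f i x"] by simp
qed

lemma pow_int_cut_bounded:
  assumes "\<And>t. t \<in> {a<..<b} \<Longrightarrow> \<bar>f t\<bar> \<le> M" "a \<le> b" "p > 0"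
  shows "pow_int p lborel (cut a b f) \<le> ennreal (M powr p * (b - a))"
proof -
  have "pow_int p lborel (cut a b f) \<le> (\<integral>\<^sup>+t. ennreal (M powr p) * indicator {a<..<b} t \<partial>lborel)"
    unfolding pow_int_def using assms
    by (intro nn_integral_mono) (auto simp: cut_def indicator_def intro!: ennreal_leI powr_mono2)
  also have "\<dots> = ennreal (M powr p * (b - a))"
    using assms by (subst nn_integral_cmult_indicator) (auto simp flip: ennreal_mult)
  finally show ?thesis .
qed

lemma Lp_bounded:
  assumes "cut a b f \<in> borel_measurable borel" "\<And>t. t \<in> {a<..<b} \<Longrightarrow> \<bar>f t\<bar> \<le> M" "a \<le> b" "p > 0"
  shows "f \<in> Lp p a b"
  using assms pow_int_cut_bounded[of a b f M p] by (auto simp: Lp_iff order_le_less_trans)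

lemma cut_continuous_measurable: "continuous_on {a<..<b} f \<Longrightarrow> cut a b f \<in> borel_measurable borel"
  using borel_measurable_continuous_on_indicator[of "{a<..<b}" f] by (simp add: cut_def[abs_def])

lemma Lp_continuous:
  assumes f: "continuous_on {a..b} f" and "a \<le> b" "p > 0"
  shows "f \<in> Lp p a b"
proof -
  have "bounded (f ` {a..b})" by (intro compact_imp_bounded compact_continuous_image f) simp
  then obtain M where "\<And>t. t \<in> {a..b} \<Longrightarrow> \<bar>f t\<bar> \<le> M" unfolding bounded_real by blast
  moreover have "cut a b f \<in> borel_measurable borel"
    by (rule cut_continuous_measurable[OF continuous_on_subset[OF f]]) auto
  ultimately show ?thesis using assms by (intro Lp_bounded[of a b f M]) auto
qed

lemma cut_join_measurable:
  assumes [measurable]: "cut a c f \<in> borel_measurable borel" "cut c b f \<in> borel_measurable borel"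
  shows "cut a b f \<in> borel_measurable borel"
proof -
  have "cut a b f = (\<lambda>t. if t < c then indicator {a<..<b} t * cut a c f t
     else if t = c then indicator {a<..<b} t * f c else indicator {a<..<b} t * cut c b f t)"
    by (auto simp: cut_def fun_eq_iff indicator_def)
  also have "\<dots> \<in> borel_measurable borel" by measurable
  finally show ?thesis .
qed

lemma pow_int_cut_join:
  assumes [measurable]: "cut a c f \<in> borel_measurable borel" "cut c b f \<in> borel_measurable borel"
  shows "pow_int p lborel (cut a b f) \<le> pow_int p lborel (cut a c f) + pow_int p lborel (cut c b f)"
proof -
  have "AE t in lborel. t \<noteq> c" by (rule AE_lborel_singleton)
  then have "pow_int p lborel (cut a b f) \<le> (\<integral>\<^sup>+t. ennreal (\<bar>cut a c f t\<bar> powr p) + ennreal (\<bar>cut c b f t\<bar> powr p) \<partial>lborel)"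
    unfolding pow_int_def by (intro nn_integral_mono_AE) (auto elim!: eventually_mono simp: cut_def indicator_def)
  also have "\<dots> = pow_int p lborel (cut a c f) + pow_int p lborel (cut c b f)"
    unfolding pow_int_def by (intro nn_integral_add) auto
  finally show ?thesis .
qed

lemma Lp_join: "f \<in> Lp p a c \<Longrightarrow> f \<in> Lp p c b \<Longrightarrow> f \<in> Lp p a b"
  using order_le_less_trans[OF pow_int_cut_join[of a c f b p], of \<infinity>]
  by (auto simp: Lp_iff intro: cut_join_measurable[of a c f b])

lemma has_integral_vec_iff:
  fixes f :: "real \<Rightarrow> real ^ 'n"
  shows "(f has_integral y) S \<longleftrightarrow> (\<forall>i. ((\<lambda>x. f x $ i) has_integral (y $ i)) S)"
  by (subst has_integral_componentwise_iff) (auto simp: Basis_vec_def inner_axis)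

lemma absolutely_integrable_vecI:
  fixes f :: "real \<Rightarrow> real ^ 'n"
  shows "(\<And>i. (\<lambda>x. f x $ i) absolutely_integrable_on S) \<Longrightarrow> f absolutely_integrable_on S"
  by (rule absolutely_integrable_componentwise) (auto simp: Basis_vec_def inner_axis)

section \<open>Equivalence of weak solutions and solutions of the integral equation\<close>

context delay_equation
begin

lemma Lp_vec_integrable:
  fixes \<phi> :: "real \<Rightarrow> real ^ 'n"
  assumes "\<phi> \<in> vec_space (Lp p (-2 * T) 0)" "p \<ge> 1"
  shows "\<phi> absolutely_integrable_on {-2 * T..0}"
  using assms T_pos by (intro absolutely_integrable_vecI Lp_abs_integral(1)[of _ p _ _ 1]) (auto simp: vec_space_def)

lemma hist_integrable:
  fixes \<phi> :: "real \<Rightarrow> real ^ 'n"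
  assumes "\<phi> \<in> vec_space (Lp p (-2 * T) 0)" "p \<ge> 1"
  shows "hist \<phi> absolutely_integrable_on UNIV"
proof -
  have "(\<lambda>r. A *v \<phi> r) absolutely_integrable_on {-2 * T..0}"
    using absolutely_integrable_linear[OF Lp_vec_integrable[OF assms] matrix_vector_mul_bounded_linear[of A]] by (simp add: o_def)
  then have "(\<lambda>r. A *v \<phi> r) integrable_on {-2 * T..0}" "(\<lambda>r. norm (A *v \<phi> r)) integrable_on {-2 * T..0}"
    by (auto simp: absolutely_integrable_on_def)
  from this[THEN integrable_shift_real_ivl, of "- (2 * T)"]
  have "(\<lambda>r. A *v \<phi> (r - 2 * T)) absolutely_integrable_on {0..2 * T}"
    by (simp add: absolutely_integrable_on_def)
  then have "(\<lambda>r. A *v \<phi> (r - 2 * T)) absolutely_integrable_on {0<..<2 * T}"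
    by (rule set_integrable_subset) auto
  then show ?thesis
    unfolding hist_def[abs_def] by (subst absolutely_integrable_restrict_UNIV)
qed

lemma is_solution_imp_delay_sol:
  assumes sol: "is_solution T p k A B h \<phi> x u" and p: "p \<ge> 1"
  shows "delay_sol h \<phi> x u"
  unfolding delay_sol_def
proof (intro conjI allI impI)
  fix t :: real assume t: "t \<ge> 0"
  have c: "continuous_on {0..} u" "u 0 = x" using sol by (auto simp: is_solution_def)
  \<comment> \<open>The weak equation is taken on the longer interval \<open>(0, t + 1)\<close>,
    because \<open>weak_deriv_imp_integral\<close> requires \<open>t\<close> to lie strictly before
    the right end.\<close>
  have "0 < t + 1" using t by simp
  then have "\<exists>u'. u' \<in> vec_space (Lp p 0 (t + 1)) \<and> (\<forall>i. weak_deriv 0 (t + 1) (\<lambda>t. u t $ i) (\<lambda>t. u' t $ i)) \<and>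
    (AE r in lborel. 0 < r \<and> r < t + 1 \<longrightarrow> u' r = h r *\<^sub>R k - B *v u r + A *v u (r - 2 * T))"
    using sol unfolding is_solution_def by blast
  then obtain u' where u': "u' \<in> vec_space (Lp p 0 (t + 1))" "\<And>i. weak_deriv 0 (t + 1) (\<lambda>t. u t $ i) (\<lambda>t. u' t $ i)"
    "AE r in lborel. 0 < r \<and> r < t + 1 \<longrightarrow> u' r = h r *\<^sub>R k - B *v u r + A *v u (r - 2 * T)"
    by blast
  have "(u' has_integral (u t - x)) {0..t}"
    unfolding has_integral_vec_iff
  proof
    fix i
    have "((\<lambda>t. u' t $ i) has_integral (u t $ i - u 0 $ i)) {0..t}"
      by (rule weak_deriv_imp_integral[OF _ _ u'(2) p]) (use t u'(1) c in \<open>auto simp: vec_space_def intro!: continuous_intros\<close>)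
    then show "((\<lambda>t. u' t $ i) has_integral ((u t - x) $ i)) {0..t}" using c by simp
  qed
  moreover have "AE r in lborel. r \<noteq> (0::real)" by (rule AE_lborel_singleton)
  then have "AE r in lborel. r \<in> {0..t} \<longrightarrow> u' r = rhs h u r"
    using u'(3) by eventually_elim (auto simp: rhs_def)
  ultimately show "(rhs h u has_integral (u t - x)) {0..t}" using has_integral_AE by blast
qed (use sol in \<open>auto simp: is_solution_def\<close>)

lemma delay_sol_Lp:
  assumes sol: "delay_sol h \<phi> x u" and \<phi>: "\<phi> \<in> vec_space (Lp p (-2 * T) 0)" and p: "p \<ge> 1" and b: "b \<ge> 0"
  shows "u \<in> vec_space (Lp p (-2 * T) b)"
  unfolding vec_space_def
proof (intro CollectI allI)
  fix i
  have "cut (-2 * T) 0 (\<lambda>t. u t $ i) = cut (-2 * T) 0 (\<lambda>t. \<phi> t $ i)"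
    using delay_solD(1)[OF sol] by (intro cut_cong) auto
  then have "(\<lambda>t. u t $ i) \<in> Lp p (-2 * T) 0" using \<phi> by (simp add: vec_space_def Lp_iff)
  moreover have "(\<lambda>t. u t $ i) \<in> Lp p 0 b"
    using p b by (intro Lp_continuous continuous_intros continuous_on_subset[OF delay_solD(2)[OF sol]]) auto
  ultimately show "(\<lambda>t. u t $ i) \<in> Lp p (-2 * T) b" by (rule Lp_join)
qed

lemma rhs_Lp:
  assumes sol: "delay_sol h \<phi> x u" and \<phi>: "\<phi> \<in> vec_space (Lp p (-2 * T) 0)" and p: "p \<ge> 1" and b: "b \<ge> 0"
    and h: "h \<in> borel_measurable borel" "\<And>t. \<bar>h t\<bar> \<le> 1"
  shows "rhs h u \<in> vec_space (Lp p 0 b)"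
  unfolding vec_space_def
proof (intro CollectI allI)
  fix i
  note u = delay_sol_Lp[OF sol \<phi> p b]
  have 1: "(\<lambda>t. k $ i * h t) \<in> Lp p 0 b"
    using h p b by (intro Lp_cmult Lp_bounded[of _ _ _ 1]) (auto simp: cut_def[abs_def])
  have "(\<lambda>t. u t $ j) \<in> Lp p 0 b" for j
    by (rule Lp_subset[of _ p "-2 * T" b]) (use u T_pos in \<open>auto simp: vec_space_def\<close>)
  then have 2: "(\<lambda>t. \<Sum>j\<in>UNIV. - (B $ i $ j) * u t $ j) \<in> Lp p 0 b"
    using p by (intro Lp_sum Lp_cmult) auto
  have "(\<lambda>t. u t $ j) \<in> Lp p (0 + - 2 * T) (b + - 2 * T)" for j
    by (rule Lp_subset[of _ p "-2 * T" b]) (use u T_pos in \<open>auto simp: vec_space_def\<close>)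
  from Lp_shift[OF this] have "(\<lambda>t. u (- 2 * T + t) $ j) \<in> Lp p 0 b" for j .
  then have 3: "(\<lambda>t. \<Sum>j\<in>UNIV. A $ i $ j * u (- 2 * T + t) $ j) \<in> Lp p 0 b"
    using p by (intro Lp_sum Lp_cmult) auto
  have "(\<lambda>t. (k $ i * h t + (\<Sum>j\<in>UNIV. - (B $ i $ j) * u t $ j)) + (\<Sum>j\<in>UNIV. A $ i $ j * u (- 2 * T + t) $ j)) \<in> Lp p 0 b"
    by (intro Lp_add(1)[OF p] 1 2 3)
  moreover have "rhs h u t $ i = (k $ i * h t + (\<Sum>j\<in>UNIV. - (B $ i $ j) * u t $ j)) + (\<Sum>j\<in>UNIV. A $ i $ j * u (- 2 * T + t) $ j)" for t
    by (simp add: rhs_def matrix_vector_mult_def sum_negf mult.commute)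
  ultimately show "(\<lambda>t. rhs h u t $ i) \<in> Lp p 0 b" by simp
qed

text \<open>\<open>hsol\<close>, \<open>u_plus\<close> and \<open>u_minus\<close> choose among weak
  solutions, so nothing is known about them until some weak solution has been exhibited. This lemma
  turns the constructed solutions into weak ones.\<close>

lemma delay_sol_imp_is_solution:
  assumes sol: "delay_sol h \<phi> x u" and \<phi>: "\<phi> \<in> vec_space (Lp p (-2 * T) 0)" and p: "p \<ge> 1"
    and h: "h \<in> borel_measurable borel" "\<And>t. \<bar>h t\<bar> \<le> 1"
  shows "is_solution T p k A B h \<phi> x u"
  unfolding is_solution_def
proof (intro conjI allI impI)
  fix T1 :: real assume T1: "T1 > 0"
  note u = delay_sol_Lp[OF sol \<phi> p, of T1] and w = rhs_Lp[OF sol \<phi> p _ h, of T1]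
  show "u \<in> vec_space (Lp p (-2 * T) T1)" using u T1 by simp
  have wd: "weak_deriv 0 T1 (\<lambda>t. u t $ i) (\<lambda>t. rhs h u t $ i)" for i
  proof (rule weak_deriv_integral[OF _ _ T1, of _ _ "x $ i"])
    have wi: "(\<lambda>t. rhs h u t $ i) \<in> Lp p 0 T1" using w T1 by (simp add: vec_space_def)
    show si: "set_integrable lborel {0<..<T1} (\<lambda>t. rhs h u t $ i)"
      using T1 by (intro Lp_set_integrable[OF wi p]) simp
    fix t assume t: "t \<in> {0<..<T1}"
    have "((\<lambda>t. rhs h u t $ i) has_integral ((u t - x) $ i)) {0..t}"
      using delay_solD(4)[OF sol, of t] t unfolding has_integral_vec_iff by auto
    then have "integral {0<..<t} (\<lambda>t. rhs h u t $ i) = (u t - x) $ i"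
      by (simp only: integral_open_interval_real[symmetric] integral_unique)
    moreover have "set_integrable lborel {0<..<t} (\<lambda>t. rhs h u t $ i)"
      using si by (rule set_integrable_subset) (use t in auto)
    ultimately show "u t $ i = x $ i + (LBINT r:{0<..<t}. rhs h u r $ i)"
      using set_borel_integral_eq_integral(2) by fastforce
  qed
  then show "\<exists>u'. u' \<in> vec_space (Lp p 0 T1) \<and> (\<forall>i. weak_deriv 0 T1 (\<lambda>t. u t $ i) (\<lambda>t. u' t $ i)) \<and>
      (AE t in lborel. 0 < t \<and> t < T1 \<longrightarrow> u' t = h t *\<^sub>R k - B *v u t + A *v u (t - 2 * T))"
    using w T1 by (intro exI[of _ "rhs h u"]) (auto simp: rhs_def)
  have "(\<lambda>t. u t $ i) \<in> Lp p 0 T1" for i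
    by (rule Lp_subset[of _ p "-2 * T" T1]) (use u T1 T_pos in \<open>auto simp: vec_space_def\<close>)
  then show "u \<in> vec_space (W1p p 0 T1)"
    using wd w T1 by (auto simp: vec_space_def W1p_def)
qed (use delay_solD[OF sol] in auto)

end

section \<open>Hysteresis\<close>

lemma hysteresis_cases: "hysteresis \<alpha> \<beta> g t = 1 \<or> hysteresis \<alpha> \<beta> g t = -1"
  by (auto simp: hysteresis_def Let_def)

lemma hysteresis_empty:
  assumes "\<And>r. 0 < r \<Longrightarrow> r \<le> t \<Longrightarrow> g r \<noteq> \<alpha> \<and> g r \<noteq> \<beta>"
  shows "hysteresis \<alpha> \<beta> g t = (if g 0 < \<beta> then 1 else -1)"
proof -
  have "{t'. 0 < t' \<and> t' \<le> t \<and> g t' \<in> {\<alpha>, \<beta>}} = {}" using assms by auto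
  then show ?thesis unfolding hysteresis_def Let_def by (simp only: if_True simp_thms)
qed

lemma hysteresis_0: "hysteresis \<alpha> \<beta> g 0 = (if g 0 < \<beta> then 1 else -1)"
  by (rule hysteresis_empty) auto

lemma hysteresis_hit:
  assumes "0 < e" "e \<le> t" "g e = \<alpha> \<or> g e = \<beta>" "\<And>r. e < r \<Longrightarrow> r \<le> t \<Longrightarrow> g r \<noteq> \<alpha> \<and> g r \<noteq> \<beta>"
  shows "hysteresis \<alpha> \<beta> g t = (if g e = \<alpha> then 1 else -1)"
proof -
  let ?X = "{t'. 0 < t' \<and> t' \<le> t \<and> g t' \<in> {\<alpha>, \<beta>}}"
  have "(GREATEST t'. t' \<in> ?X) = e"
    by (rule Greatest_equality) (use assms in \<open>auto simp: not_less[symmetric]\<close>)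
  moreover have "?X \<noteq> {}" using assms by auto
  ultimately show ?thesis unfolding hysteresis_def Let_def by (simp only: if_False simp_thms)
qed

text \<open>The only level that can change a relay with value \<open>q\<close>; a visit of the other
  level confirms the current value.\<close>

definition switch_level :: "real \<Rightarrow> real \<Rightarrow> real \<Rightarrow> real" where
  "switch_level \<alpha> \<beta> q = (if q = 1 then \<beta> else \<alpha>)"

locale relay =
  fixes \<alpha> \<beta> :: real
  assumes levels: "\<alpha> < \<beta>"
begin

text \<open>Compactness of the set of hits in \<open>[r, t]\<close>; the result is the greatest
  element that \<open>hysteresis\<close> refers to.\<close>

lemma last_hit:
  fixes g :: "real \<Rightarrow> real"
  assumes g: "continuous_on {0..} g" and r: "0 < r" "r \<le> t" "g r = \<alpha> \<or> g r = \<beta>"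
  obtains e where "r \<le> e" "e \<le> t" "g e = \<alpha> \<or> g e = \<beta>" "\<And>r. e < r \<Longrightarrow> r \<le> t \<Longrightarrow> g r \<noteq> \<alpha> \<and> g r \<noteq> \<beta>"
proof -
  define S where "S = {r..t} \<inter> g -` {\<alpha>, \<beta>}"
  have "{r..t} \<subseteq> {0..}" using r(1) by auto
  then have "closed S" unfolding S_def
    by (intro continuous_closed_preimage continuous_on_subset[OF g]) (auto intro: closed_atLeastAtMost)
  moreover have "bounded S" unfolding S_def by (rule bounded_subset[of "{r..t}"]) auto
  ultimately have "compact S" by (simp add: compact_eq_bounded_closed)
  moreover have "r \<in> S" using r by (auto simp: S_def)
  ultimately obtain e where e: "e \<in> S" "\<And>x. x \<in> S \<Longrightarrow> x \<le> e"
    using compact_attains_sup[of S] by blast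
  show thesis
  proof (rule that[of e])
    fix x assume x: "e < x" "x \<le> t"
    then have "x \<notin> S" using e(2)[of x] by auto
    then show "g x \<noteq> \<alpha> \<and> g x \<noteq> \<beta>" using x e(1) by (auto simp: S_def)
  qed (use e in \<open>auto simp: S_def\<close>)
qed

lemma hysteresis_cong:
  assumes g: "continuous_on {0..} g" and eq: "\<And>r. 0 \<le> r \<Longrightarrow> r \<le> t \<Longrightarrow> g r = g' r" and t: "0 \<le> t"
  shows "hysteresis \<alpha> \<beta> g t = hysteresis \<alpha> \<beta> g' t"
proof (cases "\<exists>r. 0 < r \<and> r \<le> t \<and> (g r = \<alpha> \<or> g r = \<beta>)")
  case True
  then obtain r where r: "0 < r" "r \<le> t" "g r = \<alpha> \<or> g r = \<beta>" by blast
  from last_hit[OF g this] obtain e where e: "r \<le> e" "e \<le> t" "g e = \<alpha> \<or> g e = \<beta>"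
    "\<And>r. e < r \<Longrightarrow> r \<le> t \<Longrightarrow> g r \<noteq> \<alpha> \<and> g r \<noteq> \<beta>" by metis
  have "hysteresis \<alpha> \<beta> g t = (if g e = \<alpha> then 1 else -1)" by (rule hysteresis_hit) (use e r in auto)
  moreover have "hysteresis \<alpha> \<beta> g' t = (if g' e = \<alpha> then 1 else -1)"
  proof (rule hysteresis_hit)
    show "g' e = \<alpha> \<or> g' e = \<beta>" using e eq[of e] r by simp
    fix x assume "e < x" "x \<le> t"
    then show "g' x \<noteq> \<alpha> \<and> g' x \<noteq> \<beta>" using e(4)[of x] eq[of x] e r by simp
  qed (use e r in auto)
  ultimately show ?thesis using eq[of e] e r by simp
next
  case False
  then have *: "\<And>r. 0 < r \<Longrightarrow> r \<le> t \<Longrightarrow> g r \<noteq> \<alpha> \<and> g r \<noteq> \<beta>" by blast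
  then have "\<And>r. 0 < r \<Longrightarrow> r \<le> t \<Longrightarrow> g' r \<noteq> \<alpha> \<and> g' r \<noteq> \<beta>" using eq by simp
  then have "hysteresis \<alpha> \<beta> g' t = (if g' 0 < \<beta> then 1 else -1)" by (rule hysteresis_empty)
  moreover have "hysteresis \<alpha> \<beta> g t = (if g 0 < \<beta> then 1 else -1)" by (rule hysteresis_empty) (rule *)
  ultimately show ?thesis using eq[of 0] t by simp
qed

text \<open>If there are hits after \<open>t\<close>, the last one is at the level opposite to the
  switch level, and there the relay takes the value that it already had. So only the switch level
  has to be avoided, not both levels.\<close>

lemma hysteresis_extend:
  assumes g: "continuous_on {0..} g" and t: "0 \<le> t" "t \<le> t'"
    and no: "\<And>r. t < r \<Longrightarrow> r \<le> t' \<Longrightarrow> g r \<noteq> switch_level \<alpha> \<beta> (hysteresis \<alpha> \<beta> g t)"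
  shows "hysteresis \<alpha> \<beta> g t' = hysteresis \<alpha> \<beta> g t"
proof (cases "\<exists>r. t < r \<and> r \<le> t' \<and> (g r = \<alpha> \<or> g r = \<beta>)")
  case True
  then obtain r where r: "t < r" "r \<le> t'" "g r = \<alpha> \<or> g r = \<beta>" by blast
  then have r0: "0 < r" using t by simp
  from last_hit[OF g r0 r(2,3)] obtain e where e: "r \<le> e" "e \<le> t'" "g e = \<alpha> \<or> g e = \<beta>"
    "\<And>r. e < r \<Longrightarrow> r \<le> t' \<Longrightarrow> g r \<noteq> \<alpha> \<and> g r \<noteq> \<beta>" by metis
  have "hysteresis \<alpha> \<beta> g t' = (if g e = \<alpha> then 1 else -1)" by (rule hysteresis_hit) (use e r r0 in auto)
  then show ?thesis
    using no[of e] e r hysteresis_cases[of \<alpha> \<beta> g t] levels by (auto simp: switch_level_def split: if_splits)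
next
  case False
  then have *: "\<And>r. t < r \<Longrightarrow> r \<le> t' \<Longrightarrow> g r \<noteq> \<alpha> \<and> g r \<noteq> \<beta>" by blast
  show ?thesis
  proof (cases "\<exists>r. 0 < r \<and> r \<le> t \<and> (g r = \<alpha> \<or> g r = \<beta>)")
    case True
    then obtain r where r: "0 < r" "r \<le> t" "g r = \<alpha> \<or> g r = \<beta>" by blast
    from last_hit[OF g this] obtain e where e: "r \<le> e" "e \<le> t" "g e = \<alpha> \<or> g e = \<beta>"
      "\<And>r. e < r \<Longrightarrow> r \<le> t \<Longrightarrow> g r \<noteq> \<alpha> \<and> g r \<noteq> \<beta>" by metis
    have "hysteresis \<alpha> \<beta> g t = (if g e = \<alpha> then 1 else -1)" by (rule hysteresis_hit) (use e r in auto)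
    moreover have "hysteresis \<alpha> \<beta> g t' = (if g e = \<alpha> then 1 else -1)"
    proof (rule hysteresis_hit)
      fix x assume "e < x" "x \<le> t'"
      then show "g x \<noteq> \<alpha> \<and> g x \<noteq> \<beta>" using e(4)[of x] *[of x] by (cases "x \<le> t") auto
    qed (use e r t in auto)
    ultimately show ?thesis by simp
  next
    case none: False
    have "g x \<noteq> \<alpha> \<and> g x \<noteq> \<beta>" if "0 < x" "x \<le> t'" for x
      using that none *[of x] by (cases "x \<le> t") auto
    then have "hysteresis \<alpha> \<beta> g t' = (if g 0 < \<beta> then 1 else -1)" by (rule hysteresis_empty)
    moreover have "hysteresis \<alpha> \<beta> g t = (if g 0 < \<beta> then 1 else -1)"
      by (rule hysteresis_empty) (use none in blast)
    ultimately show ?thesis by simp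
  qed
qed

lemma hysteresis_at_hit:
  assumes "0 < t" "g t = \<alpha> \<or> g t = \<beta>"
  shows "hysteresis \<alpha> \<beta> g t = (if g t = \<alpha> then 1 else -1)"
  by (rule hysteresis_hit) (use assms in auto)

text \<open>At the instant of a hit the relay has already switched, and at time 0 the initial rule
  never assigns a value whose switch level is the current one.\<close>

lemma not_at_switch_level:
  assumes "0 \<le> t"
  shows "g t \<noteq> switch_level \<alpha> \<beta> (hysteresis \<alpha> \<beta> g t)"
proof
  assume *: "g t = switch_level \<alpha> \<beta> (hysteresis \<alpha> \<beta> g t)"
  show False
  proof (cases "t = 0")
    case True
    then show False using * levels by (auto simp: hysteresis_0 switch_level_def split: if_splits)
  next
    case False
    have hit: "g t = \<alpha> \<or> g t = \<beta>" using * by (auto simp: switch_level_def split: if_splits)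
    have H: "hysteresis \<alpha> \<beta> g t = (if g t = \<alpha> then 1 else -1)"
      using False assms hit by (intro hysteresis_at_hit) auto
    show False using * hit levels unfolding H by (auto simp: switch_level_def)
  qed
qed

text \<open>A restart forgets the past, so the value at \<open>a\<close> must be the one that the
  initial rule assigns to \<open>g a\<close>. The condition \<open>restart\<close> fails, for
  instance, for a relay at -1 strictly between the levels.\<close>

lemma hysteresis_shift:
  assumes g: "continuous_on {0..} g" and a: "a \<ge> 0" "t \<ge> 0"
    and restart: "hysteresis \<alpha> \<beta> g a = (if g a < \<beta> then 1 else -1)"
  shows "hysteresis \<alpha> \<beta> g (a + t) = hysteresis \<alpha> \<beta> (\<lambda>r. g (a + r)) t"
proof (cases "\<exists>r. a < r \<and> r \<le> a + t \<and> (g r = \<alpha> \<or> g r = \<beta>)")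
  case True
  then obtain r where r: "a < r" "r \<le> a + t" "g r = \<alpha> \<or> g r = \<beta>" by blast
  then have r0: "0 < r" using a by simp
  from last_hit[OF g r0 r(2,3)] obtain e where e: "r \<le> e" "e \<le> a + t" "g e = \<alpha> \<or> g e = \<beta>"
    "\<And>r. e < r \<Longrightarrow> r \<le> a + t \<Longrightarrow> g r \<noteq> \<alpha> \<and> g r \<noteq> \<beta>" by metis
  have "hysteresis \<alpha> \<beta> g (a + t) = (if g e = \<alpha> then 1 else -1)" by (rule hysteresis_hit) (use e r r0 in auto)
  moreover have "hysteresis \<alpha> \<beta> (\<lambda>r. g (a + r)) t = (if g (a + (e - a)) = \<alpha> then 1 else -1)"
    by (rule hysteresis_hit) (use e r in auto)
  ultimately show ?thesis by simp
next
  case False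
  then have *: "\<And>r. a < r \<Longrightarrow> r \<le> a + t \<Longrightarrow> g r \<noteq> \<alpha> \<and> g r \<noteq> \<beta>" by blast
  have "hysteresis \<alpha> \<beta> g (a + t) = hysteresis \<alpha> \<beta> g a"
    by (rule hysteresis_extend[OF g]) (use a * in \<open>auto simp: switch_level_def\<close>)
  moreover have "hysteresis \<alpha> \<beta> (\<lambda>r. g (a + r)) t = (if g (a + 0) < \<beta> then 1 else -1)"
    by (rule hysteresis_empty) (use * in auto)
  ultimately show ?thesis using restart by simp
qed

end

section \<open>Existence of solutions of the hysteretic problem\<close>

lemma bounded_borel_integrable_on:
  fixes h :: "real \<Rightarrow> real"
  assumes "h \<in> borel_measurable borel" "\<And>t. \<bar>h t\<bar> \<le> M"
  shows "h integrable_on {a..b}"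
proof -
  have "set_integrable lborel {a..b} h"
    unfolding set_integrable_def by (rule integrableI_bounded_set_indicator[of _ _ _ M]) (use assms in \<open>auto simp: emeasure_lborel_Icc_eq\<close>)
  then show ?thesis by (rule set_borel_integral_eq_integral(1))
qed

locale hysteretic = delay_equation T k A B + relay \<alpha> \<beta>
  for T :: real and k :: "real ^ 'n" and A B :: "real ^ 'n ^ 'n" and \<alpha> \<beta> :: real +
  fixes m :: "real ^ 'n"
begin

definition binary :: "(real \<Rightarrow> real) \<Rightarrow> bool" where
  "binary h \<longleftrightarrow> h \<in> borel_measurable borel \<and> (\<forall>t. h t = 1 \<or> h t = -1)"

lemma binaryD: "binary h \<Longrightarrow> h \<in> borel_measurable borel" "binary h \<Longrightarrow> \<bar>h t\<bar> \<le> 1"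
  by (auto simp: binary_def) (metis abs_1 abs_minus_cancel order_refl)

lemma binary_sol_exists:
  assumes "hist \<phi> absolutely_integrable_on UNIV" "binary h"
  shows "\<exists>u. delay_sol h \<phi> x u"
  using assms binaryD[OF assms(2)] by (intro delay_sol_exists bounded_borel_integrable_on[of h 1]) auto

lemma norm_rhs: "norm (rhs h u r) \<le> norm (h r *\<^sub>R k) + norm (B *v u r) + norm (A *v u (r - 2 * T))"
  unfolding rhs_def
  using norm_triangle_ineq[of "h r *\<^sub>R k - B *v u r" "A *v u (r - 2 * T)"]
    norm_triangle_ineq4[of "h r *\<^sub>R k" "B *v u r"] by linarith

text \<open>The majorant depends on the history and on the bound \<open>M\<close> but not on the
  relay function. Its primitive thus serves as a modulus of continuity for all relay functions at
  once.\<close>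

lemma delay_sol_increment:
  assumes u: "delay_sol h \<phi> x u" and t: "0 \<le> t'" "t' \<le> t"
    and h: "\<And>t. \<bar>h t\<bar> \<le> 1" and hist: "hist \<phi> absolutely_integrable_on UNIV"
    and M: "\<And>r. r \<in> {0..t} \<Longrightarrow> norm (u r) \<le> M"
  shows "norm (u t - u t') \<le> integral {t'..t} (\<lambda>r. norm k + (KA + KB) * M + norm (hist \<phi> r))"
proof -
  let ?N = "\<lambda>r. norm k + (KA + KB) * M + norm (hist \<phi> r)"
  have M0: "M \<ge> 0" using order_trans[OF norm_ge_zero M[of t']] t by simp
  have shift: "((rhs (\<lambda>t. h (t' + t)) (\<lambda>t. u (t' + t))) has_integral (u t - u t')) {0..t - t'}"
    using delay_solD(4)[OF delay_sol_shift[OF u t(1)], of "t - t'"] t by simp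
  have "(\<lambda>r. norm (hist \<phi> r)) integrable_on {t'..t}"
    using absolutely_integrable_on_subinterval[OF hist, of t' t] by (simp add: absolutely_integrable_on_def)
  then have Ni: "?N integrable_on {t'..t}" by (intro integrable_add integrable_const_ivl) auto
  from has_integral_shift_real_ivl[OF shift, of "- t'"]
  have w: "((\<lambda>r. rhs (\<lambda>t. h (t' + t)) (\<lambda>t. u (t' + t)) (r - t')) has_integral (u t - u t')) {t'..t}" by simp
  \<comment> \<open>At \<open>r = 0\<close> the right-hand side reads the unspecified value
    \<open>u (- 2 * T)\<close>, which no bound covers.\<close>
  have "((\<lambda>r. if r = 0 then 0 else rhs h u r) has_integral (u t - u t')) {t'..t}"
    by (rule has_integral_spike_finite[OF _ _ w, of "{0}"]) (auto simp: rhs_def add_diff_eq)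
  then have "norm (integral {t'..t} (\<lambda>r. if r = 0 then 0 else rhs h u r)) \<le> integral {t'..t} ?N"
  proof (intro integral_norm_bound_integral Ni)
    fix r assume r: "r \<in> {t'..t}"
    show "norm (if r = 0 then 0 else rhs h u r) \<le> ?N r"
    proof (cases "r = 0")
      case False
      have 1: "norm (h r *\<^sub>R k) \<le> 1 * norm k" using h[of r] by (simp only: norm_scaleR) (intro mult_right_mono, auto)
      have 2: "norm (B *v u r) \<le> KB * M" using norm_B[of "u r"] M[of r] r t mult_left_mono[OF M[of r] K_nonneg(2)] by auto
      have 3: "norm (A *v u (r - 2 * T)) \<le> KA * M + norm (hist \<phi> r)"
      proof (cases "r < 2 * T")
        case True
        then have "hist \<phi> r = A *v u (r - 2 * T)"
          using False r t delay_solD(1)[OF u, of "r - 2 * T"] by (simp add: hist_def)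
        then show ?thesis using M0 by simp
      next
        case False
        then have "norm (u (r - 2 * T)) \<le> M" using r t T_pos by (intro M) auto
        then show ?thesis using norm_A[of "u (r - 2 * T)"] mult_left_mono[OF _ K_nonneg(1)] norm_ge_zero[of "hist \<phi> r"]
          by (smt (verit))
      qed
      have "norm (rhs h u r) \<le> norm (h r *\<^sub>R k) + norm (B *v u r) + norm (A *v u (r - 2 * T))"
        by (rule norm_rhs)
      then show ?thesis using 1 2 3 False by (simp add: algebra_simps)
    qed (use M0 in simp)
  qed (auto intro: has_integral_integrable)
  then show ?thesis using \<open>((\<lambda>r. if r = 0 then 0 else rhs h u r) has_integral _) _\<close> by (simp add: integral_unique)
qed

text \<open>All solutions with the same initial data share a modulus of continuity, so the time between two
  switchings is bounded below.\<close>

lemma uniform_gap: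
  assumes hist: "hist \<phi> absolutely_integrable_on UNIV" and b: "b \<ge> 0"
  obtains c where "c > 0" "\<And>h u t t'. (\<And>t. \<bar>h t\<bar> \<le> 1) \<Longrightarrow> delay_sol h \<phi> x u \<Longrightarrow> t \<in> {0..b} \<Longrightarrow> t' \<in> {0..b} \<Longrightarrow>
    \<bar>t - t'\<bar> \<le> c \<Longrightarrow> \<bar>m \<bullet> u t - m \<bullet> u t'\<bar> < \<beta> - \<alpha>"
proof -
  have hint: "(\<lambda>r. norm (hist \<phi> r)) integrable_on {s..t}" for s t
    using absolutely_integrable_on_subinterval[OF hist, of s t] by (simp add: absolutely_integrable_on_def)
  define Q where "Q = integral {0..b} (\<lambda>r. norm k + norm (hist \<phi> r))"
  \<comment> \<open>A bound common to all relay functions with values in \<open>[-1, 1]\<close>,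
    supplied by \<open>delay_gronwall\<close>.\<close>
  define M where "M = 2 * (norm x + Q) * exp (growth * b)"
  define N where "N r = norm k + (KA + KB) * M + norm (hist \<phi> r)" for r
  have Ni: "N integrable_on {s..t}" for s t unfolding N_def by (intro integrable_add integrable_const_ivl hint)
  have Q0: "Q \<ge> 0" unfolding Q_def by (intro integral_nonneg integrable_add integrable_const_ivl hint) auto
  have M: "norm (u t) \<le> M" if h: "\<And>t. \<bar>h t\<bar> \<le> 1" and u: "delay_sol h \<phi> x u" and t: "t \<in> {0..b}" for h u t
  proof -
    have "norm (u t) \<le> 2 * (norm x + Q) * exp (growth * t)"
    proof (rule delay_gronwall[of b u "rhs h u" x "\<lambda>r. norm k + norm (hist \<phi> r)"])
      show "continuous_on {0..b} u" by (rule continuous_on_subset[OF delay_solD(2)[OF u]]) auto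
      show "(\<lambda>r. norm k + norm (hist \<phi> r)) integrable_on {0..b}"
        by (intro integrable_add integrable_const_ivl hint)
      fix r assume r: "r \<in> {0<..<b}"
      have 1: "norm (h r *\<^sub>R k) \<le> 1 * norm k" using h[of r] by (simp only: norm_scaleR) (intro mult_right_mono, auto)
      have 3: "norm (A *v u (r - 2 * T)) \<le> norm (hist \<phi> r) + (if r \<ge> 2 * T then KA * norm (u (r - 2 * T)) else 0)"
        using delay_solD(1)[OF u, of "r - 2 * T"] r norm_A[of "u (r - 2 * T)"] by (auto simp: hist_def)
      have "norm (rhs h u r) \<le> norm (h r *\<^sub>R k) + norm (B *v u r) + norm (A *v u (r - 2 * T))"
        by (rule norm_rhs)
      then show "norm (rhs h u r) \<le> norm k + norm (hist \<phi> r) + KB * norm (u r) + (if r \<ge> 2 * T then KA * norm (u (r - 2 * T)) else 0)"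
        using 1 3 norm_B[of "u r"] by linarith
    qed (use t delay_solD(4)[OF u] in \<open>auto simp: Q_def\<close>)
    also have "\<dots> \<le> M" unfolding M_def using t Q0 growth_pos by (intro mult_left_mono) auto
    finally show ?thesis .
  qed
  have "uniformly_continuous_on {0..b} (\<lambda>t. integral {0..t} N)"
    by (intro compact_uniformly_continuous indefinite_integral_continuous_1 Ni) auto
  moreover have "(\<beta> - \<alpha>) / (norm m + 1) > 0" using levels by (intro divide_pos_pos) (auto intro: add_nonneg_pos)
  ultimately obtain d where d: "d > 0" "\<And>t t'. t \<in> {0..b} \<Longrightarrow> t' \<in> {0..b} \<Longrightarrow> dist t' t < d \<Longrightarrow>
      dist (integral {0..t'} N) (integral {0..t} N) < (\<beta> - \<alpha>) / (norm m + 1)"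
    unfolding uniformly_continuous_on_def by metis
  have ordered: "\<bar>m \<bullet> u t - m \<bullet> u t'\<bar> < \<beta> - \<alpha>"
    if h: "\<And>t. \<bar>h t\<bar> \<le> 1" and u: "delay_sol h \<phi> x u" and t: "t \<in> {0..b}" "t' \<in> {0..b}" "t' \<le> t" "t - t' \<le> d / 2" for h u t t'
  proof -
    have "norm (u t - u t') \<le> integral {t'..t} N"
      unfolding N_def by (rule delay_sol_increment[OF u _ _ h hist]) (use t M[OF h u] in auto)
    also have "integral {t'..t} N = integral {0..t} N - integral {0..t'} N"
      using Henstock_Kurzweil_Integration.integral_combine[of 0 t' t N] t Ni by simp
    also have "\<dots> < (\<beta> - \<alpha>) / (norm m + 1)" using d(2)[of t' t] t d(1) by (auto simp: dist_real_def)
    finally have n: "norm (u t - u t') < (\<beta> - \<alpha>) / (norm m + 1)" .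
    have "\<bar>m \<bullet> u t - m \<bullet> u t'\<bar> \<le> norm m * norm (u t - u t')"
      unfolding inner_diff_right[symmetric] by (rule Cauchy_Schwarz_ineq2)
    also have "\<dots> \<le> (norm m + 1) * norm (u t - u t')" by (intro mult_right_mono) auto
    also have "\<dots> < \<beta> - \<alpha>"
    proof -
      have "norm m + 1 > 0" by (auto intro: add_nonneg_pos)
      with n show ?thesis by (simp add: pos_less_divide_eq mult.commute)
    qed
    finally show ?thesis .
  qed
  show thesis
  proof (rule that[of "d / 2"])
    fix h :: "real \<Rightarrow> real" and u t t'
    assume *: "\<And>t. \<bar>h t\<bar> \<le> 1" "delay_sol h \<phi> x u" "t \<in> {0..b}" "t' \<in> {0..b}" "\<bar>t - t'\<bar> \<le> d / 2"
    show "\<bar>m \<bullet> u t - m \<bullet> u t'\<bar> < \<beta> - \<alpha>"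
      using ordered[OF *(1,2), of t t'] ordered[OF *(1,2), of t' t] * by (cases "t' \<le> t") (auto simp: abs_minus_commute)
  qed (use d in auto)
qed

text \<open>Self-consistency of a prescribed relay function: the linear equation driven by
  \<open>h\<close> reproduces \<open>h\<close> as its hysteresis. Existence thus becomes a matter of
  extending \<open>h\<close>, while the solution is supplied by the linear theory.\<close>

definition hyst_upto :: "(real \<Rightarrow> real ^ 'n) \<Rightarrow> real ^ 'n \<Rightarrow> (real \<Rightarrow> real) \<Rightarrow> real \<Rightarrow> bool" where
  "hyst_upto \<phi> x h t \<longleftrightarrow> binary h \<and>
     (\<forall>u. delay_sol h \<phi> x u \<longrightarrow> (\<forall>r\<in>{0..t}. hysteresis \<alpha> \<beta> (\<lambda>t. m \<bullet> u t) r = h r))"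

lemma continuous_level: "delay_sol h \<phi> x u \<Longrightarrow> continuous_on {0..} (\<lambda>t. m \<bullet> u t)"
  by (intro continuous_intros delay_solD(2))

text \<open>The value at \<open>t\<close> is kept until the first hit of its switch level and
  reversed there. One more switch would require the level to move by
  \<open>\<beta> - \<alpha>\<close>, which \<open>gap\<close> excludes within time
  \<open>c\<close>.\<close>

lemma hyst_upto_step:
  assumes hist: "hist \<phi> absolutely_integrable_on UNIV"
    and gap: "\<And>h u t t'. (\<And>t. \<bar>h t\<bar> \<le> 1) \<Longrightarrow> delay_sol h \<phi> x u \<Longrightarrow> t \<in> {0..b} \<Longrightarrow> t' \<in> {0..b} \<Longrightarrow>
    \<bar>t - t'\<bar> \<le> c \<Longrightarrow> \<bar>m \<bullet> u t - m \<bullet> u t'\<bar> < \<beta> - \<alpha>"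
    and h: "hyst_upto \<phi> x h t" and t: "0 \<le> t" "t \<le> t'" "t' \<le> t + c" "t' \<le> b"
  obtains h' where "hyst_upto \<phi> x h' t'" "\<And>r. r \<le> t \<Longrightarrow> h' r = h r"
proof -
  define q where "q = h t"
  have hb: "binary h" using h by (simp add: hyst_upto_def)
  then have [measurable]: "h \<in> borel_measurable borel" and q: "q = 1 \<or> q = -1" by (auto simp: binary_def q_def)
  obtain u where u: "delay_sol h \<phi> x u" using binary_sol_exists[OF hist hb] by blast
  have hu: "hysteresis \<alpha> \<beta> (\<lambda>t. m \<bullet> u t) r = h r" if "r \<in> {0..t}" for r using h u that by (auto simp: hyst_upto_def)
  \<comment> \<open>Tentative continuation without a switch; its solution decides whether and when a
    hit occurs.\<close>
  define h1 where "h1 r = (if r \<le> t then h r else q)" for r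
  have h1b: "binary h1" unfolding binary_def
  proof
    show "h1 \<in> borel_measurable borel" unfolding h1_def by measurable
  qed (use hb q in \<open>auto simp: binary_def h1_def\<close>)
  obtain u1 where u1: "delay_sol h1 \<phi> x u1" using binary_sol_exists[OF hist h1b] by blast
  define \<theta> where "\<theta> = switch_level \<alpha> \<beta> q"
  have early: "hysteresis \<alpha> \<beta> (\<lambda>t. m \<bullet> v t) r = h' r" if v: "delay_sol h' \<phi> x v" "\<And>r. r \<le> t \<Longrightarrow> h' r = h r" and r: "r \<in> {0..t}" for h' v r
  proof -
    have "v r' = u r'" if "0 \<le> r'" "r' \<le> t" for r'
      by (rule delay_sol_unique[OF v(1) u, of t]) (use v that T_pos in auto)
    then have "hysteresis \<alpha> \<beta> (\<lambda>t. m \<bullet> v t) r = hysteresis \<alpha> \<beta> (\<lambda>t. m \<bullet> u t) r"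
      using r by (intro hysteresis_cong continuous_level[OF v(1)]) auto
    then show ?thesis using hu[OF r] v(2)[of r] r by simp
  qed
  define E where "E = {t..t'} \<inter> (\<lambda>r. m \<bullet> u1 r) -` {\<theta>}"
  show thesis
  proof (cases "E = {}")
    case True
    show thesis
    proof (rule that[of h1])
      show "hyst_upto \<phi> x h1 t'" unfolding hyst_upto_def
      proof (intro conjI allI impI ballI)
        fix v r assume v: "delay_sol h1 \<phi> x v" and r: "r \<in> {0..t'}"
        have vu: "v r = u1 r" if "0 \<le> r" for r by (rule delay_sol_unique[OF v u1, of r]) (use that T_pos in auto)
        show "hysteresis \<alpha> \<beta> (\<lambda>t. m \<bullet> v t) r = h1 r"
        proof (cases "r \<le> t")
          case True
          then show ?thesis using early[OF v] r by (auto simp: h1_def)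
        next
          case False
          have ht: "hysteresis \<alpha> \<beta> (\<lambda>t. m \<bullet> v t) t = q"
            using early[OF v, of t] t by (auto simp: h1_def q_def)
          have "hysteresis \<alpha> \<beta> (\<lambda>t. m \<bullet> v t) r = hysteresis \<alpha> \<beta> (\<lambda>t. m \<bullet> v t) t"
          proof (rule hysteresis_extend[OF continuous_level[OF v]])
            fix s assume s: "t < s" "s \<le> r"
            then have "s \<notin> E" using True by simp
            then show "m \<bullet> v s \<noteq> switch_level \<alpha> \<beta> (hysteresis \<alpha> \<beta> (\<lambda>t. m \<bullet> v t) t)"
              using s r t vu[of s] by (auto simp: E_def ht \<theta>_def)
          qed (use False t in auto)
          then show ?thesis using ht False by (simp add: h1_def)
        qed
      qed (rule h1b)
    qed (simp add: h1_def)
  next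
    case False
    have "{t..t'} \<subseteq> {0..}" using t(1) by auto
    then have "closed E" unfolding E_def
      by (intro continuous_closed_preimage continuous_on_subset[OF continuous_level[OF u1]]) (auto intro: closed_atLeastAtMost)
    moreover have "bounded E" unfolding E_def by (rule bounded_subset[of "{t..t'}"]) auto
    ultimately have "compact E" by (simp add: compact_eq_bounded_closed)
    then obtain \<tau> where \<tau>: "\<tau> \<in> E" "\<And>r. r \<in> E \<Longrightarrow> \<tau> \<le> r" using compact_attains_inf[of E] False by blast
    have ht1: "hysteresis \<alpha> \<beta> (\<lambda>t. m \<bullet> u1 t) t = q" using early[OF u1, of t] t by (auto simp: h1_def q_def)
    have \<tau>t: "t < \<tau>" "\<tau> \<le> t'" "m \<bullet> u1 \<tau> = \<theta>"
      using \<tau>(1) not_at_switch_level[of t "\<lambda>t. m \<bullet> u1 t"] t ht1 by (auto simp: E_def \<theta>_def order_less_le)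
    define h2 where "h2 r = (if r \<le> t then h r else if r < \<tau> then q else - q)" for r
    have h2b: "binary h2" unfolding binary_def
    proof
      show "h2 \<in> borel_measurable borel" unfolding h2_def by measurable
    qed (use hb q in \<open>auto simp: binary_def h2_def\<close>)
    show thesis
    proof (rule that[of h2])
      show "hyst_upto \<phi> x h2 t'" unfolding hyst_upto_def
      proof (intro conjI allI impI ballI)
        fix v r assume v: "delay_sol h2 \<phi> x v" and r: "r \<in> {0..t'}"
        have vu: "v r = u1 r" if "0 \<le> r" "r \<le> \<tau>" for r
          by (rule delay_sol_unique[OF v u1, of \<tau>]) (use that T_pos in \<open>auto simp: h1_def h2_def\<close>)
        have ht: "hysteresis \<alpha> \<beta> (\<lambda>t. m \<bullet> v t) t = q"
          using early[OF v, of t] t by (auto simp: h2_def q_def)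
        have h\<tau>: "hysteresis \<alpha> \<beta> (\<lambda>t. m \<bullet> v t) \<tau> = - q"
          using hysteresis_at_hit[of \<tau> "\<lambda>t. m \<bullet> v t"] \<tau>t t vu[of \<tau>] q levels by (auto simp: \<theta>_def switch_level_def)
        consider "r \<le> t" | "t < r" "r < \<tau>" | "\<tau> \<le> r" by linarith
        then show "hysteresis \<alpha> \<beta> (\<lambda>t. m \<bullet> v t) r = h2 r"
        proof cases
          case 1
          then show ?thesis using early[OF v] r by (auto simp: h2_def)
        next
          case 2
          have "hysteresis \<alpha> \<beta> (\<lambda>t. m \<bullet> v t) r = hysteresis \<alpha> \<beta> (\<lambda>t. m \<bullet> v t) t"
          proof (rule hysteresis_extend[OF continuous_level[OF v]])
            fix s assume s: "t < s" "s \<le> r"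
            then have "s \<notin> E" using \<tau>(2)[of s] 2 by auto
            then show "m \<bullet> v s \<noteq> switch_level \<alpha> \<beta> (hysteresis \<alpha> \<beta> (\<lambda>t. m \<bullet> v t) t)"
              using s r t vu[of s] 2 by (auto simp: E_def ht \<theta>_def)
          qed (use 2 t in auto)
          then show ?thesis using ht 2 by (simp add: h2_def)
        next
          case 3
          have "hysteresis \<alpha> \<beta> (\<lambda>t. m \<bullet> v t) r = hysteresis \<alpha> \<beta> (\<lambda>t. m \<bullet> v t) \<tau>"
          proof (rule hysteresis_extend[OF continuous_level[OF v]])
            fix s assume s: "\<tau> < s" "s \<le> r"
            have "\<bar>m \<bullet> v s - m \<bullet> v \<tau>\<bar> < \<beta> - \<alpha>"
              by (rule gap[OF binaryD(2)[OF h2b] v]) (use s r t \<tau>t in auto)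
            then show "m \<bullet> v s \<noteq> switch_level \<alpha> \<beta> (hysteresis \<alpha> \<beta> (\<lambda>t. m \<bullet> v t) \<tau>)"
              using vu[of \<tau>] \<tau>t t q h\<tau> by (auto simp: \<theta>_def switch_level_def)
          qed (use 3 \<tau>t t in auto)
          then show ?thesis using h\<tau> 3 \<tau>t by (simp add: h2_def)
        qed
      qed (rule h2b)
    qed (simp add: h2_def)
  qed
qed

text \<open>The admissible step \<open>c\<close> depends on the time horizon, so the extension
  proceeds by unit intervals, each covered by finitely many steps.\<close>

lemma hyst_upto_extend:
  assumes hist: "hist \<phi> absolutely_integrable_on UNIV" and h: "hyst_upto \<phi> x h (real n)"
  shows "\<exists>h'. hyst_upto \<phi> x h' (real (Suc n)) \<and> (\<forall>r\<le>real n. h' r = h r)"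
proof -
  define b where "b = real (Suc n)"
  obtain c where c: "c > 0" "\<And>h u t t'. (\<And>t. \<bar>h t\<bar> \<le> 1) \<Longrightarrow> delay_sol h \<phi> x u \<Longrightarrow> t \<in> {0..b} \<Longrightarrow> t' \<in> {0..b} \<Longrightarrow>
    \<bar>t - t'\<bar> \<le> c \<Longrightarrow> \<bar>m \<bullet> u t - m \<bullet> u t'\<bar> < \<beta> - \<alpha>"
    using uniform_gap[OF hist, of b] unfolding b_def by (metis of_nat_0_le_iff)
  have "\<exists>h'. hyst_upto \<phi> x h' (min (real n + real j * c) b) \<and> (\<forall>r\<le>real n. h' r = h r)" for j
  proof (induction j)
    case 0
    then show ?case using h by (intro exI[of _ h]) (auto simp: b_def)
  next
    case (Suc j)
    then obtain h1 where h1: "hyst_upto \<phi> x h1 (min (real n + real j * c) b)" "\<forall>r\<le>real n. h1 r = h r" by blast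
    obtain h' where h': "hyst_upto \<phi> x h' (min (real n + real (Suc j) * c) b)" "\<And>r. r \<le> min (real n + real j * c) b \<Longrightarrow> h' r = h1 r"
    proof (rule hyst_upto_step[OF hist c(2) h1(1), of "min (real n + real (Suc j) * c) b"])
      show "0 \<le> min (real n + real j * c) b" using c(1) by (simp add: b_def)
      show "min (real n + real j * c) b \<le> min (real n + real (Suc j) * c) b"
        "min (real n + real (Suc j) * c) b \<le> min (real n + real j * c) b + c"
        using c(1) by (auto simp: algebra_simps min_def)
    qed auto
    have "r \<le> min (real n + real j * c) b" if "r \<le> real n" for r
      using that c(1) by (auto simp: b_def intro: add_increasing2)
    then show ?case using h' h1(2) by (intro exI[of _ h']) auto
  qed
  moreover obtain j where "1 / c < real j" using reals_Archimedean2 by blast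
  then have "min (real n + real j * c) b = b" using c(1) by (simp add: b_def field_simps)
  ultimately show ?thesis unfolding b_def by metis
qed

lemma hysteretic_sol_exists:
  assumes hist: "hist \<phi> absolutely_integrable_on UNIV"
  obtains h u where "binary h" "delay_sol h \<phi> x u" "\<And>t. t \<ge> 0 \<Longrightarrow> hysteresis \<alpha> \<beta> (\<lambda>t. m \<bullet> u t) t = h t"
proof -
  define h0 :: "real \<Rightarrow> real" where "h0 = (\<lambda>_. if m \<bullet> x < \<beta> then 1 else -1)"
  have "hyst_upto \<phi> x h0 (real 0)"
    using delay_solD(3) by (auto simp: hyst_upto_def binary_def h0_def hysteresis_0)
  moreover have "\<exists>h'. hyst_upto \<phi> x h' (real (Suc n)) \<and> (\<forall>r\<le>real n. h' r = h r)" if "hyst_upto \<phi> x h (real n)" for h n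
    by (rule hyst_upto_extend[OF hist that])
  ultimately obtain H where H: "\<And>n. hyst_upto \<phi> x (H n) (real n)" "\<And>n r. r \<le> real n \<Longrightarrow> H (Suc n) r = H n r"
    using dependent_nat_choice[of "\<lambda>n h. hyst_upto \<phi> x h (real n)" "\<lambda>n h h'. \<forall>r\<le>real n. h' r = h r"] by metis
  have stable: "H (n + j) r = H n r" if "r \<le> real n" for n j r
    by (induction j) (use that H(2)[of r] in auto)
  \<comment> \<open>At a fixed \<open>r\<close> the stages agree as soon as their horizon has
    reached \<open>r\<close>; so \<open>h\<close> is a pointwise limit of the \<open>H n\<close>,
    and measurable.\<close>
  define h where "h r = H (nat \<lceil>r\<rceil>) r" for r
  have h_eq: "h r = H n r" if "r \<le> real n" for n r
  proof -
    have "nat \<lceil>r\<rceil> \<le> n" using that by (simp add: ceiling_le nat_le_iff)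
    moreover have "r \<le> real (nat \<lceil>r\<rceil>)" by linarith
    ultimately show ?thesis using stable[of r "nat \<lceil>r\<rceil>" "n - nat \<lceil>r\<rceil>"] by (simp add: h_def)
  qed
  have hb: "binary h"
    unfolding binary_def
  proof
    show "h \<in> borel_measurable borel"
    proof (rule borel_measurable_LIMSEQ_metric[where f = H])
      fix r :: real assume "r \<in> space borel"
      have "\<forall>\<^sub>F n in sequentially. H n r = h r"
        using eventually_ge_at_top[of "nat \<lceil>r\<rceil>"] by eventually_elim (use h_eq[of r] in \<open>auto simp: nat_le_iff ceiling_le_iff\<close>)
      then show "(\<lambda>n. H n r) \<longlonglongrightarrow> h r" by (rule tendsto_eventually)
    qed (use H(1) in \<open>auto simp: hyst_upto_def binary_def\<close>)
  qed (use H(1) in \<open>auto simp: hyst_upto_def binary_def h_def\<close>)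
  obtain u where u: "delay_sol h \<phi> x u" using binary_sol_exists[OF hist hb] by blast
  have "hysteresis \<alpha> \<beta> (\<lambda>t. m \<bullet> u t) t = h t" if t: "t \<ge> 0" for t
  proof -
    define n where "n = nat \<lceil>t\<rceil>"
    have n: "t \<le> real n" unfolding n_def by linarith
    have "binary (H n)" using H(1)[of n] unfolding hyst_upto_def by blast
    then obtain v where v: "delay_sol (H n) \<phi> x v" using binary_sol_exists[OF hist] by blast
    have "u r = v r" if "0 \<le> r" "r \<le> t" for r
      by (rule delay_sol_unique[OF u v, of t]) (use that T_pos n in \<open>auto intro: h_eq\<close>)
    then have "hysteresis \<alpha> \<beta> (\<lambda>t. m \<bullet> u t) t = hysteresis \<alpha> \<beta> (\<lambda>t. m \<bullet> v t) t"
      using t by (intro hysteresis_cong continuous_level[OF u]) auto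
    also have "\<dots> = H n t" using H(1)[of n] v t n by (auto simp: hyst_upto_def)
    finally show ?thesis using h_eq[OF n] by simp
  qed
  with hb u show thesis by (rule that)
qed

lemma is_solution_cong:
  assumes "is_solution T p k A B h \<phi> x u" "\<And>t. t > 0 \<Longrightarrow> h t = h' t"
  shows "is_solution T p k A B h' \<phi> x u"
proof -
  have "(0 < t \<and> t < b \<longrightarrow> v = h t *\<^sub>R k - y) \<longleftrightarrow> (0 < t \<and> t < b \<longrightarrow> v = h' t *\<^sub>R k - y)" for t b v and y :: "real ^ 'n"
    using assms(2)[of t] by auto
  moreover have e: "h t *\<^sub>R k - B *v u t + A *v w = h t *\<^sub>R k - (B *v u t - A *v w)" for h :: "real \<Rightarrow> real" and t w by simp
  ultimately show ?thesis using assms(1) unfolding is_solution_def e by simp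
qed

text \<open>Existence of one solution makes the choice in \<open>hsol\<close> meaningful. The relay
  function may be replaced by the hysteresis because the two agree for positive times.\<close>

lemma hsol_is_solution:
  fixes x :: "real ^ 'n"
  assumes \<phi>: "\<phi> \<in> vec_space (Lp p (-2 * T) 0)" and p: "p \<ge> 1"
  defines "u \<equiv> hsol T \<alpha> \<beta> p k m A B \<phi> x"
  shows "delay_sol (hysteresis \<alpha> \<beta> (\<lambda>t. m \<bullet> u t)) \<phi> x u"
proof -
  obtain h v where h: "binary h" and v: "delay_sol h \<phi> x v" "\<And>t. t \<ge> 0 \<Longrightarrow> hysteresis \<alpha> \<beta> (\<lambda>t. m \<bullet> v t) t = h t"
    using hysteretic_sol_exists[OF hist_integrable[OF \<phi> p]] by metis
  have "is_solution T p k A B h \<phi> x v" by (rule delay_sol_imp_is_solution[OF v(1) \<phi> p binaryD[OF h]])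
  then have "is_solution T p k A B (hysteresis \<alpha> \<beta> (\<lambda>t. m \<bullet> v t)) \<phi> x v"
    by (rule is_solution_cong) (use v(2) in auto)
  from someI[where P = "\<lambda>u. is_solution T p k A B (hysteresis \<alpha> \<beta> (\<lambda>t. m \<bullet> u t)) \<phi> x u", OF this]
  have "is_solution T p k A B (hysteresis \<alpha> \<beta> (\<lambda>t. m \<bullet> u t)) \<phi> x u"
    by (simp only: u_def hsol_def)
  then show ?thesis by (rule is_solution_imp_delay_sol[OF _ p])
qed

lemma const_sol:
  assumes \<phi>: "\<phi> \<in> vec_space (Lp p (-2 * T) 0)" and p: "p \<ge> 1"
  shows "delay_sol (\<lambda>_. 1) \<phi> x (u_plus T p k A B \<phi> x)" "delay_sol (\<lambda>_. -1) \<phi> x (u_minus T p k A B \<phi> x)"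
proof -
  have "is_solution T p k A B (\<lambda>_. c) \<phi> x (SOME u. is_solution T p k A B (\<lambda>_. c) \<phi> x u)" if c: "c = 1 \<or> c = -1" for c
  proof -
    have b: "binary (\<lambda>_. c)" using c by (auto simp: binary_def)
    obtain v where "delay_sol (\<lambda>_. c) \<phi> x v" using binary_sol_exists[OF hist_integrable[OF \<phi> p] b] by blast
    then have "is_solution T p k A B (\<lambda>_. c) \<phi> x v"
      by (rule delay_sol_imp_is_solution[OF _ \<phi> p binaryD[OF b]])
    then show ?thesis by (rule someI[where P = "\<lambda>u. is_solution T p k A B (\<lambda>_. c) \<phi> x u"])
  qed
  from this[of 1] this[of "-1"]
  show "delay_sol (\<lambda>_. 1) \<phi> x (u_plus T p k A B \<phi> x)" "delay_sol (\<lambda>_. -1) \<phi> x (u_minus T p k A B \<phi> x)"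
    unfolding u_plus_def u_minus_def by (auto intro: is_solution_imp_delay_sol[OF _ p])
qed

end

section \<open>The phase space\<close>

lemma slobodeckij_integral_cong:
  assumes "\<And>t. a < t \<Longrightarrow> t < b \<Longrightarrow> f t = g t"
  shows "slobodeckij_integral s p a b f = slobodeckij_integral s p a b g"
  unfolding slobodeckij_integral_kernel
  by (intro nn_integral_cong) (auto simp: indicator_def slob_kernel_def assms intro!: nn_integral_cong)

lemma slobodeckij_integral_mono:
  assumes "a \<le> c" "d \<le> b"
  shows "slobodeckij_integral s p c d f \<le> slobodeckij_integral s p a b f"
  unfolding slobodeckij_integral_kernel
  using assms by (intro nn_integral_mono mult_mono) (auto simp: indicator_def intro!: nn_integral_mono)

lemma slobodeckij_integral_shift:
  assumes [measurable]: "f \<in> borel_measurable borel"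
  shows "slobodeckij_integral s p a b (\<lambda>\<xi>. f (c + \<xi>)) = slobodeckij_integral s p (a + c) (b + c) f"
proof -
  define G where "G t = (\<integral>\<^sup>+\<xi>. slob_kernel s p f t \<xi> * indicator {a + c<..<b + c} \<xi> \<partial>lborel)" for t
  have [measurable]: "G \<in> borel_measurable borel" unfolding G_def by measurable
  have "(\<integral>\<^sup>+\<xi>. slob_kernel s p (\<lambda>\<xi>. f (c + \<xi>)) t \<xi> * indicator {a<..<b} \<xi> \<partial>lborel) = G (c + 1 * t)" for t
  proof -
    have "G (c + t) = (\<integral>\<^sup>+\<xi>. slob_kernel s p f (c + t) (c + 1 * \<xi>) * indicator {a + c<..<b + c} (c + 1 * \<xi>) \<partial>lborel)"
      unfolding G_def
      by (subst nn_integral_real_affine[of "\<lambda>\<xi>. slob_kernel s p f (c + t) \<xi> * indicator {a + c<..<b + c} \<xi>" 1 c]) auto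
    also have "\<dots> = (\<integral>\<^sup>+\<xi>. slob_kernel s p (\<lambda>\<xi>. f (c + \<xi>)) t \<xi> * indicator {a<..<b} \<xi> \<partial>lborel)"
      by (intro nn_integral_cong) (auto simp: indicator_def slob_kernel_def)
    finally show ?thesis by simp
  qed
  then have "slobodeckij_integral s p a b (\<lambda>\<xi>. f (c + \<xi>)) = (\<integral>\<^sup>+t. G (c + 1 * t) * indicator {a + c<..<b + c} (c + 1 * t) \<partial>lborel)"
    unfolding slobodeckij_integral_kernel by (auto intro!: nn_integral_cong simp: indicator_def)
  also have "\<dots> = (\<integral>\<^sup>+t. G t * indicator {a + c<..<b + c} t \<partial>lborel)"
    by (subst nn_integral_real_affine[of "\<lambda>t. G t * indicator {a + c<..<b + c} t" 1 c]) auto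
  finally show ?thesis unfolding slobodeckij_integral_kernel G_def .
qed

section \<open>The phase space as a seminormed space of representatives\<close>

locale phase = hysteretic T k A B \<alpha> \<beta> m
  for T :: real and k :: "real ^ 'n" and A B :: "real ^ 'n ^ 'n" and \<alpha> \<beta> :: real and m :: "real ^ 'n" +
  fixes s p \<sigma> :: real
  assumes s: "0 < s" "s < 1" and p: "1 < p" and sp: "s * p < 1" and \<sigma>: "0 < \<sigma>" "\<sigma> \<le> T / 3"
begin

abbreviation "BS \<equiv> (Bsp T s p \<sigma> :: (real \<Rightarrow> real ^ 'n) set)"
abbreviation "bnorm \<equiv> (Bsp_norm T s p \<sigma> :: (real \<Rightarrow> real ^ 'n) \<Rightarrow> real)"
abbreviation "PS \<equiv> (phase_space T s p \<sigma> :: ((real \<Rightarrow> real ^ 'n) \<times> (real ^ 'n)) set)"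
abbreviation "pdist \<equiv> (phase_dist T s p \<sigma> :: (real \<Rightarrow> real ^ 'n) \<times> (real ^ 'n) \<Rightarrow> (real \<Rightarrow> real ^ 'n) \<times> (real ^ 'n) \<Rightarrow> real)"
abbreviation "pnorm \<equiv> (phase_norm T s p \<sigma> :: (real \<Rightarrow> real ^ 'n) \<times> (real ^ 'n) \<Rightarrow> real)"

lemma p_pos: "p > 0" "p \<ge> 1" using p by auto
lemma sp_pos: "0 < s * p" using s p by simp
lemma win: "- 2 * T \<le> - T - \<sigma>" "- T - \<sigma> < 0" using \<sigma> T_pos by auto

lemma Bsp_iff: "\<phi> \<in> BS \<longleftrightarrow> (\<forall>i. (\<lambda>t. \<phi> t $ i) \<in> Lp p (-2 * T) 0 \<and> (\<lambda>t. \<phi> t $ i) \<in> Wsp s p (- T - \<sigma>) 0)"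
  by (auto simp: Bsp_def vec_space_def)

lemma PS_iff: "z \<in> PS \<longleftrightarrow> fst z \<in> BS"
  by (cases z) (auto simp: phase_space_def)

lemma Bsp_Lp: "\<phi> \<in> BS \<Longrightarrow> \<phi> \<in> vec_space (Lp p (-2 * T) 0)"
  by (simp add: Bsp_def)

lemma Bsp_cong:
  assumes eq: "\<And>\<xi>. -2 * T < \<xi> \<Longrightarrow> \<xi> < 0 \<Longrightarrow> \<phi> \<xi> = \<psi> \<xi>"
  shows "\<phi> \<in> BS \<longleftrightarrow> \<psi> \<in> BS" "bnorm \<phi> = bnorm \<psi>"
proof -
  have 1: "cut (-2 * T) 0 (\<lambda>t. \<phi> t $ i) = cut (-2 * T) 0 (\<lambda>t. \<psi> t $ i)"
    "cut (- T - \<sigma>) 0 (\<lambda>t. \<phi> t $ i) = cut (- T - \<sigma>) 0 (\<lambda>t. \<psi> t $ i)" for i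
    using eq win by (auto intro!: cut_cong)
  have 2: "slobodeckij_integral s p (- T - \<sigma>) 0 (\<lambda>t. \<phi> t $ i) = slobodeckij_integral s p (- T - \<sigma>) 0 (\<lambda>t. \<psi> t $ i)" for i
    using eq win by (intro slobodeckij_integral_cong) auto
  show "\<phi> \<in> BS \<longleftrightarrow> \<psi> \<in> BS" by (simp only: Bsp_iff Wsp_def Lp_iff 1 2 mem_Collect_eq)
  show "bnorm \<phi> = bnorm \<psi>" by (simp only: Bsp_norm_def vec_norm_def Wsp_norm_def Lp_norm_eq 1 2)
qed

lemma bnorm_nonneg [simp]: "bnorm \<phi> \<ge> 0"
  by (auto simp: Bsp_norm_def vec_norm_def Wsp_norm_nonneg intro!: add_nonneg_nonneg sum_nonneg)

lemma Bsp_add: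
  assumes "\<phi> \<in> BS" "\<psi> \<in> BS"
  shows "(\<lambda>\<xi>. \<phi> \<xi> + \<psi> \<xi>) \<in> BS" "bnorm (\<lambda>\<xi>. \<phi> \<xi> + \<psi> \<xi>) \<le> bnorm \<phi> + bnorm \<psi>"
proof -
  have L: "(\<lambda>t. \<phi> t $ i) \<in> Lp p (-2 * T) 0" "(\<lambda>t. \<psi> t $ i) \<in> Lp p (-2 * T) 0"
    and W: "(\<lambda>t. \<phi> t $ i) \<in> Wsp s p (- T - \<sigma>) 0" "(\<lambda>t. \<psi> t $ i) \<in> Wsp s p (- T - \<sigma>) 0" for i
    using assms by (auto simp: Bsp_iff)
  show "(\<lambda>\<xi>. \<phi> \<xi> + \<psi> \<xi>) \<in> BS"
    using Lp_add(1)[OF p_pos(2) L] Wsp_add(1)[OF p_pos(2) W] by (simp add: Bsp_iff)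
  show "bnorm (\<lambda>\<xi>. \<phi> \<xi> + \<psi> \<xi>) \<le> bnorm \<phi> + bnorm \<psi>"
  proof -
    have "(\<Sum>i\<in>UNIV. Lp_norm p (-2 * T) 0 (\<lambda>t. (\<phi> t + \<psi> t) $ i)) \<le> (\<Sum>i\<in>UNIV. Lp_norm p (-2 * T) 0 (\<lambda>t. \<phi> t $ i) + Lp_norm p (-2 * T) 0 (\<lambda>t. \<psi> t $ i))"
      using Lp_add(2)[OF p_pos(2) L] by (intro sum_mono) simp
    moreover have "(\<Sum>i\<in>UNIV. Wsp_norm s p (- T - \<sigma>) 0 (\<lambda>t. (\<phi> t + \<psi> t) $ i)) \<le> (\<Sum>i\<in>UNIV. Wsp_norm s p (- T - \<sigma>) 0 (\<lambda>t. \<phi> t $ i) + Wsp_norm s p (- T - \<sigma>) 0 (\<lambda>t. \<psi> t $ i))"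
      using Wsp_add(2)[OF p_pos(2) W] by (intro sum_mono) simp
    ultimately show ?thesis unfolding Bsp_norm_def vec_norm_def sum.distrib by linarith
  qed
qed

lemma Bsp_uminus:
  assumes "\<phi> \<in> BS"
  shows "(\<lambda>\<xi>. - \<phi> \<xi>) \<in> BS" "bnorm (\<lambda>\<xi>. - \<phi> \<xi>) = bnorm \<phi>"
proof -
  have L: "(\<lambda>t. \<phi> t $ i) \<in> Lp p (-2 * T) 0" and W: "(\<lambda>t. \<phi> t $ i) \<in> Wsp s p (- T - \<sigma>) 0" for i
    using assms by (auto simp: Bsp_iff)
  show "(\<lambda>\<xi>. - \<phi> \<xi>) \<in> BS" using L Wsp_uminus(1)[OF p_pos(1) W] by (simp add: Bsp_iff Lp_uminus)
  show "bnorm (\<lambda>\<xi>. - \<phi> \<xi>) = bnorm \<phi>"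
    by (simp add: Bsp_norm_def vec_norm_def Lp_uminus Wsp_uminus(2)[OF p_pos(1) W])
qed

lemma Bsp_diff:
  assumes "\<phi> \<in> BS" "\<psi> \<in> BS"
  shows "(\<lambda>\<xi>. \<phi> \<xi> - \<psi> \<xi>) \<in> BS"
  using Bsp_add(1)[OF assms(1) Bsp_uminus(1)[OF assms(2)]] by simp

lemma pdist_alt: "pdist z w = bnorm (\<lambda>\<xi>. fst z \<xi> - fst w \<xi>) + norm (snd z - snd w)"
  by (simp add: phase_dist_def phase_norm_def)

lemma pdist_nonneg [simp]: "pdist z w \<ge> 0"
  by (simp add: pdist_alt)

lemma pdist_sym:
  assumes "z \<in> PS" "w \<in> PS"
  shows "pdist z w = pdist w z"
  using Bsp_uminus(2)[OF Bsp_diff[of "fst z" "fst w"]] assms by (simp add: pdist_alt PS_iff norm_minus_commute)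

lemma pdist_triangle:
  assumes "z \<in> PS" "w \<in> PS" "v \<in> PS"
  shows "pdist z v \<le> pdist z w + pdist w v"
proof -
  have "bnorm (\<lambda>\<xi>. (fst z \<xi> - fst w \<xi>) + (fst w \<xi> - fst v \<xi>)) \<le> bnorm (\<lambda>\<xi>. fst z \<xi> - fst w \<xi>) + bnorm (\<lambda>\<xi>. fst w \<xi> - fst v \<xi>)"
    using assms by (intro Bsp_add(2) Bsp_diff) (auto simp: PS_iff)
  moreover have "norm (snd z - snd v) \<le> norm (snd z - snd w) + norm (snd w - snd v)"
    using norm_triangle_ineq[of "snd z - snd w" "snd w - snd v"] by simp
  ultimately show ?thesis by (simp add: pdist_alt)
qed

lemma norm_snd_le: "norm (snd z - snd w) \<le> pdist z w"
  by (simp add: pdist_alt)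

text \<open>Representatives of the same point of the phase space.\<close>

definition phase_eq :: "(real \<Rightarrow> real ^ 'n) \<times> (real ^ 'n) \<Rightarrow> (real \<Rightarrow> real ^ 'n) \<times> (real ^ 'n) \<Rightarrow> bool" where
  "phase_eq z w \<longleftrightarrow> snd z = snd w \<and> (\<forall>\<xi>. -2 * T < \<xi> \<and> \<xi> < 0 \<longrightarrow> fst z \<xi> = fst w \<xi>)"

lemma phase_eq_PS: "phase_eq z w \<Longrightarrow> z \<in> PS \<longleftrightarrow> w \<in> PS"
  unfolding PS_iff by (rule Bsp_cong(1)) (simp add: phase_eq_def)

lemma phase_eq_dist:
  assumes "phase_eq z w"
  shows "pdist z v = pdist w v" "pdist v z = pdist v w"
proof -
  have "bnorm (\<lambda>\<xi>. fst z \<xi> - fst v \<xi>) = bnorm (\<lambda>\<xi>. fst w \<xi> - fst v \<xi>)"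
    "bnorm (\<lambda>\<xi>. fst v \<xi> - fst z \<xi>) = bnorm (\<lambda>\<xi>. fst v \<xi> - fst w \<xi>)"
    using assms by (auto intro!: Bsp_cong(2) simp: phase_eq_def)
  then show "pdist z v = pdist w v" "pdist v z = pdist v w"
    using assms by (simp_all add: pdist_alt phase_eq_def)
qed

lemma phase_eq_refl [simp]: "phase_eq z z" by (simp add: phase_eq_def)
lemma phase_eq_sym: "phase_eq z w \<Longrightarrow> phase_eq w z" by (simp add: phase_eq_def)

text \<open>The factor 3 counts, for each component, the L_p norm on \<open>(-2T, 0)\<close> and the
  two parts of the W^s_p norm.\<close>

lemma Bsp_boundI:
  fixes D :: real
  assumes meas: "\<And>i. cut (-2 * T) 0 (\<lambda>t. \<phi> t $ i) \<in> borel_measurable borel"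
    and I: "\<And>i. pow_int p lborel (cut (-2 * T) 0 (\<lambda>t. \<phi> t $ i)) \<le> ennreal (D powr p)"
    and S: "\<And>i. slobodeckij_integral s p (- T - \<sigma>) 0 (\<lambda>t. \<phi> t $ i) \<le> ennreal (D powr p)" and D: "D \<ge> 0"
  shows "\<phi> \<in> BS" "bnorm \<phi> \<le> 3 * CARD('n) * D"
proof -
  have m: "cut (- T - \<sigma>) 0 (\<lambda>t. \<phi> t $ i) \<in> borel_measurable borel" for i
    by (rule cut_subset_measurable[OF meas]) (use win in auto)
  have L: "(\<lambda>t. \<phi> t $ i) \<in> Lp p (-2 * T) 0" "(\<lambda>t. \<phi> t $ i) \<in> Lp p (- T - \<sigma>) 0" for i
  proof -
    show 1: "(\<lambda>t. \<phi> t $ i) \<in> Lp p (-2 * T) 0"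
      using meas I[of i] by (auto simp: Lp_iff intro: order_le_less_trans)
    show "(\<lambda>t. \<phi> t $ i) \<in> Lp p (- T - \<sigma>) 0" by (rule Lp_subset[OF 1]) (use win in auto)
  qed
  have W: "(\<lambda>t. \<phi> t $ i) \<in> Wsp s p (- T - \<sigma>) 0" for i
    using L(2)[of i] S[of i] by (auto simp: Wsp_def intro: order_le_less_trans)
  show "\<phi> \<in> BS" using L W by (simp add: Bsp_iff)
  have 1: "Lp_norm p (-2 * T) 0 (\<lambda>t. \<phi> t $ i) \<le> D" for i
    unfolding Lp_norm_eq by (intro pow_norm_leI I p_pos D)
  have 2: "Wsp_norm s p (- T - \<sigma>) 0 (\<lambda>t. \<phi> t $ i) \<le> D + D" for i
    unfolding Wsp_norm_eq[OF p_pos(1) L(2)]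
  proof (intro add_mono pow_norm_leI p_pos D)
    show "pow_int p lborel (cut (- T - \<sigma>) 0 (\<lambda>t. \<phi> t $ i)) \<le> ennreal (D powr p)"
      by (rule order_trans[OF pow_int_cut_mono I[of i]]) (use win in auto)
    show "pow_int p (lborel \<Otimes>\<^sub>M lborel) (slob_quot s p (- T - \<sigma>) 0 (\<lambda>t. \<phi> t $ i)) \<le> ennreal (D powr p)"
      using S[of i] by (simp add: slobodeckij_integral_eq[OF m p_pos(1)])
  qed
  have "bnorm \<phi> \<le> (\<Sum>i\<in>(UNIV :: 'n set). D) + (\<Sum>i\<in>(UNIV :: 'n set). D + D)"
    unfolding Bsp_norm_def vec_norm_def using 1 2 by (intro add_mono sum_mono)
  then show "bnorm \<phi> \<le> 3 * CARD('n) * D" by (simp add: algebra_simps)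
qed

lemma Bsp_boundD:
  assumes \<phi>: "\<phi> \<in> BS" and le: "bnorm \<phi> \<le> D"
  shows "cut (-2 * T) 0 (\<lambda>t. \<phi> t $ i) \<in> borel_measurable borel"
    "pow_int p lborel (cut (-2 * T) 0 (\<lambda>t. \<phi> t $ i)) \<le> ennreal (D powr p)"
    "slobodeckij_integral s p (- T - \<sigma>) 0 (\<lambda>t. \<phi> t $ i) \<le> ennreal (D powr p)"
proof -
  have D: "D \<ge> 0" using le bnorm_nonneg[of \<phi>] by linarith
  have L: "(\<lambda>t. \<phi> t $ i) \<in> Lp p (-2 * T) 0" and W: "(\<lambda>t. \<phi> t $ i) \<in> Wsp s p (- T - \<sigma>) 0"
    using \<phi> by (auto simp: Bsp_iff)
  have L2: "(\<lambda>t. \<phi> t $ i) \<in> Lp p (- T - \<sigma>) 0" using W by (simp add: Wsp_def)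
  show "cut (-2 * T) 0 (\<lambda>t. \<phi> t $ i) \<in> borel_measurable borel" using L by (simp add: Lp_iff)
  have a: "Lp_norm p (-2 * T) 0 (\<lambda>t. \<phi> t $ i) \<le> (\<Sum>i\<in>UNIV. Lp_norm p (-2 * T) 0 (\<lambda>t. \<phi> t $ i))"
    by (rule member_le_sum) (auto simp: Wsp_norm_nonneg)
  have b: "Wsp_norm s p (- T - \<sigma>) 0 (\<lambda>t. \<phi> t $ i) \<le> (\<Sum>i\<in>UNIV. Wsp_norm s p (- T - \<sigma>) 0 (\<lambda>t. \<phi> t $ i))"
    by (rule member_le_sum) (auto simp: Wsp_norm_nonneg)
  have nn: "(\<Sum>i\<in>UNIV. Lp_norm p (-2 * T) 0 (\<lambda>t. \<phi> t $ i)) \<ge> 0" "(\<Sum>i\<in>UNIV. Wsp_norm s p (- T - \<sigma>) 0 (\<lambda>t. \<phi> t $ i)) \<ge> 0"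
    by (auto intro!: sum_nonneg simp: Wsp_norm_nonneg)
  have "Lp_norm p (-2 * T) 0 (\<lambda>t. \<phi> t $ i) \<le> D" "Wsp_norm s p (- T - \<sigma>) 0 (\<lambda>t. \<phi> t $ i) \<le> D"
    using le a b nn unfolding Bsp_norm_def vec_norm_def by linarith+
  moreover have "pow_norm p (lborel \<Otimes>\<^sub>M lborel) (slob_quot s p (- T - \<sigma>) 0 (\<lambda>t. \<phi> t $ i)) \<le> Wsp_norm s p (- T - \<sigma>) 0 (\<lambda>t. \<phi> t $ i)"
    by (simp add: Wsp_norm_eq[OF p_pos(1) L2])
  ultimately have "pow_norm p lborel (cut (-2 * T) 0 (\<lambda>t. \<phi> t $ i)) \<le> D"
    "pow_norm p (lborel \<Otimes>\<^sub>M lborel) (slob_quot s p (- T - \<sigma>) 0 (\<lambda>t. \<phi> t $ i)) \<le> D"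
    by (simp_all add: Lp_norm_eq)
  then show "pow_int p lborel (cut (-2 * T) 0 (\<lambda>t. \<phi> t $ i)) \<le> ennreal (D powr p)"
    "slobodeckij_integral s p (- T - \<sigma>) 0 (\<lambda>t. \<phi> t $ i) \<le> ennreal (D powr p)"
    using L L2 W D p_pos by (simp_all add: pow_norm_le_iff Lp_iff Wsp_iff slobodeckij_integral_eq)
qed

section \<open>States of a Lipschitz function\<close>

text \<open>A Lipschitz bound satisfies the Hoelder condition with excess \<open>p - s * p\<close>.
  The interval is open on the left because a history carries no value at
  \<open>- 2 * T\<close>.\<close>

lemma state_lipschitz_PS:
  fixes f :: "real \<Rightarrow> real ^ 'n"
  assumes lip: "\<And>t t'. t \<in> {a<..b} \<Longrightarrow> t' \<in> {a<..b} \<Longrightarrow> norm (f t - f t') \<le> L * \<bar>t - t'\<bar>"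
    and t: "a + 2 * T \<le> t" "t \<le> b"
  shows "state f t \<in> PS"
proof -
  define M where "M = \<bar>L\<bar> * (b - a) + norm (f t)"
  have tab: "t \<in> {a<..b}" using t T_pos by auto
  have L: "norm (f r - f r') \<le> \<bar>L\<bar> * \<bar>r - r'\<bar>" if "r \<in> {a<..b}" "r' \<in> {a<..b}" for r r'
    using lip[OF that] by (rule order_trans) (intro mult_right_mono, auto)
  have M: "norm (f r) \<le> M" if r: "r \<in> {a<..b}" for r
  proof -
    have "norm (f r) \<le> norm (f t) + norm (f r - f t)" by (rule norm_triangle_sub)
    also have "norm (f r - f t) \<le> \<bar>L\<bar> * \<bar>r - t\<bar>" by (rule L[OF r tab])
    also have "\<dots> \<le> \<bar>L\<bar> * (b - a)" using r tab by (intro mult_left_mono) auto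
    finally show ?thesis by (simp add: M_def)
  qed
  have M0: "M \<ge> 0" using M[OF tab] norm_ge_zero[of "f t"] by linarith
  have fc: "continuous_on {a<..b} f"
    by (rule lipschitz_on_continuous_on[of "\<bar>L\<bar>"]) (auto simp: lipschitz_on_def dist_norm intro: L)
  \<comment> \<open>The L_p bound plus the seminorm bound, so that one p-th root dominates
    both.\<close>
  define K where "K = M powr p * (2 * T) + (0 - (- T - \<sigma>)) * (\<bar>L\<bar> powr p * (2 * (0 - (- T - \<sigma>)) powr (p - s * p) / (p - s * p)))"
  have psp: "p - s * p > 0" using s p by simp
  have K0: "M powr p * (2 * T) \<ge> 0" "(0 - (- T - \<sigma>)) * (\<bar>L\<bar> powr p * (2 * (0 - (- T - \<sigma>)) powr (p - s * p) / (p - s * p))) \<ge> 0"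
    using T_pos \<sigma> psp by auto
  have rt: "t + \<xi> \<in> {a<..b}" if "- 2 * T < \<xi>" "\<xi> < 0" for \<xi> using t that by auto
  have "(\<lambda>\<xi>. f (t + \<xi>)) \<in> BS"
  proof (rule Bsp_boundI(1)[of _ "K powr (1 / p)"])
    have KK: "(K powr (1 / p)) powr p = K" using K0 p_pos by (simp add: powr_powr K_def)
    fix i
    show "cut (-2 * T) 0 (\<lambda>\<xi>. f (t + \<xi>) $ i) \<in> borel_measurable borel"
      by (intro cut_continuous_measurable continuous_intros continuous_on_compose2[OF fc]) (use rt in auto)
    have "pow_int p lborel (cut (-2 * T) 0 (\<lambda>\<xi>. f (t + \<xi>) $ i)) \<le> ennreal (M powr p * (0 - (- 2 * T)))"
    proof (rule pow_int_cut_bounded)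
      fix \<xi> assume "\<xi> \<in> {- 2 * T<..<0}"
      then show "\<bar>f (t + \<xi>) $ i\<bar> \<le> M" using component_le_norm_cart[of "f (t + \<xi>)" i] M[OF rt[of \<xi>]] by auto
    qed (use T_pos p in auto)
    then show "pow_int p lborel (cut (-2 * T) 0 (\<lambda>\<xi>. f (t + \<xi>) $ i)) \<le> ennreal ((K powr (1 / p)) powr p)"
      unfolding KK using K0 by (auto simp: K_def intro: order_trans ennreal_leI)
    have "slobodeckij_integral s p (- T - \<sigma>) 0 (\<lambda>\<xi>. f (t + \<xi>) $ i)
       \<le> ennreal ((0 - (- T - \<sigma>)) * (\<bar>L\<bar> powr p * (2 * (0 - (- T - \<sigma>)) powr (p - s * p) / (p - s * p))))"
    proof (rule slobodeckij_integral_hoelder)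
      fix \<xi> \<eta> assume *: "\<xi> \<in> {- T - \<sigma><..<0}" "\<eta> \<in> {- T - \<sigma><..<0}"
      have "\<bar>f (t + \<xi>) $ i - f (t + \<eta>) $ i\<bar> \<le> norm (f (t + \<xi>) - f (t + \<eta>))"
        using component_le_norm_cart[of "f (t + \<xi>) - f (t + \<eta>)" i] by simp
      also have "\<dots> \<le> \<bar>L\<bar> * \<bar>\<xi> - \<eta>\<bar>" using L[OF rt[of \<xi>] rt[of \<eta>]] * win by auto
      finally have "\<bar>f (t + \<xi>) $ i - f (t + \<eta>) $ i\<bar> powr p \<le> (\<bar>L\<bar> * \<bar>\<xi> - \<eta>\<bar>) powr p" using p by (intro powr_mono2) auto
      also have "\<dots> = \<bar>L\<bar> powr p * \<bar>\<xi> - \<eta>\<bar> powr p" by (simp add: powr_mult)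
      finally show "\<bar>f (t + \<xi>) $ i - f (t + \<eta>) $ i\<bar> powr p \<le> \<bar>L\<bar> powr p * \<bar>\<xi> - \<eta>\<bar> powr (p - s * p + s * p)" by simp
    qed (use psp win in auto)
    then show "slobodeckij_integral s p (- T - \<sigma>) 0 (\<lambda>\<xi>. f (t + \<xi>) $ i) \<le> ennreal ((K powr (1 / p)) powr p)"
      unfolding KK using K0 by (auto simp: K_def intro: order_trans ennreal_leI)
  qed auto
  then show ?thesis by (simp add: state_def PS_iff)
qed

text \<open>Interpolating between \<open>|\<Delta>| \<le> Lh\<close> and the Lipschitz bound, for \<open>\<Delta> = f(t + \<cdot>) - f(t' + \<cdot>)\<close>, \<open>h = |t - t'|\<close>.\<close>

lemma state_lipschitz_dist:
  fixes f :: "real \<Rightarrow> real ^ 'n"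
  assumes lip: "\<And>t t'. t \<in> {a<..b} \<Longrightarrow> t' \<in> {a<..b} \<Longrightarrow> norm (f t - f t') \<le> L * \<bar>t - t'\<bar>" and L: "L > 0"
    and \<epsilon>: "\<epsilon> > 0"
  obtains \<delta> where "\<delta> > 0" "\<And>t t'. t \<in> {a + 2 * T..b} \<Longrightarrow> t' \<in> {a + 2 * T..b} \<Longrightarrow> \<bar>t - t'\<bar> < \<delta> \<Longrightarrow> pdist (state f t) (state f t') < \<epsilon>"
proof -
  \<comment> \<open>Half of the surplus \<open>p - s * p\<close>. In the p-th power, the exponent
    \<gamma> is spent on the smallness \<open>2 * L * h\<close> and the remaining
    \<open>\<gamma> + s * p\<close> on the Lipschitz bound, which keeps the kernel
    integrable.\<close>
  define \<gamma> where "\<gamma> = p * (1 - s) / 2"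
  have \<gamma>: "\<gamma> > 0" "\<gamma> + (\<gamma> + s * p) = p" using s p by (auto simp: \<gamma>_def field_simps)
  define l where "l = 0 - (- T - \<sigma>)"
  have l: "l > 0" using win by (simp add: l_def)
  define E where "E = \<epsilon> / (6 * CARD('n))"
  have E: "E > 0" using \<epsilon> by (simp add: E_def)
  define Ch where "Ch h = (L * h) powr p * (2 * T)" for h
  define Cs where "Cs h = l * (((2 * L * h) powr \<gamma> * (2 * L) powr (\<gamma> + s * p)) * (2 * l powr \<gamma> / \<gamma>))" for h
  have "((\<lambda>h. max (max (Ch h) (Cs h)) (L * h)) \<longlongrightarrow> max (max (Ch 0) (Cs 0)) (L * 0)) (at_right 0)"
    unfolding Ch_def Cs_def using p \<gamma> L by (auto intro!: tendsto_eq_intros tendsto_powr2 simp: eventually_at_right_less[of 0, THEN eventually_mono])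
  moreover have "max (max (Ch 0) (Cs 0)) (L * 0) < min (E powr p) (\<epsilon> / 2)" using E \<epsilon> by (simp add: Ch_def Cs_def)
  ultimately have "\<forall>\<^sub>F h in at_right 0. max (max (Ch h) (Cs h)) (L * h) < min (E powr p) (\<epsilon> / 2)"
    by (rule order_tendstoD(2))
  then obtain \<delta> where \<delta>: "\<delta> > 0" "\<And>h. 0 < h \<Longrightarrow> h < \<delta> \<Longrightarrow> max (max (Ch h) (Cs h)) (L * h) < min (E powr p) (\<epsilon> / 2)"
    unfolding eventually_at_right_field by auto
  have main: "pdist (state f t) (state f t') < \<epsilon>" if t: "t \<in> {a + 2 * T..b}" "t' \<in> {a + 2 * T..b}" and d: "\<bar>t - t'\<bar> < \<delta>" for t t'
  \<comment> \<open>The limit at 0 from the right says nothing about \<open>h = 0\<close>.\<close>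
  proof (cases "t = t'")
    case True
    have "bnorm (\<lambda>\<xi>. f (t' + \<xi>) - f (t' + \<xi>)) \<le> 3 * CARD('n) * (0 :: real)"
      by (rule Bsp_boundI(2)) (auto simp: cut_def[abs_def] pow_int_def slobodeckij_integral_def)
    then show ?thesis using \<epsilon> True bnorm_nonneg[of "\<lambda>\<xi>. 0"] by (simp add: pdist_alt state_def)
  next
    case False
    define h where "h = \<bar>t - t'\<bar>"
    have h: "0 < h" "h < \<delta>" using False d by (auto simp: h_def)
    have small: "Ch h \<le> E powr p" "Cs h \<le> E powr p" "L * h < \<epsilon> / 2" using \<delta>(2)[OF h] by auto
    have rt: "t + \<xi> \<in> {a<..b}" "t' + \<xi> \<in> {a<..b}" if "- 2 * T < \<xi>" "\<xi> \<le> 0" for \<xi> using t that by auto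
    define \<Delta> where "\<Delta> \<xi> = f (t + \<xi>) - f (t' + \<xi>)" for \<xi>
    have fc: "continuous_on {a<..b} f"
      by (rule lipschitz_on_continuous_on[of L]) (use L in \<open>auto simp: lipschitz_on_def dist_norm intro: lip\<close>)
    have \<Delta>: "norm (\<Delta> \<xi>) \<le> L * h" if "- 2 * T < \<xi>" "\<xi> \<le> 0" for \<xi>
      using lip[OF rt[OF that]] by (simp add: \<Delta>_def h_def)
    have "bnorm \<Delta> \<le> 3 * CARD('n) * E"
    proof (rule Bsp_boundI(2))
      fix i
      show "cut (-2 * T) 0 (\<lambda>\<xi>. \<Delta> \<xi> $ i) \<in> borel_measurable borel" unfolding \<Delta>_def
        by (intro cut_continuous_measurable continuous_intros continuous_on_compose2[OF fc]) (use rt in auto)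
      have "pow_int p lborel (cut (-2 * T) 0 (\<lambda>\<xi>. \<Delta> \<xi> $ i)) \<le> ennreal ((L * h) powr p * (0 - (- 2 * T)))"
      proof (rule pow_int_cut_bounded)
        fix \<xi> assume "\<xi> \<in> {- 2 * T<..<0}"
        then show "\<bar>\<Delta> \<xi> $ i\<bar> \<le> L * h" using component_le_norm_cart[of "\<Delta> \<xi>" i] \<Delta>[of \<xi>] by auto
      qed (use T_pos p in auto)
      also have "\<dots> \<le> ennreal (E powr p)" using small by (intro ennreal_leI) (simp add: Ch_def)
      finally show "pow_int p lborel (cut (-2 * T) 0 (\<lambda>\<xi>. \<Delta> \<xi> $ i)) \<le> ennreal (E powr p)" .
      have "slobodeckij_integral s p (- T - \<sigma>) 0 (\<lambda>\<xi>. \<Delta> \<xi> $ i)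
        \<le> ennreal ((0 - (- T - \<sigma>)) * (((2 * L * h) powr \<gamma> * (2 * L) powr (\<gamma> + s * p)) * (2 * (0 - (- T - \<sigma>)) powr \<gamma> / \<gamma>)))"
      proof (rule slobodeckij_integral_hoelder)
        fix \<xi> \<eta> assume *: "\<xi> \<in> {- T - \<sigma><..<0}" "\<eta> \<in> {- T - \<sigma><..<0}"
        then have r: "- 2 * T < \<xi>" "\<xi> \<le> 0" "- 2 * T < \<eta>" "\<eta> \<le> 0" using win by auto
        let ?x = "\<bar>\<Delta> \<xi> $ i - \<Delta> \<eta> $ i\<bar>"
        have x: "?x \<le> norm (\<Delta> \<xi> - \<Delta> \<eta>)" using component_le_norm_cart[of "\<Delta> \<xi> - \<Delta> \<eta>" i] by simp
        have "norm (\<Delta> \<xi> - \<Delta> \<eta>) \<le> norm (\<Delta> \<xi>) + norm (\<Delta> \<eta>)" by (rule norm_triangle_ineq4)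
        then have 1: "?x \<le> 2 * L * h" using x \<Delta>[of \<xi>] \<Delta>[of \<eta>] r by linarith
        have "\<Delta> \<xi> - \<Delta> \<eta> = (f (t + \<xi>) - f (t + \<eta>)) - (f (t' + \<xi>) - f (t' + \<eta>))" by (simp add: \<Delta>_def)
        then have "norm (\<Delta> \<xi> - \<Delta> \<eta>) \<le> norm (f (t + \<xi>) - f (t + \<eta>)) + norm (f (t' + \<xi>) - f (t' + \<eta>))"
          by (simp only: norm_triangle_ineq4)
        then have 2: "?x \<le> 2 * L * \<bar>\<xi> - \<eta>\<bar>"
          using x lip[OF rt(1)[of \<xi>] rt(1)[of \<eta>]] lip[OF rt(2)[of \<xi>] rt(2)[of \<eta>]] r by simp
        have "?x powr p = ?x powr \<gamma> * ?x powr (\<gamma> + s * p)" using \<gamma> by (simp flip: powr_add)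
        also have "\<dots> \<le> (2 * L * h) powr \<gamma> * (2 * L * \<bar>\<xi> - \<eta>\<bar>) powr (\<gamma> + s * p)"
          using 1 2 \<gamma> sp_pos by (intro mult_mono powr_mono2) auto
        also have "(2 * L * \<bar>\<xi> - \<eta>\<bar>) powr (\<gamma> + s * p) = (2 * L) powr (\<gamma> + s * p) * \<bar>\<xi> - \<eta>\<bar> powr (\<gamma> + s * p)"
          using L by (subst powr_mult) auto
        finally show "?x powr p \<le> ((2 * L * h) powr \<gamma> * (2 * L) powr (\<gamma> + s * p)) * \<bar>\<xi> - \<eta>\<bar> powr (\<gamma> + s * p)"
          by (simp add: mult.assoc)
      qed (use \<gamma> win in auto)
      also have "\<dots> \<le> ennreal (E powr p)" using small by (intro ennreal_leI) (simp add: Cs_def l_def)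
      finally show "slobodeckij_integral s p (- T - \<sigma>) 0 (\<lambda>\<xi>. \<Delta> \<xi> $ i) \<le> ennreal (E powr p)" .
    qed (use E in auto)
    also have "3 * CARD('n) * E = \<epsilon> / 2" by (simp add: E_def)
    finally have "bnorm \<Delta> \<le> \<epsilon> / 2" .
    moreover have "norm (f t - f t') \<le> L * h" using \<Delta>[of 0] T_pos by (simp add: \<Delta>_def)
    ultimately show ?thesis using small by (simp add: pdist_alt state_def \<Delta>_def[abs_def])
  qed
  show thesis by (rule that[OF \<delta>(1) main])
qed

end

section \<open>Continuous dependence of states on the initial data\<close>

context phase
begin

text \<open>Constants for the difference of two flights on \<open>[0, 2T]\<close>: its supremum, and
  the p-th power integral of a majorant of its derivative. The factor
  \<open>CARD('n) * (2 * T + 1)\<close> passes from the L_p norm of the history to its L_1 norm, as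
  in \<open>Lp_abs_integral\<close>.\<close>

definition "C_sup = 2 * (1 + KA * (CARD('n) * (2 * T + 1))) * exp (growth * (2 * T))"
definition "C_deriv = 2 powr (p - 1) * ((KB * C_sup) powr p * (2 * T) + KA powr p * CARD('n) powr p * CARD('n))"

lemma C_sup_nonneg: "C_sup \<ge> 0" and C_deriv_nonneg: "C_deriv \<ge> 0"
  using T_pos by (auto simp: C_sup_def C_deriv_def intro!: mult_nonneg_nonneg add_nonneg_nonneg)

end

text \<open>Both solutions are driven by the same relay function, so that the term with
  \<open>k\<close> cancels and the difference depends linearly on the difference of the initial
  data, measured by \<open>D\<close>.\<close>

locale solution_pair = phase T k A B \<alpha> \<beta> m s p \<sigma>
  for T :: real and k :: "real ^ 'n" and A B :: "real ^ 'n ^ 'n" and \<alpha> \<beta> :: real and m :: "real ^ 'n" and s p \<sigma> :: real +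
  fixes h :: "real \<Rightarrow> real" and \<phi> \<phi>' :: "real \<Rightarrow> real ^ 'n" and x x' :: "real ^ 'n" and u u' and D :: real
  assumes u: "delay_sol h \<phi> x u" and u': "delay_sol h \<phi>' x' u'" and D: "D > 0"
    and \<phi>: "\<phi> \<in> BS" "\<phi>' \<in> BS" and close: "pdist (\<phi>, x) (\<phi>', x') \<le> D"
begin

definition "\<nu> \<xi> = \<phi> \<xi> - \<phi>' \<xi>"
definition "v t = u t - u' t"

lemma nu_BS: "\<nu> \<in> BS" unfolding \<nu>_def[abs_def] by (intro Bsp_diff \<phi>)

lemma nu_norm: "bnorm \<nu> \<le> D" and xx: "norm (x - x') \<le> D"
proof -
  have "bnorm \<nu> + norm (x - x') \<le> D" using close by (simp add: pdist_alt \<nu>_def[abs_def])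
  then show "bnorm \<nu> \<le> D" "norm (x - x') \<le> D" using bnorm_nonneg[of \<nu>] norm_ge_zero[of "x - x'"] by linarith+
qed

lemmas nu_bounds = Bsp_boundD[OF nu_BS nu_norm]

lemma v_history: "- 2 * T < t \<Longrightarrow> t < 0 \<Longrightarrow> v t = \<nu> t"
  using delay_solD(1)[OF u] delay_solD(1)[OF u'] by (simp add: v_def \<nu>_def)

lemma v_cont: "continuous_on {0..} v"
  unfolding v_def[abs_def] by (intro continuous_intros delay_solD(2)[OF u] delay_solD(2)[OF u'])

definition "w r = rhs h u r - rhs h u' r"

lemma w_integral: "t \<ge> 0 \<Longrightarrow> (w has_integral (v t - (x - x'))) {0..t}"
  using has_integral_diff[OF delay_solD(4)[OF u, of t] delay_solD(4)[OF u', of t]]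
  by (simp add: w_def[abs_def] v_def algebra_simps)

lemma w_eq: "0 < r \<Longrightarrow> r < 2 * T \<Longrightarrow> w r = hist \<nu> r - B *v v r"
  using v_history[of "r - 2 * T"] by (simp add: w_def rhs_diff hist_def) (simp add: v_def)

lemma hist_le: "norm (hist \<nu> r) \<le> KA * (\<Sum>j\<in>UNIV. \<bar>cut (-2 * T) 0 (\<lambda>t. \<nu> t $ j) (r - 2 * T)\<bar>)"
proof (cases "r \<in> {0<..<2 * T}")
  case True
  have "norm (hist \<nu> r) \<le> KA * norm (\<nu> (r - 2 * T))" using True norm_A by (simp add: hist_def)
  also have "\<dots> \<le> KA * (\<Sum>j\<in>UNIV. \<bar>\<nu> (r - 2 * T) $ j\<bar>)" by (intro mult_left_mono norm_le_l1_cart) simp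
  finally show ?thesis using True by (simp add: cut_def)
next
  case False
  then have "hist \<nu> r = 0" unfolding hist_def by (rule if_not_P)
  then show ?thesis by (simp add: sum_nonneg)
qed

lemma cut_integrable: "integrable lborel (cut (-2 * T) 0 (\<lambda>t. \<nu> t $ j))"
  using Lp_set_integrable[of "\<lambda>t. \<nu> t $ j" p "-2 * T" 0] nu_BS p T_pos
  by (auto simp: set_integrable_def cut_def[abs_def] Bsp_iff)

lemma cut_shift_integrable_on: "(\<lambda>r. \<bar>cut (-2 * T) 0 (\<lambda>t. \<nu> t $ j) (r - 2 * T)\<bar>) integrable_on {c..d}"
proof -
  have "integrable lborel (\<lambda>r. cut (-2 * T) 0 (\<lambda>t. \<nu> t $ j) (- 2 * T + 1 * r))"
    by (rule lborel_integrable_real_affine[OF cut_integrable]) simp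
  then have "integrable lborel (\<lambda>r. \<bar>cut (-2 * T) 0 (\<lambda>t. \<nu> t $ j) (r - 2 * T)\<bar>)" by (simp add: algebra_simps)
  then have "(\<lambda>r. \<bar>cut (-2 * T) 0 (\<lambda>t. \<nu> t $ j) (r - 2 * T)\<bar>) integrable_on UNIV" by (rule integrable_on_lborel)
  then show ?thesis by (rule integrable_on_subinterval) auto
qed

lemma hist_integral_le: "integral {0..2 * T} (\<lambda>r. norm (hist \<nu> r)) \<le> KA * (CARD('n) * (2 * T + 1)) * D"
proof -
  have hist: "(\<lambda>r. norm (hist \<nu> r)) integrable_on {0..2 * T}"
    using absolutely_integrable_on_subinterval[OF hist_integrable[OF Bsp_Lp[OF nu_BS] p_pos(2)], of 0 "2 * T"]
    by (simp add: absolutely_integrable_on_def)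
  let ?g = "\<lambda>j r. \<bar>cut (-2 * T) 0 (\<lambda>t. \<nu> t $ j) (r - 2 * T)\<bar>"
  have one: "integral {0..2 * T} (?g j) \<le> (2 * T + 1) * D" for j
  proof -
    have "integral {0..2 * T} (?g j) = integral {-2 * T..0} (\<lambda>r. \<bar>cut (-2 * T) 0 (\<lambda>t. \<nu> t $ j) r\<bar>)"
      using integral_shift_real_ivl[of "-2 * T" "- (2 * T)" 0 "\<lambda>r. \<bar>cut (-2 * T) 0 (\<lambda>t. \<nu> t $ j) r\<bar>"] by simp
    also have "\<dots> = integral {-2 * T..0} (\<lambda>r. \<bar>\<nu> r $ j\<bar>)"
      by (rule integral_spike[of "{-2 * T, 0}"]) (auto simp: cut_def)
    also have "\<dots> \<le> (0 - (-2 * T) + 1) * D"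
      by (rule Lp_abs_integral(2)[of _ p]) (use nu_BS nu_bounds(2) p D T_pos in \<open>auto simp: Bsp_iff\<close>)
    finally show ?thesis by simp
  qed
  have "integral {0..2 * T} (\<lambda>r. norm (hist \<nu> r)) \<le> integral {0..2 * T} (\<lambda>r. KA * (\<Sum>j\<in>UNIV. ?g j r))"
    by (intro integral_le hist integrable_on_mult_right integrable_sum cut_shift_integrable_on hist_le) auto
  also have "\<dots> = KA * (\<Sum>j\<in>UNIV. integral {0..2 * T} (?g j))"
    by (subst integral_mult_right, subst integral_sum) (use cut_shift_integrable_on[of _ 0 "2 * T"] in auto)
  also have "\<dots> \<le> KA * (\<Sum>j\<in>(UNIV :: 'n set). (2 * T + 1) * D)"
    by (intro mult_left_mono sum_mono one) simp
  finally show ?thesis by (simp add: mult_ac)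
qed

lemma v_bound: "norm (v t) \<le> C_sup * D" if t: "t \<in> {0..2 * T}" for t
proof -
  have hist: "(\<lambda>r. norm (hist \<nu> r)) integrable_on {0..2 * T}"
    using absolutely_integrable_on_subinterval[OF hist_integrable[OF Bsp_Lp[OF nu_BS] p_pos(2)], of 0 "2 * T"]
    by (simp add: absolutely_integrable_on_def)
  have "norm (v t) \<le> 2 * (norm (x - x') + KA * (CARD('n) * (2 * T + 1)) * D) * exp (growth * t)"
  proof (rule delay_gronwall[of "2 * T" v w _ "\<lambda>r. norm (hist \<nu> r)"])
    show "continuous_on {0..2 * T} v" by (rule continuous_on_subset[OF v_cont]) auto
    fix r assume r: "r \<in> {0<..<2 * T}"
    show "norm (w r) \<le> norm (hist \<nu> r) + KB * norm (v r) + (if r \<ge> 2 * T then KA * norm (v (r - 2 * T)) else 0)"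
      using r w_eq[of r] norm_triangle_ineq4[of "hist \<nu> r" "B *v v r"] norm_B[of "v r"] by auto
  qed (use t hist hist_integral_le w_integral in auto)
  also have "\<dots> \<le> 2 * (D + KA * (CARD('n) * (2 * T + 1)) * D) * exp (growth * (2 * T))"
    using xx t growth_pos T_pos D by (intro mult_mono) (auto intro!: add_nonneg_nonneg)
  also have "\<dots> = C_sup * D" by (simp add: C_sup_def algebra_simps)
  finally show ?thesis .
qed

text \<open>A majorant of \<open>norm (w r)\<close>, hence of the derivative of the difference. It
  is built from shifted cutoffs of the history and is a Borel function on the whole line, as the
  Lebesgue integrals in \<open>slobodeckij_integral_W1p\<close> require.\<close>

definition "g r = KB * (C_sup * D) + KA * (\<Sum>j\<in>UNIV. \<bar>cut (-2 * T) 0 (\<lambda>t. \<nu> t $ j) (r - 2 * T)\<bar>)"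

lemma g_nonneg: "g r \<ge> 0"
  using C_sup_nonneg D by (auto simp: g_def intro!: add_nonneg_nonneg mult_nonneg_nonneg sum_nonneg)

lemma g_measurable [measurable]: "g \<in> borel_measurable borel"
proof -
  have [measurable]: "cut (-2 * T) 0 (\<lambda>t. \<nu> t $ j) \<in> borel_measurable borel" for j by (rule nu_bounds(1))
  show ?thesis unfolding g_def[abs_def] by measurable
qed

lemma w_le_g: "0 < r \<Longrightarrow> r < 2 * T \<Longrightarrow> norm (w r) \<le> g r"
  using w_eq[of r] norm_triangle_ineq4[of "hist \<nu> r" "B *v v r"] norm_B[of "v r"] hist_le[of r]
    mult_left_mono[OF v_bound[of r] K_nonneg(2)] by (simp add: g_def)

text \<open>Passage from gauge to Lebesgue integrals: \<open>w\<close> is only known to be gauge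
  integrable, but its integral is dominated by that of the nonnegative Borel function
  \<open>g\<close>.\<close>

lemma v_increment:
  assumes "0 < \<xi>" "\<xi> < t" "t < 2 * T"
  shows "ennreal \<bar>v t $ i - v \<xi> $ i\<bar> \<le> (\<integral>\<^sup>+r. ennreal \<bar>g r\<bar> * indicator {\<xi><..<t} r \<partial>lborel)"
proof -
  have wi: "w integrable_on {0..t}" using w_integral[of t] assms by auto
  have wi2: "w integrable_on {\<xi>..t}" by (rule integrable_on_subinterval[OF wi]) (use assms in auto)
  have gi: "g integrable_on {\<xi>..t}"
    unfolding g_def by (intro integrable_add integrable_const_ivl integrable_on_mult_right integrable_sum cut_shift_integrable_on) auto
  have "integral {0..\<xi>} w + integral {\<xi>..t} w = integral {0..t} w"
    by (rule Henstock_Kurzweil_Integration.integral_combine[OF _ _ wi]) (use assms in auto)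
  moreover have "integral {0..\<xi>} w = v \<xi> - (x - x')" "integral {0..t} w = v t - (x - x')"
    using w_integral[of \<xi>] w_integral[of t] assms by (auto simp: integral_unique)
  moreover have "v t - v \<xi> = (v t - (x - x')) - (v \<xi> - (x - x'))" by simp
  ultimately have veq: "v t - v \<xi> = integral {\<xi>..t} w" by (metis add_diff_cancel_left')
  have "\<bar>v t $ i - v \<xi> $ i\<bar> \<le> norm (v t - v \<xi>)" using component_le_norm_cart[of "v t - v \<xi>" i] by simp
  also have "\<dots> = norm (integral {\<xi>..t} w)" by (simp add: veq)
  also have "\<dots> \<le> integral {\<xi>..t} g"
    by (intro integral_norm_bound_integral wi2 gi w_le_g) (use assms in auto)
  finally have "ennreal \<bar>v t $ i - v \<xi> $ i\<bar> \<le> ennreal (integral {\<xi>..t} g)" by (rule ennreal_leI)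
  also have "\<dots> = (\<integral>\<^sup>+r. ennreal (if r \<in> {\<xi>..t} then g r else 0) \<partial>lborel)"
  proof (rule nn_integral_has_integral_lborel[symmetric])
    show "((\<lambda>r. if r \<in> {\<xi>..t} then g r else 0) has_integral integral {\<xi>..t} g) UNIV"
      by (subst has_integral_restrict_UNIV) (rule integrable_integral[OF gi])
  qed (use g_nonneg in auto)
  also have "\<dots> = (\<integral>\<^sup>+r. ennreal \<bar>g r\<bar> * indicator {\<xi><..<t} r \<partial>lborel)"
  proof (rule nn_integral_cong_AE)
    have "AE r in lborel. r \<noteq> \<xi>" "AE r in lborel. r \<noteq> t" by (rule AE_lborel_singleton)+
    then show "AE r in lborel. ennreal (if r \<in> {\<xi>..t} then g r else 0) = ennreal \<bar>g r\<bar> * indicator {\<xi><..<t} r"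
      by eventually_elim (use g_nonneg in \<open>auto simp: indicator_def\<close>)
  qed
  finally show ?thesis .
qed

lemma g_pow: "(\<integral>\<^sup>+r. ennreal (\<bar>g r\<bar> powr p) * indicator {0<..<2 * T} r \<partial>lborel) \<le> ennreal (C_deriv * D powr p)"
proof -
  let ?c = "\<lambda>j. cut (-2 * T) 0 (\<lambda>t. \<nu> t $ j)"
  have [measurable]: "?c j \<in> borel_measurable borel" for j by (rule nu_bounds(1))
  define a where "a = 2 powr (p - 1) * (KB * (C_sup * D)) powr p"
  define b where "b = 2 powr (p - 1) * (KA powr p * CARD('n) powr p)"
  have ab: "a \<ge> 0" "b \<ge> 0" by (auto simp: a_def b_def)
  have pw: "\<bar>g r\<bar> powr p \<le> a + b * (\<Sum>j\<in>UNIV. \<bar>?c j (- 2 * T + 1 * r)\<bar> powr p)" for r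
  proof -
    let ?S = "\<Sum>j\<in>UNIV. \<bar>?c j (r - 2 * T)\<bar>"
    have "\<bar>g r\<bar> powr p = (KB * (C_sup * D) + KA * ?S) powr p" using g_nonneg[of r] by (simp add: g_def)
    also have "\<dots> \<le> 2 powr (p - 1) * ((KB * (C_sup * D)) powr p + (KA * ?S) powr p)"
      using C_sup_nonneg D p by (intro powr_add_le2) (auto intro!: sum_nonneg mult_nonneg_nonneg)
    also have "(KA * ?S) powr p = KA powr p * ?S powr p" by (subst powr_mult) (auto intro: sum_nonneg)
    also have "2 powr (p - 1) * ((KB * (C_sup * D)) powr p + KA powr p * ?S powr p)
       \<le> 2 powr (p - 1) * ((KB * (C_sup * D)) powr p + KA powr p * (CARD('n) powr p * (\<Sum>j\<in>UNIV. \<bar>?c j (r - 2 * T)\<bar> powr p)))"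
      by (intro mult_left_mono add_left_mono powr_sum_le) (use p in auto)
    also have "\<dots> = a + b * (\<Sum>j\<in>UNIV. \<bar>?c j (- 2 * T + 1 * r)\<bar> powr p)"
      by (simp add: a_def b_def algebra_simps)
    finally show ?thesis .
  qed
  define F where "F j r = ennreal (\<bar>?c j (- 2 * T + 1 * r)\<bar> powr p)" for j r
  have [measurable]: "F j \<in> borel_measurable borel" for j unfolding F_def by measurable
  have Fj: "(\<integral>\<^sup>+r. F j r \<partial>lborel) = pow_int p lborel (?c j)" for j
  proof -
    have "(\<lambda>r. ennreal (\<bar>?c j r\<bar> powr p)) \<in> borel_measurable borel" by measurable
    from nn_integral_real_affine[OF this, of 1 "-2 * T"] show ?thesis
      unfolding pow_int_def F_def by simp
  qed
  have "(\<integral>\<^sup>+r. ennreal (\<bar>g r\<bar> powr p) * indicator {0<..<2 * T} r \<partial>lborel)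
     \<le> (\<integral>\<^sup>+r. ennreal a * indicator {0<..<2 * T} r + ennreal b * (\<Sum>j\<in>UNIV. F j r) \<partial>lborel)"
  proof (rule nn_integral_mono)
    fix r :: real
    have "ennreal (\<bar>g r\<bar> powr p) \<le> ennreal (a + b * (\<Sum>j\<in>UNIV. \<bar>?c j (- 2 * T + 1 * r)\<bar> powr p))"
      by (intro ennreal_leI pw)
    also have "\<dots> = ennreal a + ennreal b * (\<Sum>j\<in>UNIV. F j r)"
      unfolding F_def using ab by (subst sum_ennreal) (auto simp: ennreal_plus ennreal_mult sum_nonneg)
    finally show "ennreal (\<bar>g r\<bar> powr p) * indicator {0<..<2 * T} r \<le> ennreal a * indicator {0<..<2 * T} r + ennreal b * (\<Sum>j\<in>UNIV. F j r)"
      by (auto simp: indicator_def)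
  qed
  also have "\<dots> = ennreal a * emeasure lborel {0<..<2 * T} + ennreal b * (\<Sum>j\<in>UNIV. (\<integral>\<^sup>+r. F j r \<partial>lborel))"
    by (subst nn_integral_add) (auto simp: nn_integral_cmult nn_integral_sum simp del: sum_ennreal)
  also have "\<dots> = ennreal a * emeasure lborel {0<..<2 * T} + ennreal b * (\<Sum>j\<in>UNIV. pow_int p lborel (?c j))"
    by (simp only: Fj)
  also have "\<dots> \<le> ennreal a * ennreal (2 * T) + ennreal b * (\<Sum>j\<in>(UNIV :: 'n set). ennreal (D powr p))"
    using T_pos by (intro add_mono mult_left_mono sum_mono nu_bounds(2)) auto
  also have "\<dots> = ennreal (a * (2 * T) + b * (CARD('n) * D powr p))"
    using ab T_pos by (simp add: ennreal_plus ennreal_mult flip: ennreal_of_nat_eq_real_of_nat)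
  also have "a * (2 * T) + b * (CARD('n) * D powr p) = C_deriv * D powr p"
  proof -
    have "(KB * (C_sup * D)) powr p = (KB * C_sup) powr p * D powr p"
      using C_sup_nonneg D by (subst powr_mult[symmetric]) (auto simp: mult_ac)
    then show ?thesis by (simp add: a_def b_def C_deriv_def algebra_simps)
  qed
  finally show ?thesis .
qed

text \<open>History and trajectory of the difference joined into one Borel function. It may jump at
  0, since the history has no prescribed relation to \<open>x - x'\<close>.\<close>

definition "V i = cut (-2 * T) (2 * T) (\<lambda>t. v t $ i)"

lemma V_eq: "- 2 * T < t \<Longrightarrow> t < 2 * T \<Longrightarrow> V i t = v t $ i"
  by (simp add: V_def cut_def)

lemma V_measurable [measurable]: "V i \<in> borel_measurable borel"
  unfolding V_def
proof (rule cut_join_measurable[of _ 0])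
  have "cut (-2 * T) 0 (\<lambda>t. v t $ i) = cut (-2 * T) 0 (\<lambda>t. \<nu> t $ i)"
    using v_history by (intro cut_cong) auto
  then show "cut (-2 * T) 0 (\<lambda>t. v t $ i) \<in> borel_measurable borel" using nu_bounds(1) by simp
  show "cut 0 (2 * T) (\<lambda>t. v t $ i) \<in> borel_measurable borel"
    by (intro cut_continuous_measurable continuous_intros continuous_on_subset[OF v_cont]) auto
qed

lemma V_pow: "pow_int p lborel (cut (-2 * T) (2 * T) (V i)) \<le> ennreal ((1 + C_sup powr p * (2 * T)) * D powr p)"
proof -
  have "cut (-2 * T) 0 (V i) = cut (-2 * T) 0 (\<lambda>t. \<nu> t $ i)"
    using v_history T_pos by (intro cut_cong) (auto simp: V_eq)
  then have 1: "pow_int p lborel (cut (-2 * T) 0 (V i)) \<le> ennreal (D powr p)" using nu_bounds(2) by simp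
  have 2: "pow_int p lborel (cut 0 (2 * T) (V i)) \<le> ennreal ((C_sup * D) powr p * (2 * T - 0))"
  proof (rule pow_int_cut_bounded)
    fix t assume t: "t \<in> {0<..<2 * T}"
    then show "\<bar>V i t\<bar> \<le> C_sup * D"
      using component_le_norm_cart[of "v t" i] v_bound[of t] V_eq[of t i] T_pos by auto
  qed (use T_pos p in auto)
  have "pow_int p lborel (cut (-2 * T) (2 * T) (V i)) \<le> ennreal (D powr p) + ennreal ((C_sup * D) powr p * (2 * T - 0))"
    by (rule order_trans[OF pow_int_cut_join add_mono[OF 1 2]]) (auto simp: cut_def[abs_def])
  also have "\<dots> = ennreal ((1 + C_sup powr p * (2 * T)) * D powr p)"
    using T_pos C_sup_nonneg D by (subst ennreal_plus[symmetric]) (auto simp: powr_mult algebra_simps)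
  finally show ?thesis .
qed

lemma V_slob_right: "slobodeckij_integral s p 0 (2 * T) (V i)
  \<le> ennreal (2 powr p * (2 * (2 * T) powr (p - s * p) / (p - s * p)) * C_deriv * D powr p)"
proof -
  have psp: "s * p < p" using s p by simp
  have "slobodeckij_integral s p 0 (2 * T) (V i) \<le> ennreal (2 powr p * (2 * (2 * T - 0) powr (p - s * p) / (p - s * p)))
      * (\<integral>\<^sup>+r. ennreal (\<bar>g r\<bar> powr p) * indicator {0<..<2 * T} r \<partial>lborel)"
  proof (rule slobodeckij_integral_W1p)
    fix t \<xi> assume *: "0 < \<xi>" "\<xi> < t" "t < 2 * T"
    then show "ennreal \<bar>V i t - V i \<xi>\<bar> \<le> (\<integral>\<^sup>+r. ennreal \<bar>g r\<bar> * indicator {\<xi><..<t} r \<partial>lborel)"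
      using v_increment[OF *, of i] T_pos by (simp add: V_eq)
  qed (use T_pos p psp in auto)
  also have "\<dots> \<le> ennreal (2 powr p * (2 * (2 * T - 0) powr (p - s * p) / (p - s * p))) * ennreal (C_deriv * D powr p)"
    by (intro mult_left_mono g_pow) auto
  also have "\<dots> = ennreal (2 powr p * (2 * (2 * T) powr (p - s * p) / (p - s * p)) * C_deriv * D powr p)"
    using psp C_deriv_nonneg by (subst ennreal_mult[symmetric]) (auto simp: mult_ac)
  finally show ?thesis .
qed

text \<open>To the right of 0 the supremum bound does it, since
  \<open>\<xi> powr (- (s * p))\<close> is integrable at 0 for \<open>s * p < 1\<close>.\<close>

lemma V_hardy_right: "(\<integral>\<^sup>+\<xi>. ennreal (\<bar>V i \<xi>\<bar> powr p * \<bar>\<xi>\<bar> powr (- (s * p))) * indicator {0<..<2 * T} \<xi> \<partial>lborel)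
   \<le> ennreal (C_sup powr p * ((2 * T) powr (1 - s * p) / (1 - s * p)) * D powr p)"
proof -
  have "(\<integral>\<^sup>+\<xi>. ennreal (\<bar>V i \<xi>\<bar> powr p * \<bar>\<xi>\<bar> powr (- (s * p))) * indicator {0<..<2 * T} \<xi> \<partial>lborel)
    \<le> (\<integral>\<^sup>+\<xi>. ennreal ((C_sup * D) powr p) * ennreal (indicator {0<..<2 * T} \<xi> * \<xi> powr ((1 - s * p) - 1)) \<partial>lborel)"
  proof (rule nn_integral_mono)
    fix \<xi> :: real
    show "ennreal (\<bar>V i \<xi>\<bar> powr p * \<bar>\<xi>\<bar> powr (- (s * p))) * indicator {0<..<2 * T} \<xi>
      \<le> ennreal ((C_sup * D) powr p) * ennreal (indicator {0<..<2 * T} \<xi> * \<xi> powr ((1 - s * p) - 1))"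
    proof (cases "\<xi> \<in> {0<..<2 * T}")
      case True
      then have "\<bar>V i \<xi>\<bar> \<le> C_sup * D"
        using component_le_norm_cart[of "v \<xi>" i] v_bound[of \<xi>] V_eq[of \<xi> i] T_pos by auto
      then have "\<bar>V i \<xi>\<bar> powr p \<le> (C_sup * D) powr p" using p by (intro powr_mono2) auto
      then have "\<bar>V i \<xi>\<bar> powr p * \<bar>\<xi>\<bar> powr (- (s * p)) \<le> (C_sup * D) powr p * \<xi> powr (- (s * p))"
        using True by (intro mult_mono) auto
      then show ?thesis using True by (simp add: ennreal_leI flip: ennreal_mult)
    qed simp
  qed
  also have "\<dots> = ennreal ((C_sup * D) powr p) * (\<integral>\<^sup>+\<xi>. ennreal (indicator {0<..<2 * T} \<xi> * \<xi> powr ((1 - s * p) - 1)) \<partial>lborel)"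
    by (rule nn_integral_cmult) measurable
  also have "(\<integral>\<^sup>+\<xi>. ennreal (indicator {0<..<2 * T} \<xi> * \<xi> powr ((1 - s * p) - 1)) \<partial>lborel) = ennreal ((2 * T) powr (1 - s * p) / (1 - s * p))"
    by (rule nn_integral_powr_from_0) (use sp T_pos in auto)
  also have "ennreal ((C_sup * D) powr p) * ennreal ((2 * T) powr (1 - s * p) / (1 - s * p))
     = ennreal (C_sup powr p * ((2 * T) powr (1 - s * p) / (1 - s * p)) * D powr p)"
    using sp C_sup_nonneg D by (subst ennreal_mult[symmetric]) (auto simp: powr_mult)
  finally show ?thesis .
qed

text \<open>\<open>slobodeckij_integral_concat\<close> at the jump: the left weighted integral is
  estimated by Hardy's inequality, the right one by \<open>V_hardy_right\<close>. Hardy's inequality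
  enters as an assumption, so that its constant is fixed before the pair of solutions.\<close>

lemma V_slob:
  assumes H: "\<And>f. f \<in> borel_measurable borel \<Longrightarrow>
    (\<integral>\<^sup>+\<xi>. ennreal (\<bar>f \<xi>\<bar> powr p * \<bar>\<xi>\<bar> powr (- (s * p))) * indicator {- (T + \<sigma>)<..<0} \<xi> \<partial>lborel)
    \<le> ennreal CH * (slobodeckij_integral s p (- (T + \<sigma>)) 0 f + (\<integral>\<^sup>+\<xi>. ennreal (\<bar>f \<xi>\<bar> powr p) * indicator {- (T + \<sigma>)<..<0} \<xi> \<partial>lborel))"
    and CH: "CH > 0"
  shows "slobodeckij_integral s p (- T - \<sigma>) (2 * T) (V i)
    \<le> ennreal ((1 + 2 powr p * (2 * (2 * T) powr (p - s * p) / (p - s * p)) * C_deriv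
         + 2 * (2 powr (p - 1) / (s * p) * (2 * CH + C_sup powr p * ((2 * T) powr (1 - s * p) / (1 - s * p))))) * D powr p)"
proof -
  let ?a = "- T - \<sigma>"
  define Dp where "Dp = D powr p"
  have Dp: "Dp \<ge> 0" by (simp add: Dp_def)
  define c1 where "c1 = 2 powr p * (2 * (2 * T) powr (p - s * p) / (p - s * p)) * C_deriv"
  define c2 where "c2 = 2 powr (p - 1) / (s * p)"
  define c3 where "c3 = C_sup powr p * ((2 * T) powr (1 - s * p) / (1 - s * p))"
  have psp: "s * p < p" using s p by simp
  have c: "c1 \<ge> 0" "c2 \<ge> 0" "c3 \<ge> 0"
    unfolding c1_def c2_def c3_def using psp C_deriv_nonneg sp_pos sp s by (auto intro!: mult_nonneg_nonneg divide_nonneg_nonneg)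
  have "slobodeckij_integral s p ?a 0 (V i) = slobodeckij_integral s p ?a 0 (\<lambda>t. \<nu> t $ i)"
    using v_history win T_pos by (intro slobodeckij_integral_cong) (auto simp: V_eq)
  then have S1: "slobodeckij_integral s p ?a 0 (V i) \<le> ennreal Dp" using nu_bounds(3)[of i] by (simp add: Dp_def)
  have I1: "(\<integral>\<^sup>+\<xi>. ennreal (\<bar>V i \<xi>\<bar> powr p) * indicator {?a<..<0} \<xi> \<partial>lborel) \<le> ennreal Dp"
  proof -
    have "(\<integral>\<^sup>+\<xi>. ennreal (\<bar>V i \<xi>\<bar> powr p) * indicator {?a<..<0} \<xi> \<partial>lborel) = pow_int p lborel (cut ?a 0 (V i))"
      by (rule Lp_integral_eq)
    also have "\<dots> = pow_int p lborel (cut ?a 0 (\<lambda>t. \<nu> t $ i))"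
    proof -
      have "cut ?a 0 (V i) = cut ?a 0 (\<lambda>t. \<nu> t $ i)" using v_history win T_pos by (intro cut_cong) (auto simp: V_eq)
      then show ?thesis by simp
    qed
    also have "\<dots> \<le> pow_int p lborel (cut (-2 * T) 0 (\<lambda>t. \<nu> t $ i))" by (rule pow_int_cut_mono) (use win in auto)
    also have "\<dots> \<le> ennreal Dp" unfolding Dp_def by (rule nu_bounds(2))
    finally show ?thesis .
  qed
  have aeq: "- (T + \<sigma>) = ?a" by simp
  have H1: "(\<integral>\<^sup>+\<xi>. ennreal (\<bar>V i \<xi>\<bar> powr p * \<bar>\<xi>\<bar> powr (- (s * p))) * indicator {?a<..<0} \<xi> \<partial>lborel) \<le> ennreal (2 * CH * Dp)"
  proof -
    have "(\<integral>\<^sup>+\<xi>. ennreal (\<bar>V i \<xi>\<bar> powr p * \<bar>\<xi>\<bar> powr (- (s * p))) * indicator {?a<..<0} \<xi> \<partial>lborel) \<le> ennreal CH * (ennreal Dp + ennreal Dp)"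
      by (rule order_trans[OF H[OF V_measurable, unfolded aeq]]) (intro mult_left_mono add_mono S1 I1, auto)
    also have "\<dots> = ennreal (2 * CH * Dp)" using CH Dp by (simp flip: ennreal_plus ennreal_mult add: algebra_simps)
    finally show ?thesis .
  qed
  have "slobodeckij_integral s p ?a (2 * T) (V i) \<le> slobodeckij_integral s p ?a 0 (V i) + slobodeckij_integral s p 0 (2 * T) (V i)
     + 2 * (ennreal (2 powr (p - 1) / (s * p)) * ((\<integral>\<^sup>+\<xi>. ennreal (\<bar>V i \<xi>\<bar> powr p * \<bar>\<xi>\<bar> powr (- (s * p))) * indicator {?a<..<0} \<xi> \<partial>lborel)
         + (\<integral>\<^sup>+\<xi>. ennreal (\<bar>V i \<xi>\<bar> powr p * \<bar>\<xi>\<bar> powr (- (s * p))) * indicator {0<..<2 * T} \<xi> \<partial>lborel)))"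
    by (rule slobodeckij_integral_concat) (use sp_pos p win T_pos in auto)
  also have "\<dots> \<le> ennreal Dp + ennreal (c1 * Dp) + 2 * (ennreal c2 * (ennreal (2 * CH * Dp) + ennreal (c3 * Dp)))"
    unfolding c2_def
    by (intro add_mono mult_left_mono S1 H1 V_slob_right[of i, folded c1_def Dp_def] V_hardy_right[of i, folded c3_def Dp_def]) auto
  also have "\<dots> = ennreal ((1 + c1 + 2 * (c2 * (2 * CH + c3))) * Dp)"
  proof -
    have "ennreal (2 * CH * Dp) + ennreal (c3 * Dp) = ennreal (2 * CH * Dp + c3 * Dp)"
      using c Dp CH by (intro ennreal_plus[symmetric]) auto
    then have "ennreal c2 * (ennreal (2 * CH * Dp) + ennreal (c3 * Dp)) = ennreal (c2 * (2 * CH * Dp + c3 * Dp))"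
      using c Dp CH by (simp only:) (intro ennreal_mult[symmetric], auto)
    then have "2 * (ennreal c2 * (ennreal (2 * CH * Dp) + ennreal (c3 * Dp))) = ennreal (2 * (c2 * (2 * CH * Dp + c3 * Dp)))"
      using c Dp CH by (simp only: ennreal_mult ennreal_numeral) (subst ennreal_mult, auto)
    note e = this
    have "ennreal Dp + ennreal (c1 * Dp) + 2 * (ennreal c2 * (ennreal (2 * CH * Dp) + ennreal (c3 * Dp)))
       = ennreal (Dp + c1 * Dp + 2 * (c2 * (2 * CH * Dp + c3 * Dp)))"
    proof -
      have n: "0 \<le> c1 * Dp" "0 \<le> 2 * (c2 * (2 * CH * Dp + c3 * Dp))"
        using c Dp CH by (auto intro!: mult_nonneg_nonneg add_nonneg_nonneg)
      have "ennreal Dp + ennreal (c1 * Dp) = ennreal (Dp + c1 * Dp)" by (rule ennreal_plus[symmetric, OF Dp n(1)])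
      moreover have "ennreal (Dp + c1 * Dp) + ennreal (2 * (c2 * (2 * CH * Dp + c3 * Dp))) = ennreal (Dp + c1 * Dp + 2 * (c2 * (2 * CH * Dp + c3 * Dp)))"
        by (rule ennreal_plus[symmetric, OF add_nonneg_nonneg[OF Dp n(1)] n(2)])
      ultimately show ?thesis unfolding e by simp
    qed
    then show ?thesis by (simp add: algebra_simps)
  qed
  finally show ?thesis unfolding c1_def c2_def c3_def Dp_def .
qed

end

context phase
begin

text \<open>For \<open>t\<close> in \<open>[0, 2T]\<close> the windows of the state lie inside the
  intervals on which \<open>V\<close> has been estimated. The constant depends neither on the
  initial data nor on \<open>h\<close>. Membership is claimed for the difference; added to a known
  reference state it gives membership of the other state.\<close>

lemma state_diff_bound:
  obtains C where "C > 0" "\<And>D h \<phi> \<phi>' x x' u u' t. D > 0 \<Longrightarrow> delay_sol h \<phi> x u \<Longrightarrow> delay_sol h \<phi>' x' u' \<Longrightarrow> \<phi> \<in> BS \<Longrightarrow> \<phi>' \<in> BS \<Longrightarrow>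
     pdist (\<phi>, x) (\<phi>', x') \<le> D \<Longrightarrow> t \<in> {0..2 * T} \<Longrightarrow>
     (\<lambda>\<xi>. u (t + \<xi>) - u' (t + \<xi>)) \<in> BS \<and> pdist (state u t) (state u' t) \<le> C * D"
proof -
  have "T + \<sigma> > 0" using T_pos \<sigma> by simp
  from hardy[OF sp_pos sp p_pos(2) this]
  obtain CH where CH: "CH > 0" "\<And>f. f \<in> borel_measurable borel \<Longrightarrow>
    (\<integral>\<^sup>+\<xi>. ennreal (\<bar>f \<xi>\<bar> powr p * \<bar>\<xi>\<bar> powr (- (s * p))) * indicator {- (T + \<sigma>)<..<0} \<xi> \<partial>lborel)
    \<le> ennreal CH * (slobodeckij_integral s p (- (T + \<sigma>)) 0 f + (\<integral>\<^sup>+\<xi>. ennreal (\<bar>f \<xi>\<bar> powr p) * indicator {- (T + \<sigma>)<..<0} \<xi> \<partial>lborel))"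
    by blast
  define C1 where "C1 = 1 + C_sup powr p * (2 * T)"
  define C2 where "C2 = 1 + 2 powr p * (2 * (2 * T) powr (p - s * p) / (p - s * p)) * C_deriv
         + 2 * (2 powr (p - 1) / (s * p) * (2 * CH + C_sup powr p * ((2 * T) powr (1 - s * p) / (1 - s * p))))"
  define K where "K = max C1 C2"
  have C1: "C1 \<ge> 1" using T_pos by (simp add: C1_def)
  then have K: "K \<ge> 1" "C1 \<le> K" "C2 \<le> K" by (auto simp: K_def)
  define E where "E = K powr (1 / p)"
  have E: "E \<ge> 0" "E powr p = K" using K p_pos by (auto simp: E_def powr_powr)
  define C where "C = 3 * CARD('n) * E + C_sup + 1"
  have C: "C > 0" using E C_sup_nonneg by (auto simp: C_def intro!: add_nonneg_pos)
  show thesis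
  proof (rule that[OF C])
    fix D :: real and h \<phi> \<phi>' x x' u u' t
    assume D: "D > 0" and u: "delay_sol h \<phi> x u" "delay_sol h \<phi>' x' u'" and \<phi>: "\<phi> \<in> BS" "\<phi>' \<in> BS"
      and close: "pdist (\<phi>, x) (\<phi>', x') \<le> D" and t: "t \<in> {0..2 * T}"
    interpret pair: solution_pair T k A B \<alpha> \<beta> m s p \<sigma> h \<phi> \<phi>' x x' u u' D
      by unfold_locales (use D u \<phi> close in auto)
    define \<psi> where "\<psi> = (\<lambda>\<xi>. u (t + \<xi>) - u' (t + \<xi>))"
    have \<psi>: "\<psi> \<xi> $ i = pair.V i (t + \<xi>)" if "- 2 * T < \<xi>" "\<xi> < 0" for \<xi> i
      using that t pair.V_eq[of "t + \<xi>" i] by (simp add: \<psi>_def pair.v_def)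
    have ED: "(E * D) powr p = K * D powr p" using E D by (simp add: powr_mult)
    have bound: "\<psi> \<in> BS" "bnorm \<psi> \<le> 3 * CARD('n) * (E * D)"
    proof -
      have meas: "cut (- 2 * T) 0 (\<lambda>\<xi>. \<psi> \<xi> $ i) \<in> borel_measurable borel" for i
      proof -
        have "cut (- 2 * T) 0 (\<lambda>\<xi>. \<psi> \<xi> $ i) = cut (- 2 * T) 0 (\<lambda>\<xi>. pair.V i (t + \<xi>))" by (intro cut_cong \<psi>)
        also have "\<dots> \<in> borel_measurable borel" by (rule cut_shift_measurable) (simp add: cut_def[abs_def])
        finally show ?thesis .
      qed
      have I: "pow_int p lborel (cut (- 2 * T) 0 (\<lambda>\<xi>. \<psi> \<xi> $ i)) \<le> ennreal ((E * D) powr p)" for i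
      proof -
        have "cut (- 2 * T) 0 (\<lambda>\<xi>. \<psi> \<xi> $ i) = cut (- 2 * T) 0 (\<lambda>\<xi>. pair.V i (t + \<xi>))" by (intro cut_cong \<psi>)
        then have "pow_int p lborel (cut (- 2 * T) 0 (\<lambda>\<xi>. \<psi> \<xi> $ i)) = pow_int p lborel (cut (- 2 * T + t) (0 + t) (pair.V i))"
          by (simp only:) (rule pow_int_cut_shift, simp add: cut_def[abs_def])
        also have "\<dots> \<le> pow_int p lborel (cut (- 2 * T) (2 * T) (pair.V i))" by (rule pow_int_cut_mono) (use t in auto)
        also have "\<dots> \<le> ennreal (C1 * D powr p)" unfolding C1_def by (rule pair.V_pow)
        also have "\<dots> \<le> ennreal ((E * D) powr p)" unfolding ED using K by (intro ennreal_leI mult_right_mono) auto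
        finally show ?thesis .
      qed
      have S: "slobodeckij_integral s p (- T - \<sigma>) 0 (\<lambda>\<xi>. \<psi> \<xi> $ i) \<le> ennreal ((E * D) powr p)" for i
      proof -
        have "slobodeckij_integral s p (- T - \<sigma>) 0 (\<lambda>\<xi>. \<psi> \<xi> $ i) = slobodeckij_integral s p (- T - \<sigma>) 0 (\<lambda>\<xi>. pair.V i (t + \<xi>))"
          using win by (intro slobodeckij_integral_cong \<psi>) auto
        also have "\<dots> = slobodeckij_integral s p (- T - \<sigma> + t) (0 + t) (pair.V i)" by (rule slobodeckij_integral_shift) simp
        also have "\<dots> \<le> slobodeckij_integral s p (- T - \<sigma>) (2 * T) (pair.V i)" by (rule slobodeckij_integral_mono) (use t in auto)
        also have "\<dots> \<le> ennreal (C2 * D powr p)" unfolding C2_def by (rule pair.V_slob[OF CH(2,1)])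
        also have "\<dots> \<le> ennreal ((E * D) powr p)" unfolding ED using K by (intro ennreal_leI mult_right_mono) auto
        finally show ?thesis .
      qed
      show "\<psi> \<in> BS" "bnorm \<psi> \<le> 3 * CARD('n) * (E * D)" by (rule Bsp_boundI[OF meas I S]; use E D in simp)+
    qed
    have "norm (u t - u' t) \<le> C_sup * D" using pair.v_bound[OF t] by (simp add: pair.v_def)
    then have "pdist (state u t) (state u' t) \<le> 3 * CARD('n) * (E * D) + C_sup * D"
      using bound(2) by (simp add: pdist_alt state_def \<psi>_def)
    also have "\<dots> \<le> C * D" using D by (simp add: C_def algebra_simps)
    finally show "(\<lambda>\<xi>. u (t + \<xi>) - u' (t + \<xi>)) \<in> BS \<and> pdist (state u t) (state u' t) \<le> C * D"
      using bound(1) by (simp add: \<psi>_def)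
  qed
qed

end

section \<open>The periodic solution\<close>

lemma first_zero:
  fixes f :: "real \<Rightarrow> real"
  assumes f: "continuous_on {0..b} f" and b: "b \<ge> 0" "f 0 < 0" "f b \<ge> 0"
  obtains t where "0 < t" "t \<le> b" "f t = 0" "\<And>r. 0 \<le> r \<Longrightarrow> r < t \<Longrightarrow> f r < 0"
proof -
  define E where "E = {0..b} \<inter> f -` {0}"
  have ivt: "\<exists>c\<in>E. c \<le> r" if "0 \<le> r" "r \<le> b" "f r \<ge> 0" for r
  proof -
    have "continuous_on {0..r} f" by (rule continuous_on_subset[OF f]) (use that in auto)
    then have "\<exists>c\<ge>0. c \<le> r \<and> f c = 0" using IVT'[of f 0 0 r] that b(2) by auto
    then show ?thesis using that by (auto simp: E_def)
  qed
  have "closed E" unfolding E_def by (rule continuous_closed_preimage[OF f]) auto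
  moreover have "bounded E" unfolding E_def by (rule bounded_subset[of "{0..b}"]) auto
  ultimately have "compact E" by (simp add: compact_eq_bounded_closed)
  moreover have "E \<noteq> {}" using ivt[of b] b by auto
  ultimately obtain t where t: "t \<in> E" "\<And>r. r \<in> E \<Longrightarrow> t \<le> r" using compact_attains_inf[of E] by blast
  show thesis
  proof (rule that[of t])
    show "0 < t" "t \<le> b" "f t = 0" using t(1) b(2) by (auto simp: E_def order_less_le)
    fix r assume r: "0 \<le> r" "r < t"
    show "f r < 0"
    proof (rule ccontr)
      assume "\<not> f r < 0"
      then obtain c where "c \<in> E" "c \<le> r" using ivt[of r] r t(1) by (auto simp: E_def)
      then show False using t(2)[of c] r by simp
    qed
  qed
qed

text \<open>A bounded history makes the right-hand side bounded. The term \<open>KA * M\<close>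
  occurs twice, for the delayed values at nonnegative times and for those in the history.\<close>

lemma (in hysteretic) delay_sol_lipschitz:
  assumes u: "delay_sol h \<phi> x u" and h: "\<And>t. \<bar>h t\<bar> \<le> 1" and hist: "hist \<phi> absolutely_integrable_on UNIV"
    and M: "\<And>r. r \<in> {0..b} \<Longrightarrow> norm (u r) \<le> M" "\<And>\<xi>. -2 * T < \<xi> \<Longrightarrow> \<xi> < 0 \<Longrightarrow> norm (\<phi> \<xi>) \<le> M" and M0: "M \<ge> 0"
    and t: "t \<in> {0..b}" "t' \<in> {0..b}"
  shows "norm (u t - u t') \<le> (norm k + (KA + KB) * M + KA * M) * \<bar>t - t'\<bar>"
proof -
  have *: "norm (u t - u t') \<le> (norm k + (KA + KB) * M + KA * M) * \<bar>t - t'\<bar>" if t: "t \<in> {0..b}" "t' \<in> {0..b}" "t' \<le> t" for t t'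
  proof -
    have "norm (u t - u t') \<le> integral {t'..t} (\<lambda>r. norm k + (KA + KB) * M + norm (hist \<phi> r))"
      by (rule delay_sol_increment[OF u _ _ h hist]) (use t M in auto)
    also have "\<dots> \<le> integral {t'..t} (\<lambda>r. norm k + (KA + KB) * M + KA * M)"
    proof (rule integral_le)
      show "(\<lambda>r. norm k + (KA + KB) * M + norm (hist \<phi> r)) integrable_on {t'..t}"
        using absolutely_integrable_on_subinterval[OF hist, of t' t]
        by (intro integrable_add integrable_const_ivl) (auto simp: absolutely_integrable_on_def)
      fix r
      have "norm (hist \<phi> r) \<le> KA * M"
      proof (cases "r \<in> {0<..<2 * T}")
        case True
        have "norm (hist \<phi> r) \<le> KA * norm (\<phi> (r - 2 * T))" using True norm_A by (simp add: hist_def)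
        also have "\<dots> \<le> KA * M" using True by (intro mult_left_mono M(2)) auto
        finally show ?thesis .
      next
        case False
        then have "hist \<phi> r = 0" unfolding hist_def by (rule if_not_P)
        then show ?thesis using M0 by simp
      qed
      then show "norm k + (KA + KB) * M + norm (hist \<phi> r) \<le> norm k + (KA + KB) * M + KA * M" by simp
    qed (rule integrable_const_ivl)
    also have "\<dots> = (norm k + (KA + KB) * M + KA * M) * \<bar>t - t'\<bar>" using t by (simp add: mult.commute)
    finally show ?thesis .
  qed
  show ?thesis
    using *[of t t'] *[of t' t] t by (cases "t' \<le> t") (auto simp: norm_minus_commute abs_minus_commute)
qed

lemma lipschitz_glue:
  fixes f :: "real \<Rightarrow> 'a::real_normed_vector"
  assumes l: "\<And>t t'. t \<in> {a<..0} \<Longrightarrow> t' \<in> {a<..0} \<Longrightarrow> norm (f t - f t') \<le> L1 * \<bar>t - t'\<bar>"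
    and r: "\<And>t t'. t \<in> {0..b} \<Longrightarrow> t' \<in> {0..b} \<Longrightarrow> norm (f t - f t') \<le> L2 * \<bar>t - t'\<bar>"
    and t: "t \<in> {a<..b}" "t' \<in> {a<..b}" and ab: "a < 0" "0 \<le> b"
  shows "norm (f t - f t') \<le> max L1 L2 * \<bar>t - t'\<bar>"
proof -
  have mx: "L1 * \<bar>d\<bar> \<le> max L1 L2 * \<bar>d\<bar>" "L2 * \<bar>d\<bar> \<le> max L1 L2 * \<bar>d\<bar>" for d :: real
    by (auto intro!: mult_right_mono)
  have mixed: "norm (f t - f t') \<le> max L1 L2 * \<bar>t - t'\<bar>" if "t \<in> {0..b}" "t' \<in> {a<..0}" for t t'
  proof -
    have "norm (f t - f t') \<le> norm (f t - f 0) + norm (f 0 - f t')"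
      using norm_triangle_ineq[of "f t - f 0" "f 0 - f t'"] by simp
    also have "\<dots> \<le> max L1 L2 * \<bar>t - 0\<bar> + max L1 L2 * \<bar>0 - t'\<bar>"
    proof (rule add_mono)
      show "norm (f t - f 0) \<le> max L1 L2 * \<bar>t - 0\<bar>" by (rule order_trans[OF r mx(2)]) (use that ab in auto)
      show "norm (f 0 - f t') \<le> max L1 L2 * \<bar>0 - t'\<bar>" by (rule order_trans[OF l mx(1)]) (use that ab in auto)
    qed
    also have "\<dots> = max L1 L2 * \<bar>t - t'\<bar>" using that by (simp add: algebra_simps)
    finally show ?thesis .
  qed
  consider "t \<le> 0" "t' \<le> 0" | "0 \<le> t" "0 \<le> t'" | "0 \<le> t" "t' \<le> 0" | "t \<le> 0" "0 \<le> t'" by linarith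
  then show ?thesis
  proof cases
    case 1 then show ?thesis using l[of t t'] t mx(1)[of "t - t'"] by simp
  next
    case 2 then show ?thesis using r[of t t'] t mx(2)[of "t - t'"] by simp
  next
    case 3 then show ?thesis using mixed[of t t'] t by simp
  next
    case 4 then show ?thesis using mixed[of t' t] t by (simp add: norm_minus_commute abs_minus_commute)
  qed
qed

locale periodic = phase T k A B \<alpha> \<beta> m s p \<sigma>
  for T :: real and k :: "real ^ 'n" and A B :: "real ^ 'n ^ 'n" and \<alpha> \<beta> :: real and m :: "real ^ 'n" and s p \<sigma> :: real +
  fixes \<phi>\<alpha> :: "real \<Rightarrow> real ^ 'n" and x\<alpha> :: "real ^ 'n" and uper :: "real \<Rightarrow> real ^ 'n"
  assumes phi: "\<phi>\<alpha> \<in> BS"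
    and per: "delay_sol (hysteresis \<alpha> \<beta> (\<lambda>t. m \<bullet> uper t)) \<phi>\<alpha> x\<alpha> uper"
    and per_2T: "uper (2 * T) = x\<alpha>"
    and per_history: "\<And>\<xi>. -2 * T < \<xi> \<Longrightarrow> \<xi> < 0 \<Longrightarrow> uper (2 * T + \<xi>) = \<phi>\<alpha> \<xi>"
    and level_0: "m \<bullet> x\<alpha> = \<alpha>"
    and switches: "{t. 0 < t \<and> t \<le> 2 * T \<and> switching_time \<alpha> \<beta> m uper t} = {T, 2 * T}"
    and level_T: "m \<bullet> uper T = \<beta>"
    and slope_T: "\<exists>d. ((\<lambda>t. m \<bullet> uper t) has_real_derivative d) (at_left T) \<and> d \<noteq> 0"
    and slope_2T: "\<exists>d. ((\<lambda>t. m \<bullet> uper t) has_real_derivative d) (at_left (2 * T)) \<and> d \<noteq> 0"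
begin

section \<open>Relay values and levels along the two arcs\<close>

abbreviation "gper t \<equiv> m \<bullet> uper t"
abbreviation "Hper \<equiv> hysteresis \<alpha> \<beta> (\<lambda>t. m \<bullet> uper t)"
abbreviation "z\<alpha> \<equiv> (\<phi>\<alpha>, x\<alpha>)"

lemma uper_0: "uper 0 = x\<alpha>" by (rule delay_solD(3)[OF per])

lemma gper_cont: "continuous_on {0..} (\<lambda>t. m \<bullet> uper t)"
  by (rule continuous_level[OF per])

lemma uper_shift: "-2 * T < t \<Longrightarrow> t \<le> 0 \<Longrightarrow> uper t = uper (t + 2 * T)"
  using delay_solD(1)[OF per, of t] per_history[of t] uper_0 per_2T by (cases "t = 0") (auto simp: add.commute)

lemma Hper_constant:
  assumes I: "a < b" "{a<..<b} \<subseteq> {0<..<2 * T} - {T}" and c: "a \<le> c" "c < b"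
    and near: "\<exists>e>0. \<forall>t. c \<le> t \<and> t < c + e \<longrightarrow> Hper t = q" and ac: "c = a"
    and t: "c \<le> t" "t < b"
  shows "Hper t = q"
proof -
  obtain e where e: "e > 0" "\<And>t. c \<le> t \<Longrightarrow> t < c + e \<Longrightarrow> Hper t = q" using near by blast
  have "Hper constant_on {a<..<b}"
  proof (rule continuous_finite_range_constant)
    show "continuous_on {a<..<b} Hper"
      unfolding continuous_on_eq_continuous_within
    proof
      fix r assume r: "r \<in> {a<..<b}"
      have rr: "0 < r" "r < 2 * T" "r \<noteq> T" using r I(2) by auto
      have "r \<notin> {t. 0 < t \<and> t \<le> 2 * T \<and> switching_time \<alpha> \<beta> m uper t}" unfolding switches using rr by auto
      then have "continuous (at r within {0..}) Hper" using rr by (auto simp: switching_time_def)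
      then show "continuous (at r within {a<..<b}) Hper"
        by (rule continuous_within_subset) (use I in force)
    qed
    have "Hper ` {a<..<b} \<subseteq> {1, -1}" using hysteresis_cases[of \<alpha> \<beta> "\<lambda>t. m \<bullet> uper t"] by auto
    then show "finite (Hper ` {a<..<b})" by (rule finite_subset) auto
  qed simp
  then obtain y where y: "\<And>r. r \<in> {a<..<b} \<Longrightarrow> Hper r = y" by (auto simp: constant_on_def)
  define r where "r = c + min e (b - a) / 2"
  have "min e (b - a) / 2 > 0" "min e (b - a) / 2 < e" "min e (b - a) / 2 < b - a"
    using e I by (auto simp: min_def)
  then have "Hper r = q" "r \<in> {a<..<b}" using e(2)[of r] ac by (auto simp: r_def)
  then have "y = q" using y[of r] by simp
  then show ?thesis using e(2)[of t] e(1) y[of t] t ac by (cases "t = c") auto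
qed

lemma gper_near:
  assumes "t \<ge> 0" "gper t \<noteq> c"
  shows "\<exists>e>0. \<forall>r. t \<le> r \<and> r < t + e \<longrightarrow> gper r \<noteq> c"
proof -
  have "(\<lambda>t. m \<bullet> uper t) \<midarrow>t\<rightarrow> gper t \<or> True" by simp
  have "((\<lambda>t. m \<bullet> uper t) \<longlongrightarrow> gper t) (at t within {0..})"
    using gper_cont assms by (auto simp: continuous_on_def)
  then have "\<forall>\<^sub>F r in at t within {0..}. gper r \<noteq> c" by (rule tendsto_imp_eventually_ne) (rule assms)
  then obtain e where e: "e > 0" "\<And>r. r \<in> {0..} \<Longrightarrow> r \<noteq> t \<Longrightarrow> dist r t < e \<Longrightarrow> gper r \<noteq> c"
    unfolding eventually_at by auto
  show ?thesis
  proof (intro exI[of _ e] conjI allI impI e(1))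
    fix r assume "t \<le> r \<and> r < t + e"
    then show "gper r \<noteq> c" using e(2)[of r] assms by (cases "r = t") (auto simp: dist_real_def)
  qed
qed

lemma Hper_first: "0 \<le> t \<Longrightarrow> t < T \<Longrightarrow> Hper t = 1"
proof (rule Hper_constant[of 0 T 0])
  have H0: "Hper 0 = 1" using uper_0 level_0 levels by (simp add: hysteresis_0)
  obtain e where e: "e > 0" "\<And>r. 0 \<le> r \<Longrightarrow> r < e \<Longrightarrow> gper r \<noteq> \<beta>"
    using gper_near[of 0 \<beta>] uper_0 level_0 levels by auto
  have "Hper t = 1" if "0 \<le> t" "t < e" for t
    using hysteresis_extend[OF gper_cont, of 0 t] that e H0 by (simp add: switch_level_def)
  then show "\<exists>e>0. \<forall>t. 0 \<le> t \<and> t < 0 + e \<longrightarrow> Hper t = 1" using e(1) by auto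
qed (use T_pos in auto)

lemma Hper_T: "Hper T = -1"
  using hysteresis_at_hit[of T "\<lambda>t. m \<bullet> uper t"] level_T T_pos levels by simp

lemma Hper_second: "T \<le> t \<Longrightarrow> t < 2 * T \<Longrightarrow> Hper t = -1"
proof (rule Hper_constant[of T "2 * T" T])
  obtain e where e: "e > 0" "\<And>r. T \<le> r \<Longrightarrow> r < T + e \<Longrightarrow> gper r \<noteq> \<alpha>"
    using gper_near[of T \<alpha>] level_T levels T_pos by auto
  have "Hper t = -1" if "T \<le> t" "t < T + e" for t
    using hysteresis_extend[OF gper_cont, of T t] that e Hper_T T_pos by (simp add: switch_level_def)
  then show "\<exists>e>0. \<forall>t. T \<le> t \<and> t < T + e \<longrightarrow> Hper t = -1" using e(1) by auto
qed (use T_pos in auto)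

text \<open>Reaching or exceeding \<beta> would entail a hit of \<beta>, by the intermediate value
  theorem, at a time when the relay is still 1; this is excluded by
  \<open>not_at_switch_level\<close>.\<close>

lemma gper_first: "0 \<le> t \<Longrightarrow> t < T \<Longrightarrow> gper t < \<beta>"
proof (rule ccontr)
  assume t: "0 \<le> t" "t < T" and "\<not> gper t < \<beta>"
  then obtain c where "0 \<le> c" "c \<le> t" "gper c = \<beta>"
    using IVT'[of "\<lambda>t. m \<bullet> uper t" 0 \<beta> t] uper_0 level_0 levels continuous_on_subset[OF gper_cont, of "{0..t}"] by auto
  then show False using not_at_switch_level[of c "\<lambda>t. m \<bullet> uper t"] Hper_first[of c] t by (simp add: switch_level_def)
qed

lemma gper_second: "T \<le> t \<Longrightarrow> t < 2 * T \<Longrightarrow> gper t > \<alpha>"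
proof (rule ccontr)
  assume t: "T \<le> t" "t < 2 * T" and "\<not> gper t > \<alpha>"
  then obtain c where "T \<le> c" "c \<le> t" "gper c = \<alpha>"
    using IVT2'[of "\<lambda>t. m \<bullet> uper t" t \<alpha> T] level_T levels continuous_on_subset[OF gper_cont, of "{T..t}"] T_pos by auto
  then show False using not_at_switch_level[of c "\<lambda>t. m \<bullet> uper t"] Hper_second[of c] t T_pos by (simp add: switch_level_def)
qed

section \<open>Regularity of the periodic solution and of its states\<close>

lemma uper_bounded:
  obtains M where "M \<ge> 0" "\<And>t. t \<in> {-2 * T<..2 * T} \<Longrightarrow> norm (uper t) \<le> M"
proof -
  have "bounded (uper ` {0..2 * T})"
    by (intro compact_imp_bounded compact_continuous_image continuous_on_subset[OF delay_solD(2)[OF per]]) auto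
  then obtain M where M: "\<And>t. t \<in> {0..2 * T} \<Longrightarrow> norm (uper t) \<le> M" unfolding bounded_iff by blast
  show thesis
  proof (rule that[of M])
    show "M \<ge> 0" using order_trans[OF norm_ge_zero M[of 0]] T_pos by simp
    fix t assume t: "t \<in> {-2 * T<..2 * T}"
    then show "norm (uper t) \<le> M"
      using M[of t] M[of "t + 2 * T"] uper_shift[of t] by (cases "t \<le> 0") auto
  qed
qed

text \<open>By periodicity the history is a translate of the trajectory. The bound and the Lipschitz
  constant therefore carry over to negative times, and the two pieces fit together at 0 without a
  jump.\<close>

lemma uper_lipschitz:
  obtains L where "L > 0" "\<And>t t'. t \<in> {-2 * T<..2 * T} \<Longrightarrow> t' \<in> {-2 * T<..2 * T} \<Longrightarrow> norm (uper t - uper t') \<le> L * \<bar>t - t'\<bar>"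
proof -
  obtain M where M: "M \<ge> 0" "\<And>t. t \<in> {-2 * T<..2 * T} \<Longrightarrow> norm (uper t) \<le> M" using uper_bounded by blast
  define L where "L = norm k + (KA + KB) * M + KA * M"
  have abs1: "\<bar>Hper t\<bar> \<le> 1" for t using hysteresis_cases[of \<alpha> \<beta> "\<lambda>t. m \<bullet> uper t" t] by auto
  have r: "norm (uper t - uper t') \<le> L * \<bar>t - t'\<bar>" if "t \<in> {0..2 * T}" "t' \<in> {0..2 * T}" for t t'
    unfolding L_def
  proof (rule delay_sol_lipschitz[OF per abs1 hist_integrable[OF Bsp_Lp[OF phi] p_pos(2)], of "2 * T"])
    show "norm (\<phi>\<alpha> \<xi>) \<le> M" if "-2 * T < \<xi>" "\<xi> < 0" for \<xi>
      using that M(2)[of \<xi>] delay_solD(1)[OF per, of \<xi>] T_pos by auto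
  qed (use that M T_pos in auto)
  have l: "norm (uper t - uper t') \<le> L * \<bar>t - t'\<bar>" if "t \<in> {-2 * T<..0}" "t' \<in> {-2 * T<..0}" for t t'
    using r[of "t + 2 * T" "t' + 2 * T"] uper_shift[of t] uper_shift[of t'] that by auto
  show thesis
  proof (rule that[of "max (max L L) 1"])
    fix t t' assume t: "t \<in> {-2 * T<..2 * T}" "t' \<in> {-2 * T<..2 * T}"
    have "norm (uper t - uper t') \<le> max L L * \<bar>t - t'\<bar>"
      by (rule lipschitz_glue[OF l r t]) (use T_pos in auto)
    also have "\<dots> \<le> max (max L L) 1 * \<bar>t - t'\<bar>" by (intro mult_right_mono) auto
    finally show "norm (uper t - uper t') \<le> max (max L L) 1 * \<bar>t - t'\<bar>" .
  qed simp
qed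

lemma uper_cont: "continuous_on {-2 * T<..2 * T} uper"
proof -
  obtain L where L: "L > 0" "\<And>t t'. t \<in> {-2 * T<..2 * T} \<Longrightarrow> t' \<in> {-2 * T<..2 * T} \<Longrightarrow> norm (uper t - uper t') \<le> L * \<bar>t - t'\<bar>"
    using uper_lipschitz by blast
  then show ?thesis by (intro lipschitz_on_continuous_on[of L]) (auto simp: lipschitz_on_def dist_norm)
qed

lemma state_uper_PS:
  assumes "\<tau> \<in> {0..2 * T}"
  shows "state uper \<tau> \<in> PS"
proof -
  obtain L where "L > 0" "\<And>t t'. t \<in> {-2 * T<..2 * T} \<Longrightarrow> t' \<in> {-2 * T<..2 * T} \<Longrightarrow> norm (uper t - uper t') \<le> L * \<bar>t - t'\<bar>"
    using uper_lipschitz by blast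
  then show ?thesis using assms by (intro state_lipschitz_PS[of "-2 * T" "2 * T" uper L]) auto
qed

lemma state_uper_cont:
  assumes "\<epsilon> > 0"
  obtains \<delta> where "\<delta> > 0" "\<And>t t'. t \<in> {0..2 * T} \<Longrightarrow> t' \<in> {0..2 * T} \<Longrightarrow> \<bar>t - t'\<bar> < \<delta> \<Longrightarrow> pdist (state uper t) (state uper t') < \<epsilon>"
proof -
  obtain L where L: "L > 0" "\<And>t t'. t \<in> {-2 * T<..2 * T} \<Longrightarrow> t' \<in> {-2 * T<..2 * T} \<Longrightarrow> norm (uper t - uper t') \<le> L * \<bar>t - t'\<bar>"
    using uper_lipschitz by blast
  obtain \<delta> where "\<delta> > 0" "\<And>t t'. t \<in> {-2 * T + 2 * T..2 * T} \<Longrightarrow> t' \<in> {-2 * T + 2 * T..2 * T} \<Longrightarrow> \<bar>t - t'\<bar> < \<delta> \<Longrightarrow> pdist (state uper t) (state uper t') < \<epsilon>"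
    using state_lipschitz_dist[OF L(2,1) assms] by metis
  then show thesis by (intro that[of \<delta>]) auto
qed

lemma z\<alpha>_eq: "phase_eq (state uper 0) z\<alpha>" "phase_eq (state uper (2 * T)) z\<alpha>"
  using delay_solD(1)[OF per] uper_0 per_2T per_history by (auto simp: phase_eq_def state_def)

section \<open>Uniform first hits near the periodic orbit\<close>

text \<open>The sign \<open>q\<close> is the value of the relay on the arc \<open>[a, a + T]\<close> of the periodic orbit.\<close>

lemma uniform_hit:
  assumes a: "0 \<le> a" "a \<le> T" and q: "q = 1 \<or> q = -1"
    and Hq: "\<And>t. a \<le> t \<Longrightarrow> t < a + T \<Longrightarrow> Hper t = q"
    and below: "\<And>t. a \<le> t \<Longrightarrow> t < a + T \<Longrightarrow> q * (gper t - \<theta>) < 0" and at: "gper (a + T) = \<theta>"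
    and der: "\<exists>d. ((\<lambda>t. m \<bullet> uper t) has_real_derivative d) (at_left (a + T)) \<and> d \<noteq> 0"
    and \<epsilon>: "\<epsilon> > 0"
  obtains \<delta> where "\<delta> > 0" "\<And>z u \<tau>. z \<in> PS \<Longrightarrow> \<tau> \<in> {a..a + T} \<Longrightarrow> pdist z (state uper \<tau>) \<le> \<delta> \<Longrightarrow> q * (m \<bullet> snd z - \<theta>) < 0 \<Longrightarrow>
    delay_sol (\<lambda>_. q) (fst z) (snd z) u \<Longrightarrow>
    \<exists>t1. 0 < t1 \<and> t1 \<le> 2 * T \<and> \<bar>t1 - (a + T - \<tau>)\<bar> < \<epsilon> \<and> m \<bullet> u t1 = \<theta> \<and> (\<forall>t. 0 \<le> t \<and> t < t1 \<longrightarrow> q * (m \<bullet> u t - \<theta>) < 0) \<and>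
      (\<forall>t\<in>{0..t1}. state u t \<in> PS \<and> pdist (state u t) (state uper (min (\<tau> + t) (a + T))) < \<epsilon>)"
proof -
  have aPS: "state uper a \<in> PS" using a by (intro state_uper_PS) auto
  have qb: "binary (\<lambda>_. q)" using q by (auto simp: binary_def)
  have histQ: "hist (\<lambda>\<xi>. uper (a + \<xi>)) absolutely_integrable_on UNIV"
    using aPS by (intro hist_integrable[OF Bsp_Lp p_pos(2)]) (simp add: state_def PS_iff)
  \<comment> \<open>The arc with the relay frozen at \<open>q\<close>. It coincides with the orbit
    up to the switch and provides a comparison flight beyond it.\<close>
  obtain w where w: "delay_sol (\<lambda>_. q) (\<lambda>\<xi>. uper (a + \<xi>)) (uper a) w"
    using binary_sol_exists[OF histQ qb] by blast
  have w_eq: "w t = uper (a + t)" if "-2 * T < t" "t \<le> T" for t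
  proof (rule delay_sol_unique[OF w delay_sol_shift[OF per a(1)] _ _ that])
    show "q = Hper (a + r)" if "0 < r" "r < T" for r using Hq[of "a + r"] that by simp
  qed simp
  obtain M1 where M1: "M1 \<ge> 0" "\<And>t. t \<in> {-2 * T<..2 * T} \<Longrightarrow> norm (uper t) \<le> M1" using uper_bounded by blast
  have "bounded (w ` {0..2 * T})"
    by (intro compact_imp_bounded compact_continuous_image continuous_on_subset[OF delay_solD(2)[OF w]]) auto
  then obtain M2 where M2: "\<And>t. t \<in> {0..2 * T} \<Longrightarrow> norm (w t) \<le> M2" unfolding bounded_iff by blast
  obtain L1 where L1: "L1 > 0" "\<And>t t'. t \<in> {-2 * T<..2 * T} \<Longrightarrow> t' \<in> {-2 * T<..2 * T} \<Longrightarrow> norm (uper t - uper t') \<le> L1 * \<bar>t - t'\<bar>"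
    using uper_lipschitz by blast
  define L2 where "L2 = norm k + (KA + KB) * max M1 M2 + KA * max M1 M2"
  have w_right: "norm (w t - w t') \<le> L2 * \<bar>t - t'\<bar>" if "t \<in> {0..2 * T}" "t' \<in> {0..2 * T}" for t t'
    unfolding L2_def
  proof (rule delay_sol_lipschitz[OF w binaryD(2)[OF qb] histQ, of "2 * T"])
    show "norm (w r) \<le> max M1 M2" if "r \<in> {0..2 * T}" for r using M2[OF that] by simp
    show "norm (uper (a + \<xi>)) \<le> max M1 M2" if "- 2 * T < \<xi>" "\<xi> < 0" for \<xi> using M1(2)[of "a + \<xi>"] that a T_pos by auto
  qed (use that M1 in auto)
  have w_left: "norm (w t - w t') \<le> L1 * \<bar>t - t'\<bar>" if "t \<in> {-2 * T<..0}" "t' \<in> {-2 * T<..0}" for t t'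
    using L1(2)[of "a + t" "a + t'"] w_eq[of t] w_eq[of t'] that a T_pos by auto
  define L where "L = max L1 L2"
  have L: "L > 0" using L1 by (simp add: L_def less_max_iff_disj)
  have w_lip: "norm (w t - w t') \<le> L * \<bar>t - t'\<bar>" if "t \<in> {-2 * T<..2 * T}" "t' \<in> {-2 * T<..2 * T}" for t t'
    unfolding L_def by (rule lipschitz_glue[OF w_left w_right that]) (use T_pos in auto)
  have w_cont: "continuous_on {-2 * T<..2 * T} w"
    by (rule lipschitz_on_continuous_on[of L]) (use L in \<open>auto simp: lipschitz_on_def dist_norm intro: w_lip\<close>)
  define \<psi> where "\<psi> t = q * (m \<bullet> w t - \<theta>)" for t
  have \<psi>_below: "\<psi> t < 0" if "0 \<le> t" "t < T" for t
    using below[of "a + t"] w_eq[of t] that T_pos by (simp add: \<psi>_def)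
  have \<psi>_T: "\<psi> T = 0" using at w_eq[of T] T_pos by (simp add: \<psi>_def)
  have \<psi>_cont: "continuous_on {-2 * T<..2 * T} \<psi>" unfolding \<psi>_def by (intro continuous_intros w_cont)
  \<comment> \<open>A two-sided derivative at the switch: nearby, \<open>w\<close> is the integral
    of a continuous function. Time is counted from \<open>T / 2\<close>, so that \<open>T\<close>
    becomes an interior point and the delayed arguments stay in \<open>(-2T, 2T)\<close>, where
    \<open>w\<close> is continuous.\<close>
  have "\<exists>d. (w has_vector_derivative d) (at T)"
  proof -
    define W where "W r = w (T / 2 + r)" for r
    define R where "R r = q *\<^sub>R k - B *v w (T / 2 + r) + A *v w (T / 2 + r - 2 * T)" for r
    have R: "rhs (\<lambda>t. q) W r = R r" for r by (simp add: rhs_def R_def W_def algebra_simps)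
    have "continuous_on {0..T} R" unfolding R_def
      by (intro continuous_intros bounded_linear.continuous_on[OF matrix_vector_mul_bounded_linear] continuous_on_compose2[OF w_cont])
         (use T_pos in auto)
    then have 1: "((\<lambda>t. integral {0..t} R) has_vector_derivative R (T / 2)) (at (T / 2) within {0..T})"
      using T_pos by (intro integral_has_vector_derivative) auto
    have "W t = w (T / 2) + integral {0..t} R" if "t \<in> {0..T}" for t
    proof -
      have "(rhs (\<lambda>t. q) W has_integral (W t - w (T / 2))) {0..t}"
        using delay_solD(4)[OF delay_sol_shift[OF w, of "T / 2"], of t] that T_pos by (simp add: W_def[abs_def])
      moreover have "rhs (\<lambda>t. q) W = R" using R by (simp add: fun_eq_iff)
      ultimately have "integral {0..t} R = W t - w (T / 2)" by (intro integral_unique) simp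
      then show ?thesis by simp
    qed
    moreover have "((\<lambda>t. w (T / 2) + integral {0..t} R) has_vector_derivative 0 + R (T / 2)) (at (T / 2) within {0..T})"
      by (rule has_vector_derivative_add[OF has_vector_derivative_const 1])
    ultimately have "(W has_vector_derivative R (T / 2)) (at (T / 2) within {0..T})"
      using T_pos has_vector_derivative_transform[of "T / 2" "{0..T}" W "\<lambda>t. w (T / 2) + integral {0..t} R" "R (T / 2)"] by simp
    moreover have "at (T / 2) within {0..T} = at (T / 2)" using T_pos by (intro at_within_interior) auto
    ultimately have "(W has_vector_derivative R (T / 2)) (at (T / 2))" by simp
    then have "((W \<circ> (\<lambda>t. t - T / 2)) has_vector_derivative (1 *\<^sub>R R (T / 2))) (at T)"
      by (intro vector_diff_chain_at) (auto intro!: derivative_eq_intros)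
    then show ?thesis by (auto simp: W_def o_def)
  qed
  then obtain d0 where d0: "(w has_vector_derivative d0) (at T)" by blast
  have \<psi>_der: "(\<psi> has_real_derivative (q * (m \<bullet> d0))) (at T)"
  proof -
    have "((\<lambda>t. m \<bullet> w t) has_vector_derivative (m \<bullet> d0)) (at T)"
      by (rule bounded_linear.has_vector_derivative[OF bounded_linear_inner_right d0])
    then have "((\<lambda>t. m \<bullet> w t) has_real_derivative (m \<bullet> d0)) (at T)"
      by (simp add: has_real_derivative_iff_has_vector_derivative)
    then show ?thesis unfolding \<psi>_def by (auto intro!: derivative_eq_intros)
  qed
  \<comment> \<open>The left derivative of the orbit at the switch equals the derivative of \<psi>.
    It cannot be negative, as \<psi> is negative before \<open>T\<close> and zero at
    \<open>T\<close>, and it is nonzero by \<open>der\<close>.\<close>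
  have slope: "q * (m \<bullet> d0) > 0"
  proof -
    obtain d where d: "((\<lambda>t. m \<bullet> uper t) has_real_derivative d) (at_left (a + T))" "d \<noteq> 0" using der by blast
    have img: "(\<lambda>t. a + t) ` {..<T} = {..<a + T}"
    proof (intro equalityI subsetI)
      fix x assume "x \<in> {..<a + T}"
      then show "x \<in> (\<lambda>t. a + t) ` {..<T}" by (intro image_eqI[of _ _ "x - a"]) auto
    qed auto
    have "((\<lambda>t. m \<bullet> uper t) \<circ> (\<lambda>t. a + t) has_real_derivative d * 1) (at T within {..<T})"
      by (rule DERIV_image_chain) (use d(1) img in \<open>auto intro!: derivative_eq_intros\<close>)
    then have "((\<lambda>t. m \<bullet> uper (a + t)) has_real_derivative d) (at T within {..<T})" by (simp add: o_def)
    then have "((\<lambda>t. q * (m \<bullet> uper (a + t) - \<theta>)) has_real_derivative q * d) (at T within {..<T})"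
      by (auto intro!: derivative_eq_intros)
    then have "((\<lambda>t. q * (m \<bullet> uper (a + t) - \<theta>)) has_real_derivative q * d) (at T within {0<..<T})"
      by (rule has_field_derivative_subset) auto
    moreover have same: "at T within {0<..<T} = at T within {0<..T}"
      unfolding at_within_def by (intro arg_cong2[where f = inf] arg_cong[where f = principal]) auto
    ultimately have "((\<lambda>t. q * (m \<bullet> uper (a + t) - \<theta>)) has_real_derivative q * d) (at T within {0<..T})" by simp
    then have "(\<psi> has_real_derivative q * d) (at T within {0<..T})"
    proof (rule has_field_derivative_transform_within[of _ _ _ _ T])
      fix t assume "t \<in> {0<..T}"
      then show "q * (m \<bullet> uper (a + t) - \<theta>) = \<psi> t" using w_eq[of t] T_pos by (simp add: \<psi>_def)
    qed (use T_pos in auto)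
    then have 2: "(\<psi> has_real_derivative q * d) (at T within {0<..<T})" by (simp add: same)
    have 3: "(\<psi> has_real_derivative q * (m \<bullet> d0)) (at T within {0<..<T})"
      by (rule has_field_derivative_at_within[OF \<psi>_der])
    have "at T within {0<..<T} \<noteq> bot" using T_pos by (simp add: at_within_eq_bot_iff)
    then have eq: "q * d = q * (m \<bullet> d0)"
      using tendsto_unique[OF _ 2[unfolded has_field_derivative_iff] 3[unfolded has_field_derivative_iff]] by simp
    have "\<not> q * d < 0"
    proof
      assume "q * d < 0"
      from has_real_derivative_neg_dec_left[OF 2 this] obtain e where e: "e > 0" "\<And>h. h > 0 \<Longrightarrow> T - h \<in> {0<..<T} \<Longrightarrow> h < e \<Longrightarrow> \<psi> T < \<psi> (T - h)"
        by blast
      define h where "h = min e T / 2"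
      have "h > 0" "h < e" "h < T" using e(1) T_pos by (auto simp: h_def min_def)
      then show False using e(2)[of h] \<psi>_T \<psi>_below[of "T - h"] by auto
    qed
    moreover have "q * d \<noteq> 0" using q d(2) by auto
    ultimately show ?thesis using eq by linarith
  qed
  from has_real_derivative_pos_inc_right[OF \<psi>_der slope] obtain \<eta>1 where \<eta>1: "\<eta>1 > 0" "\<And>h. h > 0 \<Longrightarrow> h < \<eta>1 \<Longrightarrow> \<psi> (T + h) > 0"
    using \<psi>_T by auto
  obtain \<delta>1 where \<delta>1: "\<delta>1 > 0" "\<And>t t'. t \<in> {-2 * T + 2 * T..2 * T} \<Longrightarrow> t' \<in> {-2 * T + 2 * T..2 * T} \<Longrightarrow> \<bar>t - t'\<bar> < \<delta>1 \<Longrightarrow> pdist (state w t) (state w t') < \<epsilon> / 2"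
    by (rule state_lipschitz_dist[OF w_lip L half_gt_zero[OF \<epsilon>]]) (blast intro: that)+
  \<comment> \<open>Half-width of the time window around the switch. It respects the tolerance
    \<epsilon>, the interval after \<open>T\<close> on which \<psi> is positive, and the continuity
    modulus \<open>\<delta>1\<close> of the states.\<close>
  define \<eta> where "\<eta> = min (min \<epsilon> \<eta>1) (min T \<delta>1) / 2"
  have \<eta>: "\<eta> > 0" "\<eta> < \<epsilon>" "\<eta> < \<eta>1" "\<eta> < T" "\<eta> < \<delta>1" using \<epsilon> \<eta>1 T_pos \<delta>1 by (auto simp: \<eta>_def min_def)
  have "continuous_on {0..T - \<eta>} \<psi>" by (rule continuous_on_subset[OF \<psi>_cont]) (use T_pos \<eta> in auto)
  then obtain t0 where t0: "t0 \<in> {0..T - \<eta>}" "\<And>t. t \<in> {0..T - \<eta>} \<Longrightarrow> \<psi> t \<le> \<psi> t0"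
    using continuous_attains_sup[of "{0..T - \<eta>}" \<psi>] \<eta> by auto
  \<comment> \<open>The margin: \<psi> is at most \<open>- c\<close> on
    \<open>[0, T - \<eta>]\<close> and at least \<open>c\<close> at \<open>T + \<eta>\<close>. A
    perturbation smaller than \<open>c\<close> has its first hit in between.\<close>
  define c where "c = min (- \<psi> t0) (\<psi> (T + \<eta>))"
  have c: "c > 0" using \<psi>_below[of t0] t0(1) \<eta> \<eta>1(2)[of \<eta>] by (simp add: c_def)
  obtain C where C: "C > 0" "\<And>D h \<phi> \<phi>' x x' u u' t. D > 0 \<Longrightarrow> delay_sol h \<phi> x u \<Longrightarrow> delay_sol h \<phi>' x' u' \<Longrightarrow> \<phi> \<in> BS \<Longrightarrow> \<phi>' \<in> BS \<Longrightarrow>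
     pdist (\<phi>, x) (\<phi>', x') \<le> D \<Longrightarrow> t \<in> {0..2 * T} \<Longrightarrow>
     (\<lambda>\<xi>. u (t + \<xi>) - u' (t + \<xi>)) \<in> BS \<and> pdist (state u t) (state u' t) \<le> C * D"
    using state_diff_bound by blast
  \<comment> \<open>Ensures that \<open>C * \<delta>\<close> is below \<open>\<epsilon> / 2\<close>
    for the states and that \<open>norm m * (C * \<delta>)\<close> is below \<open>c\<close> for the
    levels.\<close>
  define \<delta> where "\<delta> = min (\<epsilon> / 2) (c / (norm m + 1)) / (2 * C)"
  have nm: "norm m + 1 > 0" by (auto intro: add_nonneg_pos)
  have mn: "min (\<epsilon> / 2) (c / (norm m + 1)) > 0" using \<epsilon> c nm by simp
  have \<delta>: "\<delta> > 0" using mn C(1) by (simp add: \<delta>_def)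
  have half: "x / 2 < x" if "x > 0" for x :: real using that by simp
  have e: "C * \<delta> = min (\<epsilon> / 2) (c / (norm m + 1)) / 2" using C(1) by (simp add: \<delta>_def)
  have "C * \<delta> < min (\<epsilon> / 2) (c / (norm m + 1))" unfolding e by (rule half[OF mn])
  then have C\<delta>: "C * \<delta> < \<epsilon> / 2" "C * \<delta> < c / (norm m + 1)" by (simp_all only: min_less_iff_conj)
  then have mC\<delta>: "norm m * (C * \<delta>) < c"
  proof -
    have "norm m * (C * \<delta>) \<le> (norm m + 1) * (C * \<delta>)" using C \<delta> by (intro mult_right_mono) auto
    also have "\<dots> < c" using C\<delta>(2) nm by (simp add: pos_less_divide_eq mult.commute)
    finally show ?thesis .
  qed
  show thesis
  proof (rule that[OF \<delta>])
    fix z u \<tau> assume z: "z \<in> PS" and \<tau>: "\<tau> \<in> {a..a + T}" and close: "pdist z (state uper \<tau>) \<le> \<delta>"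
      and neg: "q * (m \<bullet> snd z - \<theta>) < 0" and u: "delay_sol (\<lambda>_. q) (fst z) (snd z) u"
    define \<tau>' where "\<tau>' = \<tau> - a"
    have \<tau>': "0 \<le> \<tau>'" "\<tau>' \<le> T" using \<tau> by (auto simp: \<tau>'_def)
    have eqw: "phase_eq (state uper (a + r)) (state w r)" if "0 \<le> r" "r \<le> T" for r
      using that w_eq T_pos by (auto simp: phase_eq_def state_def add.assoc)
    have wPS: "state w r \<in> PS" if "0 \<le> r" "r \<le> 2 * T" for r
      by (rule state_lipschitz_PS[OF w_lip]) (use that in auto)
    have close': "pdist z (state w \<tau>') \<le> \<delta>"
      using close phase_eq_dist(2)[OF eqw[OF \<tau>'], of z] by (simp add: \<tau>'_def)
    have ws: "delay_sol (\<lambda>_. q) (\<lambda>\<xi>. w (\<tau>' + \<xi>)) (w \<tau>') (\<lambda>t. w (\<tau>' + t))"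
      using delay_sol_shift[OF w \<tau>'(1)] .
    have st: "state (\<lambda>t. w (\<tau>' + t)) t = state w (\<tau>' + t)" for t by (simp add: state_def add.assoc)
    have BSz: "fst z \<in> BS" "(\<lambda>\<xi>. w (\<tau>' + \<xi>)) \<in> BS" using z wPS[of \<tau>'] \<tau>' T_pos by (auto simp: PS_iff state_def)
    have cl: "pdist (fst z, snd z) (\<lambda>\<xi>. w (\<tau>' + \<xi>), w \<tau>') \<le> \<delta>" using close' by (simp add: state_def)
    have near: "pdist (state u t) (state w (\<tau>' + t)) \<le> C * \<delta>" "(\<lambda>\<xi>. u (t + \<xi>) - w (\<tau>' + (t + \<xi>))) \<in> BS" if "t \<in> {0..2 * T}" for t
      using C(2)[OF \<delta> u ws BSz cl that] st by auto
    have uPS: "state u t \<in> PS" if t: "0 \<le> t" "\<tau>' + t \<le> 2 * T" for t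
    proof -
      have tt: "t \<in> {0..2 * T}" using t \<tau>' by auto
      have "(\<lambda>\<xi>. (u (t + \<xi>) - w (\<tau>' + (t + \<xi>))) + w (\<tau>' + t + \<xi>)) \<in> BS"
        using near(2)[OF tt] wPS[of "\<tau>' + t"] t \<tau>' by (intro Bsp_add(1)) (auto simp: PS_iff state_def)
      then show ?thesis by (simp add: PS_iff state_def add.assoc)
    qed
    have lev: "\<bar>q * (m \<bullet> u t - \<theta>) - \<psi> (\<tau>' + t)\<bar> < c" if t: "t \<in> {0..2 * T}" for t
    proof -
      have "q * (m \<bullet> u t - \<theta>) - \<psi> (\<tau>' + t) = q * (m \<bullet> (u t - w (\<tau>' + t)))"
        by (simp add: \<psi>_def inner_diff_right algebra_simps)
      then have "\<bar>q * (m \<bullet> u t - \<theta>) - \<psi> (\<tau>' + t)\<bar> = \<bar>m \<bullet> (u t - w (\<tau>' + t))\<bar>" using q by auto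
      also have "\<dots> \<le> norm m * norm (u t - w (\<tau>' + t))" by (rule Cauchy_Schwarz_ineq2)
      also have "\<dots> \<le> norm m * (C * \<delta>)"
        using near(1)[OF t] norm_snd_le[of "state u t" "state w (\<tau>' + t)"] by (intro mult_left_mono) (auto simp: state_def)
      also have "\<dots> < c" by (rule mC\<delta>)
      finally show ?thesis .
    qed
    define b where "b = T - \<tau>' + \<eta>"
    have b: "0 \<le> b" "b \<le> 2 * T" "\<tau>' + b = T + \<eta>" using \<tau>' \<eta> by (auto simp: b_def)
    define f where "f t = q * (m \<bullet> u t - \<theta>)" for t
    have "f 0 < 0" using neg delay_solD(3)[OF u] by (simp add: f_def)
    moreover have "f b \<ge> 0" using lev[of b] b by (auto simp: f_def c_def)
    moreover have "continuous_on {0..b} f"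
      unfolding f_def by (intro continuous_intros continuous_on_subset[OF delay_solD(2)[OF u]]) auto
    ultimately obtain t1 where t1: "0 < t1" "t1 \<le> b" "f t1 = 0" "\<And>r. 0 \<le> r \<Longrightarrow> r < t1 \<Longrightarrow> f r < 0"
      using first_zero[of b f] b by metis
    have late: "T - \<eta> < \<tau>' + t1"
    proof (rule ccontr)
      assume "\<not> T - \<eta> < \<tau>' + t1"
      then have "\<psi> (\<tau>' + t1) \<le> \<psi> t0" using t0(2)[of "\<tau>' + t1"] \<tau>' t1 by auto
      moreover have "\<bar>f t1 - \<psi> (\<tau>' + t1)\<bar> < c" using lev[of t1] t1 b by (auto simp: f_def)
      ultimately show False using t1(3) by (simp add: c_def) linarith
    qed
    show "\<exists>t1. 0 < t1 \<and> t1 \<le> 2 * T \<and> \<bar>t1 - (a + T - \<tau>)\<bar> < \<epsilon> \<and> m \<bullet> u t1 = \<theta> \<and> (\<forall>t. 0 \<le> t \<and> t < t1 \<longrightarrow> q * (m \<bullet> u t - \<theta>) < 0) \<and>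
      (\<forall>t\<in>{0..t1}. state u t \<in> PS \<and> pdist (state u t) (state uper (min (\<tau> + t) (a + T))) < \<epsilon>)"
    proof (intro exI[of _ t1] conjI ballI allI impI)
      show "m \<bullet> u t1 = \<theta>" using t1(3) q by (auto simp: f_def)
      show "\<bar>t1 - (a + T - \<tau>)\<bar> < \<epsilon>" using late t1(2) \<eta> by (auto simp: b_def \<tau>'_def)
      show "q * (m \<bullet> u t - \<theta>) < 0" if "0 \<le> t \<and> t < t1" for t using t1(4)[of t] that by (simp add: f_def)
      fix t assume t: "t \<in> {0..t1}"
      have tb: "t \<in> {0..2 * T}" "\<tau>' + t \<le> 2 * T" using t t1 b \<eta> by auto
      show uP: "state u t \<in> PS" using uPS[of t] tb by auto
      define r where "r = min (\<tau>' + t) T"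
      have r: "0 \<le> r" "r \<le> T" using \<tau>' tb T_pos by (auto simp: r_def)
      have "\<bar>(\<tau>' + t) - r\<bar> \<le> \<eta>" using t t1 b \<eta> by (auto simp: r_def)
      then have "pdist (state w (\<tau>' + t)) (state w r) < \<epsilon> / 2" using \<eta> tb \<tau>' r T_pos by (intro \<delta>1(2)) auto
      moreover have "pdist (state u t) (state w r) \<le> pdist (state u t) (state w (\<tau>' + t)) + pdist (state w (\<tau>' + t)) (state w r)"
        using uP wPS tb \<tau>' r T_pos by (intro pdist_triangle) auto
      ultimately have "pdist (state u t) (state w r) < \<epsilon>" using near(1)[OF tb(1)] C\<delta>(1) by linarith
      moreover have "min (\<tau> + t) (a + T) = a + r" by (auto simp: r_def \<tau>'_def min_def)
      ultimately show "pdist (state u t) (state uper (min (\<tau> + t) (a + T))) < \<epsilon>"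
        using phase_eq_dist(2)[OF eqw[OF r], of "state u t"] by simp
    qed (use t1 b in auto)
  qed
qed

section \<open>Separation of the states of the periodic orbit\<close>

text \<open>The \<open>2T\<close>-periodic extension of the level to the line, on which the
  coincidence of two states becomes a period.\<close>

definition "gext t = gper (2 * T * frac (t / (2 * T)))"

lemma gext_add: "gext (t + 2 * T * of_int n) = gext t"
proof -
  have "(t + 2 * T * of_int n) / (2 * T) = t / (2 * T) + of_int n" using T_pos by (simp add: field_simps)
  then show ?thesis by (simp add: gext_def frac_add_of_int_right)
qed

lemma gext_first: "0 \<le> t \<Longrightarrow> t < 2 * T \<Longrightarrow> gext t = gper t"
proof -
  assume t: "0 \<le> t" "t < 2 * T"
  then have "frac (t / (2 * T)) = t / (2 * T)" using T_pos by (subst frac_eq) auto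
  then show ?thesis using T_pos by (simp add: gext_def)
qed

lemma gext_eq:
  assumes "-2 * T < t" "t \<le> 2 * T"
  shows "gext t = gper t"
proof -
  consider "t = 2 * T" | "0 \<le> t" "t < 2 * T" | "t < 0" using assms by linarith
  then show ?thesis
  proof cases
    case 1
    then show ?thesis using gext_add[of 0 1] gext_first[of 0] T_pos uper_0 per_2T by simp
  next
    case 2
    then show ?thesis by (rule gext_first)
  next
    case 3
    then show ?thesis using gext_add[of t 1] gext_first[of "t + 2 * T"] uper_shift[of t] assms by simp
  qed
qed

text \<open>The last visit of \<open>\<alpha>\<close> before the switch at \<open>T\<close> and the switch itself would reappear at a distance
  \<open>d\<close>, where they contradict the position of the orbit relative to the levels.\<close>

lemma no_smaller_period:
  assumes d: "0 < d" "d < 2 * T" and period: "\<And>t. gext (t + d) = gext t"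
  shows False
proof (cases "d < T")
  case True
  define S where "S = {0..T} \<inter> (\<lambda>t. m \<bullet> uper t) -` {\<alpha>}"
  have "closed S" unfolding S_def
    by (rule continuous_closed_preimage[OF continuous_on_subset[OF gper_cont]]) auto
  moreover have "bounded S" unfolding S_def by (rule bounded_subset[of "{0..T}"]) auto
  ultimately have "compact S" by (simp add: compact_eq_bounded_closed)
  moreover have "0 \<in> S" using T_pos uper_0 level_0 by (simp add: S_def)
  ultimately obtain t1 where t1: "t1 \<in> S" "\<And>r. r \<in> S \<Longrightarrow> r \<le> t1" using compact_attains_sup[of S] by blast
  have t1': "0 \<le> t1" "t1 < T" "gper t1 = \<alpha>" using t1(1) level_T levels by (auto simp: S_def order_less_le)
  have g1: "gext (t1 + d) = \<alpha>" using period[of t1] gext_first[of t1] t1' by simp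
  show False
  proof (cases "T \<le> t1 + d")
    case True
    then show False using g1 gext_first[of "t1 + d"] gper_second[of "t1 + d"] t1' \<open>d < T\<close> by simp
  next
    case False
    have "gext T = gext (T - d)" using period[of "T - d"] by simp
    then have "gper (T - d) = \<beta>" using gext_first[of T] gext_first[of "T - d"] True d T_pos level_T by simp
    then show False using gper_first[of "T - d"] True d by simp
  qed
next
  \<comment> \<open>A period \<open>d \<ge> T\<close> moves the switch at \<open>T\<close> to
    \<open>T + d - 2 * T\<close>, which lies in \<open>[0, T)\<close>, where the level is below
    \<beta>.\<close>
  case False
  have "gext (T + d) = gext (T + d - 2 * T)" using gext_add[of "T + d - 2 * T" 1] by simp
  then have "gper (T + d - 2 * T) = \<beta>"
    using period[of T] gext_first[of T] gext_first[of "T + d - 2 * T"] False d T_pos level_T by simp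
  then show False using gper_first[of "T + d - 2 * T"] False d by simp
qed

text \<open>Distance zero means equality almost everywhere, and continuity makes it equality on a
  window of length \<open>2T\<close>; then \<open>gext\<close> would have the period
  \<open>\<tau>' - \<tau>\<close>. The bound by \<open>2 * T\<close> excludes the endpoints 0 and
  \<open>2 * T\<close>, which share their state.\<close>

lemma state_uper_injective:
  assumes \<tau>: "\<tau> \<in> {0..2 * T}" "\<tau>' \<in> {0..2 * T}" "\<bar>\<tau>' - \<tau>\<bar> < 2 * T" and zero: "pdist (state uper \<tau>) (state uper \<tau>') = 0"
  shows "\<tau> = \<tau>'"
proof (rule ccontr)
  assume ne: "\<tau> \<noteq> \<tau>'"
  define \<Delta> where "\<Delta> \<xi> = uper (\<tau> + \<xi>) - uper (\<tau>' + \<xi>)" for \<xi>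
  have b: "bnorm \<Delta> = 0" "uper \<tau> = uper \<tau>'"
    using zero bnorm_nonneg[of \<Delta>] by (auto simp: pdist_alt state_def \<Delta>_def[abs_def] add_nonneg_eq_0_iff)
  have "\<Delta> \<in> BS" unfolding \<Delta>_def[abs_def]
    using state_uper_PS[OF \<tau>(1)] state_uper_PS[OF \<tau>(2)] by (intro Bsp_diff) (auto simp: PS_iff state_def)
  from Bsp_boundD[OF this, of 0] b(1)
  have bd: "cut (-2 * T) 0 (\<lambda>t. \<Delta> t $ i) \<in> borel_measurable borel" "pow_int p lborel (cut (-2 * T) 0 (\<lambda>t. \<Delta> t $ i)) = 0" for i
    by auto
  have \<Delta>0: "\<Delta> \<xi> $ i = 0" if \<xi>: "-2 * T < \<xi>" "\<xi> < 0" for \<xi> i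
  proof -
    \<comment> \<open>The set of discrepancy is open by continuity and null by the vanishing norm,
      hence empty.\<close>
    define S where "S = {\<xi> \<in> {-2 * T<..<0}. \<Delta> \<xi> $ i \<noteq> 0}"
    have "continuous_on {-2 * T<..<0} (\<lambda>\<xi>. \<Delta> \<xi> $ i)"
      unfolding \<Delta>_def by (intro continuous_intros continuous_on_compose2[OF uper_cont]) (use \<tau> in auto)
    then have "open ({-2 * T<..<0} \<inter> (\<lambda>\<xi>. \<Delta> \<xi> $ i) -` (- {0}))" by (intro continuous_open_preimage) auto
    also have "{-2 * T<..<0} \<inter> (\<lambda>\<xi>. \<Delta> \<xi> $ i) -` (- {0}) = S" by (auto simp: S_def)
    finally have open_S: "open S" .
    define F where "F = cut (-2 * T) 0 (\<lambda>t. \<Delta> t $ i)"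
    have [measurable]: "F \<in> borel_measurable borel" unfolding F_def by (rule bd(1))
    have "pow_int p lborel F = 0" unfolding F_def by (rule bd(2))
    then have "AE \<xi> in lborel. ennreal (\<bar>F \<xi>\<bar> powr p) = 0"
      unfolding pow_int_def by (subst (asm) nn_integral_0_iff_AE) auto
    then have "AE \<xi> in lborel. \<xi> \<notin> S"
      by eventually_elim (auto simp: F_def S_def cut_def indicator_def ennreal_eq_0_iff)
    then have "S \<in> null_sets lborel"
      using open_S by (simp add: AE_iff_null_sets[of S] borel_open)
    then have "negligible S" by (simp add: negligible_iff_null_sets null_sets_completionI)
    then have "S = {}" using open_S open_not_negligible by blast
    then show ?thesis using \<xi> by (auto simp: S_def)
  qed
  have per_eq: "gper (\<tau> + \<xi>) = gper (\<tau>' + \<xi>)" if "-2 * T < \<xi>" "\<xi> \<le> 0" for \<xi>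
  proof (cases "\<xi> = 0")
    case False
    then have "\<Delta> \<xi> = 0" using \<Delta>0 that by (simp add: vec_eq_iff)
    then show ?thesis by (simp add: \<Delta>_def)
  qed (use b(2) in simp)
  have e: "gext t = gext (t + (\<tau>' - \<tau>))" for t
  proof -
    \<comment> \<open>Reduces \<open>t\<close> modulo \<open>2T\<close> to the window that ends at
      \<tau>, where the coincidence is known.\<close>
    define n where "n = \<lceil>(t - \<tau>) / (2 * T)\<rceil>"
    define \<xi> where "\<xi> = t - \<tau> - 2 * T * of_int n"
    have "of_int n - 1 < (t - \<tau>) / (2 * T)" "(t - \<tau>) / (2 * T) \<le> of_int n" unfolding n_def by linarith+
    then have \<xi>: "-2 * T < \<xi>" "\<xi> \<le> 0" using T_pos by (auto simp: \<xi>_def field_simps)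
    have "gext t = gext ((\<tau> + \<xi>) + 2 * T * of_int n)" by (simp add: \<xi>_def)
    also have "\<dots> = gext (\<tau> + \<xi>)" by (rule gext_add)
    also have "\<dots> = gper (\<tau> + \<xi>)" by (rule gext_eq) (use \<xi> \<tau> in auto)
    also have "\<dots> = gper (\<tau>' + \<xi>)" by (rule per_eq[OF \<xi>])
    also have "\<dots> = gext (\<tau>' + \<xi>)" by (rule gext_eq[symmetric]) (use \<xi> \<tau> in auto)
    also have "\<dots> = gext ((\<tau>' + \<xi>) + 2 * T * of_int n)" by (rule gext_add[symmetric])
    also have "(\<tau>' + \<xi>) + 2 * T * of_int n = t + (\<tau>' - \<tau>)" by (simp add: \<xi>_def)
    finally show ?thesis .
  qed
  show False
  proof (cases "\<tau> < \<tau>'")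
    case True
    then show False using no_smaller_period[of "\<tau>' - \<tau>"] e \<tau>(3) by auto
  next
    case False
    have "gext (t + (\<tau> - \<tau>')) = gext t" for t using e[of "t + (\<tau> - \<tau>')"] by simp
    then show False using no_smaller_period[of "\<tau> - \<tau>'"] False ne \<tau>(3) by auto
  qed
qed

text \<open>The distance from the state at \<open>T / 2\<close> is continuous along the arc
  \<open>[T, 2T]\<close> and nowhere zero there by injectivity, so its minimum is positive. The time
  \<open>T / 2\<close> is interior to the first arc, away from both switches.\<close>

lemma separation:
  obtains \<rho> where "\<rho> > 0" "\<And>\<tau>. \<tau> \<in> {0..2 * T} \<Longrightarrow> pdist (state uper (T / 2)) (state uper \<tau>) < \<rho> \<Longrightarrow> \<tau> < T"
proof -
  define f where "f \<tau> = pdist (state uper (T / 2)) (state uper \<tau>)" for \<tau>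
  have "continuous_on {T..2 * T} f"
  proof (rule continuous_on_iff[THEN iffD2], intro ballI allI impI)
    fix \<tau> \<epsilon> :: real assume \<tau>: "\<tau> \<in> {T..2 * T}" and "\<epsilon> > 0"
    then obtain \<delta> where \<delta>: "\<delta> > 0" "\<And>t t'. t \<in> {0..2 * T} \<Longrightarrow> t' \<in> {0..2 * T} \<Longrightarrow> \<bar>t - t'\<bar> < \<delta> \<Longrightarrow> pdist (state uper t) (state uper t') < \<epsilon>"
      using state_uper_cont by metis
    show "\<exists>d>0. \<forall>x'\<in>{T..2 * T}. dist x' \<tau> < d \<longrightarrow> dist (f x') (f \<tau>) < \<epsilon>"
    proof (intro exI[of _ \<delta>] conjI ballI impI \<delta>(1))
      fix x' assume x': "x' \<in> {T..2 * T}" "dist x' \<tau> < \<delta>"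
      have in02: "x' \<in> {0..2 * T}" "\<tau> \<in> {0..2 * T}" "T / 2 \<in> {0..2 * T}" using x' \<tau> T_pos by auto
      note PSs = in02[THEN state_uper_PS]
      have "f x' \<le> f \<tau> + pdist (state uper \<tau>) (state uper x')" "f \<tau> \<le> f x' + pdist (state uper x') (state uper \<tau>)"
        unfolding f_def using PSs by (auto intro: pdist_triangle)
      moreover have "pdist (state uper \<tau>) (state uper x') < \<epsilon>" "pdist (state uper x') (state uper \<tau>) < \<epsilon>"
        using x' in02 by (auto intro!: \<delta>(2) simp: dist_real_def abs_minus_commute)
      ultimately show "dist (f x') (f \<tau>) < \<epsilon>" by (simp add: dist_real_def abs_less_iff)
    qed
  qed
  then obtain \<tau>0 where \<tau>0: "\<tau>0 \<in> {T..2 * T}" "\<And>\<tau>. \<tau> \<in> {T..2 * T} \<Longrightarrow> f \<tau>0 \<le> f \<tau>"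
    using continuous_attains_inf[of "{T..2 * T}" f] T_pos by auto
  have "f \<tau>0 \<noteq> 0"
    using state_uper_injective[of "T / 2" \<tau>0] \<tau>0(1) T_pos by (auto simp: f_def)
  then have "f \<tau>0 > 0" using pdist_nonneg[of "state uper (T / 2)" "state uper \<tau>0"] by (auto simp: f_def order_less_le)
  then show thesis
  proof (rule that)
    fix \<tau> assume "\<tau> \<in> {0..2 * T}" "pdist (state uper (T / 2)) (state uper \<tau>) < f \<tau>0"
    then show "\<tau> < T" using \<tau>0(2)[of \<tau>] by (force simp: f_def)
  qed
qed

section \<open>Solutions of the hysteretic problem as concatenations of flights\<close>

definition relay_sol :: "(real \<Rightarrow> real ^ 'n) \<times> (real ^ 'n) \<Rightarrow> (real \<Rightarrow> real ^ 'n) \<Rightarrow> bool" where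
  "relay_sol z u \<longleftrightarrow> delay_sol (hysteresis \<alpha> \<beta> (\<lambda>t. m \<bullet> u t)) (fst z) (snd z) u"

lemma relay_sol_shift:
  assumes u: "relay_sol z u" and a: "a \<ge> 0"
    and restart: "hysteresis \<alpha> \<beta> (\<lambda>t. m \<bullet> u t) a = (if m \<bullet> u a < \<beta> then 1 else -1)"
  shows "relay_sol (state u a) (\<lambda>t. u (a + t))"
proof -
  have u': "delay_sol (hysteresis \<alpha> \<beta> (\<lambda>t. m \<bullet> u t)) (fst z) (snd z) u" using u by (simp add: relay_sol_def)
  show ?thesis unfolding relay_sol_def state_def fst_conv snd_conv
    by (rule delay_sol_cong[OF delay_sol_shift[OF u' a]])
       (use hysteresis_shift[OF continuous_level[OF u'] a _ restart] in auto)
qed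

text \<open>A hit of \<open>u\<close> before \<open>t1\<close> would make the two solutions agree up
  to its first hit, so \<open>w\<close> would hit as well. A switch is a legitimate restart: the
  initial rule assigns 1 at \<alpha> and -1 at \<beta>, just as the relay does.\<close>

lemma flight:
  assumes u: "relay_sol z u" and w: "delay_sol (\<lambda>_. q) (fst z) (snd z) w"
    and q: "q = (if m \<bullet> snd z < \<beta> then 1 else -1)" and \<theta>: "\<theta> = switch_level \<alpha> \<beta> q"
    and t1: "0 < t1" "m \<bullet> w t1 = \<theta>" "\<And>t. 0 \<le> t \<Longrightarrow> t < t1 \<Longrightarrow> m \<bullet> w t \<noteq> \<theta>"
  shows "\<And>t. -2 * T < t \<Longrightarrow> t \<le> t1 \<Longrightarrow> u t = w t"
    and "\<And>t. 0 \<le> t \<Longrightarrow> t < t1 \<Longrightarrow> hysteresis \<alpha> \<beta> (\<lambda>t. m \<bullet> u t) t = q"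
    and "relay_sol (state u t1) (\<lambda>t. u (t1 + t))"
proof -
  have u': "delay_sol (hysteresis \<alpha> \<beta> (\<lambda>t. m \<bullet> u t)) (fst z) (snd z) u" using u by (simp add: relay_sol_def)
  let ?H = "hysteresis \<alpha> \<beta> (\<lambda>t. m \<bullet> u t)"
  have gc: "continuous_on {0..} (\<lambda>t. m \<bullet> u t)" by (rule continuous_level[OF u'])
  have H0: "?H 0 = q" using delay_solD(3)[OF u'] q by (simp add: hysteresis_0)
  have same: "u t = w t" if "\<And>r. 0 < r \<Longrightarrow> r < b \<Longrightarrow> m \<bullet> u r \<noteq> \<theta>" "-2 * T < t" "t \<le> b" for b t
  proof (rule delay_sol_unique[OF u' w _ _ that(2,3)])
    fix r assume r: "0 < r" "r < b"
    have "?H r = ?H 0" by (rule hysteresis_extend[OF gc]) (use r that(1) H0 \<theta> in auto)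
    then show "?H r = q" using H0 by simp
  qed simp
  have no: "m \<bullet> u r \<noteq> \<theta>" if "0 < r" "r < t1" for r
  proof
    assume hit: "m \<bullet> u r = \<theta>"
    define E where "E = {0..r} \<inter> (\<lambda>t. m \<bullet> u t) -` {\<theta>}"
    have "closed E" unfolding E_def by (rule continuous_closed_preimage[OF continuous_on_subset[OF gc]]) auto
    moreover have "bounded E" unfolding E_def by (rule bounded_subset[of "{0..r}"]) auto
    ultimately have "compact E" by (simp add: compact_eq_bounded_closed)
    moreover have "r \<in> E" using hit that by (simp add: E_def)
    ultimately obtain t2 where t2: "t2 \<in> E" "\<And>r. r \<in> E \<Longrightarrow> t2 \<le> r" using compact_attains_inf[of E] by blast
    have "m \<bullet> u r' \<noteq> \<theta>" if "0 < r'" "r' < t2" for r'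
      using t2(2)[of r'] t2(1) that by (auto simp: E_def)
    then have "u t2 = w t2" by (rule same) (use t2(1) T_pos in \<open>auto simp: E_def\<close>)
    then show False using t2(1) t1(3)[of t2] that by (auto simp: E_def)
  qed
  show uw: "u t = w t" if "-2 * T < t" "t \<le> t1" for t
    using same[of t1 t] no that by auto
  show "?H t = q" if "0 \<le> t" "t < t1" for t
  proof -
    have "?H t = ?H 0" by (rule hysteresis_extend[OF gc]) (use that no H0 \<theta> in auto)
    then show ?thesis using H0 by simp
  qed
  have hit: "m \<bullet> u t1 = \<theta>" using uw[of t1] t1 T_pos by simp
  have "?H t1 = (if m \<bullet> u t1 = \<alpha> then 1 else -1)"
    by (rule hysteresis_at_hit) (use hit \<theta> t1 in \<open>auto simp: switch_level_def\<close>)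
  also have "\<dots> = (if m \<bullet> u t1 < \<beta> then 1 else -1)" using hit \<theta> levels by (auto simp: switch_level_def)
  finally show "relay_sol (state u t1) (\<lambda>t. u (t1 + t))" using t1 by (intro relay_sol_shift[OF u]) auto
qed

section \<open>Hit maps on representatives and flights along the two arcs\<close>

abbreviation "uplus z \<equiv> u_plus T p k A B (fst z) (snd z)"
abbreviation "uminus' z \<equiv> u_minus T p k A B (fst z) (snd z)"
abbreviation "Pbeta \<equiv> P_beta T \<beta> p k m A B"
abbreviation "Palpha \<equiv> P_alpha T \<alpha> p k m A B"
abbreviation "poin \<equiv> poincare T \<alpha> \<beta> p k m A B"
abbreviation "dpoin \<equiv> dom_poincare T \<alpha> \<beta> s p \<sigma> k m A B"

lemma uplus_sol: "z \<in> PS \<Longrightarrow> delay_sol (\<lambda>_. 1) (fst z) (snd z) (uplus z)"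
  and uminus_sol: "z \<in> PS \<Longrightarrow> delay_sol (\<lambda>_. -1) (fst z) (snd z) (uminus' z)"
  using const_sol[OF Bsp_Lp p_pos(2)] by (auto simp: PS_iff)

text \<open>Equality as functions, because both sides are choices from the same predicate. Hence the
  hit maps take identical values on equivalent representatives.\<close>

lemma phase_eq_sols:
  assumes "phase_eq z w"
  shows "uplus z = uplus w" "uminus' z = uminus' w"
proof -
  have "is_solution T p k A B h (fst z) (snd z) = is_solution T p k A B h (fst w) (snd w)" for h
    using assms by (auto simp: is_solution_def phase_eq_def fun_eq_iff)
  then show "uplus z = uplus w" "uminus' z = uminus' w" by (simp_all add: u_plus_def u_minus_def)
qed

lemma phase_eq_hit_maps:
  assumes "phase_eq z w"
  shows "Pbeta z = Pbeta w" "Palpha z = Palpha w"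
    "z \<in> dom_P_beta T \<alpha> \<beta> s p \<sigma> k m A B \<longleftrightarrow> w \<in> dom_P_beta T \<alpha> \<beta> s p \<sigma> k m A B"
    "z \<in> dom_P_alpha T \<alpha> \<beta> s p \<sigma> k m A B \<longleftrightarrow> w \<in> dom_P_alpha T \<alpha> \<beta> s p \<sigma> k m A B"
  using phase_eq_sols[OF assms] phase_eq_PS[OF assms] assms
  by (auto simp: P_beta_def P_alpha_def t_beta_def t_alpha_def dom_P_beta_def dom_P_alpha_def section_at_def phase_eq_def)

lemma phase_eq_poincare:
  assumes "phase_eq z w"
  shows "poin z = poin w" "z \<in> dpoin \<longleftrightarrow> w \<in> dpoin"
  using phase_eq_hit_maps[OF assms] by (auto simp: poincare_def dom_poincare_def)

lemma plus_flight:
  assumes \<epsilon>: "\<epsilon> > 0"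
  obtains \<delta> where "\<delta> > 0" "\<And>z u \<tau>. z \<in> PS \<Longrightarrow> \<tau> \<in> {0..T} \<Longrightarrow> pdist z (state uper \<tau>) \<le> \<delta> \<Longrightarrow> m \<bullet> snd z < \<beta> \<Longrightarrow> relay_sol z u \<Longrightarrow>
    \<exists>t1. 0 < t1 \<and> t1 \<le> 2 * T \<and> \<bar>t1 - (T - \<tau>)\<bar> < \<epsilon> \<and> m \<bullet> u t1 = \<beta> \<and> (\<forall>t. 0 \<le> t \<and> t < t1 \<longrightarrow> m \<bullet> u t < \<beta>) \<and>
      (\<forall>t. 0 \<le> t \<and> t < t1 \<longrightarrow> hysteresis \<alpha> \<beta> (\<lambda>t. m \<bullet> u t) t = 1) \<and>
      (\<forall>t\<in>{0..t1}. state u t \<in> PS \<and> pdist (state u t) (state uper (min (\<tau> + t) T)) < \<epsilon>) \<and>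
      relay_sol (state u t1) (\<lambda>t. u (t1 + t)) \<and>
      (\<exists>t>0. m \<bullet> uplus z t = \<beta>) \<and> phase_eq (Pbeta z) (state u t1)"
proof -
  have 1: "1 * (gper t - \<beta>) < 0" if "0 \<le> t" "t < 0 + T" for t using gper_first that by simp
  obtain \<delta> where \<delta>: "\<delta> > 0" "\<And>z u \<tau>. z \<in> PS \<Longrightarrow> \<tau> \<in> {0..0 + T} \<Longrightarrow> pdist z (state uper \<tau>) \<le> \<delta> \<Longrightarrow> 1 * (m \<bullet> snd z - \<beta>) < 0 \<Longrightarrow>
    delay_sol (\<lambda>_. 1) (fst z) (snd z) u \<Longrightarrow>
    \<exists>t1. 0 < t1 \<and> t1 \<le> 2 * T \<and> \<bar>t1 - (0 + T - \<tau>)\<bar> < \<epsilon> \<and> m \<bullet> u t1 = \<beta> \<and> (\<forall>t. 0 \<le> t \<and> t < t1 \<longrightarrow> 1 * (m \<bullet> u t - \<beta>) < 0) \<and>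
      (\<forall>t\<in>{0..t1}. state u t \<in> PS \<and> pdist (state u t) (state uper (min (\<tau> + t) (0 + T))) < \<epsilon>)"
    by (rule uniform_hit[of 0 1 \<beta> \<epsilon>]) (use T_pos Hper_first 1 level_T slope_T \<epsilon> in auto)
  show thesis
  proof (rule that[OF \<delta>(1)])
    fix z u \<tau> assume z: "z \<in> PS" "\<tau> \<in> {0..T}" "pdist z (state uper \<tau>) \<le> \<delta>" "m \<bullet> snd z < \<beta>" and u: "relay_sol z u"
    define w where "w = uplus z"
    have w: "delay_sol (\<lambda>_. 1) (fst z) (snd z) w" unfolding w_def by (rule uplus_sol[OF z(1)])
    obtain t1 where t1: "0 < t1" "t1 \<le> 2 * T" "\<bar>t1 - (T - \<tau>)\<bar> < \<epsilon>" "m \<bullet> w t1 = \<beta>" "\<And>t. 0 \<le> t \<Longrightarrow> t < t1 \<Longrightarrow> m \<bullet> w t < \<beta>"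
      "\<And>t. t \<in> {0..t1} \<Longrightarrow> state w t \<in> PS \<and> pdist (state w t) (state uper (min (\<tau> + t) T)) < \<epsilon>"
      using \<delta>(2)[OF z(1) _ z(3) _ w] z(2,4) by auto
    have ne: "m \<bullet> w t \<noteq> \<beta>" if "0 \<le> t" "t < t1" for t using t1(5)[OF that] by simp
    note fl = flight[OF u w _ _ t1(1,4) ne]
    have eq: "u t = w t" if "-2 * T < t" "t \<le> t1" for t by (rule fl(1)) (use that z(4) in \<open>auto simp: switch_level_def\<close>)
    have st: "phase_eq (state u t) (state w t)" if "t \<in> {0..t1}" for t
      using that eq T_pos by (auto simp: phase_eq_def state_def)
    have tb: "t_beta T \<beta> p k m A B z = t1"
      unfolding t_beta_def
    proof (rule Least_equality)
      show "0 < t1 \<and> m \<bullet> uplus z t1 = \<beta>" using t1 by (simp add: w_def)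
      fix y assume "0 < y \<and> m \<bullet> uplus z y = \<beta>"
      then show "t1 \<le> y" using ne[of y] by (auto simp: w_def not_less[symmetric])
    qed
    show "\<exists>t1. 0 < t1 \<and> t1 \<le> 2 * T \<and> \<bar>t1 - (T - \<tau>)\<bar> < \<epsilon> \<and> m \<bullet> u t1 = \<beta> \<and> (\<forall>t. 0 \<le> t \<and> t < t1 \<longrightarrow> m \<bullet> u t < \<beta>) \<and>
      (\<forall>t. 0 \<le> t \<and> t < t1 \<longrightarrow> hysteresis \<alpha> \<beta> (\<lambda>t. m \<bullet> u t) t = 1) \<and>
      (\<forall>t\<in>{0..t1}. state u t \<in> PS \<and> pdist (state u t) (state uper (min (\<tau> + t) T)) < \<epsilon>) \<and>
      relay_sol (state u t1) (\<lambda>t. u (t1 + t)) \<and>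
      (\<exists>t>0. m \<bullet> uplus z t = \<beta>) \<and> phase_eq (Pbeta z) (state u t1)"
    proof (intro exI[of _ t1] conjI ballI allI impI)
      show "m \<bullet> u t1 = \<beta>" using eq[of t1] t1 T_pos by simp
      show "m \<bullet> u t < \<beta>" if "0 \<le> t \<and> t < t1" for t using eq[of t] t1(5)[of t] that T_pos by simp
      show "hysteresis \<alpha> \<beta> (\<lambda>t. m \<bullet> u t) t = 1" if "0 \<le> t \<and> t < t1" for t
        by (rule fl(2)) (use that z(4) in \<open>auto simp: switch_level_def\<close>)
      show "state u t \<in> PS" "pdist (state u t) (state uper (min (\<tau> + t) T)) < \<epsilon>" if "t \<in> {0..t1}" for t
        using t1(6)[OF that] phase_eq_PS[OF st[OF that]] phase_eq_dist(1)[OF st[OF that]] by auto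
      show "relay_sol (state u t1) (\<lambda>t. u (t1 + t))" by (rule fl(3)) (use z(4) in \<open>auto simp: switch_level_def\<close>)
      show "m \<bullet> uplus z t1 = \<beta>" using t1 by (auto simp: w_def)
      show "phase_eq (Pbeta z) (state u t1)"
        using st[of t1] t1(1) by (simp add: P_beta_def tb w_def phase_eq_sym)
    qed (use t1 in auto)
  qed
qed

definition near :: "real \<Rightarrow> (real \<Rightarrow> real ^ 'n) \<times> (real ^ 'n) \<Rightarrow> bool" where
  "near \<epsilon> z \<longleftrightarrow> (\<exists>\<tau>\<in>{0..2 * T}. pdist z (state uper \<tau>) < \<epsilon>)"

abbreviation "restarts u t \<equiv> relay_sol (state u t) (\<lambda>r. u (t + r))"
abbreviation "tube \<epsilon> u t \<equiv> \<forall>r\<in>{0..t}. state u r \<in> PS \<and> near \<epsilon> (state u r)"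

text \<open>The start lies at or above \<beta> because only there does a solution of (P) begin with
  relay value -1. The flight ends on the section near the fixed point.\<close>

definition minus_start :: "real \<Rightarrow> real \<Rightarrow> bool" where
  "minus_start \<epsilon> \<delta> \<longleftrightarrow> (\<forall>z u \<tau>. z \<in> PS \<longrightarrow> \<tau> \<in> {T..2 * T} \<longrightarrow> pdist z (state uper \<tau>) \<le> \<delta> \<longrightarrow> m \<bullet> snd z \<ge> \<beta> \<longrightarrow> relay_sol z u \<longrightarrow>
    (\<exists>t1. 0 < t1 \<and> t1 \<le> 2 * T \<and> m \<bullet> u t1 = \<alpha> \<and> (\<forall>t. 0 \<le> t \<and> t < t1 \<longrightarrow> m \<bullet> u t > \<alpha>) \<and>
      tube \<epsilon> u t1 \<and> pdist (state u t1) z\<alpha> < \<epsilon> \<and> restarts u t1 \<and>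
      (\<exists>t>0. m \<bullet> uminus' z t = \<alpha>) \<and> phase_eq (Palpha z) (state u t1)))"

lemmas minus_startD = minus_start_def[THEN iffD1, rule_format]

lemma minus_flight:
  assumes \<epsilon>: "\<epsilon> > 0"
  obtains \<delta> where "\<delta> > 0" "minus_start \<epsilon> \<delta>"
proof -
  obtain \<delta>0 where \<delta>0: "\<delta>0 > 0" "\<And>t t'. t \<in> {0..2 * T} \<Longrightarrow> t' \<in> {0..2 * T} \<Longrightarrow> \<bar>t - t'\<bar> < \<delta>0 \<Longrightarrow> pdist (state uper t) (state uper t') < \<epsilon> / 2"
    using state_uper_cont[of "\<epsilon> / 2"] \<epsilon> by (metis half_gt_zero)
  \<comment> \<open>The hit time may be off by \<epsilon>'; as \<epsilon>' is at most
    \<open>\<delta>0\<close>, the orbit has meanwhile moved by less than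
    \<open>\<epsilon> / 2\<close> from its state at \<open>2 * T\<close>, that is, from the fixed
    point.\<close>
  define \<epsilon>' where "\<epsilon>' = min (\<epsilon> / 2) \<delta>0"
  have \<epsilon>': "\<epsilon>' > 0" "\<epsilon>' \<le> \<epsilon> / 2" "\<epsilon>' \<le> \<delta>0" using \<epsilon> \<delta>0 by (auto simp: \<epsilon>'_def)
  have TT: "T + T = 2 * T" by simp
  have 1: "-1 * (gper t - \<alpha>) < 0" if "T \<le> t" "t < T + T" for t using gper_second[of t] that by simp
  obtain \<delta> where \<delta>: "\<delta> > 0" "\<And>z u \<tau>. z \<in> PS \<Longrightarrow> \<tau> \<in> {T..T + T} \<Longrightarrow> pdist z (state uper \<tau>) \<le> \<delta> \<Longrightarrow> -1 * (m \<bullet> snd z - \<alpha>) < 0 \<Longrightarrow>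
    delay_sol (\<lambda>_. -1) (fst z) (snd z) u \<Longrightarrow>
    \<exists>t1. 0 < t1 \<and> t1 \<le> 2 * T \<and> \<bar>t1 - (T + T - \<tau>)\<bar> < \<epsilon>' \<and> m \<bullet> u t1 = \<alpha> \<and> (\<forall>t. 0 \<le> t \<and> t < t1 \<longrightarrow> -1 * (m \<bullet> u t - \<alpha>) < 0) \<and>
      (\<forall>t\<in>{0..t1}. state u t \<in> PS \<and> pdist (state u t) (state uper (min (\<tau> + t) (T + T))) < \<epsilon>')"
  proof (rule uniform_hit[of T "-1" \<alpha> \<epsilon>'])
    show "0 \<le> T" "T \<le> T" "(-1 :: real) = 1 \<or> (-1 :: real) = -1" "0 < \<epsilon>'" using T_pos \<epsilon>' by auto
    show "Hper t = -1" if "T \<le> t" "t < T + T" for t using Hper_second that by simp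
    show "-1 * (gper t - \<alpha>) < 0" if "T \<le> t" "t < T + T" for t by (rule 1[OF that])
    show "gper (T + T) = \<alpha>" unfolding TT using per_2T level_0 by simp
    show "\<exists>d. ((\<lambda>t. m \<bullet> uper t) has_real_derivative d) (at_left (T + T)) \<and> d \<noteq> 0" unfolding TT by (rule slope_2T)
  qed (rule that)
  have "minus_start \<epsilon> \<delta>" unfolding minus_start_def near_def
  proof (intro allI impI)
    fix z u \<tau> assume z: "z \<in> PS" "\<tau> \<in> {T..2 * T}" "pdist z (state uper \<tau>) \<le> \<delta>" "m \<bullet> snd z \<ge> \<beta>" and u: "relay_sol z u"
    define w where "w = uminus' z"
    have w: "delay_sol (\<lambda>_. -1) (fst z) (snd z) w" unfolding w_def by (rule uminus_sol[OF z(1)])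
    have "\<tau> \<in> {T..T + T}" "-1 * (m \<bullet> snd z - \<alpha>) < 0" using z levels by auto
    from \<delta>(2)[OF z(1) this(1) z(3) this(2) w]
    obtain t1 where t1: "0 < t1" "t1 \<le> 2 * T" "\<bar>t1 - (T + T - \<tau>)\<bar> < \<epsilon>'" "m \<bullet> w t1 = \<alpha>" "\<And>t. 0 \<le> t \<Longrightarrow> t < t1 \<Longrightarrow> m \<bullet> w t > \<alpha>"
      "\<And>t. t \<in> {0..t1} \<Longrightarrow> state w t \<in> PS \<and> pdist (state w t) (state uper (min (\<tau> + t) (T + T))) < \<epsilon>'"
      by auto
    have ne: "m \<bullet> w t \<noteq> \<alpha>" if "0 \<le> t" "t < t1" for t using t1(5)[OF that] by simp
    note fl = flight[OF u w _ _ t1(1,4) ne]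
    have eq: "u t = w t" if "-2 * T < t" "t \<le> t1" for t by (rule fl(1)) (use that z(4) in \<open>auto simp: switch_level_def\<close>)
    have st: "phase_eq (state u t) (state w t)" if "t \<in> {0..t1}" for t
      using that eq T_pos by (auto simp: phase_eq_def state_def)
    have ta: "t_alpha T \<alpha> p k m A B z = t1"
      unfolding t_alpha_def
    proof (rule Least_equality)
      show "0 < t1 \<and> m \<bullet> uminus' z t1 = \<alpha>" using t1 by (simp add: w_def)
      fix y assume "0 < y \<and> m \<bullet> uminus' z y = \<alpha>"
      then show "t1 \<le> y" using ne[of y] by (auto simp: w_def not_less[symmetric])
    qed
    have near: "state u t \<in> PS" "pdist (state u t) (state uper (min (\<tau> + t) (T + T))) < \<epsilon>'" if "t \<in> {0..t1}" for t
      using t1(6)[OF that] phase_eq_PS[OF st[OF that]] phase_eq_dist(1)[OF st[OF that]] by auto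
    show "\<exists>t1. 0 < t1 \<and> t1 \<le> 2 * T \<and> m \<bullet> u t1 = \<alpha> \<and> (\<forall>t. 0 \<le> t \<and> t < t1 \<longrightarrow> m \<bullet> u t > \<alpha>) \<and>
      (\<forall>t\<in>{0..t1}. state u t \<in> PS \<and> (\<exists>\<tau>'\<in>{0..2 * T}. pdist (state u t) (state uper \<tau>') < \<epsilon>)) \<and>
      pdist (state u t1) z\<alpha> < \<epsilon> \<and> relay_sol (state u t1) (\<lambda>t. u (t1 + t)) \<and>
      (\<exists>t>0. m \<bullet> uminus' z t = \<alpha>) \<and> phase_eq (Palpha z) (state u t1)"
    proof (intro exI[of _ t1] conjI ballI allI impI)
      show "m \<bullet> u t1 = \<alpha>" using eq[of t1] t1 T_pos by simp
      show "m \<bullet> u t > \<alpha>" if "0 \<le> t \<and> t < t1" for t using eq[of t] t1(5)[of t] that T_pos by simp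
      show "state u t \<in> PS" if "t \<in> {0..t1}" for t by (rule near(1)[OF that])
      show "\<exists>\<tau>'\<in>{0..2 * T}. pdist (state u t) (state uper \<tau>') < \<epsilon>" if "t \<in> {0..t1}" for t
        using near(2)[OF that] \<epsilon>' \<epsilon> z(2) that T_pos by (intro bexI[of _ "min (\<tau> + t) (T + T)"]) auto
      show "pdist (state u t1) z\<alpha> < \<epsilon>"
      proof -
        define r where "r = min (\<tau> + t1) (T + T)"
        have r: "r \<in> {0..2 * T}" "\<bar>r - 2 * T\<bar> < \<delta>0" using t1(3) z(2) t1(1) \<epsilon>' T_pos by (auto simp: r_def min_def)
        have i2: "2 * T \<in> {0..2 * T}" using T_pos by simp
        have "pdist (state u t1) (state uper (2 * T)) \<le> pdist (state u t1) (state uper r) + pdist (state uper r) (state uper (2 * T))"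
          by (rule pdist_triangle[OF near(1) state_uper_PS[OF r(1)] state_uper_PS[OF i2]]) (use t1 in auto)
        moreover have "pdist (state uper r) (state uper (2 * T)) < \<epsilon> / 2" by (rule \<delta>0(2)[OF r(1) i2 r(2)])
        moreover have "pdist (state u t1) (state uper r) < \<epsilon>'" unfolding r_def by (rule near(2)) (use t1 in auto)
        ultimately show ?thesis using \<epsilon>' phase_eq_dist(2)[OF z\<alpha>_eq(2), of "state u t1"] by simp
      qed
      show "relay_sol (state u t1) (\<lambda>t. u (t1 + t))" by (rule fl(3)) (use z(4) in \<open>auto simp: switch_level_def\<close>)
      show "m \<bullet> uminus' z t1 = \<alpha>" using t1 by (auto simp: w_def)
      show "phase_eq (Palpha z) (state u t1)"
        using st[of t1] t1(1) by (simp add: P_alpha_def ta w_def phase_eq_sym)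
    qed (use t1 in auto)
  qed
  with \<delta>(1) show thesis by (rule that)
qed

section \<open>Cycles near the periodic orbit\<close>

text \<open>The inequalities before the hits make \<open>t1\<close> and \<open>t2\<close> first hits
  and thus unique; this later identifies the cycles of one solution seen from two starting
  times.\<close>

definition cycle :: "real \<Rightarrow> (real \<Rightarrow> real ^ 'n) \<Rightarrow> real \<Rightarrow> real \<Rightarrow> bool" where
  "cycle \<epsilon> u t1 t2 \<longleftrightarrow> 0 < t1 \<and> t1 < t2 \<and> m \<bullet> u t1 = \<beta> \<and> m \<bullet> u t2 = \<alpha> \<and>
     (\<forall>t. 0 \<le> t \<and> t < t1 \<longrightarrow> m \<bullet> u t < \<beta>) \<and> (\<forall>t. t1 \<le> t \<and> t < t2 \<longrightarrow> m \<bullet> u t > \<alpha>) \<and>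
     tube \<epsilon> u t2 \<and> pdist (state u t2) z\<alpha> < \<epsilon> \<and> restarts u t2"

lemma state_shift: "state (\<lambda>t. u (a + t)) t = state u (a + t)"
  by (simp add: state_def add.assoc)

lemma relay_sol_cong: "phase_eq z w \<Longrightarrow> relay_sol z u \<longleftrightarrow> relay_sol w u"
  by (auto simp: relay_sol_def delay_sol_def phase_eq_def)

lemma relay_sol_initial: "relay_sol z u \<Longrightarrow> phase_eq z (state u 0)"
  by (auto simp: relay_sol_def delay_sol_def phase_eq_def state_def)

lemma near_mono: "near \<epsilon> z \<Longrightarrow> \<epsilon> \<le> \<epsilon>' \<Longrightarrow> near \<epsilon>' z"
  by (force simp: near_def)

lemma pdist_uper_0: "pdist z (state uper 0) = pdist z z\<alpha>"
  by (rule phase_eq_dist(2)[OF z\<alpha>_eq(1)])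

text \<open>The start may lie near any point of the first arc, so that a cycle can also be entered
  midway. The Poincare map is involved only for starts on the section.\<close>

definition plus_start :: "real \<Rightarrow> real \<Rightarrow> bool" where
  "plus_start \<epsilon> \<delta> \<longleftrightarrow> (\<forall>z u \<tau>. z \<in> PS \<longrightarrow> \<tau> \<in> {0..T} \<longrightarrow> pdist z (state uper \<tau>) \<le> \<delta> \<longrightarrow> m \<bullet> snd z < \<beta> \<longrightarrow> relay_sol z u \<longrightarrow>
    (\<exists>t1 t2. cycle \<epsilon> u t1 t2 \<and> \<bar>t1 - (T - \<tau>)\<bar> < \<epsilon> \<and>
      (\<forall>t\<in>{0..t1}. pdist (state u t) (state uper (min (\<tau> + t) T)) < \<epsilon>) \<and>
      (\<forall>t. 0 \<le> t \<and> t < t1 \<longrightarrow> hysteresis \<alpha> \<beta> (\<lambda>t. m \<bullet> u t) t = 1) \<and>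
      (m \<bullet> snd z = \<alpha> \<longrightarrow> z \<in> dpoin \<and> phase_eq (poin z) (state u t2))))"

lemmas plus_startD = plus_start_def[THEN iffD1, rule_format]

lemma plus_cycle:
  assumes \<epsilon>: "\<epsilon> > 0"
  obtains \<delta> where "\<delta> > 0" "plus_start \<epsilon> \<delta>"
proof -
  obtain \<delta>m where \<delta>m: "\<delta>m > 0" "minus_start \<epsilon> \<delta>m" by (rule minus_flight[OF \<epsilon>])
  obtain \<delta>0 where \<delta>0: "\<delta>0 > 0" "\<And>t t'. t \<in> {0..2 * T} \<Longrightarrow> t' \<in> {0..2 * T} \<Longrightarrow> \<bar>t - t'\<bar> < \<delta>0 \<Longrightarrow> pdist (state uper t) (state uper t') < \<delta>m / 2"
    using state_uper_cont[OF half_gt_zero[OF \<delta>m(1)]] by metis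
  \<comment> \<open>One half of \<open>\<delta>m\<close> pays for the distance to the orbit at the
    hit of \<beta>, the other for the error in the hit time. The second flight then starts within
    \<open>\<delta>m\<close> of the state at \<open>T\<close>.\<close>
  define \<epsilon>' where "\<epsilon>' = min \<epsilon> (min (\<delta>m / 2) \<delta>0)"
  have \<epsilon>': "\<epsilon>' > 0" "\<epsilon>' \<le> \<epsilon>" "\<epsilon>' \<le> \<delta>m / 2" "\<epsilon>' \<le> \<delta>0" using \<epsilon> \<delta>m(1) \<delta>0(1) by (auto simp: \<epsilon>'_def)
  obtain \<delta> where \<delta>: "\<delta> > 0" "\<And>z u \<tau>. z \<in> PS \<Longrightarrow> \<tau> \<in> {0..T} \<Longrightarrow> pdist z (state uper \<tau>) \<le> \<delta> \<Longrightarrow> m \<bullet> snd z < \<beta> \<Longrightarrow> relay_sol z u \<Longrightarrow>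
    \<exists>t1. 0 < t1 \<and> t1 \<le> 2 * T \<and> \<bar>t1 - (T - \<tau>)\<bar> < \<epsilon>' \<and> m \<bullet> u t1 = \<beta> \<and> (\<forall>t. 0 \<le> t \<and> t < t1 \<longrightarrow> m \<bullet> u t < \<beta>) \<and>
      (\<forall>t. 0 \<le> t \<and> t < t1 \<longrightarrow> hysteresis \<alpha> \<beta> (\<lambda>t. m \<bullet> u t) t = 1) \<and>
      (\<forall>t\<in>{0..t1}. state u t \<in> PS \<and> pdist (state u t) (state uper (min (\<tau> + t) T)) < \<epsilon>') \<and>
      relay_sol (state u t1) (\<lambda>t. u (t1 + t)) \<and>
      (\<exists>t>0. m \<bullet> uplus z t = \<beta>) \<and> phase_eq (Pbeta z) (state u t1)"
    by (rule plus_flight[OF \<epsilon>'(1)]) (rule that)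
  have "plus_start \<epsilon> \<delta>" unfolding plus_start_def
  proof (intro allI impI)
    fix z u \<tau> assume z: "z \<in> PS" "\<tau> \<in> {0..T}" "pdist z (state uper \<tau>) \<le> \<delta>" "m \<bullet> snd z < \<beta>" and u: "relay_sol z u"
    from \<delta>(2)[OF z u] obtain t1 where t1: "0 < t1" "\<bar>t1 - (T - \<tau>)\<bar> < \<epsilon>'" "m \<bullet> u t1 = \<beta>"
      and low: "\<And>t. 0 \<le> t \<Longrightarrow> t < t1 \<Longrightarrow> m \<bullet> u t < \<beta>"
      and H: "\<And>t. 0 \<le> t \<Longrightarrow> t < t1 \<Longrightarrow> hysteresis \<alpha> \<beta> (\<lambda>t. m \<bullet> u t) t = 1"
      and st: "\<And>t. t \<in> {0..t1} \<Longrightarrow> state u t \<in> PS" "\<And>t. t \<in> {0..t1} \<Longrightarrow> pdist (state u t) (state uper (min (\<tau> + t) T)) < \<epsilon>'"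
      and re: "restarts u t1" and hit: "\<exists>t>0. m \<bullet> uplus z t = \<beta>" and Pb: "phase_eq (Pbeta z) (state u t1)"
      by blast
    define z' where "z' = state u t1"
    define r where "r = min (\<tau> + t1) T"
    have r: "r \<in> {0..2 * T}" "\<bar>r - T\<bar> < \<delta>0" "T \<in> {0..2 * T}" using t1 z(2) \<epsilon>' T_pos by (auto simp: r_def min_def)
    have z': "z' \<in> PS" "m \<bullet> snd z' = \<beta>" using st(1)[of t1] t1 by (auto simp: z'_def state_def)
    have "pdist z' (state uper T) \<le> pdist z' (state uper r) + pdist (state uper r) (state uper T)"
      by (rule pdist_triangle[OF z'(1) state_uper_PS[OF r(1)] state_uper_PS[OF r(3)]])
    moreover have "pdist z' (state uper r) < \<epsilon>'" using st(2)[of t1] t1(1) by (simp add: z'_def r_def)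
    moreover have "pdist (state uper r) (state uper T) < \<delta>m / 2" by (rule \<delta>0(2)[OF r(1,3,2)])
    ultimately have close: "pdist z' (state uper T) \<le> \<delta>m" using \<epsilon>' by linarith
    have TT: "T \<in> {T..2 * T}" and \<beta>: "m \<bullet> snd z' \<ge> \<beta>" using T_pos z' by auto
    from minus_startD[OF \<delta>m(2) z'(1) TT close \<beta> re[folded z'_def]]
    obtain s1 where s1: "0 < s1" "m \<bullet> u (t1 + s1) = \<alpha>" and high: "\<And>t. 0 \<le> t \<Longrightarrow> t < s1 \<Longrightarrow> m \<bullet> u (t1 + t) > \<alpha>"
      and st': "\<And>t. t \<in> {0..s1} \<Longrightarrow> state u (t1 + t) \<in> PS" "\<And>t. t \<in> {0..s1} \<Longrightarrow> near \<epsilon> (state u (t1 + t))"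
      and end': "pdist (state u (t1 + s1)) z\<alpha> < \<epsilon>" and re': "relay_sol (state u (t1 + s1)) (\<lambda>t. u (t1 + (s1 + t)))"
      and hit': "\<exists>t>0. m \<bullet> uminus' z' t = \<alpha>" and Pa: "phase_eq (Palpha z') (state u (t1 + s1))"
      unfolding state_shift by blast
    have tub: "state u t \<in> PS \<and> near \<epsilon> (state u t)" if t: "t \<in> {0..t1 + s1}" for t
    proof (cases "t \<le> t1")
      case True
      then have "pdist (state u t) (state uper (min (\<tau> + t) T)) < \<epsilon>" using st(2)[of t] t \<epsilon>'(2) by auto
      moreover have "min (\<tau> + t) T \<in> {0..2 * T}" using t z(2) T_pos by (auto simp: min_def)
      ultimately have "near \<epsilon> (state u t)" unfolding near_def by blast
      then show ?thesis using st(1)[of t] t True by auto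
    next
      case False
      then show ?thesis using st'[of "t - t1"] t by auto
    qed
    have cyc: "cycle \<epsilon> u t1 (t1 + s1)"
      unfolding cycle_def
    proof (intro conjI allI impI ballI)
      show "m \<bullet> u t > \<alpha>" if "t1 \<le> t \<and> t < t1 + s1" for t using high[of "t - t1"] that by auto
      show "restarts u (t1 + s1)" using re' by (simp add: add.assoc)
    qed (use t1 s1 low tub end' in auto)
    have "z \<in> dpoin \<and> phase_eq (poin z) (state u (t1 + s1))" if "m \<bullet> snd z = \<alpha>"
    proof
      have "z \<in> dom_P_beta T \<alpha> \<beta> s p \<sigma> k m A B" using z(1) that hit by (simp add: dom_P_beta_def section_at_def)
      moreover have "z' \<in> dom_P_alpha T \<alpha> \<beta> s p \<sigma> k m A B" using z' hit' by (simp add: dom_P_alpha_def section_at_def)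
      ultimately show "z \<in> dpoin"
        using phase_eq_hit_maps(4)[OF Pb] by (simp add: dom_poincare_def z'_def)
      show "phase_eq (poin z) (state u (t1 + s1))"
        using Pa phase_eq_hit_maps(2)[OF Pb] by (simp add: poincare_def z'_def)
    qed
    moreover have "\<bar>t1 - (T - \<tau>)\<bar> < \<epsilon>" using t1(2) \<epsilon>'(2) by simp
    moreover have "\<forall>t\<in>{0..t1}. pdist (state u t) (state uper (min (\<tau> + t) T)) < \<epsilon>"
      using st(2) \<epsilon>'(2) by fastforce
    ultimately show "\<exists>t1 t2. cycle \<epsilon> u t1 t2 \<and> \<bar>t1 - (T - \<tau>)\<bar> < \<epsilon> \<and>
      (\<forall>t\<in>{0..t1}. pdist (state u t) (state uper (min (\<tau> + t) T)) < \<epsilon>) \<and>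
      (\<forall>t. 0 \<le> t \<and> t < t1 \<longrightarrow> hysteresis \<alpha> \<beta> (\<lambda>t. m \<bullet> u t) t = 1) \<and>
      (m \<bullet> snd z = \<alpha> \<longrightarrow> z \<in> dpoin \<and> phase_eq (poin z) (state u t2))"
      using cyc H by blast
  qed
  with \<delta>(1) show thesis by (rule that)
qed

abbreviation "entering \<delta> z \<equiv> (\<exists>\<tau>\<in>{0..T}. pdist z (state uper \<tau>) < \<delta>) \<and> m \<bullet> snd z < \<beta> \<or>
  (\<exists>\<tau>\<in>{T..2 * T}. pdist z (state uper \<tau>) < \<delta>) \<and> m \<bullet> snd z \<ge> \<beta>"

text \<open>From the first arc a full cycle leads to the section, from the second arc a single minus
  flight. Either way the solution arrives near the fixed point and may be restarted there.\<close>

lemma entry: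
  assumes \<epsilon>: "\<epsilon> > 0"
  obtains \<delta> where "\<delta> > 0" "\<And>z u. z \<in> PS \<Longrightarrow> relay_sol z u \<Longrightarrow> entering \<delta> z \<Longrightarrow>
    \<exists>t\<ge>0. m \<bullet> u t = \<alpha> \<and> pdist (state u t) z\<alpha> < \<epsilon> \<and> restarts u t \<and> tube \<epsilon> u t"
proof -
  obtain \<delta>1 where \<delta>1: "\<delta>1 > 0" "plus_start \<epsilon> \<delta>1" by (rule plus_cycle[OF \<epsilon>])
  obtain \<delta>2 where \<delta>2: "\<delta>2 > 0" "minus_start \<epsilon> \<delta>2" by (rule minus_flight[OF \<epsilon>])
  show thesis
  proof (rule that[of "min \<delta>1 \<delta>2"])
    show "min \<delta>1 \<delta>2 > 0" using \<delta>1 \<delta>2 by simp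
    fix z u assume z: "z \<in> PS" "relay_sol z u" and e: "entering (min \<delta>1 \<delta>2) z"
    from e show "\<exists>t\<ge>0. m \<bullet> u t = \<alpha> \<and> pdist (state u t) z\<alpha> < \<epsilon> \<and> restarts u t \<and> tube \<epsilon> u t"
    proof (elim disjE conjE bexE)
      fix \<tau> assume a: "\<tau> \<in> {0..T}" "pdist z (state uper \<tau>) < min \<delta>1 \<delta>2" "m \<bullet> snd z < \<beta>"
      then have "pdist z (state uper \<tau>) \<le> \<delta>1" by simp
      from plus_startD[OF \<delta>1(2) z(1) a(1) this a(3) z(2)] obtain t1 t2 where "cycle \<epsilon> u t1 t2" by blast
      then show ?thesis unfolding cycle_def by (intro exI[of _ t2]) simp
    next
      fix \<tau> assume a: "\<tau> \<in> {T..2 * T}" "pdist z (state uper \<tau>) < min \<delta>1 \<delta>2" "m \<bullet> snd z \<ge> \<beta>"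
      then have "pdist z (state uper \<tau>) \<le> \<delta>2" by simp
      from minus_startD[OF \<delta>2(2) z(1) a(1) this a(3) z(2)]
      obtain t1 where "0 < t1" "m \<bullet> u t1 = \<alpha>" "tube \<epsilon> u t1" "pdist (state u t1) z\<alpha> < \<epsilon>" "restarts u t1" by blast
      then show ?thesis using less_imp_le by blast
    qed
  qed
qed

abbreviation "hs z \<equiv> hsol T \<alpha> \<beta> p k m A B (fst z) (snd z)"

lemma relay_sol_hs: "z \<in> PS \<Longrightarrow> relay_sol z (hs z)"
  unfolding relay_sol_def by (rule hsol_is_solution[OF Bsp_Lp p_pos(2)]) (simp add: PS_iff)

section \<open>Neighbourhoods of the periodic orbit\<close>

lemma Gammas: "Gamma1 T uper \<union> Gamma2 T uper = state uper ` {0..2 * T}"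
  unfolding Gamma1_def Gamma2_def image_Un[symmetric] using T_pos by (intro arg_cong[where f = "image _"]) auto

lemma pdist_uper_self: "\<tau> \<in> {0..2 * T} \<Longrightarrow> pdist (state uper \<tau>) (state uper \<tau>) = 0"
proof (rule ccontr)
  assume \<tau>: "\<tau> \<in> {0..2 * T}" and "pdist (state uper \<tau>) (state uper \<tau>) \<noteq> 0"
  then have "pdist (state uper \<tau>) (state uper \<tau>) > 0" by (simp add: order_less_le)
  from state_uper_cont[OF this] \<tau> show False by (metis abs_zero diff_self less_irrefl)
qed

lemma nbhd_tube:
  assumes S: "S \<subseteq> {0..2 * T}" and \<epsilon>: "\<epsilon> > 0"
  shows "phase_nbhd T s p \<sigma> (state uper ` S) {z \<in> PS. \<exists>\<tau>\<in>S. pdist z (state uper \<tau>) < \<epsilon>}" (is "phase_nbhd _ _ _ _ _ ?U")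
proof -
  have "phase_open T s p \<sigma> ?U"
    unfolding phase_open_def
  proof (intro conjI ballI)
    fix z assume "z \<in> ?U"
    then obtain \<tau> where z: "z \<in> PS" "\<tau> \<in> S" "pdist z (state uper \<tau>) < \<epsilon>" by blast
    show "\<exists>\<epsilon>>0. \<forall>w\<in>PS. pdist w z < \<epsilon> \<longrightarrow> w \<in> ?U"
    proof (intro exI[of _ "\<epsilon> - pdist z (state uper \<tau>)"] conjI ballI impI)
      fix w assume w: "w \<in> PS" "pdist w z < \<epsilon> - pdist z (state uper \<tau>)"
      have "pdist w (state uper \<tau>) \<le> pdist w z + pdist z (state uper \<tau>)"
        by (rule pdist_triangle[OF w(1) z(1) state_uper_PS]) (use z(2) S in auto)
      then have "pdist w (state uper \<tau>) < \<epsilon>" using w(2) by simp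
      then show "w \<in> ?U" using w(1) z(2) by blast
    qed (use z in simp)
  qed auto
  moreover have "state uper ` S \<subseteq> ?U"
  proof
    fix v assume "v \<in> state uper ` S"
    then obtain \<tau> where \<tau>: "\<tau> \<in> S" "v = state uper \<tau>" by blast
    then have "pdist v (state uper \<tau>) < \<epsilon>" using S \<epsilon> pdist_uper_self[of \<tau>] by auto
    then show "v \<in> ?U" using \<tau> S state_uper_PS[of \<tau>] by auto
  qed
  ultimately show ?thesis unfolding phase_nbhd_def by blast
qed

text \<open>Compactness, expressed through the parameters: points outside \<open>U\<close> that
  approach the orbit have nearest parameters with a convergent subsequence, and a ball around the
  state at its limit lies in \<open>U\<close>.\<close>

lemma tube_in_nbhd:
  assumes \<Omega>: "phase_nbhd T s p \<sigma> (Gamma1 T uper \<union> Gamma2 T uper) \<Omega>"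
  obtains \<epsilon> where "\<epsilon> > 0" "\<And>z. z \<in> PS \<Longrightarrow> near \<epsilon> z \<Longrightarrow> z \<in> \<Omega>"
proof -
  obtain U where U: "phase_open T s p \<sigma> U" "state uper ` {0..2 * T} \<subseteq> U" "U \<subseteq> \<Omega>"
    using \<Omega> unfolding phase_nbhd_def Gammas by blast
  have "\<exists>\<epsilon>>0. \<forall>z. z \<in> PS \<and> near \<epsilon> z \<longrightarrow> z \<in> U"
  proof (rule ccontr)
    assume "\<not> ?thesis"
    then have "\<exists>z \<tau>. z \<in> PS \<and> z \<notin> U \<and> \<tau> \<in> {0..2 * T} \<and> pdist z (state uper \<tau>) < 1 / real (Suc n)" for n
      unfolding near_def by (meson divide_pos_pos of_nat_0_less_iff zero_less_Suc zero_less_one)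
    then obtain z \<tau> where z: "\<And>n. z n \<in> PS" "\<And>n. z n \<notin> U" "\<And>n. \<tau> n \<in> {0..2 * T}"
        "\<And>n. pdist (z n) (state uper (\<tau> n)) < 1 / real (Suc n)"
      by metis
    have "seq_compact {0..2 * T}" by (rule compact_imp_seq_compact) simp
    then obtain l r where l: "l \<in> {0..2 * T}" "strict_mono r" "(\<tau> \<circ> r) \<longlonglongrightarrow> l"
      using z(3) unfolding seq_compact_def by metis
    have lPS: "state uper l \<in> PS" by (rule state_uper_PS[OF l(1)])
    obtain e where e: "e > 0" "\<And>w. w \<in> PS \<Longrightarrow> pdist w (state uper l) < e \<Longrightarrow> w \<in> U"
      using U(1,2) l(1) unfolding phase_open_def by blast
    obtain \<delta> where \<delta>: "\<delta> > 0" "\<And>t t'. t \<in> {0..2 * T} \<Longrightarrow> t' \<in> {0..2 * T} \<Longrightarrow> \<bar>t - t'\<bar> < \<delta> \<Longrightarrow> pdist (state uper t) (state uper t') < e / 2"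
      using state_uper_cont[OF half_gt_zero[OF e(1)]] by metis
    have "\<forall>\<^sub>F n in sequentially. dist ((\<tau> \<circ> r) n) l < \<delta>" using l(3) \<delta>(1) by (rule tendstoD)
    moreover have "(\<lambda>n. 1 / real (Suc n)) \<longlonglongrightarrow> 0" using LIMSEQ_inverse_real_of_nat by (simp add: inverse_eq_divide)
    then have "\<forall>\<^sub>F n in sequentially. 1 / real (Suc n) < e / 2" using e(1) by (intro order_tendstoD(2)) auto
    then have "\<forall>\<^sub>F n in sequentially. 1 / real (Suc (r n)) < e / 2" by (rule eventually_subseq[OF l(2)])
    ultimately have "\<forall>\<^sub>F n in sequentially. False"
    proof eventually_elim
      case (elim n)
      have "pdist (z (r n)) (state uper l) \<le> pdist (z (r n)) (state uper (\<tau> (r n))) + pdist (state uper (\<tau> (r n))) (state uper l)"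
        by (rule pdist_triangle[OF z(1) state_uper_PS[OF z(3)] lPS])
      moreover have "pdist (state uper (\<tau> (r n))) (state uper l) < e / 2"
        by (rule \<delta>(2)[OF z(3) l(1)]) (use elim in \<open>simp add: dist_real_def\<close>)
      ultimately have "pdist (z (r n)) (state uper l) < e" using z(4)[of "r n"] elim(2) by linarith
      then show False using e(2)[OF z(1)] z(2) by blast
    qed
    then show False by simp
  qed
  then show thesis using U(3) that by blast
qed

lemma ball_in_nbhd:
  assumes \<Omega>: "phase_nbhd T s p \<sigma> (Gamma1 T uper) \<Omega>"
  obtains \<epsilon> where "\<epsilon> > 0" "\<And>z. z \<in> PS \<Longrightarrow> pdist z z\<alpha> < \<epsilon> \<Longrightarrow> z \<in> \<Omega>"
proof -
  obtain U where U: "phase_open T s p \<sigma> U" "Gamma1 T uper \<subseteq> U" "U \<subseteq> \<Omega>"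
    using \<Omega> unfolding phase_nbhd_def by blast
  have "state uper 0 \<in> U" using U(2) T_pos by (auto simp: Gamma1_def)
  then obtain e where "e > 0" "\<forall>w\<in>PS. pdist w (state uper 0) < e \<longrightarrow> w \<in> U" using U(1) unfolding phase_open_def by blast
  then show thesis using U(3) pdist_uper_0 by (intro that[of e]) auto
qed

text \<open>Perturbations of the fixed point are renamed as points of the section, so that both
  notions of stability become statements about balls; \<open>Q\<close> stands for what they claim
  about the iterates.\<close>

lemma fixed_point_perturbation:
  "(\<forall>\<nu>\<in>BS. \<forall>y. pnorm (\<nu>, y) \<le> \<delta> \<and> (\<lambda>\<xi>. \<phi>\<alpha> \<xi> + \<nu> \<xi>, x\<alpha> + y) \<in> section_at T s p \<sigma> m \<alpha> \<longrightarrow> Q (\<lambda>\<xi>. \<phi>\<alpha> \<xi> + \<nu> \<xi>, x\<alpha> + y)) \<longleftrightarrow>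
   (\<forall>z. z \<in> PS \<and> m \<bullet> snd z = \<alpha> \<and> pdist z z\<alpha> \<le> \<delta> \<longrightarrow> Q z)" (is "?L \<longleftrightarrow> ?R")
proof
  assume L: ?L
  show ?R
  proof (intro allI impI, elim conjE)
    fix z assume z: "z \<in> PS" "m \<bullet> snd z = \<alpha>" "pdist z z\<alpha> \<le> \<delta>"
    have eq: "(\<lambda>\<xi>. \<phi>\<alpha> \<xi> + (fst z \<xi> - \<phi>\<alpha> \<xi>), x\<alpha> + (snd z - x\<alpha>)) = z" by simp
    have \<nu>: "(\<lambda>\<xi>. fst z \<xi> - \<phi>\<alpha> \<xi>) \<in> BS" by (rule Bsp_diff) (use z phi in \<open>auto simp: PS_iff\<close>)
    from L[rule_format, OF \<nu>, of "snd z - x\<alpha>", unfolded eq] z show "Q z"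
      by (simp add: section_at_def phase_dist_def)
  qed
next
  assume R: ?R
  show ?L
  proof (intro ballI allI impI, elim conjE)
    fix \<nu> y assume a: "\<nu> \<in> BS" "pnorm (\<nu>, y) \<le> \<delta>" "(\<lambda>\<xi>. \<phi>\<alpha> \<xi> + \<nu> \<xi>, x\<alpha> + y) \<in> section_at T s p \<sigma> m \<alpha>"
    show "Q (\<lambda>\<xi>. \<phi>\<alpha> \<xi> + \<nu> \<xi>, x\<alpha> + y)"
      by (rule R[rule_format]) (use a in \<open>auto simp: section_at_def phase_dist_def\<close>)
  qed
qed

lemmas fp_stable_iff = fp_stable_def[of T \<alpha> \<beta> s p \<sigma> k m A B \<phi>\<alpha> x\<alpha>,
    unfolded fixed_point_perturbation[where Q = "\<lambda>z. \<forall>n. (poin ^^ n) z \<in> dpoin \<and> pdist ((poin ^^ n) z) z\<alpha> \<le> _"]]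
lemmas fp_asymp_stable_iff = fp_asymp_stable_def[of T \<alpha> \<beta> s p \<sigma> k m A B \<phi>\<alpha> x\<alpha>,
    unfolded fixed_point_perturbation[where Q = "\<lambda>z. (\<lambda>n. pdist ((poin ^^ n) z) z\<alpha>) \<longlonglongrightarrow> 0"]]

text \<open>An infimum is below \<epsilon> exactly when one of its members is, which is the relation
  \<open>near\<close>.\<close>

lemma orbit_distance_tendsto:
  "((\<lambda>t. INF w\<in>Gamma1 T uper \<union> Gamma2 T uper. pdist (state u t) w) \<longlongrightarrow> 0) at_top \<longleftrightarrow>
   (\<forall>\<epsilon>>0. \<forall>\<^sub>F t in at_top. near \<epsilon> (state u t))"
proof -
  let ?d = "\<lambda>t. INF w\<in>Gamma1 T uper \<union> Gamma2 T uper. pdist (state u t) w"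
  have ne: "(pdist z ` (Gamma1 T uper \<union> Gamma2 T uper)) \<noteq> {}" for z using T_pos by (auto simp: Gammas)
  have bdd: "bdd_below (pdist z ` (Gamma1 T uper \<union> Gamma2 T uper))" for z by (rule bdd_belowI2[of _ 0]) simp
  have nonneg: "?d t \<ge> 0" for t using ne by (intro cINF_greatest) auto
  have less: "?d t < \<epsilon> \<longleftrightarrow> near \<epsilon> (state u t)" for t \<epsilon>
    using cInf_less_iff[OF ne[of "state u t"] bdd[of "state u t"], of \<epsilon>] by (auto simp: near_def Gammas)
  show ?thesis
    using nonneg by (simp add: tendsto_iff dist_real_def less)
qed

section \<open>The Poincare map governs the orbits\<close>

lemma poin_iter_cong: "phase_eq z w \<Longrightarrow> phase_eq ((poin ^^ n) z) ((poin ^^ n) w)"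
  by (cases n) (simp_all add: funpow_Suc_right phase_eq_poincare(1) del: funpow.simps)

text \<open>The lower bound \<open>T / 2\<close> for the return time forces the n-th return to occur
  after \<open>n * (T / 2)\<close>, so that the returns exhaust the half-line.\<close>

definition follows :: "real \<Rightarrow> real \<Rightarrow> bool" where
  "follows \<delta> \<epsilon> \<longleftrightarrow> (\<forall>z u. z \<in> PS \<and> m \<bullet> snd z = \<alpha> \<and> pdist z z\<alpha> \<le> \<delta> \<and> relay_sol z u \<longrightarrow>
     z \<in> dpoin \<and> (\<exists>t\<ge>T / 2. m \<bullet> u t = \<alpha> \<and> phase_eq (poin z) (state u t) \<and> restarts u t \<and> tube \<epsilon> u t))"

lemma follows_exists:
  assumes "\<epsilon> > 0"
  obtains \<delta> where "\<delta> > 0" "follows \<delta> \<epsilon>"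
proof -
  \<comment> \<open>With \<epsilon>' at most \<open>T / 2\<close>, the estimate
    \<open>\<bar>t1 - T\<bar> < \<epsilon>'\<close> gives the lower bound on the return
    time.\<close>
  define \<epsilon>' where "\<epsilon>' = min \<epsilon> (T / 2)"
  have \<epsilon>': "\<epsilon>' > 0" "\<epsilon>' \<le> \<epsilon>" "\<epsilon>' \<le> T / 2" using assms T_pos by (auto simp: \<epsilon>'_def)
  obtain \<delta> where \<delta>: "\<delta> > 0" "plus_start \<epsilon>' \<delta>" by (rule plus_cycle[OF \<epsilon>'(1)])
  have "follows \<delta> \<epsilon>"
    unfolding follows_def
  proof (intro allI impI, elim conjE)
    fix z u assume z: "z \<in> PS" "m \<bullet> snd z = \<alpha>" "pdist z z\<alpha> \<le> \<delta>" "relay_sol z u"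
    have "0 \<in> {0..T}" "pdist z (state uper 0) \<le> \<delta>" "m \<bullet> snd z < \<beta>" using T_pos z pdist_uper_0 levels by auto
    from plus_startD[OF \<delta>(2) z(1) this z(4)] z(2)
    obtain t1 t2 where t: "cycle \<epsilon>' u t1 t2" "\<bar>t1 - T\<bar> < \<epsilon>'" "z \<in> dpoin" "phase_eq (poin z) (state u t2)" by auto
    then have "T / 2 \<le> t2" using \<epsilon>'(3) by (auto simp: cycle_def)
    moreover have "tube \<epsilon> u t2" using t(1) near_mono[OF _ \<epsilon>'(2)] by (auto simp: cycle_def)
    ultimately show "z \<in> dpoin \<and> (\<exists>t\<ge>T / 2. m \<bullet> u t = \<alpha> \<and> phase_eq (poin z) (state u t) \<and> restarts u t \<and> tube \<epsilon> u t)"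
      using t by (auto simp: cycle_def)
  qed
  with \<delta>(1) show thesis by (rule that)
qed

text \<open>Each return is a new start within \<delta>, because the iterates are assumed to stay
  there. Iterate and state are different representatives, so every step transfers distances and
  images along \<open>phase_eq\<close>.\<close>

lemma reach:
  assumes fol: "follows \<delta> \<epsilon>" and z: "z \<in> PS" "m \<bullet> snd z = \<alpha>" "relay_sol z u"
    and close: "\<And>n. pdist ((poin ^^ n) z) z\<alpha> \<le> \<delta>"
  shows "\<exists>t\<ge>real n * (T / 2). m \<bullet> u t = \<alpha> \<and> phase_eq ((poin ^^ n) z) (state u t) \<and> state u t \<in> PS \<and> restarts u t \<and> tube \<epsilon> u t"
proof (induction n)
  case 0
  have e: "phase_eq z (state u 0)" by (rule relay_sol_initial[OF z(3)])
  have "pdist z z\<alpha> \<le> \<delta>" using close[of 0] by simp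
  then have "\<exists>t\<ge>T / 2. tube \<epsilon> u t" using fol[unfolded follows_def, rule_format, of z u] z by blast
  then have "tube \<epsilon> u 0" using T_pos by auto
  moreover have "relay_sol (state u 0) u" using relay_sol_cong[OF e] z(3) by blast
  moreover have "m \<bullet> u 0 = \<alpha>" using z(2) e by (simp add: phase_eq_def state_def)
  ultimately show ?case using e phase_eq_PS[OF e] z by (intro exI[of _ 0]) auto
next
  case (Suc n)
  then obtain t where t: "t \<ge> real n * (T / 2)" "m \<bullet> u t = \<alpha>" "phase_eq ((poin ^^ n) z) (state u t)" "state u t \<in> PS" "restarts u t"
    and tub: "tube \<epsilon> u t" by blast
  have "real n * (T / 2) \<ge> 0" using T_pos by simp
  then have t0: "t \<ge> 0" using t(1) by linarith
  have "pdist (state u t) z\<alpha> \<le> \<delta>" using close[of n] phase_eq_dist(1)[OF t(3)] by simp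
  then obtain r where r: "r \<ge> T / 2" "m \<bullet> u (t + r) = \<alpha>" "phase_eq (poin (state u t)) (state u (t + r))"
      "relay_sol (state u (t + r)) (\<lambda>r'. u (t + (r + r')))" and tub': "\<forall>r'\<in>{0..r}. state u (t + r') \<in> PS \<and> near \<epsilon> (state u (t + r'))"
    using fol[unfolded follows_def, rule_format, of "state u t" "\<lambda>r. u (t + r)"] t unfolding state_shift by (auto simp: state_def)
  have "tube \<epsilon> u (t + r)"
  proof
    fix r' assume "r' \<in> {0..t + r}"
    then show "state u r' \<in> PS \<and> near \<epsilon> (state u r')"
      using tub tub'[rule_format, of "r' - t"] by (cases "r' \<le> t") auto
  qed
  moreover have "real (Suc n) * (T / 2) \<le> t + r" using t(1) r(1) by (simp add: distrib_right)
  moreover have "phase_eq ((poin ^^ Suc n) z) (state u (t + r))" using r(3) phase_eq_poincare(1)[OF t(3)] by simp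
  moreover have "state u (t + r) \<in> PS" using tub'[rule_format, of r] r(1) T_pos by simp
  moreover have "restarts u (t + r)" using r(4) by (simp add: add.assoc)
  ultimately show ?case using r(2) by blast
qed

lemma reach_all:
  assumes "follows \<delta> \<epsilon>" "z \<in> PS" "m \<bullet> snd z = \<alpha>" "relay_sol z u" "\<And>n. pdist ((poin ^^ n) z) z\<alpha> \<le> \<delta>" and t: "t \<ge> 0"
  shows "state u t \<in> PS \<and> near \<epsilon> (state u t)"
proof -
  obtain n where "t / (T / 2) \<le> real n" using real_arch_simple by blast
  then have "t \<le> real n * (T / 2)" using T_pos by (simp add: pos_divide_le_eq)
  moreover obtain t' where "t' \<ge> real n * (T / 2)" "tube \<epsilon> u t'" using reach[OF assms(1-5), of n] by blast
  ultimately show ?thesis using t by auto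
qed

text \<open>\<open>entry\<close> brings the solution to the section inside the ball of radius
  \<open>\<delta>'\<close>; stability of the fixed point keeps all iterates within \<delta>, and
  \<open>reach_all\<close> converts this into a tube for all later times.\<close>

lemma fp_imp_orbitally_stable:
  assumes fp: "fp_stable T \<alpha> \<beta> s p \<sigma> k m A B \<phi>\<alpha> x\<alpha>"
  shows "orbitally_stable T \<alpha> \<beta> s p \<sigma> k m A B uper"
  unfolding orbitally_stable_def
proof (intro allI impI)
  fix \<Omega> assume "phase_nbhd T s p \<sigma> (Gamma1 T uper \<union> Gamma2 T uper) \<Omega>"
  from tube_in_nbhd[OF this] obtain \<epsilon> where \<epsilon>: "\<epsilon> > 0" "\<And>z. z \<in> PS \<Longrightarrow> near \<epsilon> z \<Longrightarrow> z \<in> \<Omega>" by metis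
  obtain \<delta> where \<delta>: "\<delta> > 0" "follows \<delta> \<epsilon>" by (rule follows_exists[OF \<epsilon>(1)])
  obtain \<delta>' where \<delta>': "\<delta>' > 0" "\<And>z. z \<in> PS \<Longrightarrow> m \<bullet> snd z = \<alpha> \<Longrightarrow> pdist z z\<alpha> \<le> \<delta>' \<Longrightarrow> \<forall>n. pdist ((poin ^^ n) z) z\<alpha> \<le> \<delta>"
    using fp[unfolded fp_stable_iff, rule_format, OF \<delta>(1)] by blast
  \<comment> \<open>Also bounded by \<epsilon>, since the passage before the arrival must stay in
    the tube as well.\<close>
  have pos: "min \<delta>' \<epsilon> > 0" using \<delta>' \<epsilon> by simp
  obtain d where d: "d > 0" "\<And>z u. z \<in> PS \<Longrightarrow> relay_sol z u \<Longrightarrow> entering d z \<Longrightarrow>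
    \<exists>t\<ge>0. m \<bullet> u t = \<alpha> \<and> pdist (state u t) z\<alpha> < min \<delta>' \<epsilon> \<and> restarts u t \<and> tube (min \<delta>' \<epsilon>) u t"
    by (rule entry[OF pos]) (rule that)
  show "\<exists>\<Omega>1 \<Omega>2. phase_nbhd T s p \<sigma> (Gamma1 T uper) \<Omega>1 \<and> phase_nbhd T s p \<sigma> (Gamma2 T uper) \<Omega>2 \<and>
           (\<forall>\<phi> x. ((\<phi>, x) \<in> \<Omega>1 \<and> m \<bullet> x < \<beta>) \<or> ((\<phi>, x) \<in> \<Omega>2 \<and> m \<bullet> x \<ge> \<beta>) \<longrightarrow>
              orbit (hsol T \<alpha> \<beta> p k m A B \<phi> x) \<subseteq> \<Omega>)"
  proof (intro exI conjI allI impI)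
    show "phase_nbhd T s p \<sigma> (Gamma1 T uper) {z \<in> PS. \<exists>\<tau>\<in>{0..T}. pdist z (state uper \<tau>) < d}"
      unfolding Gamma1_def using T_pos by (intro nbhd_tube d(1)) auto
    show "phase_nbhd T s p \<sigma> (Gamma2 T uper) {z \<in> PS. \<exists>\<tau>\<in>{T..2 * T}. pdist z (state uper \<tau>) < d}"
      unfolding Gamma2_def using T_pos by (intro nbhd_tube d(1)) auto
    fix \<phi> x
    assume a: "((\<phi>, x) \<in> {z \<in> PS. \<exists>\<tau>\<in>{0..T}. pdist z (state uper \<tau>) < d} \<and> m \<bullet> x < \<beta>) \<or>
      ((\<phi>, x) \<in> {z \<in> PS. \<exists>\<tau>\<in>{T..2 * T}. pdist z (state uper \<tau>) < d} \<and> m \<bullet> x \<ge> \<beta>)"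
    define z where "z = (\<phi>, x)"
    define u where "u = hs z"
    have z: "z \<in> PS" "entering d z" using a by (auto simp: z_def)
    have u: "relay_sol z u" unfolding u_def by (rule relay_sol_hs[OF z(1)])
    from d(2)[OF z(1) u z(2)] obtain t where t: "t \<ge> 0" "m \<bullet> u t = \<alpha>" "pdist (state u t) z\<alpha> < min \<delta>' \<epsilon>" "restarts u t" "tube (min \<delta>' \<epsilon>) u t"
      by blast
    have tP: "state u t \<in> PS" using t(1,5) by auto
    have lev: "m \<bullet> snd (state u t) = \<alpha>" using t(2) by (simp add: state_def)
    have cl: "pdist ((poin ^^ n) (state u t)) z\<alpha> \<le> \<delta>" for n using \<delta>'(2)[OF tP lev] t(3) by auto
    have "state u r \<in> \<Omega>" if r: "r \<ge> 0" for r
    proof (cases "r \<le> t")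
      case True
      then show ?thesis using t(5) r near_mono[of "min \<delta>' \<epsilon>" "state u r" \<epsilon>] by (intro \<epsilon>(2)) auto
    next
      case False
      then have "state u r \<in> PS \<and> near \<epsilon> (state u r)"
        using reach_all[OF \<delta>(2) tP lev t(4) cl, of "r - t"] unfolding state_shift by simp
      then show ?thesis using \<epsilon>(2) by blast
    qed
    then show "orbit (hsol T \<alpha> \<beta> p k m A B \<phi> x) \<subseteq> \<Omega>" by (auto simp: orbit_def u_def z_def)
  qed
qed

text \<open>For each \<epsilon> the solution is followed anew, from a return so late that all
  further iterates lie within the threshold belonging to \<epsilon>.\<close>

lemma fp_imp_orbitally_asymp_stable:
  assumes fp: "fp_asymp_stable T \<alpha> \<beta> s p \<sigma> k m A B \<phi>\<alpha> x\<alpha>"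
  shows "orbitally_asymp_stable T \<alpha> \<beta> s p \<sigma> k m A B uper"
  unfolding orbitally_asymp_stable_def
proof
  have st: "fp_stable T \<alpha> \<beta> s p \<sigma> k m A B \<phi>\<alpha> x\<alpha>" using fp by (simp add: fp_asymp_stable_def)
  show "orbitally_stable T \<alpha> \<beta> s p \<sigma> k m A B uper" by (rule fp_imp_orbitally_stable[OF st])
  obtain \<delta> where \<delta>: "\<delta> > 0" "follows \<delta> 1" by (rule follows_exists[OF zero_less_one])
  obtain \<delta>' where \<delta>': "\<delta>' > 0" "\<And>z. z \<in> PS \<Longrightarrow> m \<bullet> snd z = \<alpha> \<Longrightarrow> pdist z z\<alpha> \<le> \<delta>' \<Longrightarrow> \<forall>n. pdist ((poin ^^ n) z) z\<alpha> \<le> \<delta>"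
    using st[unfolded fp_stable_iff, rule_format, OF \<delta>(1)] by blast
  obtain \<delta>'' where \<delta>'': "\<delta>'' > 0" "\<And>z. z \<in> PS \<Longrightarrow> m \<bullet> snd z = \<alpha> \<Longrightarrow> pdist z z\<alpha> \<le> \<delta>'' \<Longrightarrow> (\<lambda>n. pdist ((poin ^^ n) z) z\<alpha>) \<longlonglongrightarrow> 0"
    using fp[unfolded fp_asymp_stable_iff] by blast
  have pos: "min \<delta>' \<delta>'' > 0" using \<delta>' \<delta>'' by simp
  obtain d where d: "d > 0" "\<And>z u. z \<in> PS \<Longrightarrow> relay_sol z u \<Longrightarrow> entering d z \<Longrightarrow>
    \<exists>t\<ge>0. m \<bullet> u t = \<alpha> \<and> pdist (state u t) z\<alpha> < min \<delta>' \<delta>'' \<and> restarts u t \<and> tube (min \<delta>' \<delta>'') u t"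
    by (rule entry[OF pos]) (rule that)
  show "\<exists>\<Theta>1 \<Theta>2. phase_nbhd T s p \<sigma> (Gamma1 T uper) \<Theta>1 \<and> phase_nbhd T s p \<sigma> (Gamma2 T uper) \<Theta>2 \<and>
        (\<forall>\<phi> x. ((\<phi>, x) \<in> \<Theta>1 \<and> m \<bullet> x < \<beta>) \<or> ((\<phi>, x) \<in> \<Theta>2 \<and> m \<bullet> x \<ge> \<beta>) \<longrightarrow>
           ((\<lambda>t. INF w\<in>Gamma1 T uper \<union> Gamma2 T uper. pdist (state (hsol T \<alpha> \<beta> p k m A B \<phi> x) t) w) \<longlongrightarrow> 0) at_top)"
  proof (intro exI conjI allI impI)
    show "phase_nbhd T s p \<sigma> (Gamma1 T uper) {z \<in> PS. \<exists>\<tau>\<in>{0..T}. pdist z (state uper \<tau>) < d}"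
      unfolding Gamma1_def using T_pos by (intro nbhd_tube d(1)) auto
    show "phase_nbhd T s p \<sigma> (Gamma2 T uper) {z \<in> PS. \<exists>\<tau>\<in>{T..2 * T}. pdist z (state uper \<tau>) < d}"
      unfolding Gamma2_def using T_pos by (intro nbhd_tube d(1)) auto
    fix \<phi> x
    assume a: "((\<phi>, x) \<in> {z \<in> PS. \<exists>\<tau>\<in>{0..T}. pdist z (state uper \<tau>) < d} \<and> m \<bullet> x < \<beta>) \<or>
      ((\<phi>, x) \<in> {z \<in> PS. \<exists>\<tau>\<in>{T..2 * T}. pdist z (state uper \<tau>) < d} \<and> m \<bullet> x \<ge> \<beta>)"
    define z where "z = (\<phi>, x)"
    define u where "u = hs z"
    have z: "z \<in> PS" "entering d z" using a by (auto simp: z_def)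
    have u: "relay_sol z u" unfolding u_def by (rule relay_sol_hs[OF z(1)])
    from d(2)[OF z(1) u z(2)] obtain t where t: "t \<ge> 0" "m \<bullet> u t = \<alpha>" "pdist (state u t) z\<alpha> < min \<delta>' \<delta>''" "restarts u t" "tube (min \<delta>' \<delta>'') u t"
      by blast
    have tP: "state u t \<in> PS" using t(1,5) by auto
    have lev: "m \<bullet> snd (state u t) = \<alpha>" using t(2) by (simp add: state_def)
    have cl: "pdist ((poin ^^ n) (state u t)) z\<alpha> \<le> \<delta>" for n using \<delta>'(2)[OF tP lev] t(3) by auto
    have lim: "(\<lambda>n. pdist ((poin ^^ n) (state u t)) z\<alpha>) \<longlonglongrightarrow> 0" using \<delta>''(2)[OF tP lev] t(3) by auto
    have "\<forall>\<^sub>F r in at_top. near \<epsilon> (state u r)" if \<epsilon>: "\<epsilon> > 0" for \<epsilon>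
    proof -
      obtain \<eta> where \<eta>: "\<eta> > 0" "follows \<eta> \<epsilon>" by (rule follows_exists[OF \<epsilon>])
      from order_tendstoD(2)[OF lim \<eta>(1)] obtain N where N: "\<And>n. n \<ge> N \<Longrightarrow> pdist ((poin ^^ n) (state u t)) z\<alpha> < \<eta>"
        by (auto simp: eventually_sequentially)
      from reach[OF \<delta>(2) tP lev t(4) cl, of N] obtain r where r: "r \<ge> real N * (T / 2)" "m \<bullet> u (t + r) = \<alpha>"
        "phase_eq ((poin ^^ N) (state u t)) (state u (t + r))" "state u (t + r) \<in> PS" "relay_sol (state u (t + r)) (\<lambda>r'. u (t + (r + r')))"
        unfolding state_shift by blast
      have r5: "restarts u (t + r)" using r(5) by (simp add: add.assoc)
      have lev': "m \<bullet> snd (state u (t + r)) = \<alpha>" using r(2) by (simp add: state_def)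
      \<comment> \<open>The iterates of the late return state are the tail of the original sequence
        of iterates.\<close>
      have cl': "pdist ((poin ^^ n) (state u (t + r))) z\<alpha> \<le> \<eta>" for n
      proof -
        have "pdist ((poin ^^ n) (state u (t + r))) z\<alpha> = pdist ((poin ^^ (n + N)) (state u t)) z\<alpha>"
          using phase_eq_dist(1)[OF poin_iter_cong[OF r(3), of n], of z\<alpha>] by (simp add: funpow_add)
        then show ?thesis using N[of "n + N"] by simp
      qed
      have "near \<epsilon> (state u r')" if "r' \<ge> t + r" for r'
        using reach_all[OF \<eta>(2) r(4) lev' r5 cl', of "r' - (t + r)"] that unfolding state_shift by simp
      then show ?thesis by (auto simp: eventually_at_top_linorder)
    qed
    then have "((\<lambda>t. INF w\<in>Gamma1 T uper \<union> Gamma2 T uper. pdist (state u t) w) \<longlongrightarrow> 0) at_top"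
      by (simp only: orbit_distance_tendsto) simp
    then show "((\<lambda>t. INF w\<in>Gamma1 T uper \<union> Gamma2 T uper. pdist (state (hsol T \<alpha> \<beta> p k m A B \<phi> x) t) w) \<longlongrightarrow> 0) at_top"
      by (simp add: u_def z_def)
  qed
qed

section \<open>The orbits govern the Poincare map\<close>

text \<open>Being near some point of the orbit at time \<open>T / 2\<close> suffices: by separation this point lies on the
  first arc, and the flight can be restarted from there with the smaller bound.\<close>

lemma step_back:
  obtains \<delta>0 where "\<delta>0 > 0" "\<And>\<epsilon>. \<epsilon> > 0 \<Longrightarrow> \<exists>\<epsilon>2>0. \<forall>z u. z \<in> PS \<and> m \<bullet> snd z = \<alpha> \<and> pdist z z\<alpha> \<le> \<delta>0 \<and> relay_sol z u \<and> near \<epsilon>2 (state u (T / 2)) \<longrightarrow>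
    z \<in> dpoin \<and> (\<exists>t\<ge>T / 2. m \<bullet> u t = \<alpha> \<and> phase_eq (poin z) (state u t) \<and> state u t \<in> PS \<and> restarts u t \<and> pdist (state u t) z\<alpha> < \<epsilon>)"
proof -
  obtain \<rho> where \<rho>: "\<rho> > 0" "\<And>\<tau>. \<tau> \<in> {0..2 * T} \<Longrightarrow> pdist (state uper (T / 2)) (state uper \<tau>) < \<rho> \<Longrightarrow> \<tau> < T"
    by (rule separation) (rule that)
  \<comment> \<open>The bound \<open>\<rho> / 2\<close> leaves room for a second distance in the
    triangle inequality. The bound \<open>T / 4\<close> puts the hit of \<beta> after
    \<open>3T/4\<close>, so that time \<open>T / 2\<close> belongs to the first flight.\<close>
  have pos: "min (\<rho> / 2) (T / 4) > 0" using \<rho> T_pos by simp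
  obtain \<delta>0 where \<delta>0: "\<delta>0 > 0" "plus_start (min (\<rho> / 2) (T / 4)) \<delta>0" by (rule plus_cycle[OF pos])
  show thesis
  proof (rule that[OF \<delta>0(1)])
    fix \<epsilon> :: real assume \<epsilon>: "\<epsilon> > 0"
    obtain \<delta> where \<delta>: "\<delta> > 0" "plus_start \<epsilon> \<delta>" by (rule plus_cycle[OF \<epsilon>])
    show "\<exists>\<epsilon>2>0. \<forall>z u. z \<in> PS \<and> m \<bullet> snd z = \<alpha> \<and> pdist z z\<alpha> \<le> \<delta>0 \<and> relay_sol z u \<and> near \<epsilon>2 (state u (T / 2)) \<longrightarrow>
      z \<in> dpoin \<and> (\<exists>t\<ge>T / 2. m \<bullet> u t = \<alpha> \<and> phase_eq (poin z) (state u t) \<and> state u t \<in> PS \<and> restarts u t \<and> pdist (state u t) z\<alpha> < \<epsilon>)"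
    proof (rule exI[of _ "min (\<rho> / 2) \<delta>"], rule conjI, goal_cases)
      case 1
      show ?case using \<rho> \<delta> by simp
    next
      case 2
      show ?case
      proof (intro allI impI, goal_cases)
        case (1 z u)
        then have z: "z \<in> PS" "m \<bullet> snd z = \<alpha>" "pdist z z\<alpha> \<le> \<delta>0" "relay_sol z u" "near (min (\<rho> / 2) \<delta>) (state u (T / 2))" by auto
        have "0 \<in> {0..T}" "pdist z (state uper 0) \<le> \<delta>0" "m \<bullet> snd z < \<beta>" using T_pos z pdist_uper_0 levels by auto
        from plus_startD[OF \<delta>0(2) z(1) this z(4)] z(2) obtain t1 t2 where c: "cycle (min (\<rho> / 2) (T / 4)) u t1 t2" "\<bar>t1 - T\<bar> < min (\<rho> / 2) (T / 4)"
          and mid: "\<And>t. t \<in> {0..t1} \<Longrightarrow> pdist (state u t) (state uper (min t T)) < min (\<rho> / 2) (T / 4)"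
          and H: "\<And>t. 0 \<le> t \<Longrightarrow> t < t1 \<Longrightarrow> hysteresis \<alpha> \<beta> (\<lambda>t. m \<bullet> u t) t = 1"
          and P: "z \<in> dpoin" "phase_eq (poin z) (state u t2)"
          by auto
        have t12: "T / 2 < t1" "t1 < t2" using c by (auto simp: cycle_def)
        let ?w = "state u (T / 2)"
        have w: "?w \<in> PS" using c(1) t12 T_pos by (auto simp: cycle_def)
        have low: "m \<bullet> u (T / 2) < \<beta>" using c(1) t12 T_pos by (auto simp: cycle_def)
        have half: "T / 2 \<in> {0..2 * T}" using T_pos by simp
        from z(5) obtain \<tau> where \<tau>: "\<tau> \<in> {0..2 * T}" "pdist ?w (state uper \<tau>) < min (\<rho> / 2) \<delta>" unfolding near_def by blast
        have "pdist (state uper (T / 2)) (state uper \<tau>) \<le> pdist (state uper (T / 2)) ?w + pdist ?w (state uper \<tau>)"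
          by (rule pdist_triangle[OF state_uper_PS[OF half] w state_uper_PS[OF \<tau>(1)]])
        moreover have "pdist (state uper (T / 2)) ?w = pdist ?w (state uper (T / 2))"
          by (rule pdist_sym[OF state_uper_PS[OF half] w])
        moreover have "pdist ?w (state uper (T / 2)) < \<rho> / 2" using mid[of "T / 2"] t12 T_pos by (simp add: min_def split: if_splits)
        ultimately have "\<tau> < T" using \<tau> by (intro \<rho>(2)) auto
        then have \<tau>': "\<tau> \<in> {0..T}" using \<tau>(1) by simp
        \<comment> \<open>On the first flight the relay is 1 and the level below \<beta>, in
          accordance with the initial rule.\<close>
        have re: "restarts u (T / 2)"
          by (rule relay_sol_shift[OF z(4)]) (use H[of "T / 2"] low t12 T_pos in auto)
        have "pdist ?w (state uper \<tau>) \<le> \<delta>" "m \<bullet> snd ?w < \<beta>" using \<tau>(2) low by (auto simp: state_def)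
        from plus_startD[OF \<delta>(2) w \<tau>' this re] obtain r1 r2 where r: "cycle \<epsilon> (\<lambda>r. u (T / 2 + r)) r1 r2" by blast
        have rD: "0 < r1" "r1 < r2" "m \<bullet> u (T / 2 + r1) = \<beta>" "m \<bullet> u (T / 2 + r2) = \<alpha>" "\<And>t. 0 \<le> t \<Longrightarrow> t < r1 \<Longrightarrow> m \<bullet> u (T / 2 + t) < \<beta>"
          "\<And>t. r1 \<le> t \<Longrightarrow> t < r2 \<Longrightarrow> m \<bullet> u (T / 2 + t) > \<alpha>" "pdist (state u (T / 2 + r2)) z\<alpha> < \<epsilon>"
          using r unfolding cycle_def state_shift by auto
        have tD: "m \<bullet> u t1 = \<beta>" "m \<bullet> u t2 = \<alpha>" "\<And>t. 0 \<le> t \<Longrightarrow> t < t1 \<Longrightarrow> m \<bullet> u t < \<beta>" "\<And>t. t1 \<le> t \<Longrightarrow> t < t2 \<Longrightarrow> m \<bullet> u t > \<alpha>"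
          using c(1) unfolding cycle_def by auto
        \<comment> \<open>The cycle from time 0 and the one restarted at \<open>T / 2\<close> belong
          to the same solution. Their hits are first hits and therefore coincide, so the sharper
          bound of the restarted cycle holds at \<open>t2\<close>.\<close>
        have e1: "T / 2 + r1 = t1"
        proof (rule antisym; rule ccontr)
          assume "\<not> T / 2 + r1 \<le> t1"
          then show False using rD(5)[of "t1 - T / 2"] tD(1) t12 by simp
        next
          assume "\<not> t1 \<le> T / 2 + r1"
          then show False using tD(3)[of "T / 2 + r1"] rD(1,3) T_pos by simp
        qed
        have e2: "T / 2 + r2 = t2"
        proof (rule antisym; rule ccontr)
          assume "\<not> T / 2 + r2 \<le> t2"
          then show False using rD(6)[of "t2 - T / 2"] tD(2) t12 e1 by simp
        next
          assume "\<not> t2 \<le> T / 2 + r2"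
          then show False using tD(4)[of "T / 2 + r2"] rD(2,4) e1 by simp
        qed
        have "state u t2 \<in> PS" "restarts u t2" using c(1) t12 T_pos unfolding cycle_def by auto
        then show ?case using P tD(2) rD(7) t12 unfolding e2 by (intro conjI exI[of _ t2]) auto
      qed
    qed
  qed
qed

text \<open>The assumption \<open>step\<close> sends the ball of radius \<delta> on the section into
  itself, with an accuracy of the orbit that is the same in every cycle. Errors thus do not
  accumulate and the step can be iterated.\<close>

lemma returns:
  assumes step: "\<And>z u. z \<in> PS \<Longrightarrow> m \<bullet> snd z = \<alpha> \<Longrightarrow> pdist z z\<alpha> \<le> \<delta> \<Longrightarrow> relay_sol z u \<Longrightarrow> near \<epsilon>2 (state u (T / 2)) \<Longrightarrow>
      z \<in> dpoin \<and> (\<exists>t\<ge>T / 2. m \<bullet> u t = \<alpha> \<and> phase_eq (poin z) (state u t) \<and> state u t \<in> PS \<and> restarts u t \<and> pdist (state u t) z\<alpha> < \<delta>)"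
    and z: "z \<in> PS" "m \<bullet> snd z = \<alpha>" "pdist z z\<alpha> \<le> \<delta>" "relay_sol z u" and orb: "\<And>t. t \<ge> 0 \<Longrightarrow> near \<epsilon>2 (state u t)"
  shows "(poin ^^ n) z \<in> dpoin \<and>
    (\<exists>t\<ge>real n * (T / 2). m \<bullet> u t = \<alpha> \<and> phase_eq ((poin ^^ n) z) (state u t) \<and> state u t \<in> PS \<and> restarts u t \<and> pdist (state u t) z\<alpha> \<le> \<delta>)"
proof -
  have next': "(poin ^^ n) z \<in> dpoin \<and> (\<exists>r\<ge>t + T / 2. m \<bullet> u r = \<alpha> \<and> phase_eq ((poin ^^ Suc n) z) (state u r) \<and> state u r \<in> PS \<and> restarts u r \<and> pdist (state u r) z\<alpha> \<le> \<delta>)"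
    if t: "t \<ge> 0" "m \<bullet> u t = \<alpha>" "phase_eq ((poin ^^ n) z) (state u t)" "state u t \<in> PS" "restarts u t" "pdist (state u t) z\<alpha> \<le> \<delta>" for n t
  proof -
    have "m \<bullet> snd (state u t) = \<alpha>" "near \<epsilon>2 (state (\<lambda>r. u (t + r)) (T / 2))"
      using t T_pos orb[of "t + T / 2"] unfolding state_shift by (auto simp: state_def)
    from step[OF t(4) this(1) t(6,5) this(2)] obtain r where r: "state u t \<in> dpoin" "r \<ge> T / 2" "m \<bullet> u (t + r) = \<alpha>"
      "phase_eq (poin (state u t)) (state u (t + r))" "state u (t + r) \<in> PS" "relay_sol (state u (t + r)) (\<lambda>r'. u (t + (r + r')))" "pdist (state u (t + r)) z\<alpha> < \<delta>"
      unfolding state_shift by blast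
    have "phase_eq ((poin ^^ Suc n) z) (state u (t + r))" using r(4) phase_eq_poincare(1)[OF t(3)] by simp
    moreover have "restarts u (t + r)" using r(6) by (simp add: add.assoc)
    ultimately show ?thesis using r phase_eq_poincare(2)[OF t(3)] by (intro conjI exI[of _ "t + r"]) auto
  qed
  have ex: "\<exists>t\<ge>real n * (T / 2). m \<bullet> u t = \<alpha> \<and> phase_eq ((poin ^^ n) z) (state u t) \<and> state u t \<in> PS \<and> restarts u t \<and> pdist (state u t) z\<alpha> \<le> \<delta>" for n
  proof (induction n)
    case 0
    have e: "phase_eq z (state u 0)" by (rule relay_sol_initial[OF z(4)])
    have "relay_sol (state u 0) u" using relay_sol_cong[OF e] z(4) by blast
    moreover have "m \<bullet> u 0 = \<alpha>" using z(2) e by (simp add: phase_eq_def state_def)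
    ultimately show ?case using e phase_eq_PS[OF e] phase_eq_dist(1)[OF e] z by (intro exI[of _ 0]) auto
  next
    case (Suc n)
    then obtain t where t: "t \<ge> real n * (T / 2)" "m \<bullet> u t = \<alpha>" "phase_eq ((poin ^^ n) z) (state u t)" "state u t \<in> PS" "restarts u t" "pdist (state u t) z\<alpha> \<le> \<delta>" by blast
    have "real n * (T / 2) \<ge> 0" using T_pos by simp
    then have "t \<ge> 0" using t(1) by linarith
    from next'[OF this t(2-6)] obtain r where r: "r \<ge> t + T / 2" "m \<bullet> u r = \<alpha>" "phase_eq ((poin ^^ Suc n) z) (state u r)" "state u r \<in> PS" "restarts u r" "pdist (state u r) z\<alpha> \<le> \<delta>"
      by blast
    have "r \<ge> real (Suc n) * (T / 2)" using r(1) t(1) by (simp add: distrib_right)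
    then show ?case using r by blast
  qed
  obtain t where t: "t \<ge> real n * (T / 2)" "m \<bullet> u t = \<alpha>" "phase_eq ((poin ^^ n) z) (state u t)" "state u t \<in> PS" "restarts u t" "pdist (state u t) z\<alpha> \<le> \<delta>"
    using ex by blast
  have "real n * (T / 2) \<ge> 0" using T_pos by simp
  then have "t \<ge> 0" using t(1) by linarith
  from next'[OF this t(2-6)] ex show ?thesis by blast
qed

text \<open>A start on the section has level \<alpha> < \<beta>, so only the neighbourhood of the
  first arc is involved; it contains a ball around the fixed point.\<close>

lemma orbit_near:
  assumes os: "orbitally_stable T \<alpha> \<beta> s p \<sigma> k m A B uper" and \<epsilon>: "\<epsilon> > 0"
  obtains \<delta> where "\<delta> > 0" "\<And>z t. z \<in> PS \<Longrightarrow> m \<bullet> snd z = \<alpha> \<Longrightarrow> pdist z z\<alpha> < \<delta> \<Longrightarrow> t \<ge> 0 \<Longrightarrow> near \<epsilon> (state (hs z) t)"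
proof -
  have "phase_nbhd T s p \<sigma> (Gamma1 T uper \<union> Gamma2 T uper) {z \<in> PS. near \<epsilon> z}"
    unfolding Gammas near_def by (rule nbhd_tube[OF order_refl \<epsilon>])
  from os[unfolded orbitally_stable_def, rule_format, OF this]
  obtain \<Omega>1 where \<Omega>1: "phase_nbhd T s p \<sigma> (Gamma1 T uper) \<Omega>1"
    "\<And>\<phi> x. (\<phi>, x) \<in> \<Omega>1 \<Longrightarrow> m \<bullet> x < \<beta> \<Longrightarrow> orbit (hsol T \<alpha> \<beta> p k m A B \<phi> x) \<subseteq> {z \<in> PS. near \<epsilon> z}"
    by blast
  obtain \<delta> where \<delta>: "\<delta> > 0" "\<And>z. z \<in> PS \<Longrightarrow> pdist z z\<alpha> < \<delta> \<Longrightarrow> z \<in> \<Omega>1" using ball_in_nbhd[OF \<Omega>1(1)] by metis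
  show thesis
  proof (rule that[OF \<delta>(1)])
    fix z t assume "z \<in> PS" "m \<bullet> snd z = \<alpha>" "pdist z z\<alpha> < \<delta>" "(t :: real) \<ge> 0"
    then show "near \<epsilon> (state (hs z) t)" using \<Omega>1(2)[of "fst z" "snd z"] \<delta>(2)[of z] levels by (auto simp: orbit_def)
  qed
qed

lemma orbitally_imp_fp_stable:
  assumes os: "orbitally_stable T \<alpha> \<beta> s p \<sigma> k m A B uper"
  shows "fp_stable T \<alpha> \<beta> s p \<sigma> k m A B \<phi>\<alpha> x\<alpha>"
  unfolding fp_stable_iff
proof (intro allI impI)
  fix \<epsilon> :: real assume \<epsilon>: "\<epsilon> > 0"
  obtain \<delta>0 where \<delta>0: "\<delta>0 > 0" "\<And>\<epsilon>. \<epsilon> > 0 \<Longrightarrow> \<exists>\<epsilon>2>0. \<forall>z u. z \<in> PS \<and> m \<bullet> snd z = \<alpha> \<and> pdist z z\<alpha> \<le> \<delta>0 \<and> relay_sol z u \<and> near \<epsilon>2 (state u (T / 2)) \<longrightarrow>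
    z \<in> dpoin \<and> (\<exists>t\<ge>T / 2. m \<bullet> u t = \<alpha> \<and> phase_eq (poin z) (state u t) \<and> state u t \<in> PS \<and> restarts u t \<and> pdist (state u t) z\<alpha> < \<epsilon>)"
    by (rule step_back) (rule that)
  \<comment> \<open>A radius at most \<open>\<delta>0\<close> keeps every return in the ball where
    \<open>step_back\<close> applies.\<close>
  define \<epsilon>' where "\<epsilon>' = min \<epsilon> \<delta>0"
  have \<epsilon>': "\<epsilon>' > 0" "\<epsilon>' \<le> \<epsilon>" "\<epsilon>' \<le> \<delta>0" using \<epsilon> \<delta>0(1) by (auto simp: \<epsilon>'_def)
  from \<delta>0(2)[OF \<epsilon>'(1)] obtain \<epsilon>2 where \<epsilon>2: "\<epsilon>2 > 0" "\<And>z u. z \<in> PS \<Longrightarrow> m \<bullet> snd z = \<alpha> \<Longrightarrow> pdist z z\<alpha> \<le> \<delta>0 \<Longrightarrow> relay_sol z u \<Longrightarrow> near \<epsilon>2 (state u (T / 2)) \<Longrightarrow>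
    z \<in> dpoin \<and> (\<exists>t\<ge>T / 2. m \<bullet> u t = \<alpha> \<and> phase_eq (poin z) (state u t) \<and> state u t \<in> PS \<and> restarts u t \<and> pdist (state u t) z\<alpha> < \<epsilon>')"
    by blast
  obtain \<delta>1 where \<delta>1: "\<delta>1 > 0" "\<And>z t. z \<in> PS \<Longrightarrow> m \<bullet> snd z = \<alpha> \<Longrightarrow> pdist z z\<alpha> < \<delta>1 \<Longrightarrow> t \<ge> 0 \<Longrightarrow> near \<epsilon>2 (state (hs z) t)"
    by (rule orbit_near[OF os \<epsilon>2(1)]) (rule that)
  show "\<exists>\<delta>>0. \<forall>z. z \<in> PS \<and> m \<bullet> snd z = \<alpha> \<and> pdist z z\<alpha> \<le> \<delta> \<longrightarrow> (\<forall>n. (poin ^^ n) z \<in> dpoin \<and> pdist ((poin ^^ n) z) z\<alpha> \<le> \<epsilon>)"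
  \<comment> \<open>Half of \<open>\<delta>1\<close> turns the non-strict bound in the stability of
    the fixed point into the strict one of \<open>orbit_near\<close>.\<close>
  proof (intro exI[of _ "min (\<delta>1 / 2) \<epsilon>'"] conjI allI impI, goal_cases)
    case 1
    show ?case using \<delta>1 \<epsilon>' by simp
  next
    case (2 z n)
    then have z: "z \<in> PS" "m \<bullet> snd z = \<alpha>" "pdist z z\<alpha> \<le> \<epsilon>'" "pdist z z\<alpha> < \<delta>1" using \<delta>1(1) by auto
    show ?case
      by (rule conjunct1, rule returns[of \<epsilon>' \<epsilon>2 z "hs z" n])
         (use z \<epsilon>'(3) \<epsilon>2(2) relay_sol_hs \<delta>1(2) in auto)
  next
    case (3 z n)
    then have z: "z \<in> PS" "m \<bullet> snd z = \<alpha>" "pdist z z\<alpha> \<le> \<epsilon>'" "pdist z z\<alpha> < \<delta>1" using \<delta>1(1) by auto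
    have "\<exists>t\<ge>real n * (T / 2). m \<bullet> hs z t = \<alpha> \<and> phase_eq ((poin ^^ n) z) (state (hs z) t) \<and> state (hs z) t \<in> PS \<and> restarts (hs z) t \<and> pdist (state (hs z) t) z\<alpha> \<le> \<epsilon>'"
      by (rule conjunct2, rule returns[of \<epsilon>' \<epsilon>2 z "hs z" n])
         (use z \<epsilon>'(3) \<epsilon>2(2) relay_sol_hs \<delta>1(2) in auto)
    then show ?case using phase_eq_dist(1) \<epsilon>'(2) by fastforce
  qed
qed

text \<open>Convergence to the orbit makes the state at time \<open>T / 2\<close> after a late
  return arbitrarily close to it, and \<open>step_back\<close> turns this into closeness of the next
  iterate to the fixed point. Stability is used to keep all the returns within
  \<open>\<delta>0\<close>.\<close>

lemma orbitally_imp_fp_asymp_stable: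
  assumes os: "orbitally_asymp_stable T \<alpha> \<beta> s p \<sigma> k m A B uper"
  shows "fp_asymp_stable T \<alpha> \<beta> s p \<sigma> k m A B \<phi>\<alpha> x\<alpha>"
  unfolding fp_asymp_stable_iff
proof
  have st: "orbitally_stable T \<alpha> \<beta> s p \<sigma> k m A B uper" using os by (simp add: orbitally_asymp_stable_def)
  show "fp_stable T \<alpha> \<beta> s p \<sigma> k m A B \<phi>\<alpha> x\<alpha>" by (rule orbitally_imp_fp_stable[OF st])
  obtain \<delta>0 where \<delta>0: "\<delta>0 > 0" "\<And>\<epsilon>. \<epsilon> > 0 \<Longrightarrow> \<exists>\<epsilon>2>0. \<forall>z u. z \<in> PS \<and> m \<bullet> snd z = \<alpha> \<and> pdist z z\<alpha> \<le> \<delta>0 \<and> relay_sol z u \<and> near \<epsilon>2 (state u (T / 2)) \<longrightarrow>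
    z \<in> dpoin \<and> (\<exists>t\<ge>T / 2. m \<bullet> u t = \<alpha> \<and> phase_eq (poin z) (state u t) \<and> state u t \<in> PS \<and> restarts u t \<and> pdist (state u t) z\<alpha> < \<epsilon>)"
    by (rule step_back) (rule that)
  from \<delta>0(2)[OF \<delta>0(1)] obtain \<epsilon>2 where \<epsilon>2: "\<epsilon>2 > 0" "\<And>z u. z \<in> PS \<Longrightarrow> m \<bullet> snd z = \<alpha> \<Longrightarrow> pdist z z\<alpha> \<le> \<delta>0 \<Longrightarrow> relay_sol z u \<Longrightarrow> near \<epsilon>2 (state u (T / 2)) \<Longrightarrow>
    z \<in> dpoin \<and> (\<exists>t\<ge>T / 2. m \<bullet> u t = \<alpha> \<and> phase_eq (poin z) (state u t) \<and> state u t \<in> PS \<and> restarts u t \<and> pdist (state u t) z\<alpha> < \<delta>0)"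
    by blast
  obtain \<delta>1 where \<delta>1: "\<delta>1 > 0" "\<And>z t. z \<in> PS \<Longrightarrow> m \<bullet> snd z = \<alpha> \<Longrightarrow> pdist z z\<alpha> < \<delta>1 \<Longrightarrow> t \<ge> 0 \<Longrightarrow> near \<epsilon>2 (state (hs z) t)"
    by (rule orbit_near[OF st \<epsilon>2(1)]) (rule that)
  from os obtain \<Theta>1 where \<Theta>1: "phase_nbhd T s p \<sigma> (Gamma1 T uper) \<Theta>1"
    "\<And>\<phi> x. (\<phi>, x) \<in> \<Theta>1 \<Longrightarrow> m \<bullet> x < \<beta> \<Longrightarrow>
       ((\<lambda>t. INF w\<in>Gamma1 T uper \<union> Gamma2 T uper. pdist (state (hsol T \<alpha> \<beta> p k m A B \<phi> x) t) w) \<longlongrightarrow> 0) at_top"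
    unfolding orbitally_asymp_stable_def by blast
  obtain \<delta>2 where \<delta>2: "\<delta>2 > 0" "\<And>z. z \<in> PS \<Longrightarrow> pdist z z\<alpha> < \<delta>2 \<Longrightarrow> z \<in> \<Theta>1" using ball_in_nbhd[OF \<Theta>1(1)] by metis
  show "\<exists>\<delta>>0. \<forall>z. z \<in> PS \<and> m \<bullet> snd z = \<alpha> \<and> pdist z z\<alpha> \<le> \<delta> \<longrightarrow> (\<lambda>n. pdist ((poin ^^ n) z) z\<alpha>) \<longlonglongrightarrow> 0"
  proof (intro exI[of _ "min \<delta>0 (min \<delta>1 \<delta>2) / 2"] conjI allI impI, goal_cases)
    case 1
    show ?case using \<delta>0 \<delta>1 \<delta>2 by simp
  next
    case (2 z)
    then have z: "z \<in> PS" "m \<bullet> snd z = \<alpha>" "pdist z z\<alpha> \<le> \<delta>0" "pdist z z\<alpha> < \<delta>1" "pdist z z\<alpha> < \<delta>2"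
      using \<delta>0(1) \<delta>1(1) \<delta>2(1) by (auto simp: min_def split: if_splits)
    define u where "u = hs z"
    have u: "relay_sol z u" unfolding u_def by (rule relay_sol_hs[OF z(1)])
    have ret: "\<exists>t\<ge>real n * (T / 2). m \<bullet> u t = \<alpha> \<and> phase_eq ((poin ^^ n) z) (state u t) \<and> state u t \<in> PS \<and> restarts u t \<and> pdist (state u t) z\<alpha> \<le> \<delta>0" for n
      by (rule conjunct2, rule returns[of \<delta>0 \<epsilon>2 z u n])
         (use z \<epsilon>2(2) u \<delta>1(2) in \<open>auto simp: u_def\<close>)
    have "((\<lambda>t. INF w\<in>Gamma1 T uper \<union> Gamma2 T uper. pdist (state u t) w) \<longlongrightarrow> 0) at_top"
      unfolding u_def by (rule \<Theta>1(2)) (use \<delta>2(2)[OF z(1,5)] z(2) levels in auto)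
    then have ev: "\<And>\<epsilon>. \<epsilon> > 0 \<Longrightarrow> \<forall>\<^sub>F t in at_top. near \<epsilon> (state u t)" by (simp only: orbit_distance_tendsto)
    show ?case
    proof (rule tendstoI)
      fix \<eta> :: real assume "\<eta> > 0"
      from \<delta>0(2)[OF this] obtain \<epsilon>3 where \<epsilon>3: "\<epsilon>3 > 0" "\<And>z u. z \<in> PS \<Longrightarrow> m \<bullet> snd z = \<alpha> \<Longrightarrow> pdist z z\<alpha> \<le> \<delta>0 \<Longrightarrow> relay_sol z u \<Longrightarrow> near \<epsilon>3 (state u (T / 2)) \<Longrightarrow>
        \<exists>t. phase_eq (poin z) (state u t) \<and> pdist (state u t) z\<alpha> < \<eta>"
        by blast
      from ev[OF \<epsilon>3(1)] obtain t0 where t0: "\<And>t. t \<ge> t0 \<Longrightarrow> near \<epsilon>3 (state u t)" by (auto simp: eventually_at_top_linorder)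
      obtain N where "t0 / (T / 2) \<le> real N" using real_arch_simple by blast
      then have N: "t0 \<le> real N * (T / 2)" using T_pos by (simp add: pos_divide_le_eq)
      \<comment> \<open>The closeness observed after the n-th return concerns the following iterate,
        hence \<open>Suc n\<close>.\<close>
      have "pdist ((poin ^^ Suc n) z) z\<alpha> < \<eta>" if n: "n \<ge> N" for n
      proof -
        from ret[of n] obtain t where t: "t \<ge> real n * (T / 2)" "m \<bullet> u t = \<alpha>" "phase_eq ((poin ^^ n) z) (state u t)" "state u t \<in> PS" "restarts u t" "pdist (state u t) z\<alpha> \<le> \<delta>0"
          by blast
        have "real N * (T / 2) \<le> real n * (T / 2)" using n T_pos by (intro mult_right_mono) auto
        then have "near \<epsilon>3 (state (\<lambda>r. u (t + r)) (T / 2))" unfolding state_shift using t(1) N T_pos by (intro t0) linarith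
        moreover have "m \<bullet> snd (state u t) = \<alpha>" using t(2) by (simp add: state_def)
        ultimately obtain r where "phase_eq (poin (state u t)) (state u (t + r))" "pdist (state u (t + r)) z\<alpha> < \<eta>"
          using \<epsilon>3(2)[OF t(4) _ t(6,5)] unfolding state_shift by blast
        then show ?thesis using phase_eq_poincare(1)[OF t(3)] phase_eq_dist(1) by simp
      qed
      then have "pdist ((poin ^^ n) z) z\<alpha> < \<eta>" if "n \<ge> Suc N" for n using that by (cases n) auto
      then show "\<forall>\<^sub>F n in sequentially. dist (pdist ((poin ^^ n) z) z\<alpha>) 0 < \<eta>"
        by (auto simp: eventually_sequentially dist_real_def)
    qed
  qed
qed

end

theorem theorem4p11:
  fixes T \<alpha> \<beta> s p \<sigma> :: real
    and k m :: "real ^ 'n"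
    and A B :: "real ^ 'n ^ 'n"
    and i0 :: 'n
    and \<phi>\<alpha> uper :: "real \<Rightarrow> real ^ 'n"
    and x\<alpha> :: "real ^ 'n"
  assumes "T > 0" and "\<alpha> < \<beta>"
    and "m $ i0 \<noteq> 0"
    and "0 < s" and "s < 1" and "1 < p" and "p < min (1 / s) (1 / (1 - s))"
    and "0 < \<sigma>" and "\<sigma> \<le> T / 3"
    and "(\<phi>\<alpha>, x\<alpha>) \<in> phase_space T s p \<sigma>"
    and "uper = hsol T \<alpha> \<beta> p k m A B \<phi>\<alpha> x\<alpha>"
    and "uper (2 * T) = x\<alpha>"
    and "\<And>\<xi>. -2 * T < \<xi> \<Longrightarrow> \<xi> < 0 \<Longrightarrow> uper (2 * T + \<xi>) = \<phi>\<alpha> \<xi>"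
    and "hysteresis \<alpha> \<beta> (\<lambda>t. m \<bullet> uper t) (2 * T) = hysteresis \<alpha> \<beta> (\<lambda>t. m \<bullet> uper t) 0"
    and "m \<bullet> x\<alpha> = \<alpha>"
    and "{t. 0 < t \<and> t \<le> 2 * T \<and> switching_time \<alpha> \<beta> m uper t} = {T, 2 * T}"
    and "m \<bullet> uper T = \<beta>" and "m \<bullet> uper (2 * T) = \<alpha>"
    and "\<And>\<theta>. -2 * T < \<theta> \<Longrightarrow> \<theta> < - T \<Longrightarrow>
           \<exists>d. (\<phi>\<alpha> has_vector_derivative d) (at \<theta>) \<and> (\<phi>\<alpha> has_vector_derivative - d) (at (\<theta> + T))"
    and "\<exists>d. ((\<lambda>t. m \<bullet> uper t) has_real_derivative d) (at_left T) \<and> d \<noteq> 0"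
    and "\<exists>d. ((\<lambda>t. m \<bullet> uper t) has_real_derivative d) (at_left (2 * T)) \<and> d \<noteq> 0"
  shows "(orbitally_asymp_stable T \<alpha> \<beta> s p \<sigma> k m A B uper \<longleftrightarrow>
            fp_asymp_stable T \<alpha> \<beta> s p \<sigma> k m A B \<phi>\<alpha> x\<alpha>) \<and>
         (orbitally_stable T \<alpha> \<beta> s p \<sigma> k m A B uper \<longleftrightarrow>
            fp_stable T \<alpha> \<beta> s p \<sigma> k m A B \<phi>\<alpha> x\<alpha>) \<and>
         (orbitally_unstable T \<alpha> \<beta> s p \<sigma> k m A B uper \<longleftrightarrow>
            fp_unstable T \<alpha> \<beta> s p \<sigma> k m A B \<phi>\<alpha> x\<alpha>)"
proof -
  \<comment> \<open>This bound on the exponent gives \<open>s * p < 1\<close>, the condition for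
    Hardy's inequality.\<close>
  have "p < 1 / s" using \<open>p < min (1 / s) (1 / (1 - s))\<close> by simp
  then have sp: "s * p < 1" using \<open>0 < s\<close> by (simp add: pos_less_divide_eq mult.commute)
  interpret phase T k A B \<alpha> \<beta> m s p \<sigma>
    by unfold_locales (fact | rule sp)+
  have phi: "\<phi>\<alpha> \<in> BS" using \<open>(\<phi>\<alpha>, x\<alpha>) \<in> phase_space T s p \<sigma>\<close> by (simp add: PS_iff)
  have per: "delay_sol (hysteresis \<alpha> \<beta> (\<lambda>t. m \<bullet> uper t)) \<phi>\<alpha> x\<alpha> uper"
    unfolding \<open>uper = _\<close> by (rule hsol_is_solution[OF Bsp_Lp[OF phi] p_pos(2)])
  interpret periodic T k A B \<alpha> \<beta> m s p \<sigma> \<phi>\<alpha> x\<alpha> uper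
    by unfold_locales (fact | rule phi per)+
  \<comment> \<open>Instability is the negation of stability on both sides, so its equivalence
    follows from that of stability.\<close>
  show ?thesis
    using fp_imp_orbitally_stable fp_imp_orbitally_asymp_stable orbitally_imp_fp_stable orbitally_imp_fp_asymp_stable
    unfolding orbitally_unstable_def fp_unstable_def by blast
qed

end
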